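(* Let $v\in V$ be $\Omega$-standard, let $\omega_0^v$ be the longest element of $W^v$, and let $\gamma\in\Gamma$. Let $[\gamma]$ denote the endomorphism of the finite-dimensional space $\mathcal D(\Omega,v)$ given by the action of $\gamma$ (equivalently, its matrix in a basis). Then the Jordan form of $[\gamma]$ consists of Jordan blocks with eigenvalue $\gamma(v)$ and of size at most $\ell(\omega_0^v)+1$. Furthermore, there is at most one block of size $\ell(\omega_0^v)+1$, and for a generic element $\gamma$ of $\Gamma$ there is exactly one such block.
   Context: Setting. $V=\mathbb C\otimes_{\mathbb R}V_{\mathbb R}$ is the complexification of a finite-dimensional Euclidean space, with the complex bilinear extension $(-,-)$ of the inner product, which is used to identify $V$ with $V^*$. $\Lambda$ is the algebra of polynomial functions on $V$ (denoted $S(V)$ in the source), graded with $\Lambda_1=V^*$, and $L=\mathrm{Frac}(\Lambda)$. A finite root system is a finite set $\Phi\subset V_{\mathbb R}^*$ of nonzero elements with $\Phi\cap\mathbb C\alpha=\{\pm\alpha\}$ and $s_\alpha^*(\Phi)\subset\Phi$ for all $\alpha\in\Phi$, where $s_\alpha$ is the orthogonal reflection through $\ker\alpha$ (it need not be crystallographic nor span $V^*$). Fix a root system $\Phi$ and a root subsystem $\Psi\subset\Phi$ with base (simple system) $\Omega$ and positive roots $\Psi^+$; let $G=W(\Phi)$ and $W=W(\Psi)\subset G$ be the groups generated by the reflections in $\Phi$ and $\Psi$. Groups act on functions by $(\sigma f)(x)=f(\sigma^{-1}x)$. Put $\Gamma=\Lambda^G$. Let $S$ be the set of simple reflections of $W$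 (for $\Omega$), $\ell$ the length, $\omega_0$ the longest element of $W$, and for a reflection $s \in W$ let $\alpha_s\in\Psi^+$ be its positive root. Divided differences: $\nabla_s=\frac1{\alpha_s}(1-s)$ and $\partial_\sigma=\nabla_{s_1}\circ\cdots\circ\nabla_{s_\ell}$ for a reduced decomposition $\sigma=s_1\cdots s_\ell$ in simple reflections. Schubert polynomials: $\mathfrak S_\sigma=\frac1{|W|}\partial_{\sigma^{-1}\omega_0}\big(\prod_{\alpha\in\Psi^+}\alpha\big)$, $\sigma\in W$. Let $I_W\subset\Lambda$ be the ideal generated by the elements of positive degree in $\Lambda^W$; the $\mathfrak S_\sigma$ form a basis of $\Lambda/I_W$. Postnikov–Stanley operators: let $\Theta$ be the algebra morphism from $\Lambda$ to constant-coefficient differential operators on $\Lambda$ such that, for $\alpha\in V^*$, $\Theta(\alpha)$ is the derivation with $\Theta(\alpha)(\beta)=(\beta,\alpha)$ for $\beta\in V^*$. Let $(f,g)_\Theta=\Theta(f)(g)(0)$ and $\mathcal H_{I_W}=\{g\in\Lambda: (f,g)_\Theta=0\ \forall f\in I_W\}$. $P_\sigma$ is the unique element of $\mathcal H_{I_W}$ with $(P_\sigma,\mathfrak S_\tau)_\Theta=\delta_{\sigma,\tau}$ for all $\tau\in W$. Put $\mathfrak D_\sigma=\Theta(P_\sigma)$, $\mathfrak D_\sigma^0(f)=\mathfrak D_\sigma(f)(0)$, and, for $v\in V$, $\mathfrak D_\sigma^v=\mathfrak D_\sigma^0\circ t_v$, where $t_v(f)(x)=f(x+v)$. Let $\mathcal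 D_\sigma^v=\mathfrak D_\sigma^v|_\Gamma\in\Gamma^*=\mathrm{Hom}_{\mathbb C}(\Gamma,\mathbb C)$, and let $\mathcal D(\Omega,v)\subset\Gamma^*$ be the span of $\{\mathcal D^v_\sigma:\sigma\in W\}$. It is a $\Gamma$-submodule of $\Gamma^*$, where $(\gamma\cdot\chi)(g)=\chi(\gamma g)$. $W_v$ is the stabilizer of $v$ in $W$. The element $v$ is $\Omega$-standard if $W_v$ is generated by a subset of $S$ (equivalently, $\{\alpha\in\Psi:\alpha(v)=0\}$ is a subsystem generated by a subset of $\Omega$). Then $W^v$ denotes the set of minimal length representatives of the left cosets $W/W_v$. "Generic" means: for all $\gamma$ whose class in the finite-dimensional vector space $\Gamma/\mathrm{ann}_\Gamma\,\mathcal D(\Omega,v)$ lies in some nonempty (hence dense) Zariski open subset. *)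

theory Defs
  imports
    "HOL-Analysis.Analysis"
    "HOL-Library.Function_Algebras"
    "Jordan_Normal_Form.Jordan_Normal_Form"
begin

no_notation Matrix.vec_index (infixl "$" 100)

text \<open>
  The Euclidean space is \<open>real ^ 'n\<close> and its complexification \<open>V\<close> is \<open>complex ^ 'n\<close>. Elements of
  \<open>V\<^sup>*\<close>, in particular roots, are given by the vectors that represent them with respect to the
  bilinear (not sesquilinear) form \<open>bil\<close>. Functions are added and multiplied pointwise.
\<close>

definition bil :: "complex ^ 'n \<Rightarrow> complex ^ 'n \<Rightarrow> complex" where
  "bil x y = (\<Sum>i\<in>UNIV. x $ i * y $ i)"

definition cvec :: "real ^ 'n \<Rightarrow> complex ^ 'n" where
  "cvec a = (\<chi> i. complex_of_real (a $ i))"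

definition linform :: "complex ^ 'n \<Rightarrow> complex ^ 'n \<Rightarrow> complex" where
  "linform a = (\<lambda>x. bil x a)"

global_interpretation funspace:
  vector_space "\<lambda>(c::complex) (f :: 'x \<Rightarrow> complex) x. c * f x"
  by unfold_locales (auto simp: fun_eq_iff algebra_simps)


section \<open>Polynomial functions\<close>

text \<open>The algebra of functions generated by a set \<open>L\<close> of functions. If \<open>L\<close> is the dual of a
  finite-dimensional space, these are the polynomial functions on that space.\<close>

inductive_set alg_gen :: "('x \<Rightarrow> complex) set \<Rightarrow> ('x \<Rightarrow> complex) set"
  for L :: "('x \<Rightarrow> complex) set" where
  gen: "f \<in> L \<Longrightarrow> f \<in> alg_gen L"
| const: "(\<lambda>x. c) \<in> alg_gen L"
| add: "f \<in> alg_gen L \<Longrightarrow> g \<in> alg_gen L \<Longrightarrow> f + g \<in> alg_gen L"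
| mult: "f \<in> alg_gen L \<Longrightarrow> g \<in> alg_gen L \<Longrightarrow> f * g \<in> alg_gen L"

definition Lam :: "(complex ^ 'n \<Rightarrow> complex) set" where
  "Lam = alg_gen (range linform)"

definition homogeneous :: "nat \<Rightarrow> (complex ^ 'n \<Rightarrow> complex) \<Rightarrow> bool" where
  "homogeneous d f \<longleftrightarrow> f \<in> Lam \<and> (\<forall>c x. f (c *s x) = c ^ d * f x)"

definition act :: "('v \<Rightarrow> 'v) \<Rightarrow> ('v \<Rightarrow> complex) \<Rightarrow> ('v \<Rightarrow> complex)" where
  "act \<sigma> f = (\<lambda>x. f (inv_into UNIV \<sigma> x))"

definition invariants :: "(complex ^ 'n \<Rightarrow> complex ^ 'n) set \<Rightarrow> (complex ^ 'n \<Rightarrow> complex) set" where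
  "invariants H = {f \<in> Lam. \<forall>\<sigma>\<in>H. act \<sigma> f = f}"


section \<open>Root systems and reflection groups\<close>

definition refl_real :: "real ^ 'n \<Rightarrow> real ^ 'n \<Rightarrow> real ^ 'n" where
  "refl_real a x = x - (2 * inner x a / inner a a) *\<^sub>R a"

definition refl :: "real ^ 'n \<Rightarrow> complex ^ 'n \<Rightarrow> complex ^ 'n" where
  "refl a x = x - (2 * bil x (cvec a) / bil (cvec a) (cvec a)) *s cvec a"

definition root_system :: "(real ^ 'n) set \<Rightarrow> bool" where
  "root_system \<Phi> \<longleftrightarrow> finite \<Phi> \<and> 0 \<notin> \<Phi> \<and>
     (\<forall>\<alpha>\<in>\<Phi>. {\<beta> \<in> \<Phi>. \<exists>c. cvec \<beta> = c *s cvec \<alpha>} = {\<alpha>, -\<alpha>}) \<and>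
     (\<forall>\<alpha>\<in>\<Phi>. refl_real \<alpha> ` \<Phi> \<subseteq> \<Phi>)"

definition root_subsystem :: "(real ^ 'n) set \<Rightarrow> (real ^ 'n) set \<Rightarrow> bool" where
  "root_subsystem \<Psi> \<Phi> \<longleftrightarrow> \<Psi> \<subseteq> \<Phi> \<and> root_system \<Psi>"

definition nonneg_combs :: "(real ^ 'n) set \<Rightarrow> (real ^ 'n) set" where
  "nonneg_combs \<Omega> = {\<Sum>\<omega>\<in>\<Omega>. c \<omega> *\<^sub>R \<omega> | c. \<forall>\<omega>\<in>\<Omega>. 0 \<le> c \<omega>}"

definition simple_system :: "(real ^ 'n) set \<Rightarrow> (real ^ 'n) set \<Rightarrow> bool" where
  "simple_system \<Psi> \<Omega> \<longleftrightarrow> \<Omega> \<subseteq> \<Psi> \<and> independent \<Omega> \<and>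
     (\<forall>\<beta>\<in>\<Psi>. \<beta> \<in> nonneg_combs \<Omega> \<or> - \<beta> \<in> nonneg_combs \<Omega>)"

definition pos_roots :: "(real ^ 'n) set \<Rightarrow> (real ^ 'n) set \<Rightarrow> (real ^ 'n) set" where
  "pos_roots \<Psi> \<Omega> = \<Psi> \<inter> nonneg_combs \<Omega>"

definition refl_word :: "(real ^ 'n) list \<Rightarrow> complex ^ 'n \<Rightarrow> complex ^ 'n" where
  "refl_word as = foldr (\<lambda>a w. refl a \<circ> w) as id"

text \<open>Reflections are involutions, so their products already form the generated group.\<close>

definition refl_group :: "(real ^ 'n) set \<Rightarrow> (complex ^ 'n \<Rightarrow> complex ^ 'n) set" where
  "refl_group R = refl_word ` lists R"

definition len :: "(real ^ 'n) set \<Rightarrow> (complex ^ 'n \<Rightarrow> complex ^ 'n) \<Rightarrow> nat" where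
  "len \<Omega> \<sigma> = (LEAST k. \<exists>as\<in>lists \<Omega>. length as = k \<and> refl_word as = \<sigma>)"

definition reduced_word ::
    "(real ^ 'n) set \<Rightarrow> (complex ^ 'n \<Rightarrow> complex ^ 'n) \<Rightarrow> (real ^ 'n) list \<Rightarrow> bool" where
  "reduced_word \<Omega> \<sigma> as \<longleftrightarrow> as \<in> lists \<Omega> \<and> refl_word as = \<sigma> \<and> length as = len \<Omega> \<sigma>"

definition longest ::
    "(real ^ 'n) set \<Rightarrow> (complex ^ 'n \<Rightarrow> complex ^ 'n) set \<Rightarrow> complex ^ 'n \<Rightarrow> complex ^ 'n" where
  "longest \<Omega> X = (ARG_MAX (len \<Omega>) w. w \<in> X)"

definition stabilizer ::
    "(real ^ 'n) set \<Rightarrow> complex ^ 'n \<Rightarrow> (complex ^ 'n \<Rightarrow> complex ^ 'n) set" where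
  "stabilizer \<Psi> v = {\<sigma> \<in> refl_group \<Psi>. \<sigma> v = v}"

definition standard :: "(real ^ 'n) set \<Rightarrow> (real ^ 'n) set \<Rightarrow> complex ^ 'n \<Rightarrow> bool" where
  "standard \<Psi> \<Omega> v \<longleftrightarrow> (\<exists>J\<subseteq>\<Omega>. stabilizer \<Psi> v = refl_group J)"

definition min_coset_reps ::
    "(real ^ 'n) set \<Rightarrow> (real ^ 'n) set \<Rightarrow> complex ^ 'n \<Rightarrow> (complex ^ 'n \<Rightarrow> complex ^ 'n) set" where
  "min_coset_reps \<Psi> \<Omega> v =
     {\<sigma> \<in> refl_group \<Psi>. \<forall>\<tau>\<in>stabilizer \<Psi> v. len \<Omega> \<sigma> \<le> len \<Omega> (\<sigma> \<circ> \<tau>)}"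


section \<open>Divided differences and Schubert polynomials\<close>

text \<open>The quotient \<open>(f - s\<^sub>\<alpha> f) / \<alpha>\<close> is taken among polynomial functions, where it is unique;
  pointwise division would give the wrong value on the hyperplane \<open>\<alpha> = 0\<close>.\<close>

definition divdiff ::
    "real ^ 'n \<Rightarrow> (complex ^ 'n \<Rightarrow> complex) \<Rightarrow> (complex ^ 'n \<Rightarrow> complex)" where
  "divdiff a f = (THE g. g \<in> Lam \<and> linform (cvec a) * g = f - act (refl a) f)"

text \<open>By the braid relations the following does not depend on the reduced word chosen.\<close>

definition divdiff_op :: "(real ^ 'n) set \<Rightarrow> (complex ^ 'n \<Rightarrow> complex ^ 'n) \<Rightarrow>
    (complex ^ 'n \<Rightarrow> complex) \<Rightarrow> (complex ^ 'n \<Rightarrow> complex)" where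
  "divdiff_op \<Omega> \<sigma> = foldr (\<lambda>a D. divdiff a \<circ> D) (SOME as. reduced_word \<Omega> \<sigma> as) id"

definition schubert :: "(real ^ 'n) set \<Rightarrow> (real ^ 'n) set \<Rightarrow> (complex ^ 'n \<Rightarrow> complex ^ 'n) \<Rightarrow>
    (complex ^ 'n \<Rightarrow> complex)" where
  "schubert \<Psi> \<Omega> \<sigma> = (\<lambda>x. 1 / of_nat (card (refl_group \<Psi>)) *
     divdiff_op \<Omega> (inv_into UNIV \<sigma> \<circ> longest \<Omega> (refl_group \<Psi>))
       (\<Prod>\<alpha>\<in>pos_roots \<Psi> \<Omega>. linform (cvec \<alpha>)) x)"

definition coinv_ideal :: "(real ^ 'n) set \<Rightarrow> (complex ^ 'n \<Rightarrow> complex) set" where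
  "coinv_ideal \<Psi> = {\<Sum>i<k. a i * f i | (k::nat) a f. \<forall>i<k. a i \<in> Lam \<and>
     f i \<in> invariants (refl_group \<Psi>) \<and> (\<exists>d>0. homogeneous d (f i))}"


section \<open>Postnikov--Stanley operators\<close>

definition derivation ::
    "((complex ^ 'n \<Rightarrow> complex) \<Rightarrow> (complex ^ 'n \<Rightarrow> complex)) \<Rightarrow> bool" where
  "derivation D \<longleftrightarrow>
     (\<forall>f\<in>Lam. D f \<in> Lam) \<and>
     (\<forall>f\<in>Lam. \<forall>g\<in>Lam. D (f + g) = D f + D g) \<and>
     (\<forall>c. \<forall>f\<in>Lam. D (\<lambda>x. c * f x) = (\<lambda>x. c * D f x)) \<and>
     (\<forall>f\<in>Lam. \<forall>g\<in>Lam. D (f * g) = D f * g + f * D g)"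

text \<open>The property characterizes \<open>T f g\<close> for \<open>f\<close> and \<open>g\<close> in \<open>Lam\<close>, since \<open>Lam\<close> is generated by the
  linear forms. It makes each \<open>T (linform a)\<close> the derivative in direction \<open>a\<close>, so that all \<open>T f\<close>
  are differential operators with constant coefficients.\<close>

definition theta_morphism :: "((complex ^ 'n \<Rightarrow> complex) \<Rightarrow>
    (complex ^ 'n \<Rightarrow> complex) \<Rightarrow> (complex ^ 'n \<Rightarrow> complex)) \<Rightarrow> bool" where
  "theta_morphism T \<longleftrightarrow>
     (\<forall>h\<in>Lam. T 1 h = h) \<and>
     (\<forall>f\<in>Lam. \<forall>g\<in>Lam. \<forall>h\<in>Lam. T (f + g) h = T f h + T g h) \<and>
     (\<forall>c. \<forall>f\<in>Lam. \<forall>h\<in>Lam. T (\<lambda>x. c * f x) h = (\<lambda>x. c * T f h x)) \<and>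
     (\<forall>f\<in>Lam. \<forall>g\<in>Lam. \<forall>h\<in>Lam. T (f * g) h = T f (T g h)) \<and>
     (\<forall>a. derivation (T (linform a)) \<and> (\<forall>b. T (linform a) (linform b) = (\<lambda>x. bil b a)))"

definition Theta :: "(complex ^ 'n \<Rightarrow> complex) \<Rightarrow>
    (complex ^ 'n \<Rightarrow> complex) \<Rightarrow> (complex ^ 'n \<Rightarrow> complex)" where
  "Theta = (SOME T. theta_morphism T)"

definition theta_pair :: "(complex ^ 'n \<Rightarrow> complex) \<Rightarrow> (complex ^ 'n \<Rightarrow> complex) \<Rightarrow> complex" where
  "theta_pair f g = Theta f g 0"

definition theta_perp :: "(complex ^ 'n \<Rightarrow> complex) set \<Rightarrow> (complex ^ 'n \<Rightarrow> complex) set" where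
  "theta_perp I = {g \<in> Lam. \<forall>f\<in>I. theta_pair f g = 0}"

definition dual_schubert :: "(real ^ 'n) set \<Rightarrow> (real ^ 'n) set \<Rightarrow> (complex ^ 'n \<Rightarrow> complex ^ 'n) \<Rightarrow>
    (complex ^ 'n \<Rightarrow> complex)" where
  "dual_schubert \<Psi> \<Omega> \<sigma> = (THE p. p \<in> theta_perp (coinv_ideal \<Psi>) \<and>
     (\<forall>\<tau>\<in>refl_group \<Psi>. theta_pair p (schubert \<Psi> \<Omega> \<tau>) = (if \<sigma> = \<tau> then 1 else 0)))"

definition PS_functional :: "(real ^ 'n) set \<Rightarrow> (real ^ 'n) set \<Rightarrow> complex ^ 'n \<Rightarrow>
    (complex ^ 'n \<Rightarrow> complex ^ 'n) \<Rightarrow> (complex ^ 'n \<Rightarrow> complex) \<Rightarrow> complex" where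
  "PS_functional \<Psi> \<Omega> v \<sigma> f = Theta (dual_schubert \<Psi> \<Omega> \<sigma>) (\<lambda>x. f (x + v)) 0"


section \<open>The module spanned by the operators restricted to invariants\<close>

abbreviation Gam :: "(real ^ 'n) set \<Rightarrow> (complex ^ 'n \<Rightarrow> complex) set" where
  "Gam \<Phi> \<equiv> invariants (refl_group \<Phi>)"

text \<open>Functionals on \<open>Gam \<Phi>\<close> are functions that vanish outside \<open>Gam \<Phi>\<close>, so that equality of such
  functions is equality on \<open>Gam \<Phi>\<close>.\<close>

definition restr :: "'x set \<Rightarrow> ('x \<Rightarrow> complex) \<Rightarrow> 'x \<Rightarrow> complex" where
  "restr X \<xi> = (\<lambda>x. if x \<in> X then \<xi> x else 0)"

definition PS_module :: "(real ^ 'n) set \<Rightarrow> (real ^ 'n) set \<Rightarrow> (real ^ 'n) set \<Rightarrow> complex ^ 'n \<Rightarrow>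
    ((complex ^ 'n \<Rightarrow> complex) \<Rightarrow> complex) set" where
  "PS_module \<Phi> \<Psi> \<Omega> v =
     funspace.span ((\<lambda>\<sigma>. restr (Gam \<Phi>) (PS_functional \<Psi> \<Omega> v \<sigma>)) ` refl_group \<Psi>)"

definition dual_act :: "(complex ^ 'n \<Rightarrow> complex) set \<Rightarrow> (complex ^ 'n \<Rightarrow> complex) \<Rightarrow>
    ((complex ^ 'n \<Rightarrow> complex) \<Rightarrow> complex) \<Rightarrow> ((complex ^ 'n \<Rightarrow> complex) \<Rightarrow> complex)" where
  "dual_act \<Gamma> \<gamma> \<xi> = restr \<Gamma> (\<lambda>g. \<xi> (\<gamma> * g))"

definition annihilator :: "(complex ^ 'n \<Rightarrow> complex) set \<Rightarrow>
    ((complex ^ 'n \<Rightarrow> complex) \<Rightarrow> complex) set \<Rightarrow> (complex ^ 'n \<Rightarrow> complex) set" where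
  "annihilator \<Gamma> M = {\<gamma> \<in> \<Gamma>. \<forall>\<xi>\<in>M. dual_act \<Gamma> \<gamma> \<xi> = 0}"


section \<open>Jordan forms of endomorphisms\<close>

definition basis_of :: "('x \<Rightarrow> complex) set \<Rightarrow> ('x \<Rightarrow> complex) list \<Rightarrow> bool" where
  "basis_of M bs \<longleftrightarrow> distinct bs \<and> funspace.independent (set bs) \<and> funspace.span (set bs) = M"

definition matrix_in :: "('x \<Rightarrow> complex) list \<Rightarrow> (('x \<Rightarrow> complex) \<Rightarrow> ('x \<Rightarrow> complex)) \<Rightarrow> complex mat" where
  "matrix_in bs T = Matrix.mat (length bs) (length bs)
     (\<lambda>(i, j). funspace.representation (set bs) (T (bs ! j)) (bs ! i))"

text \<open>As in \<^const>\<open>jordan_nf\<close>, a Jordan form is the list of its blocks, given as pairs of size and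
  eigenvalue.\<close>

definition jordan_form ::
    "('x \<Rightarrow> complex) set \<Rightarrow> (('x \<Rightarrow> complex) \<Rightarrow> ('x \<Rightarrow> complex)) \<Rightarrow> (nat \<times> complex) list \<Rightarrow> bool" where
  "jordan_form M T blocks \<longleftrightarrow> (\<exists>bs. basis_of M bs \<and> jordan_nf (matrix_in bs T) blocks)"


section \<open>Genericity\<close>

text \<open>Zariski topology on the quotient of a space \<open>E\<close> of functions by a subspace \<open>A\<close>; values of
  functions at arguments that are not cosets are irrelevant.\<close>

definition coset_of :: "('x \<Rightarrow> complex) set \<Rightarrow> ('x \<Rightarrow> complex) set \<Rightarrow> ('x \<Rightarrow> complex) \<Rightarrow> ('x \<Rightarrow> complex) set" where
  "coset_of E A f = {g \<in> E. g - f \<in> A}"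

definition quotient_dual ::
    "('x \<Rightarrow> complex) set \<Rightarrow> ('x \<Rightarrow> complex) set \<Rightarrow> (('x \<Rightarrow> complex) set \<Rightarrow> complex) set" where
  "quotient_dual E A = {\<phi>.
     (\<forall>f\<in>E. \<forall>g\<in>E. \<phi> (coset_of E A (f + g)) = \<phi> (coset_of E A f) + \<phi> (coset_of E A g)) \<and>
     (\<forall>c. \<forall>f\<in>E. \<phi> (coset_of E A (\<lambda>x. c * f x)) = c * \<phi> (coset_of E A f))}"

definition zariski_open ::
    "('x \<Rightarrow> complex) set \<Rightarrow> ('x \<Rightarrow> complex) set \<Rightarrow> ('x \<Rightarrow> complex) set set \<Rightarrow> bool" where
  "zariski_open E A U \<longleftrightarrow>
     (\<exists>F\<subseteq>alg_gen (quotient_dual E A). U = {q \<in> coset_of E A ` E. \<exists>p\<in>F. p q \<noteq> 0})"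

definition generically ::
    "('x \<Rightarrow> complex) set \<Rightarrow> ('x \<Rightarrow> complex) set \<Rightarrow> (('x \<Rightarrow> complex) \<Rightarrow> bool) \<Rightarrow> bool" where
  "generically E A P \<longleftrightarrow>
     (\<exists>U. zariski_open E A U \<and> U \<noteq> {} \<and> (\<forall>f\<in>E. coset_of E A f \<in> U \<longrightarrow> P f))"

end

theory Submission
  imports Defs "Jordan_Normal_Form.Jordan_Normal_Form_Existence" "Jordan_Normal_Form.Jordan_Normal_Form_Uniqueness"
begin

text \<open>
  Let \<open>\<Delta>\<close> be the product of the positive roots of \<open>\<Psi>\<close>. Divided differences are self-adjoint for the
  form \<open>(f, g) \<mapsto> (f g, \<Delta>)\<^sub>\<Theta>\<close>, so its radical is \<open>I\<^sub>W\<close>, the space \<open>\<H>\<close> orthogonal to \<open>I\<^sub>W\<close> consists of the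
  \<open>\<Theta>(q)(\<Delta>)\<close>, and \<open>\<D>(\<Omega>, v)\<close> consists of the functionals \<open>g \<mapsto> (q \<cdot> t\<^sub>v g, \<Delta>)\<^sub>\<Theta>\<close>. The action of
  \<open>\<gamma> - \<gamma>(v)\<close> multiplies \<open>q\<close> by \<open>\<phi> = t\<^sub>v \<gamma> - \<gamma>(v)\<close>, which vanishes at \<open>0\<close> and is invariant under the
  stabilizer of \<open>v\<close>. Antisymmetrizing \<open>q\<close> over the stabilizer turns it into a multiple of the product
  \<open>\<Delta>\<^sub>v\<close> of the positive roots that vanish at \<open>v\<close>, so that only \<open>\<Theta>(\<Delta>\<^sub>v)(\<Delta>)\<close> matters, which is homogeneous
  of degree \<open>k = \<bar>\<Psi>\<^sup>+\<bar> - \<bar>\<Psi>\<^sub>v\<^sup>+\<bar> = \<ell>(\<omega>\<^sub>0\<^sup>v)\<close>. Hence \<open>(\<gamma> - \<gamma>(v))\<^sup>k\<close> maps everything to multiples of the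
  evaluation at \<open>v\<close>, and its product with \<open>\<gamma> - \<gamma>(v)\<close> vanishes. The coefficient on the functional of
  \<open>\<Delta>\<^sub>v\<close> is a polynomial in \<open>\<gamma>\<close>, and it is nonzero for half the squared norm.

  The duality between Schubert polynomials and \<open>\<H>\<close> holds for every choice of reduced words, so no
  braid relations are needed: on functions on a generic orbit the iterated divided differences,
  evaluated at one point, are triangular with respect to the length.
\<close>



text \<open>Two standard facts are not taken as input: that the coinvariant algebra has dimension
  |W|, and that iterated divided differences do not depend on the reduced word. One regular orbit,
  that of the sum of the positive roots, replaces both. On it every function comes from a
  polynomial, and an invariant of positive degree agrees with a constant, so a homogeneous element
  of the radical can be traded for a polynomial of smaller degree with the same values. Counting
  such values by length, from below and from above, produces polynomials dual to the chosen divided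
  differences.

  The half squared norm works because its translate by v, minus its value there, is the form (v, -)
  plus terms of degree 2, and pairing (v, -)^k with a homogeneous polynomial of degree k gives k!
  times the value of that polynomial at v. For \<open>\<Theta>(\<Delta>\<^sub>v)(\<Delta>)\<close>
  this value is nonzero: translation by v turns \<Delta> into \<open>\<Delta>\<^sub>v\<close> times
  a polynomial that does not vanish at 0, and \<open>\<Delta>\<^sub>v\<close> is not isotropic. Its
  invariance under all reflections makes it available in \<Gamma> for every root system
  \<Phi>.\<close>

section \<open>Jordan forms of operators with a one-dimensional image in the top power\<close>

text \<open>As simplification rules these eta-expand sums and products of functions inside terms.\<close>

declare plus_fun_apply [simp del] times_fun_apply [simp del] zero_fun_apply [simp del]
  one_fun_apply [simp del]

lemmas pointwise = fun_eq_iff plus_fun_apply times_fun_apply zero_fun_apply one_fun_apply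
  minus_apply uminus_apply

lemma zero_scale: "(\<lambda>x. 0 * f x) = (0 :: _ \<Rightarrow> complex)"
  by (simp add: pointwise)

text \<open>Stated through entries because the blocks of a block diagonal matrix have different
  dimensions, so there is no common zero matrix to compare them with.\<close>

definition nonzero_mat :: "complex mat \<Rightarrow> bool" where
  "nonzero_mat A \<longleftrightarrow> (\<exists>i<dim_row A. \<exists>j<dim_col A. A $$ (i, j) \<noteq> 0)"

lemma not_nonzero_mat: "A \<in> carrier_mat n n \<Longrightarrow> \<not> nonzero_mat A \<Longrightarrow> A = 0\<^sub>m n n"
  unfolding nonzero_mat_def by (intro eq_matI) auto

text \<open>Rank at most one: the zero matrix is included. As an outer product the property passes
  to products and can be tested on 2 by 2 minors.\<close>

definition rank_one_mat :: "complex mat \<Rightarrow> bool" where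
  "rank_one_mat A \<longleftrightarrow> (\<exists>u w. \<forall>i<dim_row A. \<forall>j<dim_col A. A $$ (i, j) = u i * w j)"

lemma rank_one_mult_left:
  assumes "rank_one_mat B" "A \<in> carrier_mat n n" "B \<in> carrier_mat n n" shows "rank_one_mat (A * B)"
proof -
  obtain u w where "\<forall>i<n. \<forall>j<n. B $$ (i, j) = u i * w j"
    using assms unfolding rank_one_mat_def by auto
  then have "\<forall>i<n. \<forall>j<n. (A * B) $$ (i, j) = (\<Sum>k\<in>{0..<n}. A $$ (i, k) * u k) * w j"
    using assms by (auto simp: scalar_prod_def sum_distrib_right mult.assoc intro!: sum.cong)
  then show ?thesis using assms unfolding rank_one_mat_def
    by (intro exI[of _ "\<lambda>i. \<Sum>k\<in>{0..<n}. A $$ (i, k) * u k"] exI[of _ w]) auto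
qed

lemma rank_one_mult_right:
  assumes "rank_one_mat A" "A \<in> carrier_mat n n" "B \<in> carrier_mat n n" shows "rank_one_mat (A * B)"
proof -
  obtain u w where "\<forall>i<n. \<forall>j<n. A $$ (i, j) = u i * w j"
    using assms unfolding rank_one_mat_def by auto
  then have "\<forall>i<n. \<forall>j<n. (A * B) $$ (i, j) = u i * (\<Sum>k\<in>{0..<n}. w k * B $$ (k, j))"
    using assms by (auto simp: scalar_prod_def sum_distrib_left mult.assoc intro!: sum.cong)
  then show ?thesis using assms unfolding rank_one_mat_def
    by (intro exI[of _ u] exI[of _ "\<lambda>j. \<Sum>k\<in>{0..<n}. w k * B $$ (k, j)"]) auto
qed

lemma diag_block_entries:
  fixes A :: "complex mat" and As :: "complex mat list"
  defines "D \<equiv> diag_block_mat As"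
  shows "i < dim_row A \<Longrightarrow> j < dim_col A \<Longrightarrow> diag_block_mat (A # As) $$ (i, j) = A $$ (i, j)"
    and "i < dim_row A \<Longrightarrow> j < dim_col D \<Longrightarrow> diag_block_mat (A # As) $$ (i, dim_col A + j) = 0"
    and "i < dim_row D \<Longrightarrow> j < dim_col A \<Longrightarrow> diag_block_mat (A # As) $$ (dim_row A + i, j) = 0"
    and "i < dim_row D \<Longrightarrow> j < dim_col D \<Longrightarrow> diag_block_mat (A # As) $$ (dim_row A + i, dim_col A + j) = D $$ (i, j)"
    and "dim_row (diag_block_mat (A # As)) = dim_row A + dim_row D"
    and "dim_col (diag_block_mat (A # As)) = dim_col A + dim_col D"
  by (simp_all add: D_def Let_def)

lemma nonzero_diag_block: "nonzero_mat (diag_block_mat As) \<longleftrightarrow> (\<exists>A\<in>set As. nonzero_mat A)"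
proof (induction As)
  case Nil
  then show ?case by (simp add: nonzero_mat_def)
next
  case (Cons A As)
  define D where "D = diag_block_mat As"
  define M where "M = diag_block_mat (A # As)"
  note e = diag_block_entries[where A = A and As = As, folded D_def M_def]
  have "nonzero_mat M \<longleftrightarrow> nonzero_mat A \<or> nonzero_mat D"
  proof
    assume "nonzero_mat M"
    then obtain i j where ij: "i < dim_row A + dim_row D" "j < dim_col A + dim_col D" "M $$ (i, j) \<noteq> 0"
      unfolding nonzero_mat_def e(5,6) by auto
    show "nonzero_mat A \<or> nonzero_mat D"
    proof (cases "i < dim_row A")
      case True
      have "j < dim_col A"
      proof (rule ccontr)
        assume n: "\<not> j < dim_col A"
        have "j - dim_col A < dim_col D" "dim_col A + (j - dim_col A) = j" using ij(2) n by linarith+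
        then show False using e(2)[OF True, of "j - dim_col A"] ij(3) by simp
      qed
      then show ?thesis using e(1)[OF True, of j] True ij unfolding nonzero_mat_def by auto
    next
      case False
      define i' where "i' = i - dim_row A"
      have i': "i = dim_row A + i'" "i' < dim_row D" using ij(1) False unfolding i'_def by linarith+
      have "\<not> j < dim_col A" using e(3)[OF i'(2), of j] ij(3) i'(1) by auto
      define j' where "j' = j - dim_col A"
      have j': "j = dim_col A + j'" "j' < dim_col D" using ij(2) \<open>\<not> j < dim_col A\<close> unfolding j'_def by linarith+
      show ?thesis using e(4)[OF i'(2) j'(2)] ij(3) i' j' unfolding nonzero_mat_def by auto
    qed
  next
    assume "nonzero_mat A \<or> nonzero_mat D"
    then show "nonzero_mat M"
    proof
      assume "nonzero_mat A"
      then obtain i j where "i < dim_row A" "j < dim_col A" "A $$ (i, j) \<noteq> 0" unfolding nonzero_mat_def by auto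
      then show ?thesis using e(1)[of i j] unfolding nonzero_mat_def e(5,6)
        by (intro exI[of _ i] conjI exI[of _ j]) auto
    next
      assume "nonzero_mat D"
      then obtain i j where "i < dim_row D" "j < dim_col D" "D $$ (i, j) \<noteq> 0" unfolding nonzero_mat_def by auto
      then show ?thesis using e(4)[of i j] unfolding nonzero_mat_def e(5,6)
        by (intro exI[of _ "dim_row A + i"] conjI exI[of _ "dim_col A + j"]) auto
    qed
  qed
  then show ?case using Cons by (simp only: M_def D_def) auto
qed

text \<open>Two nonzero diagonal blocks would give a nonzero 2 by 2 minor.\<close>

lemma rank_one_diag_block:
  assumes "rank_one_mat (diag_block_mat As)" shows "length (filter nonzero_mat As) \<le> 1"
  using assms
proof (induction As)
  case (Cons A As)
  define D where "D = diag_block_mat As"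
  define M where "M = diag_block_mat (A # As)"
  note e = diag_block_entries[where A = A and As = As, folded D_def M_def]
  obtain u w where uw: "\<And>i j. i < dim_row A + dim_row D \<Longrightarrow> j < dim_col A + dim_col D \<Longrightarrow> M $$ (i, j) = u i * w j"
    using Cons.prems[folded M_def] unfolding rank_one_mat_def e(5,6) by auto
  show ?case
  proof (cases "nonzero_mat A")
    case True
    then obtain i j where ij: "i < dim_row A" "j < dim_col A" "A $$ (i, j) \<noteq> 0" unfolding nonzero_mat_def by auto
    then have u: "u i \<noteq> 0" "w j \<noteq> 0" using e(1)[OF ij(1,2)] uw[of i j] ij by (auto simp: pointwise)
    have "D $$ (k, l) = 0" if kl: "k < dim_row D" "l < dim_col D" for k l
    proof -
      have "w (dim_col A + l) = 0" using e(2)[OF ij(1) kl(2)] uw[of i "dim_col A + l"] u ij kl by (auto simp: pointwise)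
      then show ?thesis using e(4)[OF kl] uw[of "dim_row A + k" "dim_col A + l"] kl by (auto simp: pointwise)
    qed
    then have "\<not> nonzero_mat D" unfolding nonzero_mat_def by auto
    then have "filter nonzero_mat As = []" unfolding D_def nonzero_diag_block by (simp add: filter_empty_conv)
    then show ?thesis using True by simp
  next
    case False
    have "rank_one_mat D" unfolding rank_one_mat_def
      by (intro exI[of _ "\<lambda>i. u (dim_row A + i)"] exI[of _ "\<lambda>j. w (dim_col A + j)"])
        (use uw e(4) in auto)
    then show ?thesis using Cons.IH False unfolding D_def by simp
  qed
qed simp

lemma char_matrix_jordan_matrix:
  "char_matrix (jordan_matrix bl) (c :: complex) = jordan_matrix (map (\<lambda>(n, a). (n, a - c)) bl)"
proof (induction bl)
  case Nil
  show ?case by (rule eq_matI) (auto simp: char_matrix_def jordan_matrix_def)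
next
  case (Cons b bl)
  obtain n a where b: "b = (n, a)" by force
  let ?s = "sum_list (map fst bl)"
  have s: "sum_list (map fst (map (\<lambda>(n, a). (n, a - c)) bl)) = ?s" by (induction bl) auto
  have "char_matrix (jordan_matrix ((n, a) # bl)) c =
    four_block_mat (char_matrix (jordan_block n a) c) (0\<^sub>m n ?s) (0\<^sub>m ?s n) (char_matrix (jordan_matrix bl) c)"
    unfolding jordan_matrix_Cons by (rule eq_matI) (auto simp: char_matrix_def)
  note * = this[unfolded Cons char_matrix_jordan_block]
  show ?case unfolding b * by (simp only: list.map prod.case jordan_matrix_Cons[of n "a - c"] s)
qed

text \<open>After subtracting c, a block of size k with eigenvalue a has vanishing N-th power only
  if a = c and k \<le> N, and then its (N-1)-st power is nonzero exactly if k = N. So the blocks of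
  size N are counted by the nonzero diagonal blocks of the (N-1)-st power, and rank at most one
  leaves room for one of them.\<close>

lemma jordan_blocks_rank_one:
  fixes A :: "complex mat"
  assumes A: "A \<in> carrier_mat n n" and jnf: "jordan_nf A bl" and N: "N \<ge> 1"
    and nil: "char_matrix A c ^\<^sub>m N = 0\<^sub>m n n" and rank: "rank_one_mat (char_matrix A c ^\<^sub>m (N - 1))"
  shows "\<forall>(k, a)\<in>set bl. a = c \<and> k \<le> N" "count_list (map fst bl) N \<le> 1"
    "char_matrix A c ^\<^sub>m (N - 1) \<noteq> 0\<^sub>m n n \<Longrightarrow> count_list (map fst bl) N = 1"
proof -
  \<comment> \<open>\<open>jordan_nf\<close> excludes empty blocks, so every block has an entry (0,
    0) that can be tested.\<close>
  have pos: "k \<noteq> 0" if "(k, a) \<in> set bl" for k a using jnf that unfolding jordan_nf_def by force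
  let ?J = "char_matrix (jordan_matrix bl) c"
  obtain P Q where wit: "similar_mat_wit A (jordan_matrix bl) P Q"
    using jnf unfolding jordan_nf_def similar_mat_def by auto
  note wk = similar_mat_wit_pow[OF similar_mat_wit_char_matrix[OF wit, of c]]
  have CA: "char_matrix A c \<in> carrier_mat n n" using A by simp
  have Ck: "dim_row (char_matrix A c ^\<^sub>m k) = n" for k using CA by simp
  have PQ: "P \<in> carrier_mat n n" "Q \<in> carrier_mat n n" "?J ^\<^sub>m k \<in> carrier_mat n n"
    and eq: "?J ^\<^sub>m k = Q * (char_matrix A c ^\<^sub>m k) * P"
    and eq': "char_matrix A c ^\<^sub>m k = P * (?J ^\<^sub>m k) * Q" for k
  proof -
    note d = similar_mat_witD[OF Ck[symmetric] wk]
    show "P \<in> carrier_mat n n" "Q \<in> carrier_mat n n" and J: "?J ^\<^sub>m k \<in> carrier_mat n n"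
      and "char_matrix A c ^\<^sub>m k = P * (?J ^\<^sub>m k) * Q" by (rule d)+
    have "n = dim_row (?J ^\<^sub>m k)" by (rule carrier_matD(1)[OF J, symmetric])
    from similar_mat_witD[OF this similar_mat_wit_sym[OF wk]]
    show "?J ^\<^sub>m k = Q * (char_matrix A c ^\<^sub>m k) * P" by (simp only:)
  qed
  define B where "B r = map (\<lambda>(k, a). jordan_block k (a - c) ^\<^sub>m r) bl" for r
  have JB: "?J ^\<^sub>m r = diag_block_mat (B r)" for r
    unfolding char_matrix_jordan_matrix jordan_matrix_pow B_def
    by (rule arg_cong[of _ _ diag_block_mat]) (auto simp: o_apply)
  have "?J ^\<^sub>m N = 0\<^sub>m n n" unfolding eq nil using PQ by simp
  then have "\<not> nonzero_mat (diag_block_mat (B N))" unfolding JB by (simp add: nonzero_mat_def)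
  then have z: "\<not> nonzero_mat (jordan_block k (a - c) ^\<^sub>m N)" if "(k, a) \<in> set bl" for k a
  proof -
    have "(\<lambda>(k, a). jordan_block k (a - c) ^\<^sub>m N) (k, a) \<in> set (B N)"
      unfolding B_def set_map by (rule imageI[OF that])
    then show ?thesis using \<open>\<not> nonzero_mat (diag_block_mat (B N))\<close> unfolding nonzero_diag_block by simp
  qed
  show blocks: "\<forall>(k, a)\<in>set bl. a = c \<and> k \<le> N"
  proof (clarify)
    fix k a assume ka: "(k, a) \<in> set bl"
    have zz: "(jordan_block k (a - c) ^\<^sub>m N) $$ (i, j) = 0" if "i < k" "j < k" for i j
      using z[OF ka] that unfolding nonzero_mat_def by auto
    have "(a - c) ^ N = 0" using zz[of 0 0] pos[OF ka] unfolding jordan_block_pow by simp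
    then have a: "a = c" by simp
    have "k \<le> N"
    proof (rule ccontr)
      assume "\<not> k \<le> N"
      \<comment> \<open>The N-th power of a nilpotent block of size larger than N has entry 1 at
        position (0, N).\<close>
      then show False using zz[of 0 N] pos[OF ka] unfolding a jordan_block_pow by simp
    qed
    with a show "a = c \<and> k \<le> N" by simp
  qed
  have nz: "nonzero_mat (jordan_block k (a - c) ^\<^sub>m (N - 1)) \<longleftrightarrow> k = N" if ka: "(k, a) \<in> set bl" for k a
  proof -
    have a: "a = c" "k \<le> N" using blocks ka by auto
    let ?X = "jordan_block k (0 :: complex) ^\<^sub>m (N - 1)"
    have ent: "?X $$ (i, j) = (if j \<ge> i \<and> j - i = N - 1 then 1 else 0)" if "i < k" "j < k" for i j
      unfolding jordan_block_zero_pow using that by simp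
    have "nonzero_mat ?X \<longleftrightarrow> k = N"
    proof
      assume "nonzero_mat ?X"
      then obtain i j where ij: "i < k" "j < k" "?X $$ (i, j) \<noteq> 0"
        unfolding nonzero_mat_def jordan_block_pow_dim by blast
      then have "j - i = N - 1" using ent[OF ij(1,2)] by (simp split: if_splits)
      then show "k = N" using ij(2) a(2) N by linarith
    next
      assume k: "k = N"
      then have "0 < k" "N - 1 < k" using N by auto
      then show "nonzero_mat ?X"
        using ent[of 0 "N - 1"] unfolding nonzero_mat_def jordan_block_pow_dim
        by (intro exI[of _ 0] conjI exI[of _ "N - 1"]) simp_all
    qed
    then show ?thesis unfolding a(1) by simp
  qed
  have count: "count_list (map fst bl) N = length (filter nonzero_mat (B (N - 1)))"
  proof -
    have "\<forall>(k, a)\<in>set l. nonzero_mat (jordan_block k (a - c) ^\<^sub>m (N - 1)) \<longleftrightarrow> k = N \<Longrightarrow>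
      count_list (map fst l) N = length (filter nonzero_mat (map (\<lambda>(k, a). jordan_block k (a - c) ^\<^sub>m (N - 1)) l))" for l
      by (induction l) auto
    moreover have "\<forall>(k, a)\<in>set bl. nonzero_mat (jordan_block k (a - c) ^\<^sub>m (N - 1)) \<longleftrightarrow> k = N"
      using nz by blast
    ultimately show ?thesis unfolding B_def .
  qed
  have "rank_one_mat (?J ^\<^sub>m (N - 1))"
    unfolding eq using rank PQ CA
    by (intro rank_one_mult_right[of _ n] rank_one_mult_left[of _ _ n]) auto
  then show le: "count_list (map fst bl) N \<le> 1"
    unfolding count JB by (rule rank_one_diag_block)
  assume ne: "char_matrix A c ^\<^sub>m (N - 1) \<noteq> 0\<^sub>m n n"
  have "nonzero_mat (?J ^\<^sub>m (N - 1))"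
  proof (rule ccontr)
    assume "\<not> nonzero_mat (?J ^\<^sub>m (N - 1))"
    with PQ(3) have "?J ^\<^sub>m (N - 1) = 0\<^sub>m n n" by (rule not_nonzero_mat)
    then have "char_matrix A c ^\<^sub>m (N - 1) = 0\<^sub>m n n" unfolding eq' using PQ by simp
    then show False using ne by simp
  qed
  then have "filter nonzero_mat (B (N - 1)) \<noteq> []"
    unfolding JB nonzero_diag_block by (simp add: filter_empty_conv)
  then have "count_list (map fst bl) N \<noteq> 0" unfolding count by simp
  then show "count_list (map fst bl) N = 1" using le by simp
qed

section \<open>Matrices of linear operators on spaces of functions\<close>

definition linear_on :: "('x \<Rightarrow> complex) set \<Rightarrow> (('x \<Rightarrow> complex) \<Rightarrow> ('x \<Rightarrow> complex)) \<Rightarrow> bool" where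
  "linear_on M T \<longleftrightarrow> (\<forall>f\<in>M. T f \<in> M) \<and> (\<forall>f\<in>M. \<forall>g\<in>M. T (f + g) = T f + T g) \<and>
     (\<forall>c. \<forall>f\<in>M. T (\<lambda>x. c * f x) = (\<lambda>x. c * T f x))"

lemma linear_on_sum:
  assumes T: "linear_on M T" and M: "funspace.subspace M" and I: "finite I" "\<And>i. i \<in> I \<Longrightarrow> g i \<in> M"
  shows "(\<Sum>i\<in>I. (\<lambda>x. c i * g i x)) \<in> M \<and> T (\<Sum>i\<in>I. (\<lambda>x. c i * g i x)) = (\<Sum>i\<in>I. (\<lambda>x. c i * T (g i) x))"
  using I
proof (induction I rule: finite_induct)
  case empty
  have "T (\<lambda>x. 0 * (0 :: _ \<Rightarrow> complex) x) = (\<lambda>x. 0 * T 0 x)"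
    using T funspace.subspace_0[OF M] unfolding linear_on_def by (simp only:)
  then show ?case unfolding zero_scale[of 0] zero_scale[of "T 0"] using funspace.subspace_0[OF M] by simp
next
  case (insert i I)
  have s: "(\<lambda>x. c i * g i x) \<in> M" using insert.prems by (intro funspace.subspace_scale[OF M]) auto
  have IH: "(\<Sum>i\<in>I. (\<lambda>x. c i * g i x)) \<in> M" "T (\<Sum>i\<in>I. (\<lambda>x. c i * g i x)) = (\<Sum>i\<in>I. (\<lambda>x. c i * T (g i) x))"
    using insert by auto
  have "T ((\<lambda>x. c i * g i x) + (\<Sum>i\<in>I. (\<lambda>x. c i * g i x))) = T (\<lambda>x. c i * g i x) + T (\<Sum>i\<in>I. (\<lambda>x. c i * g i x))"
    using T s IH(1) unfolding linear_on_def by (simp only:)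
  also have "T (\<lambda>x. c i * g i x) = (\<lambda>x. c i * T (g i) x)"
    using T insert.prems unfolding linear_on_def by auto
  finally show ?case
    using funspace.subspace_add[OF M s IH(1)] unfolding sum.insert[OF insert.hyps(1,2)] IH(2) by simp
qed

lemma linear_on_funpow: "linear_on M T \<Longrightarrow> linear_on M (T ^^ k)"
  by (induction k) (auto simp: linear_on_def id_apply o_apply)

context
  fixes M :: "('x \<Rightarrow> complex) set" and bs :: "('x \<Rightarrow> complex) list"
  assumes basis: "basis_of M bs"
begin

lemma basis_facts: "distinct bs" "funspace.independent (set bs)" "funspace.span (set bs) = M"
  using basis by (auto simp: basis_of_def)

lemma span_basis: "f \<in> M \<longleftrightarrow> f \<in> funspace.span (set bs)"
  using basis_facts by simp

lemma subspace_M: "funspace.subspace M"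
  using basis_facts(3) funspace.subspace_span[of "set bs"] by simp

lemma linear_on_representation:
  assumes T: "linear_on M T" and f: "f \<in> M"
  shows "funspace.representation (set bs) (T f) b
    = (\<Sum>b'\<in>set bs. funspace.representation (set bs) f b' * funspace.representation (set bs) (T b') b)"
proof -
  let ?r = "funspace.representation (set bs)"
  have bM: "b \<in> M" if "b \<in> set bs" for b using that unfolding span_basis by (rule funspace.span_base)
  have "f = (\<Sum>b'\<in>set bs. (\<lambda>x. ?r f b' * b' x))"
    using f unfolding span_basis by (intro funspace.sum_representation_eq[symmetric] basis_facts) auto
  then have "T f = (\<Sum>b'\<in>set bs. (\<lambda>x. ?r f b' * T b' x))"
    using linear_on_sum[OF T subspace_M, of "set bs" "\<lambda>b. b" "?r f"] bM by auto
  then have "?r (T f) b = ?r (\<Sum>b'\<in>set bs. (\<lambda>x. ?r f b' * T b' x)) b" by simp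
  also have "\<dots> = (\<Sum>b'\<in>set bs. ?r (\<lambda>x. ?r f b' * T b' x) b)"
  proof (subst funspace.representation_sum[OF basis_facts(2)])
    fix b' assume "b' \<in> set bs"
    then have "T b' \<in> M" using bM T unfolding linear_on_def by auto
    then show "(\<lambda>x. ?r f b' * T b' x) \<in> funspace.span (set bs)" unfolding span_basis by (rule funspace.span_scale)
  qed simp
  also have "\<dots> = (\<Sum>b'\<in>set bs. ?r f b' * ?r (T b') b)"
  proof (rule sum.cong[OF refl])
    fix b' assume "b' \<in> set bs"
    then have "T b' \<in> M" using bM T unfolding linear_on_def by auto
    then show "?r (\<lambda>x. ?r f b' * T b' x) b = ?r f b' * ?r (T b') b"
      unfolding span_basis by (simp add: funspace.representation_scale[OF basis_facts(2)])
  qed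
  finally show ?thesis .
qed

lemma nth_basis: "i < length bs \<Longrightarrow> bs ! i \<in> M"
  unfolding span_basis by (intro funspace.span_base nth_mem)

lemma matrix_in_comp:
  assumes "linear_on M S" "linear_on M T"
  shows "matrix_in bs (\<lambda>f. S (T f)) = matrix_in bs S * matrix_in bs T"
proof (rule eq_matI)
  fix i j assume "i < dim_row (matrix_in bs S * matrix_in bs T)" "j < dim_col (matrix_in bs S * matrix_in bs T)"
  then have ij: "i < length bs" "j < length bs" by (auto simp: matrix_in_def)
  have "T (bs ! j) \<in> M" using assms nth_basis ij unfolding linear_on_def by auto
  from linear_on_representation[OF assms(1) this, of "bs ! i"]
  have "matrix_in bs (\<lambda>f. S (T f)) $$ (i, j) = (\<Sum>b\<in>set bs. funspace.representation (set bs) (T (bs ! j)) b * funspace.representation (set bs) (S b) (bs ! i))"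
    using ij by (simp add: matrix_in_def)
  also have "\<dots> = (\<Sum>k\<in>{0..<length bs}. funspace.representation (set bs) (T (bs ! j)) (bs ! k) * funspace.representation (set bs) (S (bs ! k)) (bs ! i))"
    using sum.reindex_bij_betw[OF bij_betw_nth[OF basis_facts(1) refl refl], of "\<lambda>b. funspace.representation (set bs) (T (bs ! j)) b * funspace.representation (set bs) (S b) (bs ! i)"]
    by (simp add: atLeast0LessThan)
  also have "\<dots> = (matrix_in bs S * matrix_in bs T) $$ (i, j)"
    using ij by (simp add: matrix_in_def scalar_prod_def mult.commute)
  finally show "matrix_in bs (\<lambda>f. S (T f)) $$ (i, j) = (matrix_in bs S * matrix_in bs T) $$ (i, j)" .
qed (auto simp: matrix_in_def)

lemma matrix_in_index: "i < length bs \<Longrightarrow> j < length bs \<Longrightarrow>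
    matrix_in bs T $$ (i, j) = funspace.representation (set bs) (T (bs ! j)) (bs ! i)"
  by (simp add: matrix_in_def)

lemma representation_nth: "i < length bs \<Longrightarrow> j < length bs \<Longrightarrow>
    funspace.representation (set bs) (bs ! j) (bs ! i) = (if i = j then 1 else 0)"
  using basis_facts(1) by (auto simp: funspace.representation_basis[OF basis_facts(2)] nth_eq_iff_index_eq)

lemma matrix_in_minus_scalar:
  assumes "linear_on M T"
  shows "matrix_in bs (\<lambda>f. T f - (\<lambda>x. c * f x)) = char_matrix (matrix_in bs T) c"
proof (rule eq_matI)
  fix i j assume "i < dim_row (char_matrix (matrix_in bs T) c)" "j < dim_col (char_matrix (matrix_in bs T) c)"
  then have ij: "i < length bs" "j < length bs" by (auto simp: matrix_in_def char_matrix_def)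
  have "T (bs ! j) \<in> funspace.span (set bs)" "(\<lambda>x. c * (bs ! j) x) \<in> funspace.span (set bs)" "bs ! j \<in> funspace.span (set bs)"
    using assms nth_basis[OF ij(2)] basis_facts(3) unfolding linear_on_def by (auto intro: funspace.span_scale)
  then have "funspace.representation (set bs) (T (bs ! j) - (\<lambda>x. c * (bs ! j) x)) (bs ! i)
      = funspace.representation (set bs) (T (bs ! j)) (bs ! i) - c * (if i = j then 1 else 0)"
    using ij by (simp add: funspace.representation_diff[OF basis_facts(2)] funspace.representation_scale[OF basis_facts(2)] representation_nth)
  then show "matrix_in bs (\<lambda>f. T f - (\<lambda>x. c * f x)) $$ (i, j) = char_matrix (matrix_in bs T) c $$ (i, j)"
    using ij by (simp add: matrix_in_def char_matrix_def)
qed (auto simp: matrix_in_def char_matrix_def)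

lemma linear_on_minus_scalar:
  assumes "linear_on M T" shows "linear_on M (\<lambda>f. T f - (\<lambda>x. c * f x))"
  unfolding linear_on_def
proof (intro conjI ballI allI)
  note T = assms[unfolded linear_on_def]
  show "T f - (\<lambda>x. c * f x) \<in> M" if "f \<in> M" for f
    using that T basis_facts(3) by (auto intro: funspace.span_diff funspace.span_scale)
  show "T (f + g) - (\<lambda>x. c * (f + g) x) = T f - (\<lambda>x. c * f x) + (T g - (\<lambda>x. c * g x))" if "f \<in> M" "g \<in> M" for f g
  proof -
    have "T (f + g) = T f + T g" using T that by auto
    then show ?thesis by (simp add: pointwise distrib_left)
  qed
  show "T (\<lambda>x. d * f x) - (\<lambda>x. c * (d * f x)) = (\<lambda>x. d * (T f - (\<lambda>x. c * f x)) x)" if "f \<in> M" for d f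
  proof -
    have *: "T (\<lambda>x. d * f x) = (\<lambda>x. d * T f x)" using T that by auto
    show ?thesis unfolding * by (simp only: pointwise right_diff_distrib mult.left_commute[of d c]) simp
  qed
qed

lemma matrix_in_funpow:
  assumes "linear_on M T" shows "matrix_in bs (T ^^ k) = matrix_in bs T ^\<^sub>m k"
proof (induction k)
  case 0
  show ?case by (rule eq_matI) (auto simp: matrix_in_def representation_nth id_apply)
next
  case (Suc k)
  have "matrix_in bs (T ^^ Suc k) = matrix_in bs (\<lambda>f. (T ^^ k) (T f))"
    by (simp only: funpow_Suc_right comp_def)
  also have "\<dots> = matrix_in bs (T ^^ k) * matrix_in bs T"
    by (rule matrix_in_comp[OF linear_on_funpow[OF assms] assms])
  finally show ?case unfolding Suc pow_mat.simps .
qed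

lemma matrix_in_zero_iff:
  assumes "linear_on M T"
  shows "matrix_in bs T = 0\<^sub>m (length bs) (length bs) \<longleftrightarrow> (\<forall>f\<in>M. T f = 0)"
proof
  assume z: "matrix_in bs T = 0\<^sub>m (length bs) (length bs)"
  have r: "funspace.representation (set bs) (T b') b = 0" if m: "b' \<in> set bs" "b \<in> set bs" for b b'
  proof -
    obtain i j where "i < length bs" "bs ! i = b" "j < length bs" "bs ! j = b'" using m by (auto simp: in_set_conv_nth)
    then show ?thesis using arg_cong[OF z, of "\<lambda>A. A $$ (i, j)"] by (simp add: matrix_in_def)
  qed
  show "\<forall>f\<in>M. T f = 0"
  proof
    fix f assume f: "f \<in> M"
    have "T f \<in> funspace.span (set bs)" using f assms basis_facts(3) unfolding linear_on_def by auto
    then have "T f = (\<Sum>b\<in>set bs. (\<lambda>x. funspace.representation (set bs) (T f) b * b x))"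
      by (intro funspace.sum_representation_eq[symmetric] basis_facts) auto
    also have "\<dots> = (\<Sum>b\<in>set bs. 0)"
    proof (rule sum.cong[OF refl])
      fix b assume "b \<in> set bs"
      then have "funspace.representation (set bs) (T f) b = 0"
        unfolding linear_on_representation[OF assms f] using r by (simp add: pointwise)
      then show "(\<lambda>x. funspace.representation (set bs) (T f) b * b x) = 0" by (simp add: pointwise)
    qed
    finally show "T f = 0" by simp
  qed
next
  assume "\<forall>f\<in>M. T f = 0"
  then show "matrix_in bs T = 0\<^sub>m (length bs) (length bs)"
    by (intro eq_matI) (auto simp: matrix_in_def nth_basis funspace.representation_zero)
qed

end

text \<open>The image of the (N-1)-st power lies on the line of \<open>\<eta>\<close>, so in every
  basis each column of its matrix is a multiple of the coordinates of \<open>\<eta>\<close>, which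
  is an outer product. A Jordan form exists because characteristic polynomials split over the
  complex numbers.\<close>

lemma jordan_form_one_dimensional_top_power:
  fixes M :: "('x \<Rightarrow> complex) set"
  assumes M: "M = funspace.span S" "finite S" and T: "linear_on M T" and N: "N \<ge> 1"
    and nil: "\<And>f. f \<in> M \<Longrightarrow> ((\<lambda>f. T f - (\<lambda>x. c * f x)) ^^ N) f = 0"
    and \<eta>: "\<eta> \<in> M" "\<And>f. f \<in> M \<Longrightarrow> \<exists>a. ((\<lambda>f. T f - (\<lambda>x. c * f x)) ^^ (N - 1)) f = (\<lambda>x. a * \<eta> x)"
  shows "\<exists>bl. jordan_form M T bl"
    and "jordan_form M T bl \<Longrightarrow> (\<forall>(k, a)\<in>set bl. a = c \<and> k \<le> N) \<and> count_list (map fst bl) N \<le> 1"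
    and "jordan_form M T bl \<Longrightarrow> f \<in> M \<Longrightarrow> ((\<lambda>f. T f - (\<lambda>x. c * f x)) ^^ (N - 1)) f \<noteq> 0 \<Longrightarrow> count_list (map fst bl) N = 1"
proof -
  obtain B where B: "B \<subseteq> S" "funspace.independent B" "S \<subseteq> funspace.span B"
    by (rule funspace.maximal_independent_subset[of S])
  have "funspace.span B = M"
    unfolding M(1) using funspace.span_mono[OF B(1)] funspace.span_minimal[OF B(3) funspace.subspace_span] by (rule antisym)
  moreover obtain bs0 where "set bs0 = B" "distinct bs0" using finite_distinct_list[of B] finite_subset[OF B(1) M(2)] by auto
  ultimately have "basis_of M bs0" using B unfolding basis_of_def by auto
  moreover have "\<exists>bl. jordan_nf (matrix_in bs0 T) bl"
  proof -
    have c: "matrix_in bs0 T \<in> carrier_mat (length bs0) (length bs0)" by (simp add: matrix_in_def)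
    from char_poly_factorized[OF this] obtain as where "char_poly (matrix_in bs0 T) = (\<Prod>a\<leftarrow>as. [:- a, 1:])" by auto
    from jordan_nf_exists[OF c this] show ?thesis .
  qed
  ultimately show "\<exists>bl. jordan_form M T bl" unfolding jordan_form_def by auto
  let ?D = "\<lambda>f. T f - (\<lambda>x. c * f x)"
  have key: "(\<forall>(k, a)\<in>set bl. a = c \<and> k \<le> N)" "count_list (map fst bl) N \<le> 1"
    "f \<in> M \<Longrightarrow> (?D ^^ (N - 1)) f \<noteq> 0 \<Longrightarrow> count_list (map fst bl) N = 1"
    if jf: "jordan_form M T bl" for bl f
  proof -
    obtain bs where bs: "basis_of M bs" "jordan_nf (matrix_in bs T) bl" using jf unfolding jordan_form_def by auto
    let ?n = "length bs"
    have c: "matrix_in bs T \<in> carrier_mat ?n ?n" by (simp add: matrix_in_def)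
    note D = linear_on_minus_scalar[OF bs(1) T, of c]
    have pw: "char_matrix (matrix_in bs T) c ^\<^sub>m k = matrix_in bs (?D ^^ k)" for k
      by (simp only: matrix_in_funpow[OF bs(1) D] matrix_in_minus_scalar[OF bs(1) T])
    have n: "char_matrix (matrix_in bs T) c ^\<^sub>m N = 0\<^sub>m ?n ?n"
      unfolding pw matrix_in_zero_iff[OF bs(1) linear_on_funpow[OF D]] using nil by auto
    define a where "a f = (SOME a. (?D ^^ (N - 1)) f = (\<lambda>x. a * \<eta> x))" for f
    have a: "(?D ^^ (N - 1)) f = (\<lambda>x. a f * \<eta> x)" if "f \<in> M" for f
      unfolding a_def by (rule someI_ex[OF \<eta>(2)[OF that]])
    have "rank_one_mat (matrix_in bs (?D ^^ (N - 1)))"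
      unfolding rank_one_mat_def
    proof (intro exI allI impI)
      fix i j assume "i < dim_row (matrix_in bs (?D ^^ (N - 1)))" "j < dim_col (matrix_in bs (?D ^^ (N - 1)))"
      then have ij: "i < ?n" "j < ?n" by (auto simp: matrix_in_def)
      have \<eta>': "\<eta> \<in> funspace.span (set bs)" using \<eta>(1) basis_facts(3)[OF bs(1)] by simp
      show "matrix_in bs (?D ^^ (N - 1)) $$ (i, j) = funspace.representation (set bs) \<eta> (bs ! i) * a (bs ! j)"
        unfolding matrix_in_index[OF bs(1) ij] a[OF nth_basis[OF bs(1) ij(2)]]
          funspace.representation_scale[OF basis_facts(2)[OF bs(1)] \<eta>'] by (rule mult.commute)
    qed
    then have r: "rank_one_mat (char_matrix (matrix_in bs T) c ^\<^sub>m (N - 1))" unfolding pw .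
    note J = jordan_blocks_rank_one[OF c bs(2) N n r]
    show "(\<forall>(k, a)\<in>set bl. a = c \<and> k \<le> N)" "count_list (map fst bl) N \<le> 1" by (rule J(1), rule J(2))
    assume "f \<in> M" "(?D ^^ (N - 1)) f \<noteq> 0"
    then have "char_matrix (matrix_in bs T) c ^\<^sub>m (N - 1) \<noteq> 0\<^sub>m ?n ?n"
      unfolding pw matrix_in_zero_iff[OF bs(1) linear_on_funpow[OF D]] by auto
    then show "count_list (map fst bl) N = 1" by (rule J(3))
  qed
  show "jordan_form M T bl \<Longrightarrow> (\<forall>(k, a)\<in>set bl. a = c \<and> k \<le> N) \<and> count_list (map fst bl) N \<le> 1"
    using key(1,2) by auto
  show "jordan_form M T bl \<Longrightarrow> f \<in> M \<Longrightarrow> (?D ^^ (N - 1)) f \<noteq> 0 \<Longrightarrow> count_list (map fst bl) N = 1"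
    using key(3) by auto
qed


section \<open>Graded polynomial functions\<close>

lemma bil_add_left: "bil (x + y) a = bil x a + bil y a"
  and bil_add_right: "bil a (x + y) = bil a x + bil a y"
  and bil_diff_left: "bil (x - y) a = bil x a - bil y a"
  and bil_diff_right: "bil a (x - y) = bil a x - bil a y"
  and bil_scale_left: "bil (c *s x) a = c * bil x a"
  and bil_scale_right: "bil a (c *s x) = c * bil a x"
  and bil_0_left: "bil 0 a = 0"
  and bil_0_right: "bil a 0 = 0"
  and bil_minus_left: "bil (- x) a = - bil x a"
  and bil_minus_right: "bil a (- x) = - bil a x"
  by (simp_all add: bil_def sum.distrib algebra_simps sum_distrib_left sum_subtractf sum_negf
    plus_fun_apply times_fun_apply zero_fun_apply)

lemma bil_commute: "bil x y = bil y x"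
  by (simp add: bil_def mult.commute)

lemmas bil_simps = bil_add_left bil_add_right bil_diff_left bil_diff_right bil_scale_left
  bil_scale_right bil_0_left bil_0_right bil_minus_left bil_minus_right

declare minus_apply [simp del] uminus_apply [simp del]

lemma sum_pointwise: "sum f I x = (\<Sum>i\<in>I. (f i x :: complex))"
  by (induction I rule: infinite_finite_induct) (auto simp: pointwise)

lemma prod_pointwise: "prod f I x = (\<Prod>i\<in>I. (f i x :: complex))"
  by (induction I rule: infinite_finite_induct) (auto simp: pointwise)

text \<open>These products span \<open>Lam\<close>, and the length of the list is the degree.
  Identities that are linear in a polynomial are checked on them, by induction on the list.\<close>

definition linprod :: "(complex ^ 'n) list \<Rightarrow> complex ^ 'n \<Rightarrow> complex" where
  "linprod as x = (\<Prod>a\<leftarrow>as. bil x a)"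

lemma linprod_Nil: "linprod [] = (\<lambda>x. 1)"
  and linprod_Cons: "linprod (a # as) = linform a * linprod as"
  and linprod_append: "linprod (as @ bs) = linprod as * linprod bs"
  and linprod_single: "linprod [a] = linform a"
  by (auto simp: linprod_def pointwise linform_def)

text \<open>The polynomial functions whose homogeneous components have degrees in \<open>A\<close>.\<close>

definition Lams :: "nat set \<Rightarrow> (complex ^ 'n \<Rightarrow> complex) set" where
  "Lams A = funspace.span {linprod as | as. length as \<in> A}"

lemma Lams_mon: "length as \<in> A \<Longrightarrow> linprod as \<in> Lams A"
  unfolding Lams_def by (rule funspace.span_base) auto

lemma Lams_zero: "0 \<in> Lams A"
  unfolding Lams_def by (rule funspace.span_zero)

lemma Lams_add: "f \<in> Lams A \<Longrightarrow> g \<in> Lams A \<Longrightarrow> f + g \<in> Lams A"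
  unfolding Lams_def by (rule funspace.span_add)

lemma Lams_diff: "f \<in> Lams A \<Longrightarrow> g \<in> Lams A \<Longrightarrow> f - g \<in> Lams A"
  unfolding Lams_def by (rule funspace.span_diff)

lemma Lams_scale: "f \<in> Lams A \<Longrightarrow> (\<lambda>x. c * f x) \<in> Lams A"
  unfolding Lams_def by (rule funspace.span_scale)

lemma Lams_sum: "(\<And>i. i \<in> I \<Longrightarrow> f i \<in> Lams A) \<Longrightarrow> sum f I \<in> Lams A"
  unfolding Lams_def by (rule funspace.span_sum)

lemma Lams_mono: "A \<subseteq> B \<Longrightarrow> f \<in> Lams A \<Longrightarrow> f \<in> Lams B"
  unfolding Lams_def using funspace.span_mono[of "{linprod as | as. length as \<in> A}" "{linprod as | as. length as \<in> B}"] by blast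

lemma Lams_induct [consumes 1, case_names zero mon add scale]:
  assumes "f \<in> Lams A"
    and "P 0" and "\<And>as. length as \<in> A \<Longrightarrow> P (linprod as)"
    and "\<And>f g. f \<in> Lams A \<Longrightarrow> g \<in> Lams A \<Longrightarrow> P f \<Longrightarrow> P g \<Longrightarrow> P (f + g)"
    and "\<And>c f. f \<in> Lams A \<Longrightarrow> P f \<Longrightarrow> P (\<lambda>x. c * f x)"
  shows "P f"
proof -
  have "f \<in> Lams A \<and> P f"
    using assms(1) unfolding Lams_def
  proof (induction rule: funspace.span_induct_alt)
    case base
    show ?case using assms(2) funspace.span_zero by (auto simp: zero_fun_def)
  next
    case (step c x y)
    from step(1) obtain as where x: "x = linprod as" "length as \<in> A" by auto
    have "x \<in> Lams A" using x Lams_mon by auto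
    moreover have "P x" using x assms(3) by auto
    ultimately have "(\<lambda>z. c * x z) \<in> Lams A" "P (\<lambda>z. c * x z)" using assms(5) Lams_scale by auto
    moreover have "y \<in> Lams A" "P y" using step by (auto simp: Lams_def)
    ultimately show ?case unfolding Lams_def[symmetric]
      by (intro conjI assms(4) Lams_add) auto
  qed
  then show ?thesis by auto
qed

lemma Lams_mult:
  assumes "f \<in> Lams A" "g \<in> Lams B" "\<And>a b. a \<in> A \<Longrightarrow> b \<in> B \<Longrightarrow> a + b \<in> C"
  shows "f * g \<in> Lams C"
  using assms(1)
proof (induction rule: Lams_induct)
  case zero
  then show ?case using Lams_zero by simp
next
  case (mon as)
  show ?case using assms(2)
  proof (induction rule: Lams_induct)
    case zero
    then show ?case using Lams_zero by simp
  next
    case (mon bs)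
    then show ?case unfolding linprod_append[symmetric]
      using \<open>length as \<in> A\<close> assms(3) by (intro Lams_mon) auto
  next
    case (add f g)
    then show ?case by (metis Lams_add distrib_left)
  next
    case (scale c f)
    have "linprod as * (\<lambda>x. c * f x) = (\<lambda>x. c * (linprod as * f) x)" by (auto simp: pointwise)
    then show ?case using scale Lams_scale by metis
  qed
next
  case (add f g)
  then show ?case by (metis Lams_add distrib_right)
next
  case (scale c f)
  have "(\<lambda>x. c * f x) * g = (\<lambda>x. c * (f * g) x)" by (auto simp: pointwise)
  then show ?case using scale Lams_scale by metis
qed

lemma Lams_const: "0 \<in> A \<Longrightarrow> (\<lambda>x. c) \<in> Lams A"
  using Lams_scale[OF Lams_mon[of "[]" A], of c] by (simp add: linprod_Nil)

lemma Lams_linform: "1 \<in> A \<Longrightarrow> linform a \<in> Lams A"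
  using Lams_mon[of "[a]" A] by (simp add: linprod_single)

lemma Lam_eq_Lams: "Lam = Lams UNIV"
proof
  show "Lam \<subseteq> Lams UNIV"
  proof
    fix f :: "complex ^ 'n \<Rightarrow> complex"
    assume "f \<in> Lam"
    then show "f \<in> Lams UNIV" unfolding Lam_def
      by (induction rule: alg_gen.induct) (auto intro: Lams_linform Lams_const Lams_add Lams_mult)
  qed
  show "Lams UNIV \<subseteq> Lam"
  proof
    fix f :: "complex ^ 'n \<Rightarrow> complex"
    assume "f \<in> Lams UNIV"
    then show "f \<in> Lam" unfolding Lam_def
    proof (induction rule: Lams_induct)
      case zero
      then show ?case using alg_gen.const[of 0] by (simp add: zero_fun_def)
    next
      case (mon as)
      then show ?case
        by (induction as) (auto simp: linprod_Nil linprod_Cons intro: alg_gen.intros)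
    next
      case (add f g)
      then show ?case by (auto intro: alg_gen.intros)
    next
      case (scale c f)
      have "(\<lambda>x. c * f x) = (\<lambda>x. c) * f" by (auto simp: pointwise)
      then show ?case using scale by (metis alg_gen.intros(2,4))
    qed
  qed
qed

lemma Lams_Lam: "f \<in> Lams A \<Longrightarrow> f \<in> Lam"
  unfolding Lam_eq_Lams by (erule Lams_mono[rotated]) simp

lemma Lam_zero: "0 \<in> Lam"
  and Lam_one: "1 \<in> Lam"
  and Lam_add: "f \<in> Lam \<Longrightarrow> g \<in> Lam \<Longrightarrow> f + g \<in> Lam"
  and Lam_diff: "f \<in> Lam \<Longrightarrow> g \<in> Lam \<Longrightarrow> f - g \<in> Lam"
  and Lam_mult: "f \<in> Lam \<Longrightarrow> g \<in> Lam \<Longrightarrow> f * g \<in> Lam"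
  and Lam_const: "(\<lambda>x. c) \<in> Lam"
  and Lam_scale: "f \<in> Lam \<Longrightarrow> (\<lambda>x. c * f x) \<in> Lam"
  and Lam_linform: "linform a \<in> Lam"
  and Lam_mon: "linprod as \<in> Lam"
  unfolding Lam_eq_Lams one_fun_def
  by (auto intro: Lams_zero Lams_add Lams_diff Lams_mult Lams_const Lams_scale Lams_linform Lams_mon)

lemma Lam_sum: "(\<And>i. i \<in> I \<Longrightarrow> f i \<in> Lam) \<Longrightarrow> sum f I \<in> Lam"
  unfolding Lam_eq_Lams by (rule Lams_sum)

lemma Lam_power: "f \<in> Lam \<Longrightarrow> f ^ k \<in> Lam"
  by (induction k) (auto intro: Lam_one Lam_mult)

lemma Lam_prod: "(\<And>i. i \<in> I \<Longrightarrow> f i \<in> Lam) \<Longrightarrow> prod f I \<in> Lam"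
  by (induction I rule: infinite_finite_induct) (auto intro: Lam_one Lam_mult)

lemma Lams_prod:
  assumes "finite I" "\<And>i. i \<in> I \<Longrightarrow> f i \<in> Lams {1}"
  shows "prod f I \<in> Lams {card I}"
  using assms
proof (induction I rule: finite_induct)
  case empty
  then show ?case using Lams_const[of "{0}" 1] by (simp add: one_fun_def)
next
  case (insert i I)
  then show ?case by (auto intro!: Lams_mult[of _ "{1}" _ "{card I}"])
qed

lemmas Lam_intros = Lam_zero Lam_one Lam_add Lam_diff Lam_mult Lam_const Lam_scale Lam_linform
  Lam_mon Lam_sum Lam_power Lam_prod

lemma Lam_induct [consumes 1, case_names zero mon add scale]:
  assumes "f \<in> Lam"
    and "P 0" and "\<And>as. P (linprod as)"
    and "\<And>f g. f \<in> Lam \<Longrightarrow> g \<in> Lam \<Longrightarrow> P f \<Longrightarrow> P g \<Longrightarrow> P (f + g)"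
    and "\<And>c f. f \<in> Lam \<Longrightarrow> P f \<Longrightarrow> P (\<lambda>x. c * f x)"
  shows "P f"
  using assms unfolding Lam_eq_Lams by (induction rule: Lams_induct) auto

lemma Lams_bounded: "f \<in> Lam \<Longrightarrow> \<exists>k. f \<in> Lams {..k}"
proof (induction rule: Lam_induct)
  case (add f g)
  then obtain k l where "f \<in> Lams {..k}" "g \<in> Lams {..l}" by auto
  then have "f \<in> Lams {..max k l}" "g \<in> Lams {..max k l}" by (auto elim!: Lams_mono[rotated])
  then show ?case using Lams_add by auto
qed (auto intro: Lams_zero Lams_mon Lams_scale)

text \<open>Used with disjoint A and B, to split off a homogeneous component. Uniqueness of the
  splitting follows only later, from \<open>Lams_disjoint\<close>.\<close>

lemma Lams_Un:
  assumes "f \<in> Lams (A \<union> B)"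
  obtains g h where "g \<in> Lams A" "h \<in> Lams B" "f = g + h"
proof -
  have *: "{linprod as |as. length as \<in> A \<union> B} = {linprod as |as. length as \<in> A} \<union> {linprod as |as. length as \<in> B}"
    by auto
  have "f \<in> {x + y |x y. x \<in> Lams A \<and> y \<in> Lams B}"
    using assms[unfolded Lams_def * funspace.span_Un] unfolding Lams_def .
  then show ?thesis using that by auto
qed

lemma Lams_0_const: assumes "f \<in> Lams {0}" shows "f x = f 0"
  using assms by (induction rule: Lams_induct) (auto simp: linprod_Nil pointwise)

lemma Lams_positive_at_0: assumes "f \<in> Lams {1..}" shows "f 0 = 0"
  using assms
proof (induction rule: Lams_induct)
  case (mon as)
  then show ?case by (cases as) (auto simp: linprod_def bil_simps pointwise)
qed (auto simp: pointwise)

lemma Lams_vanishing_at_0: assumes "f \<in> Lam" "f 0 = 0" shows "f \<in> Lams {1..}"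
proof -
  have "f \<in> Lams ({0} \<union> {1..})" using assms(1) unfolding Lam_eq_Lams by (rule Lams_mono[rotated]) auto
  then obtain g h where gh: "g \<in> Lams {0}" "h \<in> Lams {1..}" "f = g + h" by (rule Lams_Un)
  have "g 0 = 0" using gh(3) assms(2) Lams_positive_at_0[OF gh(2)] by (simp add: plus_fun_apply)
  then have "g x = 0" for x using Lams_0_const[OF gh(1), of x] by simp
  then have "f = h" unfolding gh(3) by (simp add: pointwise)
  then show ?thesis using gh(2) by simp
qed

lemma Lams_power: "f \<in> Lams {k..} \<Longrightarrow> f ^ j \<in> Lams {j * k..}"
proof (induction j)
  case 0
  then show ?case by (simp add: one_fun_def Lams_const)
next
  case (Suc j)
  then show ?case by (auto intro!: Lams_mult[of f "{k..}" "f ^ j" "{j * k..}"])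
qed

lemma Lams_homogeneous:
  assumes "f \<in> Lams {k}" shows "f (c *s x) = c ^ k * f x"
  using assms
proof (induction rule: Lams_induct)
  case (mon as)
  then have "k = length as" by simp
  then show ?case by (induction as arbitrary: k) (auto simp: linprod_def bil_simps)
qed (auto simp: pointwise algebra_simps)

lemma Lams_comp_linear:
  assumes "f \<in> Lams A" and "\<And>a. \<exists>a'. \<forall>x. bil (\<sigma> x) a = bil x a'"
  shows "f \<circ> \<sigma> \<in> Lams A"
  using assms(1)
proof (induction rule: Lams_induct)
  case zero
  then show ?case using Lams_zero by (simp add: zero_fun_def comp_def)
next
  case (mon as)
  obtain \<sigma>' where "\<And>a x. bil (\<sigma> x) a = bil x (\<sigma>' a)" using assms(2) by metis
  then have "linprod as \<circ> \<sigma> = linprod (map \<sigma>' as)"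
    by (auto simp: pointwise linprod_def comp_def)
  then show ?case using mon by (simp add: Lams_mon)
next
  case (add f g)
  moreover have "(f + g) \<circ> \<sigma> = (f \<circ> \<sigma>) + (g \<circ> \<sigma>)" by (simp add: pointwise)
  ultimately show ?case by (simp only: Lams_add)
next
  case (scale c f)
  then show ?case using Lams_scale[of "f \<circ> \<sigma>" A c] by (simp add: comp_def)
qed

lemma Lam_translate: assumes "f \<in> Lam" shows "(\<lambda>x. f (x + v)) \<in> Lam"
  using assms
proof (induction rule: Lam_induct)
  case zero
  then show ?case using Lam_zero by (simp add: zero_fun_def)
next
  case (mon as)
  show ?case
  proof (induction as)
    case Nil
    then show ?case by (simp add: linprod_Nil Lam_const)
  next
    case (Cons a as)
    have "(\<lambda>x. linprod (a # as) (x + v)) = (linform a + (\<lambda>x. bil v a)) * (\<lambda>x. linprod as (x + v))"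
      by (auto simp: pointwise linprod_def linform_def bil_simps)
    then show ?case using Cons by (simp only:) (intro Lam_intros)
  qed
next
  case (add f g)
  then show ?case using Lam_add by (fastforce simp: plus_fun_def)
next
  case (scale c f)
  then show ?case using Lam_scale by fastforce
qed

text \<open>Reflections and projections along \<open>a\<close> both have this form, and both quotients are needed.\<close>

lemma Lams_divide:
  assumes "f \<in> Lams A"
  shows "\<exists>g\<in>Lams (Suc -` A). f - (\<lambda>x. f (x - (c * bil x a) *s u)) = linform a * g"
  using assms
proof (induction rule: Lams_induct)
  case zero
  then show ?case by (intro bexI[of _ 0]) (auto simp: Lams_zero pointwise)
next
  case (mon as)
  have "\<exists>g\<in>Lams {k. Suc k = length as}. linprod as - (\<lambda>x. linprod as (x - (c * bil x a) *s u)) = linform a * g"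
  proof (induction as)
    case Nil
    then show ?case by (intro bexI[of _ 0]) (auto simp: Lams_zero pointwise linprod_Nil)
  next
    case (Cons b as)
    then obtain g where g: "g\<in>Lams {k. Suc k = length as}"
      "linprod as - (\<lambda>x. linprod as (x - (c * bil x a) *s u)) = linform a * g" by auto
    let ?L = "\<lambda>x. x - (c * bil x a) *s u"
    \<comment> \<open>A Leibniz rule for differences. If y is the image of x under \<open>?L\<close>
      and f is the product over the tail, then (x, b) f(x) - (y, b) f(y) = ((x, b) - (y, b)) f(x) +
      (y, b) (f(x) - f(y)), and the first bracket is c (x, a) (u, b).\<close>
    let ?g = "(\<lambda>x. c * bil u b * linprod as x) + (linform b \<circ> ?L) * g"
    have g2: "linprod as x - linprod as (?L x) = bil x a * g x" for x
      using fun_cong[OF g(2), of x] by (simp add: linform_def pointwise)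
    have "linprod (b # as) x - linprod (b # as) (?L x) = (linform a * ?g) x" for x
    proof -
      define y where "y = ?L x"
      have y1: "bil y b = bil x b - c * bil x a * bil u b" by (simp add: y_def bil_simps)
      have y2: "linprod as y = linprod as x - bil x a * g x" unfolding y_def g2[of x, symmetric] by simp
      have "bil x b * linprod as x - bil y b * linprod as y
          = bil x a * (c * bil u b * linprod as x + bil y b * g x)"
        unfolding y1 y2 by (simp add: algebra_simps pointwise)
      then show ?thesis unfolding y_def by (simp add: linform_def pointwise linprod_def)
    qed
    then have "linprod (b # as) - (\<lambda>x. linprod (b # as) (?L x)) = linform a * ?g"
      by (simp add: pointwise)
    moreover have "linform b \<circ> ?L \<in> Lams {1}"
    proof (rule Lams_comp_linear)
      show "\<exists>a'. \<forall>x. bil (?L x) d = bil x a'" for d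
        by (intro exI[of _ "d - (c * bil u d) *s a"]) (auto simp: bil_simps algebra_simps pointwise)
    qed (auto intro: Lams_linform)
    then have "?g \<in> Lams {k. Suc k = length (b # as)}"
      using g(1) by (intro Lams_add Lams_scale Lams_mon Lams_mult[of _ "{1}" _ "{k. Suc k = length as}"]) auto
    ultimately show ?case by blast
  qed
  then obtain g where "g\<in>Lams {k. Suc k = length as}" "linprod as - (\<lambda>x. linprod as (x - (c * bil x a) *s u)) = linform a * g"
    by auto
  moreover then have "g \<in> Lams (Suc -` A)" using mon by (auto elim!: Lams_mono[rotated])
  ultimately show ?case by blast
next
  case (add f g)
  then obtain f' g' where fg: "f' \<in> Lams (Suc -` A)" "g' \<in> Lams (Suc -` A)"
    "f - (\<lambda>x. f (x - (c * bil x a) *s u)) = linform a * f'"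
    "g - (\<lambda>x. g (x - (c * bil x a) *s u)) = linform a * g'" by auto
  have "f + g - (\<lambda>x. (f + g) (x - (c * bil x a) *s u)) = linform a * (f' + g')"
    unfolding pointwise
  proof
    fix x
    show "f x + g x - (f (x - (c * bil x a) *s u) + g (x - (c * bil x a) *s u))
        = linform a x * (f' x + g' x)"
      using fun_cong[OF fg(3), of x] fun_cong[OF fg(4), of x]
      unfolding minus_apply times_fun_apply distrib_left add_diff_add by (simp only:)
  qed
  then show ?case by (rule bexI[of _ "f' + g'"]) (rule Lams_add[OF fg(1,2)])
next
  case (scale d f)
  then obtain f' where f: "f' \<in> Lams (Suc -` A)"
    "f - (\<lambda>x. f (x - (c * bil x a) *s u)) = linform a * f'" by auto
  have "d * f x - d * f (x - (c * bil x a) *s u) = linform a x * (d * f' x)" for x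
    using fun_cong[OF f(2), of x] unfolding minus_apply times_fun_apply
    by (simp only: right_diff_distrib[symmetric] mult.left_commute[of d])
  then have "(\<lambda>x. d * f x) - (\<lambda>x. d * f (x - (c * bil x a) *s u)) = linform a * (\<lambda>x. d * f' x)"
    by (auto simp only: pointwise)
  then show ?case by (rule bexI[of _ "\<lambda>x. d * f' x"]) (rule Lams_scale[OF f(1)])
qed


section \<open>Differential operators and the pairing\<close>

text \<open>Taken from analysis, so that it visibly depends on the function only. A definition on
  products of linear forms would have to be shown independent of the way a polynomial is
  written.\<close>

definition dird :: "complex ^ 'n \<Rightarrow> (complex ^ 'n \<Rightarrow> complex) \<Rightarrow> complex ^ 'n \<Rightarrow> complex" where
  "dird a f x = deriv (\<lambda>t. f (x + t *s a)) 0"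

lemma Lam_has_dird:
  assumes "f \<in> Lam"
  shows "((\<lambda>t. f (x + t *s a)) has_field_derivative dird a f x) (at 0)"
proof -
  have "\<exists>D. ((\<lambda>t. f (x + t *s a)) has_field_derivative D) (at 0)"
    using assms
  proof (induction rule: Lam_induct)
    case zero
    then show ?case by (auto simp: pointwise intro!: exI[of _ 0])
  next
    case (mon as)
    show ?case
    proof (induction as)
      case Nil
      then show ?case by (auto simp: linprod_Nil intro!: exI[of _ 0])
    next
      case (Cons b as)
      then obtain D where D: "((\<lambda>t. linprod as (x + t *s a)) has_field_derivative D) (at 0)" by auto
      have "((\<lambda>t. bil x b + t * bil a b) has_field_derivative bil a b) (at 0)"
        by (auto intro!: derivative_eq_intros simp: pointwise)
      from DERIV_mult[OF this D] show ?case
        by (auto simp: linprod_def bil_simps)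
    qed
  next
    case (add f g)
    then show ?case by (auto simp: pointwise intro: DERIV_add)
  next
    case (scale c f)
    then show ?case by (auto intro: DERIV_cmult)
  qed
  then obtain D where "((\<lambda>t. f (x + t *s a)) has_field_derivative D) (at 0)" ..
  with DERIV_imp_deriv[OF this] show ?thesis unfolding dird_def by (simp only:)
qed

lemma dirdI: "((\<lambda>t. f (x + t *s a)) has_field_derivative D) (at 0) \<Longrightarrow> dird a f x = D"
  unfolding dird_def by (rule DERIV_imp_deriv)

lemma dird_add: "f \<in> Lam \<Longrightarrow> g \<in> Lam \<Longrightarrow> dird a (f + g) = dird a f + dird a g"
  unfolding pointwise using DERIV_add[OF Lam_has_dird Lam_has_dird] by (auto intro!: dirdI simp: pointwise)

lemma dird_scale: "f \<in> Lam \<Longrightarrow> dird a (\<lambda>x. c * f x) = (\<lambda>x. c * dird a f x)"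
  unfolding pointwise using DERIV_cmult[OF Lam_has_dird] by (auto intro!: dirdI)

lemma dird_mult: "f \<in> Lam \<Longrightarrow> g \<in> Lam \<Longrightarrow> dird a (f * g) = dird a f * g + f * dird a g"
  unfolding pointwise
  by (intro allI dirdI) (use DERIV_mult[OF Lam_has_dird Lam_has_dird] in \<open>fastforce simp: pointwise algebra_simps\<close>)

lemma dird_const: "dird a (\<lambda>x. c) = 0"
  by (auto simp: pointwise intro!: dirdI)

lemma dird_zero: "dird a 0 = 0"
  using dird_const[of a 0] by (simp add: zero_fun_def)

lemma dird_linform: "dird a (linform b) = (\<lambda>x. bil b a)"
  unfolding pointwise linform_def
  by (intro allI dirdI) (auto simp: bil_simps bil_commute[of a b] pointwise intro!: derivative_eq_intros)

text \<open>\<open>Leib a bs F\<close> is the sum of \<open>(a, b) F(cs)\<close> over all ways to split \<open>b\<close> off the list \<open>bs\<close>.\<close>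

fun Leib :: "complex ^ 'n \<Rightarrow> (complex ^ 'n) list \<Rightarrow> ((complex ^ 'n) list \<Rightarrow> complex) \<Rightarrow> complex" where
  "Leib a [] F = 0"
| "Leib a (b # bs) F = bil b a * F bs + Leib a bs (\<lambda>cs. F (b # cs))"

lemma Leib_scale: "Leib a bs (\<lambda>cs. c * F cs) = c * Leib a bs F"
  by (induction bs arbitrary: F) (auto simp: algebra_simps pointwise)


lemma Leib_Lams:
  assumes "\<And>cs. Suc (length cs) = length bs \<Longrightarrow> F cs \<in> Lams A"
  shows "(\<lambda>x. Leib a bs (\<lambda>cs. F cs x)) \<in> Lams A"
  using assms
proof (induction bs arbitrary: F)
  case Nil
  then show ?case using Lams_zero by (auto simp: zero_fun_def)
next
  case (Cons b bs)
  have "(\<lambda>x. Leib a (b # bs) (\<lambda>cs. F cs x)) =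
     (\<lambda>x. bil b a * F bs x) + (\<lambda>x. Leib a bs (\<lambda>cs. F (b # cs) x))"
    by (auto simp: pointwise)
  also have "\<dots> \<in> Lams A"
    by (intro Lams_add Lams_scale Cons.IH) (auto intro: Cons.prems)
  finally show ?case .
qed

lemma dird_linprod: "dird a (linprod bs) = (\<lambda>x. Leib a bs (\<lambda>cs. linprod cs x))"
proof (induction bs)
  case Nil
  then show ?case by (simp add: linprod_Nil dird_const zero_fun_def)
next
  case (Cons b bs)
  have *: "linprod (b # cs) x = bil x b * linprod cs x" for cs x
    by (simp add: linprod_def)
  have "dird a (linprod (b # bs)) = dird a (linform b) * linprod bs + linform b * dird a (linprod bs)"
    unfolding linprod_Cons by (intro dird_mult Lam_intros)
  then have **: "dird a (linprod (b # bs)) =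
      (\<lambda>x. bil b a) * linprod bs + linform b * (\<lambda>x. Leib a bs (\<lambda>cs. linprod cs x))"
    unfolding Cons dird_linform .
  show ?case unfolding ** by (simp add: pointwise linform_def * Leib_scale)
qed

text \<open>A preimage under \<open>Suc\<close> instead of a subtraction: degree 0 has no
  predecessor, and constants are indeed sent to 0. The same convention describes degrees after
  divided differences and \<open>Theta\<close>.\<close>

lemma Lams_dird:
  assumes "f \<in> Lams A" shows "dird a f \<in> Lams (Suc -` A)"
  using assms
proof (induction rule: Lams_induct)
  case zero
  then show ?case unfolding dird_zero by (rule Lams_zero)
next
  case (mon as)
  show ?case unfolding dird_linprod
    by (rule Leib_Lams) (use mon in \<open>auto intro!: Lams_mon\<close>)
next
  case (add f g)
  then show ?case unfolding dird_add[OF add(1,2)[THEN Lams_Lam]] by (intro Lams_add)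
next
  case (scale c f)
  then show ?case unfolding dird_scale[OF scale(1)[THEN Lams_Lam]] by (intro Lams_scale)
qed

lemma Lam_dird: "f \<in> Lam \<Longrightarrow> dird a f \<in> Lam"
  using Lams_dird[of f UNIV] by (simp add: Lam_eq_Lams)

lemma dird_commute:
  assumes "f \<in> Lam" shows "dird a (dird b f) = dird b (dird a f)"
  using assms
proof (induction rule: Lam_induct)
  case zero
  show ?case by (simp add: dird_zero)
next
  case (mon as)
  show ?case
  proof (induction as)
    case Nil
    show ?case by (simp add: linprod_Nil dird_const dird_zero)
  next
    case (Cons c as)
    have *: "dird a (dird b (linprod (c # as))) =
      (\<lambda>x. bil c b * dird a (linprod as) x) + ((\<lambda>x. bil c a * dird b (linprod as) x) + linform c * dird a (dird b (linprod as)))"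
      for a b
    proof -
      have "dird b (linprod (c # as)) = (\<lambda>x. bil c b * linprod as x) + linform c * dird b (linprod as)"
        unfolding linprod_Cons by (subst dird_mult) (auto intro: Lam_intros simp: dird_linform pointwise)
      then have "dird a (dird b (linprod (c # as))) = dird a (\<lambda>x. bil c b * linprod as x) + dird a (linform c * dird b (linprod as))"
        by (simp only:) (intro dird_add Lam_intros Lam_dird)
      also have "dird a (linform c * dird b (linprod as)) = dird a (linform c) * dird b (linprod as) + linform c * dird a (dird b (linprod as))"
        by (intro dird_mult Lam_intros Lam_dird)
      finally show ?thesis by (simp only: dird_scale[OF Lam_mon] dird_linform) (simp add: pointwise)
    qed
    show ?case unfolding * Cons by (simp add: pointwise)
  qed
next
  case (add f g)
  then show ?case by (simp add: dird_add Lam_dird)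
next
  case (scale c f)
  then show ?case by (simp add: dird_scale Lam_dird)
qed

section \<open>Iterated derivatives\<close>

definition dirds :: "(complex ^ 'n) list \<Rightarrow> (complex ^ 'n \<Rightarrow> complex) \<Rightarrow> complex ^ 'n \<Rightarrow> complex" where
  "dirds as f = foldr dird as f"

lemma dirds_Nil: "dirds [] f = f"
  and dirds_Cons: "dirds (a # as) f = dird a (dirds as f)"
  and dirds_append: "dirds (as @ bs) f = dirds as (dirds bs f)"
  by (simp_all add: dirds_def)

lemma Lam_dirds: "f \<in> Lam \<Longrightarrow> dirds as f \<in> Lam"
  by (induction as) (auto simp: dirds_Nil dirds_Cons Lam_dird)

lemma dirds_add: "f \<in> Lam \<Longrightarrow> g \<in> Lam \<Longrightarrow> dirds as (f + g) = dirds as f + dirds as g"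
  by (induction as) (auto simp: dirds_Nil dirds_Cons dird_add Lam_dirds)

lemma dirds_scale: "f \<in> Lam \<Longrightarrow> dirds as (\<lambda>x. c * f x) = (\<lambda>x. c * dirds as f x)"
  by (induction as) (auto simp: dirds_Nil dirds_Cons dird_scale Lam_dirds)

lemma dirds_zero: "dirds as 0 = 0"
  by (induction as) (auto simp: dirds_Nil dirds_Cons dird_zero)

lemma dirds_sum: "(\<And>i. i \<in> I \<Longrightarrow> f i \<in> Lam) \<Longrightarrow> dirds as (sum f I) = (\<Sum>i\<in>I. dirds as (f i))"
  by (induction I rule: infinite_finite_induct) (simp_all add: dirds_zero dirds_add Lam_sum)

lemma Lams_dirds: "f \<in> Lams A \<Longrightarrow> dirds as f \<in> Lams ((\<lambda>k. length as + k) -` A)"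
proof (induction as)
  case Nil
  then show ?case by (simp add: dirds_Nil vimage_def)
next
  case (Cons a as)
  from Lams_dird[OF Cons.IH[OF Cons.prems], of a] show ?case
    by (simp add: dirds_Cons vimage_def)
qed

lemma dird_dirds_commute: "f \<in> Lam \<Longrightarrow> dird a (dirds as f) = dirds as (dird a f)"
proof (induction as)
  case (Cons b as)
  have "dird a (dird b (dirds as f)) = dird b (dird a (dirds as f))"
    by (rule dird_commute) (rule Lam_dirds[OF Cons.prems])
  then show ?case using Cons by (simp add: dirds_Cons)
qed (simp add: dirds_Nil)

lemma Leib_dird:
  assumes "\<And>cs. F cs \<in> Lam"
  shows "dird b (\<lambda>x. Leib a bs (\<lambda>cs. F cs x)) = (\<lambda>x. Leib a bs (\<lambda>cs. dird b (F cs) x))"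
  using assms
proof (induction bs arbitrary: F)
  case Nil
  then show ?case by (simp add: dird_const zero_fun_def)
next
  case (Cons c bs)
  have "(\<lambda>x. Leib a (c # bs) (\<lambda>cs. F cs x)) =
     (\<lambda>x. bil c a * F bs x) + (\<lambda>x. Leib a bs (\<lambda>cs. F (c # cs) x))"
    by (auto simp: pointwise)
  moreover have "(\<lambda>x. Leib a bs (\<lambda>cs. F (c # cs) x)) \<in> Lam"
    unfolding Lam_eq_Lams by (rule Leib_Lams) (use Cons.prems Lam_eq_Lams in auto)
  ultimately have "dird b (\<lambda>x. Leib a (c # bs) (\<lambda>cs. F cs x))
    = dird b (\<lambda>x. bil c a * F bs x) + dird b (\<lambda>x. Leib a bs (\<lambda>cs. F (c # cs) x))"
    using Cons.prems by (simp only:) (intro dird_add Lam_intros)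
  also have "\<dots> = (\<lambda>x. bil c a * dird b (F bs) x) + (\<lambda>x. Leib a bs (\<lambda>cs. dird b (F (c # cs)) x))"
    using Cons by (simp only: dird_scale)
  finally show ?case by (simp add: pointwise)
qed

text \<open>The commutator of iterated derivatives with a multiplication operator. Each derivative
  that hits the linear form uses up one direction of the list, so the same sum over removed entries
  appears as in \<open>dird_linprod\<close>; this match gives the symmetry of the pairing.\<close>

lemma dirds_linform_mult:
  assumes "g \<in> Lam"
  shows "dirds bs (linform a * g) = linform a * dirds bs g + (\<lambda>x. Leib a bs (\<lambda>cs. dirds cs g x))"
proof (induction bs)
  case Nil
  then show ?case by (simp add: dirds_Nil pointwise)
next
  case (Cons b bs)
  have L: "(\<lambda>x. Leib a bs (\<lambda>cs. dirds cs g x)) \<in> Lam"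
    unfolding Lam_eq_Lams by (rule Leib_Lams) (use assms Lam_dirds Lam_eq_Lams in auto)
  have "dird b (linform a * dirds bs g + (\<lambda>x. Leib a bs (\<lambda>cs. dirds cs g x)))
    = (dird b (linform a) * dirds bs g + linform a * dird b (dirds bs g)) + dird b (\<lambda>x. Leib a bs (\<lambda>cs. dirds cs g x))"
    using assms by (simp add: dird_add dird_mult Lam_intros Lam_dirds L)
  also have "dird b (\<lambda>x. Leib a bs (\<lambda>cs. dirds cs g x)) = (\<lambda>x. Leib a bs (\<lambda>cs. dird b (dirds cs g) x))"
    by (rule Leib_dird) (rule Lam_dirds[OF assms])
  finally have *: "dird b (linform a * dirds bs g + (\<lambda>x. Leib a bs (\<lambda>cs. dirds cs g x))) =
    dird b (linform a) * dirds bs g + linform a * dird b (dirds bs g) +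
    (\<lambda>x. Leib a bs (\<lambda>cs. dird b (dirds cs g) x))" .
  show ?case unfolding dirds_Cons Cons *
    by (simp add: dird_linform pointwise dirds_Cons bil_commute[of a b])
qed

lemma linprod_0: "linprod as 0 = (if as = [] then 1 else 0)"
  by (cases as) (auto simp: linprod_def bil_simps pointwise)

lemma dirds_Leib:
  assumes "\<And>cs. F cs \<in> Lam"
  shows "dirds bs (\<lambda>x. Leib a ds (\<lambda>cs. F cs x)) = (\<lambda>x. Leib a ds (\<lambda>cs. dirds bs (F cs) x))"
proof (induction bs)
  case (Cons b bs)
  have "dird b (\<lambda>x. Leib a ds (\<lambda>cs. dirds bs (F cs) x)) = (\<lambda>x. Leib a ds (\<lambda>cs. dird b (dirds bs (F cs)) x))"
    by (rule Leib_dird) (rule Lam_dirds[OF assms])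
  then show ?case unfolding dirds_Cons Cons .
qed (simp add: dirds_Nil)

text \<open>Differentiating the product over \<open>bs\<close> in direction a removes one entry b
  and leaves the factor (b, a). Moving multiplication by the form of a past the derivatives along
  \<open>bs\<close> does the same, apart from a term with that form as a factor, which vanishes at
  0.\<close>

lemma dirds_linprod_commute: "dirds as (linprod bs) 0 = dirds bs (linprod as) 0"
proof (induction as arbitrary: bs)
  case Nil
  have "dirds bs (linprod []) = (if bs = [] then 1 else 0)"
    by (cases bs rule: rev_cases) (auto simp: linprod_Nil dirds_append dirds_Cons dirds_Nil dird_const dirds_zero one_fun_def)
  then show ?case by (auto simp: dirds_Nil linprod_0 pointwise)
next
  case (Cons a as)
  have "dirds (a # as) (linprod bs) = dirds as (\<lambda>x. Leib a bs (\<lambda>cs. linprod cs x))"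
    by (simp add: dirds_Cons dird_dirds_commute Lam_mon dird_linprod)
  also have "\<dots> = (\<lambda>x. Leib a bs (\<lambda>cs. dirds as (linprod cs) x))"
    by (rule dirds_Leib) (rule Lam_mon)
  finally have "dirds (a # as) (linprod bs) 0 = Leib a bs (\<lambda>cs. dirds cs (linprod as) 0)"
    by (simp add: Cons.IH)
  also have "\<dots> = dirds bs (linprod (a # as)) 0"
    unfolding linprod_Cons by (subst dirds_linform_mult) (auto simp: Lam_mon pointwise linform_def bil_simps)
  finally show ?case .
qed

lemma dird_translate: "dird a (\<lambda>y. f (y + v)) = (\<lambda>x. dird a f (x + v))"
proof
  fix x
  have "x + t *s a + v = x + v + t *s a" for t by simp
  then show "dird a (\<lambda>y. f (y + v)) x = dird a f (x + v)" unfolding dird_def by (simp only:)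
qed

lemma dirds_translate: "dirds as (\<lambda>y. f (y + v)) = (\<lambda>x. dirds as f (x + v))"
  by (induction as) (auto simp: dirds_Nil dirds_Cons dird_translate)


text \<open>A concrete \<open>\<Theta>\<close>: expand \<open>f\<close> in a basis of \<open>Lam\<close> that consists of products of linear
  forms. By the symmetry of the pairing the choice of the basis does not matter.\<close>

lemma theta_morphism_exists:
  "\<exists>T. theta_morphism (T :: (complex ^ 'n \<Rightarrow> complex) \<Rightarrow> (complex ^ 'n \<Rightarrow> complex) \<Rightarrow> (complex ^ 'n \<Rightarrow> complex))"
proof -
  obtain B :: "(complex ^ 'n \<Rightarrow> complex) set" where B: "B \<subseteq> range linprod" "funspace.independent B" "range linprod \<subseteq> funspace.span B"
    using funspace.maximal_independent_subset by metis
  have span: "Lam = funspace.span B"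
  proof -
    have "funspace.span (range linprod) \<subseteq> funspace.span B" using B(3) by (simp add: funspace.span_minimal)
    moreover have "funspace.span B \<subseteq> funspace.span (range linprod)" using B(1) by (rule funspace.span_mono)
    moreover have "(Lam :: (complex ^ 'n \<Rightarrow> complex) set) = funspace.span (range linprod)"
      unfolding Lam_eq_Lams Lams_def by (simp add: full_SetCompr_eq)
    ultimately show ?thesis by simp
  qed
  define dual_word where "dual_word b = (SOME as. linprod as = b)" for b :: "complex ^ 'n \<Rightarrow> complex"
  have dual_word: "linprod (dual_word b) = b" if "b \<in> B" for b
    unfolding dual_word_def by (rule someI_ex) (use that B(1) in auto)
  define R where "R f = {b. funspace.representation B f b \<noteq> 0}" for f
  have RB: "R f \<subseteq> B" for f unfolding R_def using funspace.representation_ne_zero by auto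
  have finR: "finite (R f)" for f unfolding R_def by (rule funspace.finite_representation)
  define P where "P f h = (\<Sum>b\<in>R f. funspace.representation B f b * dirds (dual_word b) h 0)" for f h
  \<comment> \<open>Symmetry moves the derivatives to the side of f, where the basis expansion
    reassembles f. From here on neither the basis nor the words chosen for it are visible.\<close>
  have P_linprod: "P f (linprod bs) = dirds bs f 0" if "f \<in> Lam" for f bs
  proof -
    have "P f (linprod bs) = (\<Sum>b\<in>R f. funspace.representation B f b * dirds bs b 0)"
      unfolding P_def by (intro sum.cong refl) (metis RB dual_word dirds_linprod_commute subsetD)
    also have "\<dots> = (\<Sum>b\<in>R f. dirds bs (\<lambda>x. funspace.representation B f b * b x) 0)"
      by (intro sum.cong refl) (use RB dual_word Lam_mon in \<open>metis dirds_scale subsetD\<close>)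
    also have "\<dots> = (\<Sum>b\<in>R f. dirds bs (\<lambda>x. funspace.representation B f b * b x)) 0"
      by (simp add: sum_pointwise)
    also have "\<dots> = dirds bs (\<Sum>b\<in>R f. (\<lambda>x. funspace.representation B f b * b x)) 0"
    proof (subst dirds_sum)
      fix b assume "b \<in> R f"
      then have "b \<in> B" using RB by blast
      then have "b \<in> Lam" using dual_word[of b] Lam_mon[of "dual_word b"] by (simp only:)
      then show "(\<lambda>x. funspace.representation B f b * b x) \<in> Lam" by (rule Lam_scale)
    qed simp
    also have "(\<Sum>b\<in>R f. (\<lambda>x. funspace.representation B f b * b x)) = f"
      unfolding R_def using that span B(2) by (simp add: funspace.sum_nonzero_representation_eq)
    finally show ?thesis .
  qed
  have P_add: "P f (g + h) = P f g + P f h" if "g \<in> Lam" "h \<in> Lam" for f g h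
    unfolding P_def dirds_add[OF that] by (simp add: pointwise algebra_simps sum.distrib)
  have P_scale: "P f (\<lambda>x. c * h x) = c * P f h" if "h \<in> Lam" for c f h
    unfolding P_def dirds_scale[OF that] by (simp add: sum_distrib_left mult.left_commute)
  have P_zero: "P f 0 = 0" for f
    unfolding P_def dirds_zero by (simp add: pointwise)
  have P_mon: "P (linprod as) h = dirds as h 0" if "h \<in> Lam" for as h
    using that
  proof (induction rule: Lam_induct)
    case zero
    then show ?case unfolding P_zero dirds_zero by (simp add: pointwise)
  next
    case (mon bs)
    show ?case unfolding P_linprod[OF Lam_mon] by (rule dirds_linprod_commute)
  next
    case (add f g)
    then show ?case by (simp only: P_add dirds_add) (simp only: plus_fun_apply)
  next
    case (scale c f)
    then show ?case by (simp only: P_scale dirds_scale)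
  qed
  have P_add1: "P (f + g) h = P f h + P g h" if "f \<in> Lam" "g \<in> Lam" "h \<in> Lam" for f g h
    using that(3)
  proof (induction rule: Lam_induct)
    case zero
    then show ?case by (simp only: P_zero add_0_left mult_zero_right)
  next
    case (mon bs)
    show ?case using that by (simp only: P_linprod Lam_add dirds_add) (simp only: plus_fun_apply)
  next
    case (add f g)
    then show ?case by (simp only: P_add distrib_left add_ac)
  next
    case (scale c f)
    then show ?case by (simp only: P_scale distrib_left mult_ac)
  qed
  have P_scale1: "P (\<lambda>x. c * f x) h = c * P f h" if "f \<in> Lam" "h \<in> Lam" for c f h
    using that(2)
  proof (induction rule: Lam_induct)
    case zero
    then show ?case by (simp only: P_zero add_0_left mult_zero_right)
  next
    case (mon bs)
    show ?case using that by (simp only: P_linprod Lam_scale dirds_scale)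
  next
    case (add f g)
    then show ?case by (simp only: P_add distrib_left add_ac)
  next
    case (scale d f)
    then show ?case by (simp only: P_scale distrib_left mult_ac)
  qed
  \<comment> \<open>An operator with constant coefficients commutes with translations, so its value
    at x is its value at 0 on the translated function.\<close>
  define T where "T f h x = P f (\<lambda>y. h (y + x))" for f h x
  have T_mon: "T (linprod as) h = dirds as h" if "h \<in> Lam" for as h
    unfolding T_def using P_mon[OF Lam_translate[OF that]] by (simp add: dirds_translate)
  have T_add: "T (f + g) h = T f h + T g h" if "f \<in> Lam" "g \<in> Lam" "h \<in> Lam" for f g h
    using that Lam_translate[OF that(3)] by (simp add: T_def P_add1 pointwise)
  have T_scale: "T (\<lambda>x. c * f x) h = (\<lambda>x. c * T f h x)" if "f \<in> Lam" "h \<in> Lam" for c f h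
    using that Lam_translate[OF that(2)] by (simp add: T_def P_scale1 pointwise)
  have T_zero: "T 0 h = 0" if "h \<in> Lam" for h
    using T_scale[OF Lam_zero that, of 0] unfolding zero_scale[of 0] zero_scale[of "T 0 h"] .
  have T_Lam: "T f h \<in> Lam" if "f \<in> Lam" "h \<in> Lam" for f h
    using that(1)
  proof (induction rule: Lam_induct)
    case zero
    then show ?case using that by (simp only: T_zero Lam_zero)
  next
    case (mon as)
    then show ?case using that by (simp only: T_mon Lam_dirds)
  next
    case (add f g)
    then show ?case using that by (simp only: T_add Lam_add)
  next
    case (scale c f)
    then show ?case using that by (simp only: T_scale Lam_scale)
  qed
  have T_mult_mon: "T (linprod as * g) h = T (linprod as) (T g h)" if "g \<in> Lam" "h \<in> Lam" for as g h
    using that(1)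
  proof (induction rule: Lam_induct)
    case zero
    have "linprod as * (0 :: complex ^ 'n \<Rightarrow> complex) = 0" by (simp add: pointwise)
    then show ?case using that by (simp only: T_zero T_mon Lam_zero dirds_zero)
  next
    case (mon bs)
    show ?case using that by (simp only: linprod_append[symmetric] T_mon Lam_dirds dirds_append)
  next
    case (add f g)
    then show ?case using that
      by (simp only: distrib_left T_add T_Lam T_mon Lam_add Lam_mult Lam_mon dirds_add)
  next
    case (scale c f)
    have "linprod as * (\<lambda>x. c * f x) = (\<lambda>x. c * (linprod as * f) x)" by (simp add: pointwise)
    then show ?case using that scale
      by (simp only: T_scale T_Lam T_mon Lam_scale Lam_mult Lam_mon dirds_scale)
  qed
  have T_mult: "T (f * g) h = T f (T g h)" if "f \<in> Lam" "g \<in> Lam" "h \<in> Lam" for f g h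
    using that(1)
  proof (induction rule: Lam_induct)
    case zero
    have "(0 :: complex ^ 'n \<Rightarrow> complex) * g = 0" by (simp add: pointwise)
    then show ?case using that by (simp only: T_zero T_Lam)
  next
    case (mon bs)
    show ?case by (rule T_mult_mon[OF that(2,3)])
  next
    case (add f f')
    then show ?case using that by (simp only: distrib_right T_add T_Lam Lam_mult)
  next
    case (scale c f)
    have "(\<lambda>x. c * f x) * g = (\<lambda>x. c * (f * g) x)" by (simp add: pointwise)
    then show ?case using that scale by (simp only: T_scale T_Lam Lam_mult Lam_scale)
  qed
  have T_lin: "T (linform a) h = dird a h" if "h \<in> Lam" for a h
    using T_mon[OF that, of "[a]"] by (simp only: linprod_single dirds_Cons dirds_Nil)
  have "theta_morphism T"
    unfolding theta_morphism_def derivation_def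
  proof (intro conjI allI ballI)
    fix h :: "complex ^ 'n \<Rightarrow> complex" assume "h \<in> Lam"
    then show "T 1 h = h" using T_mon[of h "[]"] by (simp only: linprod_Nil one_fun_def dirds_Nil)
  qed (simp_all only: T_add T_scale T_mult T_lin Lam_dird dird_add dird_scale dird_mult dird_linform
      Lam_add Lam_scale Lam_mult Lam_linform)
  then show ?thesis by (rule exI[of theta_morphism])
qed

section \<open>Computing with the chosen morphism and its pairing\<close>

lemma theta_morphism_Theta: "theta_morphism Theta"
  unfolding Theta_def by (rule someI_ex[of theta_morphism, OF theta_morphism_exists])

lemmas Theta_rules = theta_morphism_Theta[unfolded theta_morphism_def]

lemmas Theta_one = Theta_rules[THEN conjunct1, rule_format]
  and Theta_add = Theta_rules[THEN conjunct2, THEN conjunct1, rule_format]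
  and Theta_scale = Theta_rules[THEN conjunct2, THEN conjunct2, THEN conjunct1, rule_format]
  and Theta_mult = Theta_rules[THEN conjunct2, THEN conjunct2, THEN conjunct2, THEN conjunct1, rule_format]
  and derivation_Theta = Theta_rules[THEN conjunct2, THEN conjunct2, THEN conjunct2, THEN conjunct2,
    THEN spec, THEN conjunct1]
  and Theta_linform_linform = Theta_rules[THEN conjunct2, THEN conjunct2, THEN conjunct2, THEN conjunct2,
    THEN spec, THEN conjunct2, THEN spec]

lemma Theta_zero: "h \<in> Lam \<Longrightarrow> Theta 0 h = 0"
  using Theta_scale[OF Lam_zero, of h 0] unfolding zero_scale[of 0] zero_scale[of "Theta 0 h"] .

text \<open>A derivation kills constants and is determined by its values on the linear forms, which
  generate \<open>Lam\<close>.\<close>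

lemma Theta_linform:
  assumes "h \<in> Lam" shows "Theta (linform a) h = dird a h"
proof -
  note D = derivation_Theta[unfolded derivation_def, THEN conjunct2]
  have scale_rule: "Theta (linform a) (\<lambda>x. c * f x) = (\<lambda>x. c * Theta (linform a) f x)" if "f \<in> Lam" for c f
    by (rule D[THEN conjunct2, THEN conjunct1, rule_format, OF that])
  have mult_rule: "Theta (linform a) (f * g) = Theta (linform a) f * g + f * Theta (linform a) g" if "f \<in> Lam" "g \<in> Lam" for f g
    by (rule D[THEN conjunct2, THEN conjunct2, rule_format, OF that])
  have add_rule: "Theta (linform a) (f + g) = Theta (linform a) f + Theta (linform a) g" if "f \<in> Lam" "g \<in> Lam" for f g
    by (rule D[THEN conjunct1, rule_format, OF that])
  have zero_rule: "Theta (linform a) 0 = 0"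
    using scale_rule[OF Lam_zero, of 0] unfolding zero_scale[of 0] zero_scale[of "Theta (linform a) 0"] .
  have one: "Theta (linform a) 1 = 0"
    using mult_rule[OF Lam_one Lam_one] by (simp add: pointwise)
  show ?thesis using assms
  proof (induction rule: Lam_induct)
    case zero
    then show ?case by (simp only: zero_rule dird_zero)
  next
    case (mon as)
    then show ?case
    proof (induction as)
      case Nil
      then show ?case using one by (simp add: linprod_Nil dird_const one_fun_def)
    next
      case (Cons b as)
      then show ?case unfolding linprod_Cons
        by (simp only: mult_rule dird_mult Lam_linform Lam_mon Theta_linform_linform dird_linform)
    qed
  next
    case (add f g)
    then show ?case by (simp only: dird_add add_rule)
  next
    case (scale c f)
    then show ?case by (simp only: dird_scale scale_rule)
  qed
qed

lemma Theta_linprod: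
  assumes "h \<in> Lam" shows "Theta (linprod as) h = dirds as h"
proof (induction as)
  case Nil
  then show ?case using Theta_one[OF assms] by (simp add: linprod_Nil one_fun_def dirds_Nil)
next
  case (Cons a as)
  have "Theta (linprod (a # as)) h = Theta (linform a) (Theta (linprod as) h)"
    unfolding linprod_Cons by (intro Theta_mult Lam_intros assms)
  then show ?case using assms by (simp only: Cons Theta_linform Lam_dirds dirds_Cons)
qed

lemma Theta_sum:
  assumes "\<And>i. i \<in> I \<Longrightarrow> f i \<in> Lam" "h \<in> Lam"
  shows "Theta (sum f I) h = (\<Sum>i\<in>I. Theta (f i) h)"
  using assms
proof (induction I rule: infinite_finite_induct)
  case (insert i I)
  have "f i \<in> Lam" "sum f I \<in> Lam" using insert.prems(1) by (auto intro: Lam_sum)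
  moreover have "Theta (sum f I) h = (\<Sum>i\<in>I. Theta (f i) h)" using insert by auto
  ultimately show ?case using assms(2)
    unfolding sum.insert[OF insert.hyps] by (simp only: Theta_add)
qed (simp_all add: Theta_zero)

lemma Lam_Theta: "f \<in> Lam \<Longrightarrow> h \<in> Lam \<Longrightarrow> Theta f h \<in> Lam"
proof (induction rule: Lam_induct)
  case zero
  then show ?case by (simp only: Theta_zero Lam_zero)
next
  case (mon as)
  then show ?case by (simp only: Theta_linprod Lam_dirds)
next
  case (add f g)
  then show ?case by (simp only: Theta_add Lam_add)
next
  case (scale c f)
  then show ?case by (simp only: Theta_scale Lam_scale)
qed

lemma Theta_add_right: "f \<in> Lam \<Longrightarrow> g \<in> Lam \<Longrightarrow> h \<in> Lam \<Longrightarrow> Theta f (g + h) = Theta f g + Theta f h"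
proof (induction rule: Lam_induct)
  case zero
  then show ?case by (simp add: Theta_zero Lam_add)
next
  case (mon as)
  then show ?case by (simp only: Theta_linprod Lam_add dirds_add)
next
  case (add f f')
  then show ?case by (simp only: Theta_add Lam_add add_ac)
next
  case (scale c f)
  then show ?case by (simp only: Theta_scale Lam_add) (simp add: pointwise distrib_left)
qed

lemma Theta_scale_right: "f \<in> Lam \<Longrightarrow> g \<in> Lam \<Longrightarrow> Theta f (\<lambda>x. c * g x) = (\<lambda>x. c * Theta f g x)"
proof (induction rule: Lam_induct)
  case zero
  then show ?case by (simp only: Theta_zero Lam_scale) (simp add: pointwise)
next
  case (mon as)
  then show ?case by (simp only: Theta_linprod Lam_scale dirds_scale)
next
  case (add f f')
  then show ?case by (simp only: Theta_add Lam_scale) (simp add: pointwise distrib_left)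
next
  case (scale c f)
  then show ?case by (simp only: Theta_scale Lam_scale mult_ac)
qed

lemma Theta_translate:
  "f \<in> Lam \<Longrightarrow> h \<in> Lam \<Longrightarrow> Theta f (\<lambda>y. h (y + v)) = (\<lambda>x. Theta f h (x + v))"
proof (induction rule: Lam_induct)
  case zero
  then show ?case by (simp only: Theta_zero Lam_translate) (simp add: pointwise)
next
  case (mon as)
  then show ?case by (simp only: Theta_linprod Lam_translate dirds_translate)
next
  case (add f f')
  then show ?case by (simp only: Theta_add Lam_translate) (simp add: pointwise)
next
  case (scale c f)
  then show ?case by (simp only: Theta_scale Lam_translate)
qed

lemma pair_linprod: "h \<in> Lam \<Longrightarrow> theta_pair (linprod as) h = dirds as h 0"
  by (simp only: theta_pair_def Theta_linprod)

lemma pair_add_left: "f \<in> Lam \<Longrightarrow> g \<in> Lam \<Longrightarrow> h \<in> Lam \<Longrightarrow> theta_pair (f + g) h = theta_pair f h + theta_pair g h"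
  and pair_add_right: "f \<in> Lam \<Longrightarrow> g \<in> Lam \<Longrightarrow> h \<in> Lam \<Longrightarrow> theta_pair f (g + h) = theta_pair f g + theta_pair f h"
  and pair_scale_left: "f \<in> Lam \<Longrightarrow> g \<in> Lam \<Longrightarrow> theta_pair (\<lambda>x. c * f x) g = c * theta_pair f g"
  and pair_scale_right: "f \<in> Lam \<Longrightarrow> g \<in> Lam \<Longrightarrow> theta_pair f (\<lambda>x. c * g x) = c * theta_pair f g"
  and pair_zero_left: "g \<in> Lam \<Longrightarrow> theta_pair 0 g = 0"
  by (simp_all only: theta_pair_def Theta_add Theta_add_right Theta_scale Theta_scale_right plus_fun_apply
      Theta_zero zero_fun_apply)

lemma pair_mult: "f \<in> Lam \<Longrightarrow> g \<in> Lam \<Longrightarrow> h \<in> Lam \<Longrightarrow> theta_pair (f * g) h = theta_pair f (Theta g h)"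
  by (simp only: theta_pair_def Theta_mult)

lemma pair_zero_right: "f \<in> Lam \<Longrightarrow> theta_pair f 0 = 0"
  using pair_scale_right[OF _ Lam_zero, of f 0] unfolding zero_scale[of 0] by (simp add: pointwise)

lemma pair_commute: "f \<in> Lam \<Longrightarrow> g \<in> Lam \<Longrightarrow> theta_pair f g = theta_pair g f"
proof (induction rule: Lam_induct)
  case zero
  then show ?case by (simp only: pair_zero_left pair_zero_right)
next
  case (mon as)
  from mon show ?case
  proof (induction rule: Lam_induct)
    case zero
    then show ?case by (simp only: pair_zero_left pair_zero_right Lam_mon)
  next
    case (mon bs)
    show ?case by (simp only: pair_linprod Lam_mon dirds_linprod_commute[of as bs])
  next
    case (add f f')
    then show ?case by (simp only: pair_add_left pair_add_right Lam_mon)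
  next
    case (scale c f)
    then show ?case by (simp only: pair_scale_left pair_scale_right Lam_mon)
  qed
next
  case (add f f')
  then show ?case by (simp only: pair_add_left pair_add_right)
next
  case (scale c f)
  then show ?case by (simp only: pair_scale_left pair_scale_right)
qed

lemma pair_sum_left:
  assumes "\<And>i. i \<in> I \<Longrightarrow> f i \<in> Lam" "h \<in> Lam"
  shows "theta_pair (sum f I) h = (\<Sum>i\<in>I. theta_pair (f i) h)"
proof -
  have "Theta (sum f I) h = (\<Sum>i\<in>I. Theta (f i) h)" by (rule Theta_sum) (use assms in auto)
  then show ?thesis unfolding theta_pair_def by (simp only: sum_pointwise)
qed

lemma pair_diff_left:
  assumes "f \<in> Lam" "g \<in> Lam" "h \<in> Lam"
  shows "theta_pair (f - g) h = theta_pair f h - theta_pair g h"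
proof -
  have "f = (f - g) + g" by simp
  then have "theta_pair f h = theta_pair (f - g) h + theta_pair g h"
    using pair_add_left[OF Lam_diff[OF assms(1,2)] assms(2,3)] by simp
  then show ?thesis by simp
qed

text \<open>For a product of linear forms f, derivatives along its factors kill components of g of
  smaller degree and leave components of larger degree with positive degree, hence with value 0 at
  the origin.\<close>

lemma pair_orthogonal:
  assumes "f \<in> Lams A" "g \<in> Lams B" "A \<inter> B = {}"
  shows "theta_pair f g = 0"
  using assms(1)
proof (induction rule: Lams_induct)
  case zero
  then show ?case using assms by (simp only: pair_zero_left Lams_Lam)
next
  case (mon as)
  have "(\<lambda>k. length as + k) -` B \<subseteq> {1..}"
  proof
    fix k assume "k \<in> (\<lambda>k. length as + k) -` B"
    then show "k \<in> {1..}" using mon assms(3) by (cases k) auto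
  qed
  then have "dirds as g \<in> Lams {1..}"
    by (rule Lams_mono[OF _ Lams_dirds[OF assms(2)]])
  then show ?case using Lams_positive_at_0 pair_linprod[OF Lams_Lam[OF assms(2)]] by (simp only:)
next
  case (add f f')
  then show ?case using assms by (simp add: pair_add_left Lams_Lam)
next
  case (scale c f)
  then show ?case using assms by (simp add: pair_scale_left Lams_Lam)
qed

text \<open>By symmetry it suffices to differentiate the power (x, -)^k along the k factors of a
  product. Each derivative multiplies by the current exponent and by one factor evaluated at
  x.\<close>

lemma dirds_replicate: 
  assumes "f \<in> Lams {k}" shows "dirds (replicate k x) f 0 = fact k * f x"
  using assms
proof (induction rule: Lams_induct)
  case zero
  show ?case unfolding dirds_zero by (simp add: pointwise)
next
  case (mon as)
  have rep: "linprod (replicate n x) y = bil y x ^ n" for n and x y :: "complex ^ 'a"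
    by (induction n) (auto simp: linprod_def)
  have "dirds (replicate (length as) x) (linprod as) 0 = fact (length as) * linprod as x" for as
  proof -
    have "dirds as (linprod (replicate (length as) x)) 0 = fact (length as) * linprod as x" for as
    proof (induction as)
      case Nil
      then show ?case by (simp add: dirds_Nil linprod_def)
    next
      case (Cons a as)
      have "dird a (linprod (replicate n x)) = (\<lambda>y. (of_nat n * bil x a) * linprod (replicate (n - 1) x) y)" for n
        unfolding dird_linprod
      proof
        fix y
        show "Leib a (replicate n x) (\<lambda>cs. linprod cs y) = of_nat n * bil x a * linprod (replicate (n - 1) x) y"
        proof (induction n)
          case (Suc n)
          have *: "Leib a (replicate (Suc n) x) (\<lambda>cs. linprod cs y)
            = bil x a * linprod (replicate n x) y + bil y x * Leib a (replicate n x) (\<lambda>cs. linprod cs y)"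
            by (simp add: linprod_def Leib_scale)
          show ?case unfolding * Suc rep by (cases n) (auto simp: algebra_simps pointwise)
        qed (simp add: pointwise)
      qed
      note d = this[of "Suc (length as)"]
      have "dirds (a # as) (linprod (replicate (length (a # as)) x)) = dirds as (dird a (linprod (replicate (Suc (length as)) x)))"
        by (simp add: dirds_Cons dird_dirds_commute Lam_mon)
      also have "\<dots> = (\<lambda>y. (of_nat (Suc (length as)) * bil x a) * dirds as (linprod (replicate (length as) x)) y)"
        unfolding d by (simp only: dirds_scale Lam_mon diff_Suc_1)
      finally show ?case by (simp only: Cons.IH) (simp add: linprod_def)
    qed
    then show ?thesis by (simp add: dirds_linprod_commute[of "replicate (length as) x" as])
  qed
  then show ?case using mon by auto
next
  case (add f f')
  then show ?case unfolding dirds_add[OF add(1,2)[THEN Lams_Lam]] by (simp add: pointwise distrib_left)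
next
  case (scale c f)
  then show ?case unfolding dirds_scale[OF scale(1)[THEN Lams_Lam]] by simp
qed

text \<open>The reproducing property of the pairing: on homogeneous polynomials of degree k,
  evaluation at x is represented by (x, -)^k / k!.\<close>

lemma pair_linform_power:
  assumes "f \<in> Lams {k}" shows "theta_pair (linform x ^ k) f = fact k * f x"
proof -
  have "linprod (replicate k x) = linform x ^ k"
    by (induction k) (simp_all add: linprod_Nil linprod_Cons one_fun_def)
  then show ?thesis using pair_linprod[OF Lams_Lam[OF assms], of "replicate k x"] dirds_replicate[OF assms] by simp
qed

text \<open>Pairing \<open>f\<close> with powers of the linear form of \<open>x\<close> recovers the homogeneous components of \<open>f\<close>
  at \<open>x\<close>.\<close>

lemma pair_nondegenerate:
  assumes "f \<in> Lam" "\<And>g. g \<in> Lam \<Longrightarrow> theta_pair g f = 0"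
  shows "f = 0"
proof -
  obtain k where "f \<in> Lams {..k}" using Lams_bounded[OF assms(1)] by auto
  then show ?thesis using assms(2)
  proof (induction k arbitrary: f)
    case 0
    then have f: "f \<in> Lams {0}" by (auto elim: Lams_mono[rotated])
    have "f x = 0" for x
      using pair_linform_power[OF f, of x] 0(2)[OF Lam_one] by simp
    then show ?case by (simp add: pointwise)
  next
    case (Suc k)
    have "f \<in> Lams ({..k} \<union> {Suc k})" by (rule Lams_mono[OF _ Suc(2)]) auto
    then obtain g h where gh: "g \<in> Lams {..k}" "h \<in> Lams {Suc k}" "f = g + h" by (rule Lams_Un)
    have "h x = 0" for x
    proof -
      have "linform x ^ Suc k \<in> Lams {Suc k}"
      proof -
        have "linform x ^ j \<in> Lams {j}" for j
          by (induction j) (auto intro!: Lams_const Lams_mult[of _ "{1}"] Lams_linform simp: one_fun_def)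
        then show ?thesis .
      qed
      then have "theta_pair (linform x ^ Suc k) g = 0" by (rule pair_orthogonal[OF _ gh(1)]) auto
      moreover have "theta_pair (linform x ^ Suc k) f = theta_pair (linform x ^ Suc k) g + theta_pair (linform x ^ Suc k) h"
        unfolding gh(3) using gh by (intro pair_add_right Lam_intros) (auto intro: Lams_Lam)
      moreover have "theta_pair (linform x ^ Suc k) f = 0" by (intro Suc.prems Lam_intros)
      ultimately show ?thesis using pair_linform_power[OF gh(2), of x] by (simp del: fact_Suc power_Suc)
    qed
    then have "f = g" using gh(3) by (simp add: pointwise)
    then show ?case using Suc.IH[OF gh(1)] Suc.prems by simp
  qed
qed

text \<open>Split a test polynomial into its parts with degrees inside and outside A. The first is
  orthogonal to f as an element of \<open>Lams B\<close>, the second as an element of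
  \<open>Lams A\<close>, and the pairing is nondegenerate.\<close>

lemma Lams_disjoint:
  assumes "f \<in> Lams A" "f \<in> Lams B" "A \<inter> B = {}"
  shows "f = 0"
proof (rule pair_nondegenerate[OF Lams_Lam[OF assms(1)]])
  fix g :: "complex ^ 'a \<Rightarrow> complex" assume "g \<in> Lam"
  then have *: "g \<in> Lams (A \<union> - A)" by (simp add: Lam_eq_Lams)
  from * obtain g1 g2 where g: "g1 \<in> Lams A" "g2 \<in> Lams (- A)" "g = g1 + g2" by (rule Lams_Un)
  have "theta_pair g1 f = 0" by (rule pair_orthogonal[OF g(1) assms(2,3)])
  moreover have "theta_pair g2 f = 0" by (rule pair_orthogonal[OF g(2) assms(1)]) auto
  ultimately show "theta_pair g f = 0"
    unfolding g(3) using pair_add_left[OF g(1,2)[THEN Lams_Lam] Lams_Lam[OF assms(1)]] by simp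
qed

lemma Lams_Theta:
  assumes "f \<in> Lams {j}" "h \<in> Lams {k}"
  shows "Theta f h \<in> Lams ((\<lambda>i. j + i) -` {k})"
  using assms(1)
proof (induction rule: Lams_induct)
  case zero
  then show ?case using assms by (simp only: Theta_zero Lams_Lam Lams_zero)
next
  case (mon as)
  then show ?case using Lams_dirds[OF assms(2), of as] by (simp add: Theta_linprod Lams_Lam[OF assms(2)])
next
  case (add f g)
  then show ?case using assms by (simp only: Theta_add Lams_Lam Lams_add)
next
  case (scale c f)
  then show ?case using assms by (simp only: Theta_scale Lams_Lam Lams_scale)
qed


section \<open>Reflections\<close>

lemma cvec_add: "cvec (x + y) = cvec x + cvec y"
  and cvec_diff: "cvec (x - y) = cvec x - cvec y"
  and cvec_minus: "cvec (- x) = - cvec x"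
  and cvec_scale: "cvec (c *\<^sub>R x) = complex_of_real c *s cvec x"
  and cvec_0: "cvec 0 = 0"
  by (simp_all add: cvec_def Finite_Cartesian_Product.vec_eq_iff)

lemma bil_cvec: "bil (cvec x) (cvec y) = complex_of_real (inner x y)"
  by (simp add: bil_def cvec_def inner_vec_def)

lemma cvec_inject: "cvec x = cvec y \<longleftrightarrow> x = y"
  by (simp add: cvec_def Finite_Cartesian_Product.vec_eq_iff)


lemma refl_cvec: "refl a (cvec x) = cvec (refl_real a x)"
  by (simp add: refl_def refl_real_def bil_cvec cvec_diff cvec_scale)

lemma refl_eq: "refl a x = x - (2 / complex_of_real (inner a a) * bil x (cvec a)) *s cvec a"
  by (simp add: refl_def bil_cvec)

lemma refl_add: "refl a (x + y) = refl a x + refl a y"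
  by (simp add: refl_eq bil_simps Finite_Cartesian_Product.vec_eq_iff algebra_simps pointwise)

lemma refl_scale: "refl a (c *s x) = c *s refl a x"
  by (simp add: refl_eq bil_simps Finite_Cartesian_Product.vec_eq_iff algebra_simps pointwise)

lemma bil_refl_left: "bil (refl a x) y = bil x (refl a y)"
  by (simp add: refl_eq bil_simps bil_commute[of _ "cvec a"] algebra_simps pointwise)

lemma refl_refl: "refl a (refl a x) = x"
proof (cases "a = 0")
  case False
  then have "complex_of_real (inner a a) \<noteq> 0" by simp
  then have "bil (refl a x) (cvec a) = - bil x (cvec a)"
    by (simp add: refl_eq bil_simps bil_cvec field_simps pointwise)
  then show ?thesis
    by (simp add: refl_eq[of a "refl a x"]) (simp add: refl_eq Finite_Cartesian_Product.vec_eq_iff)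
qed (simp add: refl_eq cvec_0)

lemma bil_refl_refl: "bil (refl a x) (refl a y) = bil x y"
  by (simp add: bil_refl_left refl_refl)

lemma refl_self: "a \<noteq> 0 \<Longrightarrow> refl a (cvec a) = - cvec a"
  by (simp add: refl_eq bil_cvec Finite_Cartesian_Product.vec_eq_iff)

lemma refl_real_refl_real: "refl_real a (refl_real a x) = x"
  using refl_refl[of a "cvec x"] by (simp add: refl_cvec cvec_inject)

lemma refl_fixes: "bil x (cvec a) = 0 \<Longrightarrow> refl a x = x"
  by (simp add: refl_eq)

lemma refl_fixes_iff: "a \<noteq> 0 \<Longrightarrow> refl a x = x \<longleftrightarrow> bil x (cvec a) = 0"
  by (auto simp: refl_eq Finite_Cartesian_Product.vec_eq_iff cvec_def)

text \<open>The properties of the elements of reflection groups that the action on polynomials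
  relies on. The last one says that real vectors go to real vectors, so that roots, which are real,
  can be moved by complex maps.\<close>

definition real_orthogonal :: "(complex ^ 'n \<Rightarrow> complex ^ 'n) \<Rightarrow> bool" where
  "real_orthogonal \<sigma> \<longleftrightarrow> (\<forall>x y. \<sigma> (x + y) = \<sigma> x + \<sigma> y) \<and> (\<forall>c x. \<sigma> (c *s x) = c *s \<sigma> x) \<and>
     (\<forall>x y. bil (\<sigma> x) (\<sigma> y) = bil x y) \<and> bij \<sigma> \<and> (\<forall>x. \<exists>y. \<sigma> (cvec x) = cvec y)"

lemma
  assumes "real_orthogonal \<sigma>"
  shows real_orthogonal_add: "\<sigma> (x + y) = \<sigma> x + \<sigma> y"
    and real_orthogonal_scale: "\<sigma> (c *s x) = c *s \<sigma> x"
    and real_orthogonal_bil: "bil (\<sigma> x) (\<sigma> y) = bil x y"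
    and real_orthogonal_bij: "bij \<sigma>"
    and real_orthogonal_real: "\<exists>y. \<sigma> (cvec z) = cvec y"
  using assms unfolding real_orthogonal_def by auto

lemma real_orthogonal_minus: assumes "real_orthogonal \<sigma>" shows "\<sigma> (- x) = - \<sigma> x"
  using real_orthogonal_scale[OF assms, of "-1" x] by simp

lemma real_orthogonal_diff: assumes "real_orthogonal \<sigma>" shows "\<sigma> (x - y) = \<sigma> x - \<sigma> y"
  using real_orthogonal_add[OF assms, of x "-y"] real_orthogonal_minus[OF assms] by simp

lemma real_orthogonal_id: "real_orthogonal id"
  by (auto simp: real_orthogonal_def)

lemma real_orthogonal_comp: "real_orthogonal \<sigma> \<Longrightarrow> real_orthogonal \<tau> \<Longrightarrow> real_orthogonal (\<sigma> \<circ> \<tau>)"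
  unfolding real_orthogonal_def by (auto intro: bij_comp) metis

lemma real_orthogonal_refl: "real_orthogonal (refl a)"
  unfolding real_orthogonal_def
  using refl_refl[of a] by (auto simp: refl_add refl_scale bil_refl_refl refl_cvec intro!: o_bij[of "refl a"])

lemma bil_inv_orthogonal:
  assumes "real_orthogonal \<sigma>" shows "bil (inv_into UNIV \<sigma> x) a = bil x (\<sigma> a)"
  using real_orthogonal_bil[OF assms, of "inv_into UNIV \<sigma> x" a] real_orthogonal_bij[OF assms]
  by (simp add: bij_is_surj surj_f_inv_f)

lemma refl_conj:
  assumes "real_orthogonal \<sigma>" "\<sigma> (cvec a) = cvec b" shows "\<sigma> \<circ> refl a = refl b \<circ> \<sigma>"
proof
  fix x
  have "complex_of_real (inner a a) = complex_of_real (inner b b)"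
    using real_orthogonal_bil[OF assms(1), of "cvec a" "cvec a"] unfolding assms(2) bil_cvec by simp
  then have "inner a a = inner b b" by simp
  moreover have "bil (\<sigma> x) (cvec b) = bil x (cvec a)"
    using real_orthogonal_bil[OF assms(1), of x "cvec a"] assms(2) by simp
  ultimately show "(\<sigma> \<circ> refl a) x = (refl b \<circ> \<sigma>) x"
    by (simp add: refl_eq real_orthogonal_diff[OF assms(1)] real_orthogonal_scale[OF assms(1)] assms(2))
qed

section \<open>Words of reflections and the groups that they form\<close>

lemma refl_word_Nil: "refl_word [] = id"
  and refl_word_Cons: "refl_word (a # as) = refl a \<circ> refl_word as"
  by (simp_all add: refl_word_def)

lemma refl_word_append: "refl_word (as @ bs) = refl_word as \<circ> refl_word bs"
  by (induction as) (auto simp: refl_word_Nil refl_word_Cons)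

lemma refl_word_rev: "refl_word (rev as) \<circ> refl_word as = id"
  by (induction as) (auto simp: refl_word_Nil refl_word_Cons refl_word_append fun_eq_iff refl_refl)

lemma refl_word_rev': "refl_word as \<circ> refl_word (rev as) = id"
  using refl_word_rev[of "rev as"] by simp

lemma inv_refl_word: "inv_into UNIV (refl_word as) = refl_word (rev as)"
  by (rule inv_unique_comp[OF refl_word_rev' refl_word_rev])

lemma real_orthogonal_refl_word: "real_orthogonal (refl_word as)"
  by (induction as) (simp_all only: refl_word_Nil refl_word_Cons real_orthogonal_id real_orthogonal_comp real_orthogonal_refl)

lemma refl_group_orthogonal: "\<sigma> \<in> refl_group R \<Longrightarrow> real_orthogonal \<sigma>"
  unfolding refl_group_def using real_orthogonal_refl_word by auto

lemma refl_group_id: "id \<in> refl_group R"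
  unfolding refl_group_def by (rule image_eqI[of _ _ "[]"]) (auto simp: refl_word_Nil)

lemma refl_group_refl: "a \<in> R \<Longrightarrow> refl a \<in> refl_group R"
  unfolding refl_group_def by (rule image_eqI[of _ _ "[a]"]) (auto simp: refl_word_Nil refl_word_Cons)

lemma refl_group_comp: "\<sigma> \<in> refl_group R \<Longrightarrow> \<tau> \<in> refl_group R \<Longrightarrow> \<sigma> \<circ> \<tau> \<in> refl_group R"
proof -
  assume "\<sigma> \<in> refl_group R" "\<tau> \<in> refl_group R"
  then obtain as bs where "as \<in> lists R" "bs \<in> lists R" "\<sigma> = refl_word as" "\<tau> = refl_word bs"
    unfolding refl_group_def by auto
  then show ?thesis unfolding refl_group_def by (intro image_eqI[of _ _ "as @ bs"]) (auto simp: refl_word_append)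
qed

lemma refl_group_inv: "\<sigma> \<in> refl_group R \<Longrightarrow> inv_into UNIV \<sigma> \<in> refl_group R"
proof -
  assume "\<sigma> \<in> refl_group R"
  then obtain as where "as \<in> lists R" "\<sigma> = refl_word as"
    unfolding refl_group_def by auto
  then show ?thesis unfolding refl_group_def by (intro image_eqI[of _ _ "rev as"]) (auto simp: inv_refl_word in_lists_conv_set)
qed

lemma refl_group_inv_comp:
  assumes "\<sigma> \<in> refl_group R"
  shows "inv_into UNIV \<sigma> \<circ> \<sigma> = id" "\<sigma> \<circ> inv_into UNIV \<sigma> = id" "inv_into UNIV (inv_into UNIV \<sigma>) = \<sigma>"
  using real_orthogonal_bij[OF refl_group_orthogonal[OF assms]]
  by (simp_all add: bij_is_inj inv_inv_eq surj_iff[THEN iffD1, OF bij_is_surj])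

lemma refl_group_induct [consumes 1, case_names id step]:
  assumes "\<sigma> \<in> refl_group R" "P id" "\<And>a \<sigma>. a \<in> R \<Longrightarrow> \<sigma> \<in> refl_group R \<Longrightarrow> P \<sigma> \<Longrightarrow> P (refl a \<circ> \<sigma>)"
  shows "P \<sigma>"
proof -
  obtain as where as: "as \<in> lists R" "\<sigma> = refl_word as" using assms(1) unfolding refl_group_def by auto
  have "as \<in> lists R \<Longrightarrow> P (refl_word as)" for as
    by (induction as) (auto simp: refl_word_Nil refl_word_Cons assms(2) refl_group_def intro!: assms(3))
  then show ?thesis using as by auto
qed

lemma refl_group_mono: "R \<subseteq> R' \<Longrightarrow> refl_group R \<subseteq> refl_group R'"
  unfolding refl_group_def by (intro image_mono lists_mono)

section \<open>Group actions on polynomial functions\<close>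

lemma act_id: "act id f = f"
  by (simp add: act_def)

lemma act_refl: "act (refl a) f = (\<lambda>x. f (refl a x))"
proof -
  have "inv_into UNIV (refl a) = refl a"
    using inv_refl_word[of "[a]"] by (simp add: refl_word_Nil refl_word_Cons)
  then show ?thesis by (simp add: act_def)
qed

lemma act_comp:
  assumes "bij \<sigma>" "bij \<tau>" shows "act (\<sigma> \<circ> \<tau>) f = act \<sigma> (act \<tau> f)"
  by (simp add: act_def o_inv_distrib[OF assms])

lemma act_refl_group_comp:
  assumes "\<sigma> \<in> refl_group R" "\<tau> \<in> refl_group R" shows "act (\<sigma> \<circ> \<tau>) f = act \<sigma> (act \<tau> f)"
  using assms by (intro act_comp real_orthogonal_bij refl_group_orthogonal)

lemma act_refl_comp: "\<sigma> \<in> refl_group R \<Longrightarrow> act (refl a \<circ> \<sigma>) f = act (refl a) (act \<sigma> f)"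
  by (intro act_comp real_orthogonal_bij refl_group_orthogonal real_orthogonal_refl)

lemma act_add: "act \<sigma> (f + g) = act \<sigma> f + act \<sigma> g"
  and act_diff: "act \<sigma> (f - g) = act \<sigma> f - act \<sigma> g"
  and act_mult: "act \<sigma> (f * g) = act \<sigma> f * act \<sigma> g"
  and act_scale: "act \<sigma> (\<lambda>x. c * f x) = (\<lambda>x. c * act \<sigma> f x)"
  and act_zero: "act \<sigma> 0 = 0"
  and act_one: "act \<sigma> 1 = 1"
  by (simp_all add: act_def pointwise)

lemma act_sum: "act \<sigma> (sum f I) = (\<Sum>i\<in>I. act \<sigma> (f i))"
  by (simp add: act_def fun_eq_iff sum_pointwise)

lemma act_prod: "act \<sigma> (prod f I) = (\<Prod>i\<in>I. act \<sigma> (f i))"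
  by (simp add: act_def fun_eq_iff prod_pointwise)

lemma act_linform: "real_orthogonal \<sigma> \<Longrightarrow> act \<sigma> (linform a) = linform (\<sigma> a)"
  by (simp add: act_def linform_def bil_inv_orthogonal)

lemma act_linprod: "real_orthogonal \<sigma> \<Longrightarrow> act \<sigma> (linprod as) = linprod (map \<sigma> as)"
  by (simp add: fun_eq_iff act_def linprod_def bil_inv_orthogonal comp_def)

lemma Lams_act: assumes "real_orthogonal \<sigma>" "f \<in> Lams A" shows "act \<sigma> f \<in> Lams A"
proof -
  have "act \<sigma> f = f \<circ> inv_into UNIV \<sigma>" by (simp add: act_def comp_def)
  also have "\<dots> \<in> Lams A"
    by (rule Lams_comp_linear[OF assms(2)]) (use bil_inv_orthogonal[OF assms(1)] in auto)
  finally show ?thesis .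
qed

lemma Lam_act: "real_orthogonal \<sigma> \<Longrightarrow> f \<in> Lam \<Longrightarrow> act \<sigma> f \<in> Lam"
  unfolding Lam_eq_Lams by (rule Lams_act)

lemma dird_act: assumes "real_orthogonal \<sigma>" shows "dird (\<sigma> a) (act \<sigma> f) = act \<sigma> (dird a f)"
proof
  fix x
  have "inv_into UNIV \<sigma> (x + t *s \<sigma> a) = inv_into UNIV \<sigma> x + t *s a" for t
  proof -
    have "\<sigma> (inv_into UNIV \<sigma> x + t *s a) = x + t *s \<sigma> a"
      using real_orthogonal_bij[OF assms]
      by (simp add: real_orthogonal_add[OF assms] real_orthogonal_scale[OF assms] bij_is_surj surj_f_inv_f)
    then show ?thesis using real_orthogonal_bij[OF assms] by (metis bij_is_inj inv_f_f)
  qed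
  then show "dird (\<sigma> a) (act \<sigma> f) x = act \<sigma> (dird a f) x"
    by (simp add: dird_def act_def)
qed

lemma dirds_act: assumes "real_orthogonal \<sigma>" shows "dirds (map \<sigma> as) (act \<sigma> f) = act \<sigma> (dirds as f)"
  by (induction as) (auto simp: dirds_Nil dirds_Cons dird_act[OF assms])

lemma orthogonal_0: "real_orthogonal \<sigma> \<Longrightarrow> \<sigma> 0 = 0"
  using real_orthogonal_scale[of \<sigma> 0 0] by simp

lemma act_at_0: assumes "real_orthogonal \<sigma>" shows "act \<sigma> f 0 = f 0"
proof -
  have "inv_into UNIV \<sigma> (\<sigma> 0) = 0"
    using real_orthogonal_bij[OF assms] by (intro inv_f_f bij_is_inj)
  then show ?thesis by (simp add: act_def orthogonal_0[OF assms])
qed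

lemma pair_act:
  assumes "real_orthogonal \<sigma>" "f \<in> Lam" "h \<in> Lam"
  shows "theta_pair (act \<sigma> f) (act \<sigma> h) = theta_pair f h"
  using assms(2)
proof (induction rule: Lam_induct)
  case zero
  then show ?case using assms by (simp only: act_zero pair_zero_left Lam_act)
next
  case (mon as)
  have "theta_pair (act \<sigma> (linprod as)) (act \<sigma> h) = dirds (map \<sigma> as) (act \<sigma> h) 0"
    unfolding act_linprod[OF assms(1)] by (rule pair_linprod) (intro Lam_act assms)
  then show ?case unfolding dirds_act[OF assms(1)] act_at_0[OF assms(1)] pair_linprod[OF assms(3)] .
next
  case (add f g)
  then show ?case using assms by (simp only: act_add pair_add_left Lam_act)
next
  case (scale c f)
  then show ?case using assms by (simp only: act_scale pair_scale_left Lam_act)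
qed

section \<open>Divisibility by linear forms\<close>

lemma Lam_zero_on_line:
  assumes "f \<in> Lam" "\<And>t. t \<noteq> 0 \<Longrightarrow> f (x + t *s u) = 0" shows "f x = 0"
proof -
  have "isCont (\<lambda>t. f (x + t *s u)) 0"
    using Lam_has_dird[OF assms(1)] by (rule DERIV_isCont)
  then have "(\<lambda>t. f (x + t *s u)) \<midarrow>0\<rightarrow> f (x + 0 *s u)" unfolding isCont_def .
  moreover have "(\<lambda>t::complex. f (x + t *s u)) \<midarrow>0\<rightarrow> 0"
    using assms(2) by (intro tendsto_eventually) (auto simp: eventually_at_filter)
  ultimately have "f (x + 0 *s u) = 0" by (rule LIM_unique)
  then show ?thesis by simp
qed

text \<open>Away from the hyperplane the factor can be divided out. A point of the hyperplane is a
  limit of such points along the normal direction, because the vector a is real and therefore not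
  isotropic.\<close>

lemma linform_cancel:
  assumes "f \<in> Lam" "a \<noteq> 0" "linform (cvec a) * f = 0" shows "f = 0"
proof -
  have z: "f y = 0" if "bil y (cvec a) \<noteq> 0" for y
    using fun_cong[OF assms(3), of y] that by (simp add: pointwise linform_def)
  have "f x = 0" for x
  proof (cases "bil x (cvec a) = 0")
    case True
    show ?thesis
    proof (rule Lam_zero_on_line[OF assms(1), of _ "cvec a"])
      fix t :: complex assume "t \<noteq> 0"
      then show "f (x + t *s cvec a) = 0" using True assms(2) by (intro z) (simp add: bil_simps bil_cvec)
    qed
  qed (rule z)
  then show ?thesis by (simp add: pointwise)
qed

text \<open>With the constant 1 / (a, a) the substitution in \<open>Lams_divide\<close> is the
  orthogonal projection to the hyperplane. There f vanishes, so the difference that gets divided is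
  f itself.\<close>

lemma linform_divides:
  assumes "f \<in> Lam" "a \<noteq> 0" "\<And>x. bil x (cvec a) = 0 \<Longrightarrow> f x = 0"
  shows "\<exists>g\<in>Lam. f = linform (cvec a) * g"
proof -
  let ?c = "1 / complex_of_real (inner a a)"
  have "f \<in> Lams UNIV" using assms(1) by (simp add: Lam_eq_Lams)
  from Lams_divide[OF this, of ?c "cvec a" "cvec a"] obtain g where g: "g \<in> Lam"
    "f - (\<lambda>x. f (x - (?c * bil x (cvec a)) *s cvec a)) = linform (cvec a) * g"
    by (auto simp: Lam_eq_Lams)
  have "f (x - (?c * bil x (cvec a)) *s cvec a) = 0" for x
    by (rule assms(3)) (use assms(2) in \<open>simp add: bil_simps bil_cvec\<close>)
  then have "f - (\<lambda>x. f (x - (?c * bil x (cvec a)) *s cvec a)) = f" by (simp add: pointwise)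
  then show ?thesis using g by auto
qed

text \<open>The forms are divided out one at a time. What has to be carried along is that the
  quotient still vanishes on the hyperplanes that are left, which holds since no two of the forms
  are proportional.\<close>

lemma linforms_divide:
  assumes "finite Q" "0 \<notin> Q" "\<And>a b c. a \<in> Q \<Longrightarrow> b \<in> Q \<Longrightarrow> b = c *\<^sub>R a \<Longrightarrow> a = b"
    and "f \<in> Lam" "\<And>a x. a \<in> Q \<Longrightarrow> bil x (cvec a) = 0 \<Longrightarrow> f x = 0"
  shows "\<exists>g\<in>Lam. f = (\<Prod>a\<in>Q. linform (cvec a)) * g"
proof -
  have "R \<subseteq> Q \<Longrightarrow> \<exists>g\<in>Lam. f = (\<Prod>a\<in>R. linform (cvec a)) * g \<and> (\<forall>a\<in>Q-R. \<forall>x. bil x (cvec a) = 0 \<longrightarrow> g x = 0)" for R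
  proof -
    assume "R \<subseteq> Q"
    then have "finite R" using assms(1) finite_subset by auto
    from this \<open>R \<subseteq> Q\<close> show ?thesis
    proof (induction R rule: finite_induct)
      case empty
      then show ?case using assms by (intro bexI[of _ f]) auto
    next
      case (insert b R)
      then obtain g where g: "g \<in> Lam" "f = (\<Prod>a\<in>R. linform (cvec a)) * g" "\<And>a x. a \<in> Q - R \<Longrightarrow> bil x (cvec a) = 0 \<Longrightarrow> g x = 0"
        by auto
      have b: "b \<in> Q - R" "b \<noteq> 0" using insert assms(2) by auto
      obtain g' where g': "g' \<in> Lam" "g = linform (cvec b) * g'"
        using linform_divides[OF g(1) b(2) g(3)[OF b(1)]] by auto
      have "g' x = 0" if a: "a \<in> Q - insert b R" and x: "bil x (cvec a) = 0" for a x
      proof -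
        have gg: "bil y (cvec b) * g' y = 0" if "bil y (cvec a) = 0" for y
          using g(3)[of a y] a that g'(2) by (simp add: pointwise linform_def)
        have a0: "a \<noteq> 0" using a assms(2) by auto
        \<comment> \<open>The part of b orthogonal to a: moving along it stays inside the hyperplane
          of a and leaves that of b, so the zeros of the quotient extend by continuity to the
          intersection of the two.\<close>
        define u where "u = b - (inner a b / inner a a) *\<^sub>R a"
        have ua: "inner u a = 0" using a0 by (simp add: u_def inner_diff_left inner_commute[of b a])
        have "u \<noteq> 0"
        proof
          assume "u = 0"
          then have "b = (inner a b / inner a a) *\<^sub>R a" by (simp add: u_def)
          then have "a = b" using a b by (intro assms(3)[of a b "inner a b / inner a a"]) auto
          then show False using a by auto
        qed
        moreover have "inner u u = inner u b"
          using ua by (simp add: u_def inner_diff_right)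
        ultimately have ub: "inner u b \<noteq> 0" by (metis inner_eq_zero_iff)
        show ?thesis
        proof (cases "bil x (cvec b) = 0")
          case True
          show ?thesis
          proof (rule Lam_zero_on_line[OF g'(1), of _ "cvec u"])
            fix t :: complex assume "t \<noteq> 0"
            then have "bil (x + t *s cvec u) (cvec b) \<noteq> 0" using True ub by (simp add: bil_simps bil_cvec)
            moreover have "bil (x + t *s cvec u) (cvec a) = 0" using x ua by (simp add: bil_simps bil_cvec)
            ultimately show "g' (x + t *s cvec u) = 0" using gg by auto
          qed
        qed (use gg[OF x] in auto)
      qed
      moreover have "f = (\<Prod>a\<in>insert b R. linform (cvec a)) * g'"
        unfolding g(2) g'(2) prod.insert[OF insert(1,2)] by (simp add: mult_ac)
      ultimately show ?case using g'(1) by (intro bexI[of _ g']) auto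
    qed
  qed
  from this[OF subset_refl] show ?thesis by auto
qed


declare o_apply [simp del] id_apply [simp del]

section \<open>Root systems with a base\<close>

text \<open>The action on roots as real vectors. Taking real parts loses nothing for maps with
  \<open>real_orthogonal\<close>; see \<open>cvec_root_act\<close>.\<close>

definition root_act :: "(complex ^ 'n \<Rightarrow> complex ^ 'n) \<Rightarrow> real ^ 'n \<Rightarrow> real ^ 'n" where
  "root_act \<sigma> x = (\<chi> i. Re (\<sigma> (cvec x) $ i))"

lemma cvec_root_act: "real_orthogonal \<sigma> \<Longrightarrow> cvec (root_act \<sigma> x) = \<sigma> (cvec x)"
  using real_orthogonal_real[of \<sigma> x] by (auto simp: root_act_def cvec_def)

lemma root_act_id: "root_act id x = x" "root_act (\<lambda>x. x) x = x"
  by (simp_all add: root_act_def cvec_def id_apply)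

lemma root_act_refl: "root_act (refl a) x = refl_real a x"
  using cvec_root_act[OF real_orthogonal_refl, of a x] by (simp add: refl_cvec cvec_inject)

lemma root_act_comp:
  assumes "real_orthogonal \<sigma>" "real_orthogonal \<tau>"
  shows "root_act (\<sigma> \<circ> \<tau>) x = root_act \<sigma> (root_act \<tau> x)"
proof -
  have "cvec (root_act (\<sigma> \<circ> \<tau>) x) = cvec (root_act \<sigma> (root_act \<tau> x))"
    using assms by (simp add: cvec_root_act real_orthogonal_comp o_apply)
  then show ?thesis by (simp add: cvec_inject)
qed

lemma
  assumes "real_orthogonal \<sigma>"
  shows root_act_add: "root_act \<sigma> (x + y) = root_act \<sigma> x + root_act \<sigma> y"
    and root_act_scale: "root_act \<sigma> (c *\<^sub>R x) = c *\<^sub>R root_act \<sigma> x"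
    and root_act_minus: "root_act \<sigma> (- x) = - root_act \<sigma> x"
    and root_act_zero: "root_act \<sigma> 0 = 0"
    and inner_root_act: "inner (root_act \<sigma> x) (root_act \<sigma> y) = inner x y"
proof -
  note c = cvec_root_act[OF assms] real_orthogonal_add[OF assms] real_orthogonal_scale[OF assms]
    real_orthogonal_minus[OF assms] orthogonal_0[OF assms]
  have "cvec (root_act \<sigma> (x + y)) = cvec (root_act \<sigma> x + root_act \<sigma> y)" by (simp add: c cvec_add)
  then show "root_act \<sigma> (x + y) = root_act \<sigma> x + root_act \<sigma> y" by (simp add: cvec_inject)
  have "cvec (root_act \<sigma> (c *\<^sub>R x)) = cvec (c *\<^sub>R root_act \<sigma> x)" by (simp add: c cvec_scale)
  then show "root_act \<sigma> (c *\<^sub>R x) = c *\<^sub>R root_act \<sigma> x" by (simp add: cvec_inject)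
  have "cvec (root_act \<sigma> (- x)) = cvec (- root_act \<sigma> x)" by (simp add: c cvec_minus)
  then show "root_act \<sigma> (- x) = - root_act \<sigma> x" by (simp add: cvec_inject)
  have "cvec (root_act \<sigma> 0) = cvec 0" by (simp add: c cvec_0)
  then show "root_act \<sigma> 0 = 0" by (simp only: cvec_inject)
  have "bil (cvec (root_act \<sigma> x)) (cvec (root_act \<sigma> y)) = bil (cvec x) (cvec y)"
    by (simp add: c real_orthogonal_bil[OF assms])
  then show "inner (root_act \<sigma> x) (root_act \<sigma> y) = inner x y" by (simp add: bil_cvec)
qed

lemma root_act_sum:
  "real_orthogonal \<sigma> \<Longrightarrow> root_act \<sigma> (\<Sum>i\<in>I. c i *\<^sub>R x i) = (\<Sum>i\<in>I. c i *\<^sub>R root_act \<sigma> (x i))"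
  by (induction I rule: infinite_finite_induct) (auto simp: root_act_zero root_act_add root_act_scale)

lemma refl_minus: "refl (- a) = refl a"
  by (auto simp: fun_eq_iff refl_eq cvec_minus bil_simps)

lemma refl_real_self: "a \<noteq> 0 \<Longrightarrow> refl_real a a = - a"
  by (simp add: refl_real_def scaleR_2)

lemma arg_max_len:
  assumes "finite X" "\<sigma> \<in> X" "\<And>\<tau>. \<tau> \<in> X \<Longrightarrow> len \<Omega> \<tau> \<le> len \<Omega> \<sigma>"
  shows "longest \<Omega> X \<in> X" "len \<Omega> (longest \<Omega> X) = len \<Omega> \<sigma>"
proof -
  have "\<forall>y. y \<in> X \<longrightarrow> len \<Omega> y < Suc (len \<Omega> \<sigma>)" using assms(3) by (auto simp: less_Suc_eq_le)
  from arg_max_nat_lemma[of "\<lambda>w. w \<in> X", OF assms(2) this]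
  have "longest \<Omega> X \<in> X \<and> (\<forall>y. y \<in> X \<longrightarrow> len \<Omega> y \<le> len \<Omega> (longest \<Omega> X))"
    unfolding longest_def .
  then show "longest \<Omega> X \<in> X" "len \<Omega> (longest \<Omega> X) = len \<Omega> \<sigma>"
    using assms by (auto intro: antisym)
qed

locale simple_roots =
  fixes \<Psi> \<Omega> :: "(real ^ 'n) set"
  assumes root_system: "root_system \<Psi>" and simple: "simple_system \<Psi> \<Omega>"
begin

abbreviation pos :: "(real ^ 'n) set" where "pos \<equiv> pos_roots \<Psi> \<Omega>"
abbreviation W :: "(complex ^ 'n \<Rightarrow> complex ^ 'n) set" where "W \<equiv> refl_group \<Psi>"
abbreviation coord :: "real ^ 'n \<Rightarrow> real ^ 'n \<Rightarrow> real" where "coord \<equiv> representation \<Omega>"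

lemma finite_roots: "finite \<Psi>"
  and zero_not_root: "0 \<notin> \<Psi>"
  using root_system by (auto simp: root_system_def)

lemma refl_real_root: "\<alpha> \<in> \<Psi> \<Longrightarrow> \<beta> \<in> \<Psi> \<Longrightarrow> refl_real \<alpha> \<beta> \<in> \<Psi>"
  using root_system unfolding root_system_def by blast

lemma root_line: "\<alpha> \<in> \<Psi> \<Longrightarrow> {\<beta> \<in> \<Psi>. \<exists>c. cvec \<beta> = c *s cvec \<alpha>} = {\<alpha>, -\<alpha>}"
  using root_system unfolding root_system_def by blast

lemma minus_root: "\<alpha> \<in> \<Psi> \<Longrightarrow> - \<alpha> \<in> \<Psi>"
  using root_line[of \<alpha>] by auto

lemma proportional_roots: assumes "\<alpha> \<in> \<Psi>" "\<beta> \<in> \<Psi>" "\<beta> = c *\<^sub>R \<alpha>" shows "\<beta> = \<alpha> \<or> \<beta> = - \<alpha>"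
proof -
  have "cvec \<beta> = complex_of_real c *s cvec \<alpha>" using assms(3) by (simp add: cvec_scale)
  then have "\<beta> \<in> {\<beta> \<in> \<Psi>. \<exists>c. cvec \<beta> = c *s cvec \<alpha>}" using assms(2) by blast
  then show ?thesis unfolding root_line[OF assms(1)] by simp
qed

lemma simple_subset: "\<Omega> \<subseteq> \<Psi>"
  and independent_simple: "independent \<Omega>"
  and finite_simple: "finite \<Omega>"
  and root_sign: "\<beta> \<in> \<Psi> \<Longrightarrow> \<beta> \<in> nonneg_combs \<Omega> \<or> - \<beta> \<in> nonneg_combs \<Omega>"
  using simple finite_subset[OF _ finite_roots] by (auto simp: simple_system_def)

lemma coord_sum:
  assumes "\<omega> \<in> \<Omega>" shows "coord (\<Sum>\<omega>\<in>\<Omega>. c \<omega> *\<^sub>R \<omega>) \<omega> = c \<omega>"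
proof -
  have "coord (\<Sum>\<omega>\<in>\<Omega>. c \<omega> *\<^sub>R \<omega>) = (\<lambda>b. \<Sum>\<omega>\<in>\<Omega>. coord (c \<omega> *\<^sub>R \<omega>) b)"
    by (rule real_vector.representation_sum[OF independent_simple]) (auto intro: span_scale span_base)
  then have "coord (\<Sum>\<omega>\<in>\<Omega>. c \<omega> *\<^sub>R \<omega>) \<omega> = (\<Sum>\<omega>'\<in>\<Omega>. coord (c \<omega>' *\<^sub>R \<omega>') \<omega>)" by simp
  also have "\<dots> = (\<Sum>\<omega>'\<in>\<Omega>. if \<omega>' = \<omega> then c \<omega>' else 0)"
    by (intro sum.cong refl)
      (simp add: real_vector.representation_scale[OF independent_simple] span_base
        real_vector.representation_basis[OF independent_simple])
  finally show ?thesis using assms finite_simple by simp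
qed

lemma sum_coord: "x \<in> span \<Omega> \<Longrightarrow> (\<Sum>\<omega>\<in>\<Omega>. coord x \<omega> *\<^sub>R \<omega>) = x"
  using real_vector.sum_representation_eq[OF independent_simple _ finite_simple] by auto

lemma nonneg_combs_iff: "x \<in> nonneg_combs \<Omega> \<longleftrightarrow> x \<in> span \<Omega> \<and> (\<forall>\<omega>\<in>\<Omega>. 0 \<le> coord x \<omega>)"
proof
  assume "x \<in> nonneg_combs \<Omega>"
  then obtain c where c: "x = (\<Sum>\<omega>\<in>\<Omega>. c \<omega> *\<^sub>R \<omega>)" "\<forall>\<omega>\<in>\<Omega>. 0 \<le> c \<omega>" unfolding nonneg_combs_def by auto
  have "x \<in> span \<Omega>" unfolding c(1) by (intro span_sum span_scale span_base)
  then show "x \<in> span \<Omega> \<and> (\<forall>\<omega>\<in>\<Omega>. 0 \<le> coord x \<omega>)"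
    using coord_sum[of _ c] c by simp
next
  assume "x \<in> span \<Omega> \<and> (\<forall>\<omega>\<in>\<Omega>. 0 \<le> coord x \<omega>)"
  then show "x \<in> nonneg_combs \<Omega>" unfolding nonneg_combs_def using sum_coord[of x] by (auto intro!: exI[of _ "coord x"])
qed

lemma root_in_span: "\<beta> \<in> \<Psi> \<Longrightarrow> \<beta> \<in> span \<Omega>"
  using root_sign[of \<beta>] span_neg[of "- \<beta>" \<Omega>] by (auto simp: nonneg_combs_iff)

lemma coord_minus: "x \<in> span \<Omega> \<Longrightarrow> coord (- x) \<omega> = - coord x \<omega>"
  by (simp add: real_vector.representation_neg[OF independent_simple])

lemma pos_iff: "\<beta> \<in> pos \<longleftrightarrow> \<beta> \<in> \<Psi> \<and> (\<forall>\<omega>\<in>\<Omega>. 0 \<le> coord \<beta> \<omega>)"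
  using root_in_span by (auto simp: pos_roots_def nonneg_combs_iff)

lemma pos_root: "\<beta> \<in> pos \<Longrightarrow> \<beta> \<in> \<Psi>"
  by (simp add: pos_iff)

lemma finite_pos: "finite pos"
  using finite_roots finite_subset[of pos \<Psi>] pos_root by auto

lemma not_pos_iff: assumes "\<beta> \<in> \<Psi>" shows "\<beta> \<notin> pos \<longleftrightarrow> - \<beta> \<in> pos"
proof -
  have "\<not> (\<beta> \<in> pos \<and> - \<beta> \<in> pos)"
  proof
    assume "\<beta> \<in> pos \<and> - \<beta> \<in> pos"
    then have "coord \<beta> \<omega> = 0" if "\<omega> \<in> \<Omega>" for \<omega>
      using that root_in_span[OF assms] coord_minus[of \<beta> \<omega>] by (auto simp: pos_iff intro!: antisym)
    then have "\<beta> = 0" using sum_coord[OF root_in_span[OF assms]] by simp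
    then show False using assms zero_not_root by simp
  qed
  moreover have "\<beta> \<in> pos \<or> - \<beta> \<in> pos"
    using root_sign[OF assms] assms minus_root[OF assms] by (auto simp: pos_roots_def)
  ultimately show ?thesis by auto
qed

lemma simple_pos: "\<Omega> \<subseteq> pos"
  using simple_subset by (auto simp: pos_iff real_vector.representation_basis[OF independent_simple])

lemma simple_root: "\<alpha> \<in> \<Omega> \<Longrightarrow> \<alpha> \<in> \<Psi>"
  using simple_subset by auto

lemma root_nonzero: "\<alpha> \<in> \<Psi> \<Longrightarrow> \<alpha> \<noteq> 0"
  using zero_not_root by auto

text \<open>The reflection changes the coordinate at \<alpha> only. If the image were negative, all
  other coordinates of \<beta> would be both nonnegative and nonpositive, so \<beta> would be
  proportional to \<alpha>.\<close>

lemma simple_refl_pos: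
  assumes "\<alpha> \<in> \<Omega>" "\<beta> \<in> pos" "\<beta> \<noteq> \<alpha>" shows "refl_real \<alpha> \<beta> \<in> pos"
proof (rule ccontr)
  define k where "k = 2 * inner \<beta> \<alpha> / inner \<alpha> \<alpha>"
  have \<gamma>: "refl_real \<alpha> \<beta> = \<beta> - k *\<^sub>R \<alpha>" by (simp add: refl_real_def k_def)
  have root: "refl_real \<alpha> \<beta> \<in> \<Psi>" using assms simple_root pos_root refl_real_root by auto
  assume "refl_real \<alpha> \<beta> \<notin> pos"
  then have neg: "- refl_real \<alpha> \<beta> \<in> pos" using not_pos_iff[OF root] by simp
  have sp: "\<beta> \<in> span \<Omega>" "\<alpha> \<in> span \<Omega>" using assms pos_root root_in_span simple_root by auto
  have z: "coord \<beta> \<omega> = 0" if "\<omega> \<in> \<Omega>" "\<omega> \<noteq> \<alpha>" for \<omega>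
  proof -
    have "coord (refl_real \<alpha> \<beta>) \<omega> = coord \<beta> \<omega>"
      unfolding \<gamma> using sp that assms(1) by (simp add: real_vector.representation_diff[OF independent_simple]
        real_vector.representation_scale[OF independent_simple] span_scale real_vector.representation_basis[OF independent_simple])
    moreover have "coord (refl_real \<alpha> \<beta>) \<omega> \<le> 0"
      using neg that coord_minus[OF root_in_span[OF root], of \<omega>] by (auto simp: pos_iff)
    ultimately show ?thesis using assms(2) that by (auto simp: pos_iff intro: antisym)
  qed
  have "\<beta> = (\<Sum>\<omega>\<in>\<Omega>. if \<omega> = \<alpha> then coord \<beta> \<alpha> *\<^sub>R \<alpha> else 0)"
    by (subst (1) sum_coord[OF sp(1), symmetric], intro sum.cong) (auto simp: z)
  then have "\<beta> = coord \<beta> \<alpha> *\<^sub>R \<alpha>" using finite_simple assms(1) by simp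
  with simple_root[OF assms(1)] pos_root[OF assms(2)] have "\<beta> = \<alpha> \<or> \<beta> = - \<alpha>" by (rule proportional_roots)
  then have "\<beta> = - \<alpha>" using assms(3) by simp
  then show False using not_pos_iff[of \<alpha>] assms simple_pos simple_root by auto
qed

lemma root_act_root: "\<sigma> \<in> W \<Longrightarrow> \<beta> \<in> \<Psi> \<Longrightarrow> root_act \<sigma> \<beta> \<in> \<Psi>"
proof (induction rule: refl_group_induct)
  case id
  then show ?case by (simp add: root_act_id)
next
  case (step a \<sigma>)
  then show ?case
    by (simp only: root_act_comp[OF real_orthogonal_refl refl_group_orthogonal[OF step(2)]] root_act_refl refl_real_root)
qed

lemma root_act_refl_word_Cons:
  "root_act (refl_word (a # as)) x = refl_real a (root_act (refl_word as) x)"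
  by (simp only: refl_word_Cons root_act_comp real_orthogonal_refl real_orthogonal_refl_word root_act_refl)

lemma root_act_refl_word_snoc:
  "root_act (refl_word (as @ [a])) x = root_act (refl_word as) (refl_real a x)"
  by (simp only: refl_word_append refl_word_Cons refl_word_Nil comp_id root_act_comp real_orthogonal_refl
      real_orthogonal_refl_word root_act_refl)

text \<open>Among the positive roots in the orbit of \<open>\<beta>\<close>, one of minimal height is simple.\<close>

lemma root_conj_simple:
  assumes "\<beta> \<in> pos"
  shows "\<exists>as\<in>lists \<Omega>. \<exists>\<omega>\<in>\<Omega>. root_act (refl_word as) \<omega> = \<beta>"
proof -
  define X where "X = {\<gamma>\<in>pos. \<exists>as\<in>lists \<Omega>. root_act (refl_word as) \<gamma> = \<beta>}"
  define h where "h \<gamma> = (\<Sum>\<omega>\<in>\<Omega>. coord \<gamma> \<omega>)" for \<gamma>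
  have "\<beta> \<in> X" using assms by (auto simp: X_def refl_word_Nil root_act_id intro!: bexI[of _ "[]"])
  moreover have "finite X" using finite_pos by (simp add: X_def)
  ultimately have "Min (h ` X) \<in> h ` X" by (intro Min_in) auto
  then obtain \<gamma> where \<gamma>: "\<gamma> \<in> X" "h \<gamma> = Min (h ` X)" by auto
  then have min: "h \<gamma> \<le> h \<delta>" if "\<delta> \<in> X" for \<delta> using that \<open>finite X\<close> by auto
  obtain as where as: "as \<in> lists \<Omega>" "root_act (refl_word as) \<gamma> = \<beta>" and "\<gamma> \<in> pos" using \<gamma> by (auto simp: X_def)
  have sp: "\<gamma> \<in> span \<Omega>" using \<open>\<gamma> \<in> pos\<close> pos_root root_in_span by auto
  have "inner \<gamma> \<gamma> > 0" using \<open>\<gamma> \<in> pos\<close> pos_root root_nonzero by simp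
  also have "inner \<gamma> \<gamma> = inner (\<Sum>\<omega>\<in>\<Omega>. coord \<gamma> \<omega> *\<^sub>R \<omega>) \<gamma>" by (simp add: sum_coord[OF sp])
  also have "\<dots> = (\<Sum>\<omega>\<in>\<Omega>. coord \<gamma> \<omega> * inner \<omega> \<gamma>)" by (simp add: inner_sum_left)
  finally have sum_pos: "(\<Sum>\<omega>\<in>\<Omega>. coord \<gamma> \<omega> * inner \<omega> \<gamma>) > 0" .
  \<comment> \<open>The inner product of \<gamma> with itself is positive and is a sum of these
    terms. Reflecting in a simple root with a positive term lowers the height.\<close>
  have "\<exists>\<omega>\<in>\<Omega>. coord \<gamma> \<omega> * inner \<omega> \<gamma> > 0"
  proof (rule ccontr)
    assume "\<not> ?thesis"
    then have "(\<Sum>\<omega>\<in>\<Omega>. coord \<gamma> \<omega> * inner \<omega> \<gamma>) \<le> 0" by (intro sum_nonpos) (simp add: not_less)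
    then show False using sum_pos by simp
  qed
  then obtain \<omega> where \<omega>: "\<omega> \<in> \<Omega>" "coord \<gamma> \<omega> * inner \<omega> \<gamma> > 0" by blast
  then have pos_inner: "inner \<omega> \<gamma> > 0" using \<open>\<gamma> \<in> pos\<close> by (auto simp: pos_iff zero_less_mult_iff)
  show ?thesis
  proof (cases "\<gamma> = \<omega>")
    case True
    then show ?thesis using as \<omega> by blast
  next
    case False
    define k where "k = 2 * inner \<gamma> \<omega> / inner \<omega> \<omega>"
    have "inner \<omega> \<omega> > 0" using \<omega> simple_root root_nonzero by auto
    then have "k > 0" using pos_inner by (simp add: k_def inner_commute)
    have d: "refl_real \<omega> \<gamma> = \<gamma> - k *\<^sub>R \<omega>" by (simp add: refl_real_def k_def)
    have "refl_real \<omega> \<gamma> \<in> X"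
      unfolding X_def using simple_refl_pos[OF \<omega>(1) \<open>\<gamma> \<in> pos\<close> False] as \<omega>
      by (auto intro!: bexI[of _ "as @ [\<omega>]"] simp: root_act_refl_word_snoc refl_real_refl_real)
    then have "h \<gamma> \<le> h (refl_real \<omega> \<gamma>)" by (rule min)
    also have "h (refl_real \<omega> \<gamma>) = (\<Sum>\<omega>'\<in>\<Omega>. coord \<gamma> \<omega>' - (if \<omega>' = \<omega> then k else 0))"
      unfolding h_def d using sp \<omega>(1)
      by (intro sum.cong refl) (simp add: real_vector.representation_diff[OF independent_simple] span_base
        real_vector.representation_scale[OF independent_simple] span_scale real_vector.representation_basis[OF independent_simple])
    also have "\<dots> = h \<gamma> - k" unfolding sum_subtractf using finite_simple \<omega>(1) by (simp add: h_def)
    finally show ?thesis using \<open>k > 0\<close> by simp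
  qed
qed

text \<open>A positive root is conjugate to a simple one by a word in simple reflections, and its
  reflection is conjugate by the same word. Opposite roots have the same reflection.\<close>

lemma refl_simple_group: assumes "\<beta> \<in> \<Psi>" shows "refl \<beta> \<in> refl_group \<Omega>"
proof -
  have pos: "refl \<beta> \<in> refl_group \<Omega>" if p: "\<beta> \<in> pos" for \<beta>
  proof -
    obtain as \<omega> where as: "as \<in> lists \<Omega>" "\<omega> \<in> \<Omega>" "root_act (refl_word as) \<omega> = \<beta>"
      using root_conj_simple[OF p] by auto
    then have "refl_word as (cvec \<omega>) = cvec \<beta>"
      using cvec_root_act[OF real_orthogonal_refl_word, of as \<omega>] by simp
    then have "refl_word as \<circ> refl \<omega> = refl \<beta> \<circ> refl_word as"
      by (rule refl_conj[OF real_orthogonal_refl_word])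
    then have "refl_word as \<circ> refl \<omega> \<circ> refl_word (rev as) = refl \<beta> \<circ> (refl_word as \<circ> refl_word (rev as))"
      by (simp add: comp_assoc)
    then have "refl \<beta> = refl_word (as @ [\<omega>] @ rev as)"
      unfolding refl_word_rev' by (simp add: refl_word_append refl_word_Cons refl_word_Nil comp_assoc)
    then show ?thesis using as unfolding refl_group_def by (auto simp: in_lists_conv_set)
  qed
  show ?thesis
    using pos[of \<beta>] pos[of "- \<beta>"] not_pos_iff[OF assms] by (auto simp: refl_minus)
qed

lemma W_eq: "W = refl_group \<Omega>"
proof
  show "refl_group \<Omega> \<subseteq> W" by (rule refl_group_mono[OF simple_subset])
  show "W \<subseteq> refl_group \<Omega>"
  proof
    fix \<sigma> assume "\<sigma> \<in> W"
    then show "\<sigma> \<in> refl_group \<Omega>"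
      by (induction rule: refl_group_induct) (auto intro: refl_group_id refl_group_comp refl_simple_group)
  qed
qed

section \<open>Inversion sets, length and the longest element\<close>

definition invs :: "(complex ^ 'n \<Rightarrow> complex ^ 'n) \<Rightarrow> (real ^ 'n) set" where
  "invs \<sigma> = {\<beta> \<in> pos. root_act \<sigma> \<beta> \<notin> pos}"

lemma finite_invs: "finite (invs \<sigma>)"
  using finite_pos by (simp add: invs_def)

text \<open>The simple reflection permutes the positive roots other than \<alpha>, and so carries
  the inversions of \<sigma> to those of the product that differ from \<alpha>. The root \<alpha>
  itself is the additional inversion.\<close>

lemma card_invs_refl:
  assumes "\<sigma> \<in> W" "\<alpha> \<in> \<Omega>" "root_act \<sigma> \<alpha> \<in> pos"
  shows "card (invs (\<sigma> \<circ> refl \<alpha>)) = Suc (card (invs \<sigma>))"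
proof -
  note o = refl_group_orthogonal[OF assms(1)]
  have ra: "root_act (\<sigma> \<circ> refl \<alpha>) \<beta> = root_act \<sigma> (refl_real \<alpha> \<beta>)" for \<beta>
    by (simp only: root_act_comp o real_orthogonal_refl root_act_refl)
  have \<alpha>: "\<alpha> \<in> pos" "\<alpha> \<in> \<Psi>" "\<alpha> \<noteq> 0" using assms simple_pos simple_root root_nonzero by auto
  have "invs (\<sigma> \<circ> refl \<alpha>) = insert \<alpha> (refl_real \<alpha> ` invs \<sigma>)"
  proof (intro equalityI subsetI)
    fix \<beta> assume b: "\<beta> \<in> invs (\<sigma> \<circ> refl \<alpha>)"
    show "\<beta> \<in> insert \<alpha> (refl_real \<alpha> ` invs \<sigma>)"
    proof (cases "\<beta> = \<alpha>")
      case False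
      then have "refl_real \<alpha> \<beta> \<in> invs \<sigma>" using b simple_refl_pos[OF assms(2)] by (auto simp: invs_def ra)
      then show ?thesis using refl_real_refl_real[of \<alpha> \<beta>] by (metis image_eqI insertI2)
    qed simp
  next
    fix \<beta> assume "\<beta> \<in> insert \<alpha> (refl_real \<alpha> ` invs \<sigma>)"
    then consider "\<beta> = \<alpha>" | \<gamma> where "\<gamma> \<in> invs \<sigma>" "\<beta> = refl_real \<alpha> \<gamma>" by auto
    then show "\<beta> \<in> invs (\<sigma> \<circ> refl \<alpha>)"
    proof cases
      case 1
      have "- root_act \<sigma> \<alpha> \<notin> pos" using not_pos_iff[of "root_act \<sigma> \<alpha>"] assms root_act_root \<alpha> by auto
      then show ?thesis using 1 \<alpha> by (simp add: invs_def ra refl_real_self root_act_minus[OF o])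
    next
      case 2
      then have "\<gamma> \<noteq> \<alpha>" using assms(3) by (auto simp: invs_def)
      then show ?thesis using 2 simple_refl_pos[OF assms(2)] by (auto simp: invs_def ra refl_real_refl_real)
    qed
  qed
  moreover have "\<alpha> \<notin> refl_real \<alpha> ` invs \<sigma>"
  proof
    assume "\<alpha> \<in> refl_real \<alpha> ` invs \<sigma>"
    then obtain \<gamma> where "\<gamma> \<in> pos" "\<alpha> = refl_real \<alpha> \<gamma>" by (auto simp: invs_def)
    then have "- \<alpha> \<in> pos" using refl_real_refl_real[of \<alpha> \<gamma>] refl_real_self[OF \<alpha>(3)] by simp
    then show False using not_pos_iff[OF \<alpha>(2)] \<alpha>(1) by simp
  qed
  moreover have "inj_on (refl_real \<alpha>) (invs \<sigma>)" by (metis inj_onI refl_real_refl_real)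
  ultimately show ?thesis using finite_invs[of \<sigma>] by (simp add: card_image)
qed

lemma comp_refl_refl: "\<sigma> \<circ> refl \<alpha> \<circ> refl \<alpha> = \<sigma>"
  by (simp add: fun_eq_iff o_apply refl_refl)

lemma card_invs_refl_neg:
  assumes "\<sigma> \<in> W" "\<alpha> \<in> \<Omega>" "root_act \<sigma> \<alpha> \<notin> pos"
  shows "card (invs \<sigma>) = Suc (card (invs (\<sigma> \<circ> refl \<alpha>)))"
proof -
  note o = refl_group_orthogonal[OF assms(1)]
  have \<alpha>: "\<alpha> \<in> \<Psi>" "\<alpha> \<noteq> 0" using assms simple_root root_nonzero by auto
  have "root_act (\<sigma> \<circ> refl \<alpha>) \<alpha> = - root_act \<sigma> \<alpha>"
    by (simp only: root_act_comp o real_orthogonal_refl root_act_refl refl_real_self[OF \<alpha>(2)] root_act_minus)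
  also have "\<dots> \<in> pos" using not_pos_iff[of "root_act \<sigma> \<alpha>"] assms root_act_root \<alpha> by auto
  finally have "card (invs (\<sigma> \<circ> refl \<alpha> \<circ> refl \<alpha>)) = Suc (card (invs (\<sigma> \<circ> refl \<alpha>)))"
    using assms \<alpha> by (intro card_invs_refl refl_group_comp refl_group_refl) auto
  then show ?thesis unfolding comp_refl_refl .
qed

text \<open>Somewhere in the word a letter b sends a positive root to a negative one. The only
  positive root for which this happens is b itself, so the tail after that letter conjugates the
  reflection in \<alpha> into that in b, and the letter can be deleted.\<close>

lemma exchange:
  assumes "as \<in> lists \<Omega>" "\<alpha> \<in> \<Omega>" "root_act (refl_word as) \<alpha> \<notin> pos"
  shows "\<exists>bs\<in>lists \<Omega>. Suc (length bs) = length as \<and> refl_word bs = refl_word as \<circ> refl \<alpha>"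
  using assms(1,3)
proof (induction as rule: list.induct)
  case Nil
  then show ?case using assms(2) simple_pos by (auto simp: refl_word_Nil root_act_id)
next
  case (Cons b as)
  show ?case
  proof (cases "root_act (refl_word as) \<alpha> \<in> pos")
    case False
    then obtain bs where "bs\<in>lists \<Omega>" "Suc (length bs) = length as" "refl_word bs = refl_word as \<circ> refl \<alpha>"
      using Cons by auto
    then show ?thesis using Cons by (intro bexI[of _ "b # bs"]) (auto simp: refl_word_Cons comp_assoc)
  next
    case True
    have "refl_real b (root_act (refl_word as) \<alpha>) \<notin> pos"
      using Cons.prems(2) by (simp add: root_act_refl_word_Cons)
    then have "root_act (refl_word as) \<alpha> = b" using simple_refl_pos[of b] True Cons.prems(1) by auto
    then have "refl_word as (cvec \<alpha>) = cvec b"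
      using cvec_root_act[OF real_orthogonal_refl_word, of as \<alpha>] by simp
    then have "refl_word as \<circ> refl \<alpha> = refl b \<circ> refl_word as"
      by (rule refl_conj[OF real_orthogonal_refl_word])
    then have "refl_word as = refl_word (b # as) \<circ> refl \<alpha>"
      by (simp add: refl_word_Cons comp_assoc) (simp add: fun_eq_iff o_apply refl_refl)
    then show ?thesis using Cons.prems by (intro bexI[of _ as]) auto
  qed
qed

lemma reduced_word_exists: assumes "\<sigma> \<in> W" shows "\<exists>as. reduced_word \<Omega> \<sigma> as"
proof -
  obtain bs where "bs \<in> lists \<Omega>" "refl_word bs = \<sigma>" using assms unfolding W_eq unfolding refl_group_def by auto
  then have "\<exists>k. \<exists>as\<in>lists \<Omega>. length as = k \<and> refl_word as = \<sigma>" by auto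
  from LeastI_ex[OF this] show ?thesis unfolding reduced_word_def len_def by auto
qed

lemma len_le: "as \<in> lists \<Omega> \<Longrightarrow> len \<Omega> (refl_word as) \<le> length as"
  unfolding len_def by (rule Least_le) auto

lemma refl_word_W: "as \<in> lists \<Omega> \<Longrightarrow> refl_word as \<in> W"
  unfolding W_eq unfolding refl_group_def by auto

text \<open>A prefix of a reduced word is reduced. If the prefix sent the last letter to a negative
  root, \<open>exchange\<close> would give a word that is too short; hence each letter adds one
  inversion.\<close>

lemma card_invs_reduced:
  "as \<in> lists \<Omega> \<Longrightarrow> length as = len \<Omega> (refl_word as) \<Longrightarrow> card (invs (refl_word as)) = length as"
proof (induction as rule: rev_induct)
  case Nil
  have "invs id = {}" by (simp add: invs_def root_act_id id_def)
  then show ?case by (simp add: refl_word_Nil)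
next
  case (snoc \<alpha> as)
  have as: "as \<in> lists \<Omega>" "\<alpha> \<in> \<Omega>" using snoc by auto
  have \<sigma>: "refl_word (as @ [\<alpha>]) = refl_word as \<circ> refl \<alpha>"
    by (simp add: refl_word_append refl_word_Cons refl_word_Nil)
  have "length as \<le> len \<Omega> (refl_word as)"
  proof -
    obtain bs where bs: "reduced_word \<Omega> (refl_word as) bs" using reduced_word_exists[OF refl_word_W[OF as(1)]] by auto
    then have "refl_word (bs @ [\<alpha>]) = refl_word (as @ [\<alpha>])" by (simp add: refl_word_append reduced_word_def)
    moreover have "bs @ [\<alpha>] \<in> lists \<Omega>" using bs as by (auto simp: reduced_word_def)
    ultimately have "len \<Omega> (refl_word (as @ [\<alpha>])) \<le> Suc (length bs)" using len_le[of "bs @ [\<alpha>]"] by simp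
    then show ?thesis using snoc.prems bs by (simp add: reduced_word_def)
  qed
  then have l: "length as = len \<Omega> (refl_word as)" using len_le[OF as(1)] by simp
  have "root_act (refl_word as) \<alpha> \<in> pos"
  proof (rule ccontr)
    assume "root_act (refl_word as) \<alpha> \<notin> pos"
    then obtain bs where "bs\<in>lists \<Omega>" "Suc (length bs) = length as" "refl_word bs = refl_word as \<circ> refl \<alpha>"
      using exchange[OF as] by auto
    then show False using len_le[of bs] snoc.prems(2) \<sigma> by simp
  qed
  then show ?case using card_invs_refl[OF refl_word_W[OF as(1)] as(2)] snoc.IH[OF as(1) l] \<sigma> by simp
qed

lemma len_eq: assumes "\<sigma> \<in> W" shows "len \<Omega> \<sigma> = card (invs \<sigma>)"
proof -
  obtain as where "reduced_word \<Omega> \<sigma> as" using reduced_word_exists[OF assms] by auto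
  then show ?thesis using card_invs_reduced[of as] by (auto simp: reduced_word_def)
qed

lemma len_0_id: assumes "\<sigma> \<in> W" "len \<Omega> \<sigma> = 0" shows "\<sigma> = id"
proof -
  obtain as where "reduced_word \<Omega> \<sigma> as" using reduced_word_exists[OF assms(1)] by auto
  then show ?thesis using assms(2) by (auto simp: reduced_word_def refl_word_Nil)
qed

lemma id_if_pos: assumes "\<sigma> \<in> W" "\<And>\<beta>. \<beta> \<in> pos \<Longrightarrow> root_act \<sigma> \<beta> \<in> pos" shows "\<sigma> = id"
proof -
  have "invs \<sigma> = {}" using assms(2) by (auto simp: invs_def)
  then show ?thesis using len_0_id[OF assms(1)] len_eq[OF assms(1)] by simp
qed

text \<open>Although the roots need not span the space, an element of W that fixes every root is the
  identity, since it has no inversions. So W embeds into the maps from the finite set of roots to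
  itself.\<close>

lemma finite_W: "finite W"
proof -
  have "inj_on (\<lambda>\<sigma>. restrict (root_act \<sigma>) \<Psi>) W"
  proof (rule inj_onI)
    fix \<sigma> \<tau> assume s: "\<sigma> \<in> W" "\<tau> \<in> W" "restrict (root_act \<sigma>) \<Psi> = restrict (root_act \<tau>) \<Psi>"
    let ?\<rho> = "inv_into UNIV \<tau> \<circ> \<sigma>"
    have \<tau>': "inv_into UNIV \<tau> \<in> W" by (rule refl_group_inv[OF s(2)])
    have "root_act ?\<rho> \<beta> = \<beta>" if "\<beta> \<in> \<Psi>" for \<beta>
    proof -
      have "root_act \<sigma> \<beta> = root_act \<tau> \<beta>" using fun_cong[OF s(3), of \<beta>] that by simp
      then have "root_act ?\<rho> \<beta> = root_act (inv_into UNIV \<tau> \<circ> \<tau>) \<beta>"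
        by (simp only: root_act_comp refl_group_orthogonal[OF s(1)] refl_group_orthogonal[OF s(2)]
            refl_group_orthogonal[OF \<tau>'])
      then show ?thesis by (simp only: refl_group_inv_comp(1)[OF s(2)] root_act_id)
    qed
    then have "?\<rho> = id" using pos_root by (intro id_if_pos refl_group_comp \<tau>' s(1)) auto
    then have "\<tau> \<circ> inv_into UNIV \<tau> \<circ> \<sigma> = \<tau>" by (simp add: comp_assoc)
    then show "\<sigma> = \<tau>" unfolding refl_group_inv_comp(2)[OF s(2)] by simp
  qed
  moreover have "(\<lambda>\<sigma>. restrict (root_act \<sigma>) \<Psi>) ` W \<subseteq> \<Psi> \<rightarrow>\<^sub>E \<Psi>" using root_act_root by auto
  moreover have "finite (\<Psi> \<rightarrow>\<^sub>E \<Psi>)" using finite_roots by (intro finite_PiE) auto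
  ultimately show ?thesis by (meson finite_imageD finite_subset)
qed

lemma nonneg_root_act:
  assumes "\<sigma> \<in> W" "\<beta> \<in> pos" "\<And>\<omega>. \<omega> \<in> \<Omega> \<Longrightarrow> coord \<beta> \<omega> \<noteq> 0 \<Longrightarrow> root_act \<sigma> \<omega> \<in> pos"
  shows "root_act \<sigma> \<beta> \<in> pos"
proof -
  have sp: "\<beta> \<in> span \<Omega>" using assms pos_root root_in_span by auto
  have "root_act \<sigma> \<beta> = root_act \<sigma> (\<Sum>\<omega>\<in>\<Omega>. coord \<beta> \<omega> *\<^sub>R \<omega>)" by (simp add: sum_coord[OF sp])
  also have "\<dots> = (\<Sum>\<omega>\<in>\<Omega>. coord \<beta> \<omega> *\<^sub>R root_act \<sigma> \<omega>)"
    by (rule root_act_sum[OF refl_group_orthogonal[OF assms(1)]])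
  finally have eq: "root_act \<sigma> \<beta> = (\<Sum>\<omega>\<in>\<Omega>. coord \<beta> \<omega> *\<^sub>R root_act \<sigma> \<omega>)" .
  have "0 \<le> coord (root_act \<sigma> \<beta>) \<omega>'" if "\<omega>' \<in> \<Omega>" for \<omega>'
  proof -
    have s: "root_act \<sigma> \<omega> \<in> span \<Omega>" if "\<omega> \<in> \<Omega>" for \<omega>
      using that assms(1) root_act_root simple_root root_in_span by auto
    have "coord (\<Sum>\<omega>\<in>\<Omega>. coord \<beta> \<omega> *\<^sub>R root_act \<sigma> \<omega>) = (\<lambda>b. \<Sum>\<omega>\<in>\<Omega>. coord (coord \<beta> \<omega> *\<^sub>R root_act \<sigma> \<omega>) b)"
      by (rule real_vector.representation_sum[OF independent_simple]) (auto intro: span_scale s)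
    then have "coord (root_act \<sigma> \<beta>) \<omega>' = (\<Sum>\<omega>\<in>\<Omega>. coord (coord \<beta> \<omega> *\<^sub>R root_act \<sigma> \<omega>) \<omega>')" unfolding eq by simp
    also have "\<dots> = (\<Sum>\<omega>\<in>\<Omega>. coord \<beta> \<omega> * coord (root_act \<sigma> \<omega>) \<omega>')"
      by (intro sum.cong refl) (simp add: real_vector.representation_scale[OF independent_simple] s)
    also have "\<dots> \<ge> 0"
    proof (rule sum_nonneg)
      fix \<omega> assume "\<omega> \<in> \<Omega>"
      then show "0 \<le> coord \<beta> \<omega> * coord (root_act \<sigma> \<omega>) \<omega>'"
        using assms(2) assms(3)[of \<omega>] that by (cases "coord \<beta> \<omega> = 0") (auto simp: pos_iff pointwise)
    qed
    finally show ?thesis .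
  qed
  moreover have "root_act \<sigma> \<beta> \<in> \<Psi>" using assms root_act_root pos_root by auto
  ultimately show ?thesis by (simp add: pos_iff)
qed

text \<open>An element of maximal length makes every simple root negative, as otherwise
  \<open>card_invs_refl\<close> would give a longer one; then all positive roots are inverted by
  linearity. Counting inversions transfers this to whichever maximal element \<open>longest\<close>
  selects.\<close>

lemma longest_inverts:
  "longest \<Omega> W \<in> W" "len \<Omega> (longest \<Omega> W) = card pos"
  "\<And>\<beta>. \<beta> \<in> pos \<Longrightarrow> root_act (longest \<Omega> W) \<beta> \<notin> pos"
proof -
  have "Max (len \<Omega> ` W) \<in> len \<Omega> ` W" using finite_W refl_group_id by (intro Max_in) auto
  then obtain \<sigma> where \<sigma>: "\<sigma> \<in> W" "len \<Omega> \<sigma> = Max (len \<Omega> ` W)" by auto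
  then have max: "len \<Omega> \<tau> \<le> len \<Omega> \<sigma>" if "\<tau> \<in> W" for \<tau> using that finite_W by simp
  note o = refl_group_orthogonal[OF \<sigma>(1)]
  have neg: "root_act \<sigma> \<alpha> \<notin> pos" if "\<alpha> \<in> \<Omega>" for \<alpha>
  proof
    assume "root_act \<sigma> \<alpha> \<in> pos"
    then have "card (invs (\<sigma> \<circ> refl \<alpha>)) = Suc (card (invs \<sigma>))" using card_invs_refl[OF \<sigma>(1) that] by simp
    moreover have *: "\<sigma> \<circ> refl \<alpha> \<in> W" using \<sigma> that simple_root by (intro refl_group_comp refl_group_refl) auto
    ultimately show False using max[OF *] len_eq[OF *] len_eq[OF \<sigma>(1)] by simp
  qed
  have inv: "root_act \<sigma> \<beta> \<notin> pos" if b: "\<beta> \<in> pos" for \<beta>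
  proof -
    have sp: "\<beta> \<in> span \<Omega>" using b pos_root root_in_span by auto
    have "- root_act \<sigma> \<beta> = - root_act \<sigma> (\<Sum>\<omega>\<in>\<Omega>. coord \<beta> \<omega> *\<^sub>R \<omega>)" by (simp add: sum_coord[OF sp])
    also have "\<dots> = (\<Sum>\<omega>\<in>\<Omega>. coord \<beta> \<omega> *\<^sub>R (- root_act \<sigma> \<omega>))"
      unfolding root_act_sum[OF o] by (simp add: sum_negf)
    finally have eq: "- root_act \<sigma> \<beta> = (\<Sum>\<omega>\<in>\<Omega>. coord \<beta> \<omega> *\<^sub>R (- root_act \<sigma> \<omega>))" .
    have m: "- root_act \<sigma> \<omega> \<in> pos" if "\<omega> \<in> \<Omega>" for \<omega>
      using neg[OF that] not_pos_iff[of "root_act \<sigma> \<omega>"] root_act_root[OF \<sigma>(1)] simple_root that by auto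
    have s: "- root_act \<sigma> \<omega> \<in> span \<Omega>" if "\<omega> \<in> \<Omega>" for \<omega>
      using m[OF that] pos_root root_in_span by auto
    have "0 \<le> coord (- root_act \<sigma> \<beta>) \<omega>'" if "\<omega>' \<in> \<Omega>" for \<omega>'
    proof -
      have "coord (\<Sum>\<omega>\<in>\<Omega>. coord \<beta> \<omega> *\<^sub>R (- root_act \<sigma> \<omega>)) = (\<lambda>b. \<Sum>\<omega>\<in>\<Omega>. coord (coord \<beta> \<omega> *\<^sub>R (- root_act \<sigma> \<omega>)) b)"
        by (rule real_vector.representation_sum[OF independent_simple]) (intro span_scale s)
      then have "coord (- root_act \<sigma> \<beta>) \<omega>' = (\<Sum>\<omega>\<in>\<Omega>. coord (coord \<beta> \<omega> *\<^sub>R (- root_act \<sigma> \<omega>)) \<omega>')" unfolding eq by (rule fun_cong)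
      also have "\<dots> = (\<Sum>\<omega>\<in>\<Omega>. coord \<beta> \<omega> * coord (- root_act \<sigma> \<omega>) \<omega>')"
        by (intro sum.cong refl) (rule real_vector.representation_scale[OF independent_simple s, THEN fun_cong])
      also have "\<dots> \<ge> 0"
      proof (rule sum_nonneg)
        fix \<omega> assume "\<omega> \<in> \<Omega>"
        then show "0 \<le> coord \<beta> \<omega> * coord (- root_act \<sigma> \<omega>) \<omega>'"
          using b m[of \<omega>] that by (auto simp: pos_iff)
      qed
      finally show ?thesis .
    qed
    moreover have r: "root_act \<sigma> \<beta> \<in> \<Psi>" using b \<sigma> root_act_root pos_root by auto
    ultimately have "- root_act \<sigma> \<beta> \<in> pos" using minus_root by (auto simp: pos_iff)
    then show ?thesis using not_pos_iff[OF r] by simp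
  qed
  have "invs \<sigma> = pos" using inv by (auto simp: invs_def)
  then have l: "len \<Omega> \<sigma> = card pos" using len_eq[OF \<sigma>(1)] by simp
  note lw = arg_max_len[OF finite_W \<sigma>(1) max]
  show "longest \<Omega> W \<in> W" "len \<Omega> (longest \<Omega> W) = card pos" using lw l by auto
  then have "invs (longest \<Omega> W) = pos"
    using len_eq[of "longest \<Omega> W"] finite_pos by (intro card_subset_eq) (auto simp: invs_def)
  then show "\<And>\<beta>. \<beta> \<in> pos \<Longrightarrow> root_act (longest \<Omega> W) \<beta> \<notin> pos" by (auto simp: invs_def)
qed

text \<open>Composing with the longest element reverses the sign of every image of a root, so
  inversions and positive roots that are not inversions trade places.\<close>

lemma len_longest_comp:
  assumes "\<sigma> \<in> W" shows "len \<Omega> (longest \<Omega> W \<circ> \<sigma>) + len \<Omega> \<sigma> = card pos"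
proof -
  let ?w = "longest \<Omega> W"
  have c: "?w \<circ> \<sigma> \<in> W" using longest_inverts(1) assms by (rule refl_group_comp)
  have ra: "root_act (?w \<circ> \<sigma>) \<beta> = root_act ?w (root_act \<sigma> \<beta>)" for \<beta>
    by (rule root_act_comp) (intro refl_group_orthogonal[OF longest_inverts(1)] refl_group_orthogonal[OF assms])+
  have "invs (?w \<circ> \<sigma>) = pos - invs \<sigma>"
  proof -
    have "root_act ?w \<gamma> \<in> pos" if "\<gamma> \<in> \<Psi>" "\<gamma> \<notin> pos" for \<gamma>
    proof -
      have "root_act ?w (- \<gamma>) \<notin> pos" using that not_pos_iff longest_inverts(3) by auto
      then show ?thesis using not_pos_iff[of "root_act ?w \<gamma>"] root_act_root[OF longest_inverts(1) that(1)]
        by (simp add: root_act_minus[OF refl_group_orthogonal[OF longest_inverts(1)]])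
    qed
    then show ?thesis
      using longest_inverts(3) root_act_root[OF assms pos_root] by (auto simp: invs_def ra)
  qed
  moreover have "card (pos - invs \<sigma>) + card (invs \<sigma>) = card pos"
    using finite_pos card_mono[of pos "invs \<sigma>"] by (subst card_Diff_subset) (auto simp: finite_invs invs_def)
  ultimately show ?thesis by (simp add: len_eq[OF c] len_eq[OF assms])
qed

lemma len_inv: assumes "\<sigma> \<in> W" shows "len \<Omega> (inv_into UNIV \<sigma>) = len \<Omega> \<sigma>"
proof -
  have le: "len \<Omega> (inv_into UNIV \<sigma>) \<le> len \<Omega> \<sigma>" if p: "\<sigma> \<in> W" for \<sigma>
  proof -
    obtain as where as: "reduced_word \<Omega> \<sigma> as" using reduced_word_exists[OF p] by auto
    then have "inv_into UNIV \<sigma> = refl_word (rev as)" using inv_refl_word[of as] by (simp add: reduced_word_def)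
    moreover have "rev as \<in> lists \<Omega>" using as by (auto simp: reduced_word_def)
    ultimately show ?thesis using len_le[of "rev as"] as by (simp add: reduced_word_def)
  qed
  show ?thesis using le[OF assms] le[OF refl_group_inv[OF assms]] refl_group_inv_comp(3)[OF assms] by simp
qed

end


context simple_roots
begin

subsection \<open>Minimal coset representatives\<close>

abbreviation pos_at :: "complex ^ 'n \<Rightarrow> (real ^ 'n) set" where
  "pos_at v \<equiv> {\<beta> \<in> pos. bil v (cvec \<beta>) = 0}"

lemma root_act_minus_span:
  assumes "\<sigma> \<in> refl_group J" shows "root_act \<sigma> x - x \<in> span J"
  using assms
proof (induction rule: refl_group_induct)
  case id
  then show ?case by (simp add: root_act_id span_zero)
next
  case (step a \<sigma>)
  define y where "y = root_act \<sigma> x"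
  have "root_act (refl a \<circ> \<sigma>) x - x = (y - x) - (2 * inner y a / inner a a) *\<^sub>R a"
    unfolding y_def root_act_comp[OF real_orthogonal_refl refl_group_orthogonal[OF step(2)]] root_act_refl
    by (simp add: refl_real_def)
  also have "\<dots> \<in> span J"
    by (rule span_diff[OF step(3)[folded y_def] span_scale[OF span_base[OF step(1)]]])
  finally show ?case .
qed

text \<open>The reflection in \<beta> fixes v and thus lies in the group generated by J, whose
  elements move every vector by a combination of J. It moves \<beta> by -2 \<beta>.\<close>

lemma stabilizer_coords:
  assumes J: "J \<subseteq> \<Omega>" "stabilizer \<Psi> v = refl_group J" and \<beta>: "\<beta> \<in> \<Psi>" "bil v (cvec \<beta>) = 0"
  shows "\<beta> \<in> span J" "\<And>\<omega>. \<omega> \<in> \<Omega> - J \<Longrightarrow> coord \<beta> \<omega> = 0"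
proof -
  have "refl \<beta> \<in> stabilizer \<Psi> v"
    using \<beta> by (simp add: stabilizer_def refl_group_refl refl_fixes)
  then have "refl \<beta> \<in> refl_group J" using J by simp
  from root_act_minus_span[OF this, of \<beta>] have "(- (1/2)) *\<^sub>R (root_act (refl \<beta>) \<beta> - \<beta>) \<in> span J"
    by (rule span_scale)
  also have "(- (1/2)) *\<^sub>R (root_act (refl \<beta>) \<beta> - \<beta>) = \<beta>"
    unfolding root_act_refl refl_real_self[OF root_nonzero[OF \<beta>(1)]]
    by (simp add: Finite_Cartesian_Product.vec_eq_iff)
  finally show *: "\<beta> \<in> span J" .
  fix \<omega> assume "\<omega> \<in> \<Omega> - J"
  moreover have "coord \<beta> = representation J \<beta>"
    by (rule real_vector.representation_extend[OF independent_simple * J(1)])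
  ultimately show "coord \<beta> \<omega> = 0" using real_vector.representation_ne_zero[of J \<beta> \<omega>] by auto
qed

lemma stabilizer_simple: assumes "J \<subseteq> \<Omega>" "stabilizer \<Psi> v = refl_group J" "j \<in> J"
  shows "bil v (cvec j) = 0"
proof -
  have "refl j \<in> stabilizer \<Psi> v" using assms by (simp add: refl_group_refl)
  then have "refl j v = v" by (simp add: stabilizer_def)
  moreover have "j \<noteq> 0" using assms simple_root root_nonzero by auto
  ultimately show ?thesis by (simp add: refl_fixes_iff)
qed

text \<open>A minimal representative keeps the roots in J positive, hence also all positive roots
  that vanish at v, so its inversions lie among the other positive roots. This upper bound is
  attained in the coset of the longest element.\<close>

lemma len_longest_min_coset_reps:
  assumes "standard \<Psi> \<Omega> v"
  shows "len \<Omega> (longest \<Omega> (min_coset_reps \<Psi> \<Omega> v)) + card (pos_at v) = card pos"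
proof -
  obtain J where J: "J \<subseteq> \<Omega>" "stabilizer \<Psi> v = refl_group J" using assms unfolding standard_def by auto
  let ?X = "min_coset_reps \<Psi> \<Omega> v"
  have XW: "?X \<subseteq> W" by (auto simp: min_coset_reps_def)
  have stabW: "stabilizer \<Psi> v \<subseteq> W" by (auto simp: stabilizer_def)
  have upper: "invs \<sigma> \<subseteq> pos - pos_at v" if \<sigma>: "\<sigma> \<in> ?X" for \<sigma>
  proof -
    have \<sigma>W: "\<sigma> \<in> W" using \<sigma> XW by auto
    have j: "root_act \<sigma> j \<in> pos" if "j \<in> J" for j
    proof (rule ccontr)
      assume n: "root_act \<sigma> j \<notin> pos"
      have "refl j \<in> stabilizer \<Psi> v" using J that by (simp add: refl_group_refl)
      then have l: "len \<Omega> \<sigma> \<le> len \<Omega> (\<sigma> \<circ> refl j)" and c: "\<sigma> \<circ> refl j \<in> W"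
        using \<sigma> \<sigma>W stabW by (auto simp: min_coset_reps_def intro: refl_group_comp)
      have "j \<in> \<Omega>" using that J by auto
      from card_invs_refl_neg[OF \<sigma>W this n] show False
        using l len_eq[OF \<sigma>W] len_eq[OF c] by simp
    qed
    have "root_act \<sigma> \<beta> \<in> pos" if "\<beta> \<in> pos_at v" for \<beta>
    proof (rule nonneg_root_act[OF \<sigma>W])
      show "\<beta> \<in> pos" using that by auto
      fix \<omega> assume "\<omega> \<in> \<Omega>" "coord \<beta> \<omega> \<noteq> 0"
      then show "root_act \<sigma> \<omega> \<in> pos"
        using stabilizer_coords(2)[OF J, of \<beta> \<omega>] that pos_root j by auto
    qed
    then show ?thesis by (auto simp: invs_def)
  qed
  \<comment> \<open>A shortest element in the coset of \<open>?w\<close> is a minimal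
    representative; it is shown to invert every positive root that does not vanish at v.\<close>
  let ?w = "longest \<Omega> W"
  let ?C = "(\<lambda>\<tau>. ?w \<circ> \<tau>) ` stabilizer \<Psi> v"
  have "finite (stabilizer \<Psi> v)" using finite_W stabW finite_subset by auto
  moreover have "id \<in> stabilizer \<Psi> v" using J refl_group_id by auto
  ultimately have "Min (len \<Omega> ` ?C) \<in> len \<Omega> ` ?C" by (intro Min_in) auto
  then obtain \<tau> where \<tau>: "\<tau> \<in> stabilizer \<Psi> v" "len \<Omega> (?w \<circ> \<tau>) = Min (len \<Omega> ` ?C)" by auto
  have min: "len \<Omega> (?w \<circ> \<tau>) \<le> len \<Omega> (?w \<circ> \<tau>')" if "\<tau>' \<in> stabilizer \<Psi> v" for \<tau>'
    using \<tau>(2) that \<open>finite (stabilizer \<Psi> v)\<close> by simp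
  have \<tau>W: "\<tau> \<in> W" using \<tau> stabW by auto
  have "?w \<circ> \<tau> \<in> ?X"
    unfolding min_coset_reps_def
  proof (intro CollectI conjI ballI)
    show "?w \<circ> \<tau> \<in> W" by (intro refl_group_comp longest_inverts(1) \<tau>W)
    fix \<tau>' assume "\<tau>' \<in> stabilizer \<Psi> v"
    then have "\<tau> \<circ> \<tau>' \<in> stabilizer \<Psi> v" using \<tau>(1) unfolding J(2) by (intro refl_group_comp)
    from min[OF this] show "len \<Omega> (?w \<circ> \<tau>) \<le> len \<Omega> (?w \<circ> \<tau> \<circ> \<tau>')" by (simp only: comp_assoc)
  qed
  moreover have "invs (?w \<circ> \<tau>) = pos - pos_at v"
  proof
    show "invs (?w \<circ> \<tau>) \<subseteq> pos - pos_at v" by (rule upper) fact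
    show "pos - pos_at v \<subseteq> invs (?w \<circ> \<tau>)"
    proof
      fix \<beta> assume \<beta>: "\<beta> \<in> pos - pos_at v"
      \<comment> \<open>The stabilizer keeps this set of roots: a reflection in J fixes v and turns
        only its own root negative, which vanishes at v.\<close>
      have "\<sigma> \<in> refl_group J \<Longrightarrow> root_act \<sigma> \<beta> \<in> pos - pos_at v" for \<sigma>
      proof (induction rule: refl_group_induct)
        case id
        then show ?case using \<beta> by (simp only: root_act_id)
      next
        case (step a \<sigma>)
        let ?\<gamma> = "root_act \<sigma> \<beta>"
        have a: "refl a v = v" using stabilizer_simple[OF J step(1)] by (rule refl_fixes)
        have "?\<gamma> \<noteq> a" using step(3) stabilizer_simple[OF J step(1)] by auto
        then have "refl_real a ?\<gamma> \<in> pos" using step J simple_refl_pos by auto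
        moreover have "bil v (cvec (refl_real a ?\<gamma>)) = bil (refl a v) (cvec ?\<gamma>)"
          by (simp add: refl_cvec[symmetric] bil_refl_left)
        ultimately have "refl_real a ?\<gamma> \<in> pos - pos_at v" using a step(3) by auto
        then show ?case
          by (simp only: root_act_comp[OF real_orthogonal_refl refl_group_orthogonal[OF step(2)]] root_act_refl)
      qed
      then have "root_act \<tau> \<beta> \<in> pos" using \<tau> J by auto
      then have "root_act ?w (root_act \<tau> \<beta>) \<notin> pos" by (rule longest_inverts(3))
      then show "\<beta> \<in> invs (?w \<circ> \<tau>)" using \<beta>
        by (simp add: invs_def root_act_comp[OF refl_group_orthogonal[OF longest_inverts(1)] refl_group_orthogonal[OF \<tau>W]])
    qed
  qed
  moreover have l: "len \<Omega> \<sigma> \<le> card (pos - pos_at v)" if "\<sigma> \<in> ?X" for \<sigma>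
    unfolding len_eq[OF subsetD[OF XW that]] by (intro card_mono upper that finite_Diff finite_pos)
  moreover have "?w \<circ> \<tau> \<in> W" by (intro refl_group_comp longest_inverts(1) \<tau>W)
  ultimately have "len \<Omega> (longest \<Omega> ?X) = card (pos - pos_at v)"
    using arg_max_len(2)[of ?X "?w \<circ> \<tau>" \<Omega>] finite_subset[OF XW finite_W] by (simp add: len_eq)
  moreover have "card (pos - pos_at v) + card (pos_at v) = card pos"
    using finite_pos card_mono[of pos "pos_at v"] by (subst card_Diff_subset) auto
  ultimately show ?thesis by simp
qed

subsection \<open>Alternating polynomials\<close>

definition disc :: "complex ^ 'n \<Rightarrow> complex" where
  "disc = (\<Prod>\<alpha>\<in>pos. linform (cvec \<alpha>))"

abbreviation m :: nat where "m \<equiv> card pos"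

lemma Lams_disc: "disc \<in> Lams {m}"
  unfolding disc_def by (intro Lams_prod finite_pos Lams_linform) simp

lemma Lam_disc: "disc \<in> Lam"
  by (rule Lams_Lam[OF Lams_disc])

lemma disc_nonzero: "disc \<noteq> 0"
proof -
  have "finite Q \<Longrightarrow> Q \<subseteq> pos \<Longrightarrow> (\<Prod>\<alpha>\<in>Q. linform (cvec \<alpha>)) \<noteq> (0 :: complex ^ 'n \<Rightarrow> complex)" for Q
  proof (induction Q rule: finite_induct)
    case empty
    then show ?case by (auto simp: pointwise)
  next
    case (insert a Q)
    have "(\<Prod>\<alpha>\<in>Q. linform (cvec \<alpha>)) \<in> Lam" by (intro Lam_prod Lam_linform)
    moreover have "a \<noteq> 0" using insert pos_root root_nonzero by auto
    moreover have "(\<Prod>\<alpha>\<in>Q. linform (cvec \<alpha>)) \<noteq> (0 :: complex ^ 'n \<Rightarrow> complex)" using insert by simp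
    ultimately have "linform (cvec a) * (\<Prod>\<alpha>\<in>Q. linform (cvec \<alpha>)) \<noteq> 0" using linform_cancel by blast
    then show ?case unfolding prod.insert[OF insert(1,2)] .
  qed
  from this[OF finite_pos subset_refl] show ?thesis unfolding disc_def .
qed

lemma simple_refl_bij:
  assumes "\<alpha> \<in> \<Omega>" shows "bij_betw (refl_real \<alpha>) (pos - {\<alpha>}) (pos - {\<alpha>})"
proof -
  have \<alpha>: "\<alpha> \<in> pos" "\<alpha> \<noteq> 0" using assms simple_pos simple_root root_nonzero by auto
  show ?thesis
  proof (rule bij_betw_byWitness[of _ "refl_real \<alpha>"])
    have "refl_real \<alpha> \<beta> \<in> pos - {\<alpha>}" if "\<beta> \<in> pos - {\<alpha>}" for \<beta>
    proof -
      have "refl_real \<alpha> \<beta> \<noteq> \<alpha>"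
      proof
        assume "refl_real \<alpha> \<beta> = \<alpha>"
        then have "\<beta> = - \<alpha>" using refl_real_refl_real[of \<alpha> \<beta>] refl_real_self[OF \<alpha>(2)] by simp
        then show False using that not_pos_iff[of \<alpha>] assms \<alpha>(1) simple_root by auto
      qed
      then show ?thesis using simple_refl_pos[OF assms] that by auto
    qed
    then show "refl_real \<alpha> ` (pos - {\<alpha>}) \<subseteq> pos - {\<alpha>}" "refl_real \<alpha> ` (pos - {\<alpha>}) \<subseteq> pos - {\<alpha>}" by auto
  qed (auto simp: refl_real_refl_real)
qed

lemma act_simple_disc: assumes "\<alpha> \<in> \<Omega>" shows "act (refl \<alpha>) disc = - disc"
proof -
  have \<alpha>: "\<alpha> \<in> pos" "\<alpha> \<noteq> 0" using assms simple_pos simple_root root_nonzero by auto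
  let ?P = "\<Prod>\<beta>\<in>pos - {\<alpha>}. linform (cvec \<beta>)"
  have d: "disc = linform (cvec \<alpha>) * ?P"
    unfolding disc_def by (rule prod.remove[OF finite_pos \<alpha>(1)])
  have "act (refl \<alpha>) ?P = (\<Prod>\<beta>\<in>pos - {\<alpha>}. linform (cvec (refl_real \<alpha> \<beta>)))"
    unfolding act_prod act_linform[OF real_orthogonal_refl] refl_cvec ..
  also have "\<dots> = ?P"
    by (rule prod.reindex_bij_betw[OF simple_refl_bij[OF assms]])
  finally have "act (refl \<alpha>) disc = linform (- cvec \<alpha>) * ?P"
    unfolding d act_mult act_linform[OF real_orthogonal_refl] refl_self[OF \<alpha>(2)] by simp
  then show ?thesis unfolding d by (simp add: pointwise linform_def bil_simps)
qed

lemma act_word_disc: "as \<in> lists \<Omega> \<Longrightarrow> act (refl_word as) disc = (\<lambda>x. (-1) ^ length as * disc x)"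
proof (induction as rule: list.induct)
  case Nil
  then show ?case by (simp add: refl_word_Nil act_id)
next
  case (Cons a as)
  have as: "as \<in> lists \<Omega>" using Cons.prems by auto
  have "act (refl_word (a # as)) disc = act (refl a) (act (refl_word as) disc)"
    unfolding refl_word_Cons by (intro act_comp real_orthogonal_bij real_orthogonal_refl real_orthogonal_refl_word)
  also have "\<dots> = (\<lambda>x. (-1) ^ length as * act (refl a) disc x)"
    unfolding Cons.IH[OF as] by (rule act_scale)
  also have "act (refl a) disc = - disc" using Cons.prems by (intro act_simple_disc) auto
  finally show ?case by (simp add: pointwise)
qed

section \<open>The sign character and antisymmetrization\<close>

definition sgn_of :: "(complex ^ 'n \<Rightarrow> complex ^ 'n) \<Rightarrow> complex" where
  "sgn_of \<sigma> = (-1) ^ len \<Omega> \<sigma>"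

lemma act_disc: assumes "\<sigma> \<in> W" shows "act \<sigma> disc = (\<lambda>x. sgn_of \<sigma> * disc x)"
proof -
  obtain as where "reduced_word \<Omega> \<sigma> as" using reduced_word_exists[OF assms] by auto
  then show ?thesis using act_word_disc[of as] by (auto simp: reduced_word_def sgn_of_def)
qed

lemma sgn_of_square: "sgn_of \<sigma> * sgn_of \<sigma> = 1"
  unfolding sgn_of_def power_mult_distrib[symmetric] by (simp add: pointwise)

lemma sgn_of_nonzero: "sgn_of \<sigma> \<noteq> 0"
  by (simp add: sgn_of_def)

lemma scale_disc_cancel: assumes "(\<lambda>x. c * disc x) = (\<lambda>x. d * disc x)" shows "c = d"
proof -
  obtain x where "disc x \<noteq> 0" using disc_nonzero by (auto simp: pointwise)
  then show ?thesis using fun_cong[OF assms, of x] by simp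
qed

text \<open>The sign is read off from the action on \<open>disc\<close>, which is a nonzero
  polynomial; this turns a statement about lengths into the law of a group action.\<close>

lemma sgn_of_comp: assumes "\<sigma> \<in> W" "\<tau> \<in> W" shows "sgn_of (\<sigma> \<circ> \<tau>) = sgn_of \<sigma> * sgn_of \<tau>"
proof (rule scale_disc_cancel)
  have "(\<lambda>x. sgn_of (\<sigma> \<circ> \<tau>) * disc x) = act \<sigma> (act \<tau> disc)"
    unfolding act_disc[OF refl_group_comp[OF assms], symmetric] by (rule act_refl_group_comp[OF assms])
  then show "(\<lambda>x. sgn_of (\<sigma> \<circ> \<tau>) * disc x) = (\<lambda>x. sgn_of \<sigma> * sgn_of \<tau> * disc x)"
    unfolding act_disc[OF assms(2)] act_scale act_disc[OF assms(1)]
    by (simp only: mult.assoc mult.left_commute)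
qed

lemma sgn_of_refl: assumes "\<beta> \<in> \<Psi>" shows "sgn_of (refl \<beta>) = -1"
proof -
  have p: "sgn_of (refl \<beta>) = -1" if p: "\<beta> \<in> pos" for \<beta>
  proof -
    obtain as \<omega> where as: "as \<in> lists \<Omega>" "\<omega> \<in> \<Omega>" "root_act (refl_word as) \<omega> = \<beta>"
      using root_conj_simple[OF p] by auto
    then have "refl_word as (cvec \<omega>) = cvec \<beta>"
      using cvec_root_act[OF real_orthogonal_refl_word, of as \<omega>] by simp
    then have *: "refl_word as \<circ> refl \<omega> = refl \<beta> \<circ> refl_word as"
      by (rule refl_conj[OF real_orthogonal_refl_word])
    have W: "refl_word as \<in> W" "refl \<omega> \<in> W" "refl \<beta> \<in> W"
      using as refl_word_W simple_root p pos_root by (auto intro: refl_group_refl)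
    have "act (refl \<omega>) disc = (\<lambda>x. -1 * disc x)" using act_simple_disc[OF as(2)] by (simp add: pointwise)
    then have "sgn_of (refl \<omega>) = -1" unfolding act_disc[OF W(2)] by (rule scale_disc_cancel)
    moreover have "sgn_of (refl_word as) * sgn_of (refl \<omega>) = sgn_of (refl \<beta>) * sgn_of (refl_word as)"
      using * W by (simp only: sgn_of_comp[symmetric])
    ultimately have "sgn_of (refl \<beta>) * sgn_of (refl_word as) = (-1) * sgn_of (refl_word as)" by (simp add: pointwise)
    then show ?thesis by (rule mult_right_cancel[OF sgn_of_nonzero, THEN iffD1])
  qed
  show ?thesis using p[of \<beta>] p[of "- \<beta>"] not_pos_iff[OF assms] by (auto simp: refl_minus)
qed

text \<open>At a point of the hyperplane of \<beta> the reflection acts trivially, so f equals its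
  own negative there. With Q smaller than \<open>pos\<close> this serves the stabilizer of
  v.\<close>

lemma alternating_divisible:
  assumes "Q \<subseteq> pos" "f \<in> Lam" "\<And>\<beta>. \<beta> \<in> Q \<Longrightarrow> act (refl \<beta>) f = - f"
  shows "\<exists>g\<in>Lam. f = (\<Prod>\<beta>\<in>Q. linform (cvec \<beta>)) * g"
proof (rule linforms_divide[OF finite_subset[OF assms(1) finite_pos] _ _ assms(2)])
  show "0 \<notin> Q" using assms(1) pos_root zero_not_root by auto
  show "a = b" if "a \<in> Q" "b \<in> Q" "b = c *\<^sub>R a" for a b c
  proof -
    have p: "a \<in> pos" "b \<in> pos" using that(1,2) assms(1) by auto
    have "b = a \<or> b = - a" by (rule proportional_roots[OF pos_root[OF p(1)] pos_root[OF p(2)] that(3)])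
    then show ?thesis using p not_pos_iff[OF pos_root[OF p(1)]] by auto
  qed
  show "f x = 0" if "\<beta> \<in> Q" "bil x (cvec \<beta>) = 0" for \<beta> x
    using fun_cong[OF assms(3)[OF that(1)], of x] refl_fixes[OF that(2)] by (simp add: act_refl pointwise)
qed

text \<open>Antisymmetrization without normalizing factor, over the subgroup generated by R but with
  the sign of W. Reflections have sign -1 in either group.\<close>

definition alt :: "(real ^ 'n) set \<Rightarrow> (complex ^ 'n \<Rightarrow> complex) \<Rightarrow> complex ^ 'n \<Rightarrow> complex" where
  "alt R f = (\<Sum>\<sigma>\<in>refl_group R. (\<lambda>x. sgn_of \<sigma> * act \<sigma> f x))"

lemma Lams_alt: "f \<in> Lams A \<Longrightarrow> alt R f \<in> Lams A"
  unfolding alt_def by (intro Lams_sum Lams_scale Lams_act refl_group_orthogonal)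

lemma bij_refl_group_comp:
  assumes "\<tau> \<in> refl_group R" shows "bij_betw (\<lambda>\<sigma>. \<tau> \<circ> \<sigma>) (refl_group R) (refl_group R)"
proof (rule bij_betw_byWitness[of _ "\<lambda>\<sigma>. inv_into UNIV \<tau> \<circ> \<sigma>"])
  show "\<forall>\<sigma>\<in>refl_group R. inv_into UNIV \<tau> \<circ> (\<tau> \<circ> \<sigma>) = \<sigma>" "\<forall>\<sigma>\<in>refl_group R. \<tau> \<circ> (inv_into UNIV \<tau> \<circ> \<sigma>) = \<sigma>"
    by (simp_all only: comp_assoc[symmetric] refl_group_inv_comp[OF assms] id_comp) auto
qed (auto intro: refl_group_comp assms refl_group_inv)

lemma act_alt:
  assumes R: "R \<subseteq> \<Psi>" and \<tau>: "\<tau> \<in> refl_group R" shows "act \<tau> (alt R f) = (\<lambda>x. sgn_of \<tau> * alt R f x)"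
proof
  fix x
  note RW = subsetD[OF refl_group_mono[OF R]]
  have "act \<tau> (alt R f) x = (\<Sum>\<sigma>\<in>refl_group R. sgn_of \<sigma> * act \<tau> (act \<sigma> f) x)"
    unfolding alt_def act_sum act_scale sum_pointwise ..
  also have "\<dots> = (\<Sum>\<sigma>\<in>refl_group R. sgn_of \<tau> * (sgn_of (\<tau> \<circ> \<sigma>) * act (\<tau> \<circ> \<sigma>) f x))"
  proof (rule sum.cong[OF refl])
    fix \<sigma> assume s: "\<sigma> \<in> refl_group R"
    show "sgn_of \<sigma> * act \<tau> (act \<sigma> f) x = sgn_of \<tau> * (sgn_of (\<tau> \<circ> \<sigma>) * act (\<tau> \<circ> \<sigma>) f x)"
      unfolding sgn_of_comp[OF RW[OF \<tau>] RW[OF s]] act_refl_group_comp[OF \<tau> s]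
      using sgn_of_square[of \<tau>] by (simp add: mult.assoc[symmetric])
  qed
  also have "\<dots> = (\<Sum>\<sigma>\<in>refl_group R. sgn_of \<tau> * (sgn_of \<sigma> * act \<sigma> f x))"
    by (rule sum.reindex_bij_betw[OF bij_refl_group_comp[OF \<tau>]])
  finally show "act \<tau> (alt R f) x = sgn_of \<tau> * alt R f x"
    unfolding alt_def sum_pointwise sum_distrib_left .
qed

lemma act_refl_alt: assumes "R \<subseteq> \<Psi>" "\<beta> \<in> R" shows "act (refl \<beta>) (alt R f) = - alt R f"
  unfolding act_alt[OF assms(1) refl_group_refl[OF assms(2)]] sgn_of_refl[OF subsetD[OF assms]] by (simp add: pointwise)

lemma alt_divisible: assumes "f \<in> Lam" shows "\<exists>g\<in>Lam. alt \<Psi> f = disc * g"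
proof (rule alternating_divisible[OF subset_refl, folded disc_def])
  show "alt \<Psi> f \<in> Lam" using Lams_alt assms unfolding Lam_eq_Lams .
qed (intro act_refl_alt subset_refl pos_root)

lemma pair_act_disc:
  assumes "\<sigma> \<in> W" "f \<in> Lam" shows "theta_pair (act \<sigma> f) disc = sgn_of \<sigma> * theta_pair f disc"
proof -
  note o = refl_group_orthogonal[OF assms(1)]
  have "theta_pair f disc = theta_pair (act \<sigma> f) (act \<sigma> disc)" by (rule pair_act[OF o assms(2) Lam_disc, symmetric])
  also have "\<dots> = sgn_of \<sigma> * theta_pair (act \<sigma> f) disc"
    unfolding act_disc[OF assms(1)] by (rule pair_scale_right[OF Lam_act[OF o assms(2)] Lam_disc])
  finally have "sgn_of \<sigma> * theta_pair f disc = (sgn_of \<sigma> * sgn_of \<sigma>) * theta_pair (act \<sigma> f) disc" by simp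
  then show ?thesis by (simp add: sgn_of_square)
qed

text \<open>The pairing is invariant and \<open>disc\<close> is antisymmetric, so every summand
  pairs with \<open>disc\<close> like f does. Hence f may be replaced by its antisymmetrization
  whenever it is paired with \<open>disc\<close>.\<close>

lemma pair_alt:
  assumes "R \<subseteq> \<Psi>" "f \<in> Lam" shows "theta_pair (alt R f) disc = of_nat (card (refl_group R)) * theta_pair f disc"
proof -
  note o = refl_group_orthogonal
  have "theta_pair (alt R f) disc = (\<Sum>\<sigma>\<in>refl_group R. theta_pair (\<lambda>x. sgn_of \<sigma> * act \<sigma> f x) disc)"
    unfolding alt_def by (intro pair_sum_left Lam_scale Lam_act o assms Lam_disc)
  also have "\<dots> = (\<Sum>\<sigma>\<in>refl_group R. theta_pair f disc)"
  proof (rule sum.cong[OF refl])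
    fix \<sigma> assume s: "\<sigma> \<in> refl_group R"
    then have sW: "\<sigma> \<in> W" using refl_group_mono[OF assms(1)] by auto
    have "theta_pair (\<lambda>x. sgn_of \<sigma> * act \<sigma> f x) disc = sgn_of \<sigma> * (sgn_of \<sigma> * theta_pair f disc)"
      unfolding pair_scale_left[OF Lam_act[OF o[OF s] assms(2)] Lam_disc] pair_act_disc[OF sW assms(2)] ..
    then show "theta_pair (\<lambda>x. sgn_of \<sigma> * act \<sigma> f x) disc = theta_pair f disc"
      by (simp only: mult.assoc[symmetric] sgn_of_square mult_1_left)
  qed
  finally show ?thesis by simp
qed

lemma split_const: assumes "h \<in> Lam"
  obtains h1 where "h1 \<in> Lams {1..}" "h = (\<lambda>x. h 0) + h1"
proof
  show "h - (\<lambda>x. h 0) \<in> Lams {1..}"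
    using assms by (intro Lams_vanishing_at_0 Lam_diff Lam_const) (simp_all add: pointwise)
qed simp

text \<open>Only the constant term of h keeps the product in degree m; everything else is orthogonal
  to \<open>disc\<close>.\<close>

lemma pair_disc_mult: assumes "h \<in> Lam" shows "theta_pair (disc * h) disc = h 0 * theta_pair disc disc"
proof -
  obtain h1 where h1: "h1 \<in> Lams {1..}" "h = (\<lambda>x. h 0) + h1" using split_const[OF assms] .
  have "disc * h = (\<lambda>x. h 0 * disc x) + disc * h1"
    by (subst h1(2)) (simp add: pointwise algebra_simps)
  then have "theta_pair (disc * h) disc = theta_pair (\<lambda>x. h 0 * disc x) disc + theta_pair (disc * h1) disc"
    using Lam_disc Lams_Lam[OF h1(1)] by (simp only: pair_add_left Lam_scale Lam_mult)
  moreover have "disc * h1 \<in> Lams {Suc m..}"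
    by (rule Lams_mult[OF Lams_disc h1(1)]) auto
  then have "theta_pair (disc * h1) disc = 0" by (rule pair_orthogonal[OF _ Lams_disc]) auto
  ultimately show ?thesis using pair_scale_left[OF Lam_disc Lam_disc] by simp
qed

text \<open>Antisymmetrization makes every g a multiple of \<open>disc\<close> as far as pairing
  with \<open>disc\<close> is concerned. If \<open>disc\<close> were isotropic, it would be
  orthogonal to all polynomials, against nondegeneracy.\<close>

lemma pair_disc_disc_nonzero: "theta_pair disc disc \<noteq> 0"
proof
  assume z: "theta_pair disc disc = 0"
  have "disc = 0"
  proof (rule pair_nondegenerate[OF Lam_disc])
    fix g :: "complex ^ 'n \<Rightarrow> complex" assume g: "g \<in> Lam"
    obtain h where h: "h \<in> Lam" "alt \<Psi> g = disc * h" using alt_divisible[OF g] by auto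
    have "of_nat (card W) * theta_pair g disc = 0"
      using pair_alt[OF subset_refl g] pair_disc_mult[OF h(1)] z unfolding h(2) by simp
    then show "theta_pair g disc = 0" using finite_W refl_group_id by auto
  qed
  then show False using disc_nonzero by simp
qed


end


section \<open>Divided differences\<close>

text \<open>The definite description in \<open>divdiff\<close> calls for uniqueness, which is
  cancellation of a linear form; existence is \<open>Lams_divide\<close>.\<close>

lemma divdiff_eqI:
  assumes "g \<in> Lam" "a \<noteq> 0" "linform (cvec a) * g = f - act (refl a) f"
  shows "divdiff a f = g"
  unfolding divdiff_def
proof (rule the_equality)
  show "g \<in> Lam \<and> linform (cvec a) * g = f - act (refl a) f" using assms by simp
  fix h assume h: "h \<in> Lam \<and> linform (cvec a) * h = f - act (refl a) f"
  have "linform (cvec a) * (h - g) = linform (cvec a) * h - linform (cvec a) * g"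
    by (simp add: pointwise right_diff_distrib)
  also have "\<dots> = 0" using h assms by simp
  finally have "h - g = 0" using h assms by (intro linform_cancel[OF Lam_diff]) auto
  then show "h = g" by simp
qed

lemma divdiff_exists:
  assumes "f \<in> Lams A" "a \<noteq> 0"
  shows "divdiff a f \<in> Lams (Suc -` A)" "linform (cvec a) * divdiff a f = f - act (refl a) f"
proof -
  obtain g where g: "g \<in> Lams (Suc -` A)"
    "f - (\<lambda>x. f (x - (2 / complex_of_real (inner a a) * bil x (cvec a)) *s cvec a)) = linform (cvec a) * g"
    using Lams_divide[OF assms(1)] by blast
  have "linform (cvec a) * g = f - act (refl a) f" unfolding g(2)[symmetric] act_refl refl_eq ..
  with Lams_Lam[OF g(1)] assms(2) have "divdiff a f = g" "linform (cvec a) * g = f - act (refl a) f"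
    by (auto intro: divdiff_eqI)
  then show "divdiff a f \<in> Lams (Suc -` A)" "linform (cvec a) * divdiff a f = f - act (refl a) f"
    using g(1) by auto
qed

lemma Lam_divdiff: assumes "f \<in> Lam" "a \<noteq> 0" shows "divdiff a f \<in> Lam"
  using divdiff_exists(1)[of f UNIV a] assms by (simp add: Lam_eq_Lams)

lemma divdiff_mult: assumes "f \<in> Lam" "a \<noteq> 0" shows "linform (cvec a) * divdiff a f = f - act (refl a) f"
  using divdiff_exists(2)[of f UNIV a] assms by (simp add: Lam_eq_Lams)

lemma divdiff_add:
  assumes "f \<in> Lam" "g \<in> Lam" "a \<noteq> 0" shows "divdiff a (f + g) = divdiff a f + divdiff a g"
proof (rule divdiff_eqI)
  show "linform (cvec a) * (divdiff a f + divdiff a g) = f + g - act (refl a) (f + g)"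
    unfolding distrib_left divdiff_mult[OF assms(1,3)] divdiff_mult[OF assms(2,3)] act_add
    by (rule add_diff_add[symmetric])
qed (use assms in \<open>auto intro: Lam_add Lam_divdiff\<close>)


lemma act_refl_divdiff:
  assumes "f \<in> Lam" "a \<noteq> 0" shows "act (refl a) (divdiff a f) = divdiff a f"
proof (rule divdiff_eqI[OF _ assms(2), symmetric])
  have aa: "act (refl a) (act (refl a) f) = f" by (simp add: act_refl refl_refl)
  have "act (refl a) (linform (cvec a) * divdiff a f) = act (refl a) f - f"
    unfolding divdiff_mult[OF assms] act_diff aa ..
  then show "linform (cvec a) * act (refl a) (divdiff a f) = f - act (refl a) f"
    unfolding act_mult act_linform[OF real_orthogonal_refl] refl_self[OF assms(2)]
    by (simp add: pointwise linform_def bil_simps minus_equation_iff)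
qed (intro Lam_act real_orthogonal_refl Lam_divdiff assms)

text \<open>Divided differences along an explicit word, so that what is proved applies to whichever
  reduced word \<open>divdiff_op\<close> selects.\<close>

definition divdiffs :: "(real ^ 'n) list \<Rightarrow> (complex ^ 'n \<Rightarrow> complex) \<Rightarrow> (complex ^ 'n \<Rightarrow> complex)" where
  "divdiffs as = foldr (\<lambda>a D. divdiff a \<circ> D) as id"

lemma divdiffs_Nil: "divdiffs [] f = f"
  and divdiffs_Cons: "divdiffs (a # as) f = divdiff a (divdiffs as f)"
  by (simp_all add: divdiffs_def id_apply o_apply)

lemma divdiffs_append: "divdiffs (as @ bs) f = divdiffs as (divdiffs bs f)"
  by (induction as) (simp_all add: divdiffs_Nil divdiffs_Cons)

lemma Lams_divdiffs:
  "0 \<notin> set as \<Longrightarrow> f \<in> Lams A \<Longrightarrow> divdiffs as f \<in> Lams ((\<lambda>k. length as + k) -` A)"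
proof (induction as)
  case (Cons a as)
  then have "divdiffs as f \<in> Lams ((\<lambda>k. length as + k) -` A)" "a \<noteq> 0" by auto
  from divdiff_exists(1)[OF this] show ?case by (simp add: divdiffs_Cons vimage_def)
qed (simp add: divdiffs_Nil vimage_def)

lemma Lam_divdiffs: "0 \<notin> set as \<Longrightarrow> f \<in> Lam \<Longrightarrow> divdiffs as f \<in> Lam"
  using Lams_divdiffs[of as f UNIV] by (simp add: Lam_eq_Lams)

lemma divdiffs_add:
  "0 \<notin> set as \<Longrightarrow> f \<in> Lam \<Longrightarrow> g \<in> Lam \<Longrightarrow> divdiffs as (f + g) = divdiffs as f + divdiffs as g"
proof (induction as)
  case (Cons a as)
  then have "divdiffs as (f + g) = divdiffs as f + divdiffs as g" "a \<noteq> 0" "divdiffs as f \<in> Lam" "divdiffs as g \<in> Lam"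
    by (auto intro: Lam_divdiffs)
  then show ?case unfolding divdiffs_Cons by (simp only:) (intro divdiff_add)
qed (simp add: divdiffs_Nil)


section \<open>The coinvariant ideal\<close>

lemma coinv_ideal_zero: "0 \<in> coinv_ideal \<Psi>"
  unfolding coinv_ideal_def by (intro CollectI exI[of _ "0 :: nat"]) auto

lemma coinv_ideal_mem:
  assumes "a \<in> Lam" "f \<in> invariants (refl_group \<Psi>)" "homogeneous d f" "d > 0"
  shows "a * f \<in> coinv_ideal \<Psi>"
  unfolding coinv_ideal_def
  by (intro CollectI exI[of _ "1 :: nat"] exI[of _ "\<lambda>_. a"] exI[of _ "\<lambda>_. f"]) (use assms in auto)

lemma coinv_ideal_add:
  assumes "f \<in> coinv_ideal \<Psi>" "g \<in> coinv_ideal \<Psi>" shows "f + g \<in> coinv_ideal \<Psi>"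
proof -
  obtain k :: nat and a p where f: "f = (\<Sum>i<k. a i * p i)" "\<forall>i<k. a i \<in> Lam \<and> p i \<in> invariants (refl_group \<Psi>) \<and> (\<exists>d>0. homogeneous d (p i))"
    using assms(1) unfolding coinv_ideal_def by blast
  obtain l :: nat and b q where g: "g = (\<Sum>i<l. b i * q i)" "\<forall>i<l. b i \<in> Lam \<and> q i \<in> invariants (refl_group \<Psi>) \<and> (\<exists>d>0. homogeneous d (q i))"
    using assms(2) unfolding coinv_ideal_def by blast
  let ?a = "\<lambda>i. if i < k then a i else b (i - k)"
  let ?p = "\<lambda>i. if i < k then p i else q (i - k)"
  have "(\<Sum>i<k + l. ?a i * ?p i) = (\<Sum>i<k. ?a i * ?p i) + (\<Sum>i\<in>{k..<k + l}. ?a i * ?p i)"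
    unfolding lessThan_atLeast0 by (rule sum.atLeastLessThan_concat[symmetric]) auto
  also have "(\<Sum>i\<in>{k..<k + l}. ?a i * ?p i) = (\<Sum>i<l. ?a (i + k) * ?p (i + k))"
    unfolding lessThan_atLeast0 using sum.shift_bounds_nat_ivl[of "\<lambda>i. ?a i * ?p i" 0 k l] by (simp add: add.commute)
  also have "\<dots> = g" unfolding g(1) by (rule sum.cong) auto
  also have "(\<Sum>i<k. ?a i * ?p i) = f" unfolding f(1) by (rule sum.cong) auto
  finally have "f + g = (\<Sum>i<k + l. ?a i * ?p i)" by simp
  moreover have "\<forall>i<k + l. ?a i \<in> Lam \<and> ?p i \<in> invariants (refl_group \<Psi>) \<and> (\<exists>d>0. homogeneous d (?p i))"
    using f(2) g(2) by auto
  ultimately show ?thesis unfolding coinv_ideal_def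
    by (intro CollectI exI[of _ "k + l"] exI[of _ ?a] exI[of _ ?p] conjI)
qed

lemma coinv_ideal_induct [consumes 1, case_names zero mem add]:
  assumes "f \<in> coinv_ideal \<Psi>" and "P 0"
    and "\<And>a f d. a \<in> Lam \<Longrightarrow> f \<in> invariants (refl_group \<Psi>) \<Longrightarrow> homogeneous d f \<Longrightarrow> d > 0 \<Longrightarrow> P (a * f)"
    and "\<And>f g. f \<in> coinv_ideal \<Psi> \<Longrightarrow> g \<in> coinv_ideal \<Psi> \<Longrightarrow> P f \<Longrightarrow> P g \<Longrightarrow> P (f + g)"
  shows "P f"
proof -
  obtain k :: nat and a p where f: "f = (\<Sum>i<k. a i * p i)" "\<forall>i<k. a i \<in> Lam \<and> p i \<in> invariants (refl_group \<Psi>) \<and> (\<exists>d>0. homogeneous d (p i))"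
    using assms(1) unfolding coinv_ideal_def by blast
  have "l \<le> k \<Longrightarrow> (\<Sum>i<l. a i * p i) \<in> coinv_ideal \<Psi> \<and> P (\<Sum>i<l. a i * p i)" for l
  proof (induction l)
    case 0
    then show ?case using assms(2) coinv_ideal_zero by simp
  next
    case (Suc l)
    then obtain d where d: "a l \<in> Lam" "p l \<in> invariants (refl_group \<Psi>)" "d > 0" "homogeneous d (p l)"
      using f(2) by (meson Suc_le_lessD)
    have "a l * p l \<in> coinv_ideal \<Psi>" "P (a l * p l)"
      using d by (auto intro: coinv_ideal_mem assms(3))
    then show ?case using Suc unfolding sum.lessThan_Suc by (auto intro: coinv_ideal_add assms(4))
  qed
  then show ?thesis using f(1) by auto
qed


lemma coinv_ideal_mult: "f \<in> coinv_ideal \<Psi> \<Longrightarrow> b \<in> Lam \<Longrightarrow> b * f \<in> coinv_ideal \<Psi>"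
proof (induction rule: coinv_ideal_induct)
  case zero
  have "b * 0 = 0" by (simp add: pointwise)
  then show ?case by (simp only: coinv_ideal_zero)
next
  case (mem a f d)
  then show ?case unfolding mult.assoc[symmetric] by (intro coinv_ideal_mem[of _ _ _ d] Lam_mult)
next
  case (add f g)
  then show ?case unfolding distrib_left by (intro coinv_ideal_add)
qed

lemma coinv_ideal_act: "f \<in> coinv_ideal \<Psi> \<Longrightarrow> \<sigma> \<in> refl_group \<Psi> \<Longrightarrow> act \<sigma> f \<in> coinv_ideal \<Psi>"
proof (induction rule: coinv_ideal_induct)
  case zero
  then show ?case by (simp only: act_zero coinv_ideal_zero)
next
  case (mem a f d)
  then have "act \<sigma> f = f" by (auto simp: invariants_def)
  then show ?case unfolding act_mult using mem
    by (simp only:) (intro coinv_ideal_mem[of _ _ _ d] Lam_act refl_group_orthogonal)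
next
  case (add f g)
  then show ?case unfolding act_add by (intro coinv_ideal_add)
qed

section \<open>The radical of the pairing with the product of the positive roots\<close>

context simple_roots
begin

text \<open>Divided differences are invariant under their reflection, and so is the difference of
  the two products, because the terms with the linear form as a factor cancel. Since
  \<open>disc\<close> changes sign, an invariant polynomial pairs to 0 with it.\<close>

lemma divdiff_self_adjoint:
  assumes "a \<in> \<Psi>" "f \<in> Lam" "g \<in> Lam"
  shows "theta_pair (divdiff a f * g) disc = theta_pair (f * divdiff a g) disc"
proof -
  have a: "a \<noteq> 0" using assms(1) root_nonzero by auto
  let ?s = "act (refl a)"
  let ?u = "divdiff a f * g - f * divdiff a g"
  note L = Lam_divdiff[OF assms(2) a] Lam_divdiff[OF assms(3) a]
  have u: "?u \<in> Lam" using L assms by (intro Lam_diff Lam_mult)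
  have sf: "?s f x = f x - linform (cvec a) x * divdiff a f x" for x
    using fun_cong[OF divdiff_mult[OF assms(2) a], of x] by (simp add: pointwise)
  have sg: "?s g x = g x - linform (cvec a) x * divdiff a g x" for x
    using fun_cong[OF divdiff_mult[OF assms(3) a], of x] by (simp add: pointwise)
  have "?s ?u = divdiff a f * ?s g - ?s f * divdiff a g"
    unfolding act_diff act_mult act_refl_divdiff[OF assms(2) a] act_refl_divdiff[OF assms(3) a] ..
  also have "\<dots> = ?u"
    unfolding pointwise sf sg right_diff_distrib left_diff_distrib by (simp add: mult_ac pointwise)
  finally have "theta_pair ?u disc = sgn_of (refl a) * theta_pair ?u disc"
    using pair_act_disc[OF refl_group_refl[OF assms(1)] u] by simp
  then have "theta_pair ?u disc = 0" by (simp add: sgn_of_refl[OF assms(1)] pointwise)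
  then show ?thesis using pair_diff_left[OF Lam_mult[OF L(1) assms(3)] Lam_mult[OF assms(2) L(2)] Lam_disc] by simp
qed

lemma not_0_set: "as \<in> lists \<Omega> \<Longrightarrow> 0 \<notin> set as"
  using simple_root zero_not_root by (auto simp: in_lists_conv_set)

lemma divdiffs_self_adjoint:
  assumes "as \<in> lists \<Omega>" "f \<in> Lam" "g \<in> Lam"
  shows "theta_pair (divdiffs as f * g) disc = theta_pair (f * divdiffs (rev as) g) disc"
  using assms
proof (induction as arbitrary: g rule: list.induct)
  case Nil
  then show ?case by (simp add: divdiffs_Nil)
next
  case (Cons a as)
  then have a: "a \<in> \<Psi>" "a \<noteq> 0" "as \<in> lists \<Omega>" using simple_root root_nonzero by auto
  have "theta_pair (divdiffs (a # as) f * g) disc = theta_pair (divdiffs as f * divdiff a g) disc"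
    unfolding divdiffs_Cons by (intro divdiff_self_adjoint a Lam_divdiffs not_0_set Cons.prems)
  also have "\<dots> = theta_pair (f * divdiffs (rev as) (divdiff a g)) disc"
    by (intro Cons.IH a Lam_divdiff Cons.prems)
  finally show ?case by (simp add: divdiffs_append divdiffs_Cons divdiffs_Nil)
qed

text \<open>Membership is a condition on pairings, which suits divided differences better than a
  representation by generators. It is identified with the coinvariant ideal in
  \<open>coinv_ideal_eq_Ann\<close>.\<close>

definition Ann :: "(complex ^ 'n \<Rightarrow> complex) set" where
  "Ann = {f \<in> Lam. \<forall>g\<in>Lam. theta_pair (f * g) disc = 0}"

lemma Ann_Lam: "f \<in> Ann \<Longrightarrow> f \<in> Lam"
  by (simp add: Ann_def)

lemma AnnI: "f \<in> Lam \<Longrightarrow> (\<And>g. g \<in> Lam \<Longrightarrow> theta_pair (f * g) disc = 0) \<Longrightarrow> f \<in> Ann"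
  by (simp add: Ann_def)

lemma AnnD: "f \<in> Ann \<Longrightarrow> g \<in> Lam \<Longrightarrow> theta_pair (f * g) disc = 0"
  by (simp add: Ann_def)

lemma Ann_add: "f \<in> Ann \<Longrightarrow> g \<in> Ann \<Longrightarrow> f + g \<in> Ann"
  by (rule AnnI) (simp_all only: Ann_Lam Lam_add Lam_mult distrib_right pair_add_left Lam_disc AnnD add_0_left)

text \<open>Only the component of the second factor in degree m - k can contribute to a pairing of h
  with \<open>disc\<close>, and against that component g stays below degree m. This allows induction
  on the degree by removing top components.\<close>

lemma Ann_component:
  assumes "f = g + h" "f \<in> Ann" "g \<in> Lams {..<k}" "h \<in> Lams {k}"
  shows "h \<in> Ann"
proof (rule AnnI)
  show h: "h \<in> Lam" using assms(4) by (rule Lams_Lam)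
  have g: "g \<in> Lam" using assms(3) by (rule Lams_Lam)
  fix q :: "complex ^ 'n \<Rightarrow> complex" assume "q \<in> Lam"
  then have *: "q \<in> Lams ({j. k + j = m} \<union> {j. k + j \<noteq> m})"
    by (simp add: Lam_eq_Lams Collect_disj_eq[symmetric])
  from * obtain q1 q2 where q: "q1 \<in> Lams {j. k + j = m}" "q2 \<in> Lams {j. k + j \<noteq> m}" "q = q1 + q2" by (rule Lams_Un)
  note L = q(1)[THEN Lams_Lam] q(2)[THEN Lams_Lam]
  have "h * q2 \<in> Lams {j. j \<noteq> m}" by (rule Lams_mult[OF assms(4) q(2)]) auto
  then have 2: "theta_pair (h * q2) disc = 0" by (rule pair_orthogonal[OF _ Lams_disc]) auto
  have "g * q1 \<in> Lams {..<m}" by (rule Lams_mult[OF assms(3) q(1)]) auto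
  then have g0: "theta_pair (g * q1) disc = 0" by (rule pair_orthogonal[OF _ Lams_disc]) auto
  have "theta_pair (f * q1) disc = theta_pair (g * q1) disc + theta_pair (h * q1) disc"
    unfolding assms(1) distrib_right by (intro pair_add_left Lam_mult g h L Lam_disc)
  then have 1: "theta_pair (h * q1) disc = 0" using AnnD[OF assms(2) L(1)] g0 by simp
  have "theta_pair (h * q) disc = theta_pair (h * q1) disc + theta_pair (h * q2) disc"
    unfolding q(3) distrib_left by (intro pair_add_left Lam_mult h L Lam_disc)
  then show "theta_pair (h * q) disc = 0" using 1 2 by simp
qed

lemma Ann_divdiff: assumes "f \<in> Ann" "a \<in> \<Psi>" shows "divdiff a f \<in> Ann"
proof (rule AnnI)
  have a: "a \<noteq> 0" using assms(2) root_nonzero by auto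
  show "divdiff a f \<in> Lam" using assms(1) a by (intro Lam_divdiff Ann_Lam)
  fix g :: "complex ^ 'n \<Rightarrow> complex" assume g: "g \<in> Lam"
  show "theta_pair (divdiff a f * g) disc = 0"
    unfolding divdiff_self_adjoint[OF assms(2) Ann_Lam[OF assms(1)] g]
    by (intro AnnD assms(1) Lam_divdiff g a)
qed

lemma Ann_high_degree: assumes "f \<in> Lams {k}" "k > m" shows "f \<in> Ann"
proof (rule AnnI)
  show "f \<in> Lam" using assms(1) by (rule Lams_Lam)
  fix g :: "complex ^ 'n \<Rightarrow> complex" assume "g \<in> Lam"
  then have "f * g \<in> Lams {Suc m..}" unfolding Lam_eq_Lams
    by (rule Lams_mult[OF assms(1)]) (use assms(2) in auto)
  then show "theta_pair (f * g) disc = 0" by (rule pair_orthogonal[OF _ Lams_disc]) auto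
qed

text \<open>If \<open>f \<in> Ann\<close> then \<open>f - s\<^sub>a f\<close> is a multiple of \<open>\<partial>\<^sub>a f \<in> Ann\<close>, which has smaller degree;
  therefore \<open>f\<close> agrees with its average over \<open>W\<close> modulo anything that is stable under the operations
  below.\<close>

lemma Ann_homogeneous_induct:
  fixes S :: "nat \<Rightarrow> (complex ^ 'n \<Rightarrow> complex) set"
  assumes zero: "\<And>k. 0 \<in> S k" and add: "\<And>k f g. f \<in> S k \<Longrightarrow> g \<in> S k \<Longrightarrow> f + g \<in> S k"
    and scale: "\<And>k c f. f \<in> S k \<Longrightarrow> (\<lambda>x. c * f x) \<in> S k"
    and act: "\<And>k f \<sigma>. f \<in> S k \<Longrightarrow> \<sigma> \<in> W \<Longrightarrow> act \<sigma> f \<in> S k"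
    and linform: "\<And>k f a. f \<in> S k \<Longrightarrow> linform a * f \<in> S (Suc k)"
    and inv: "\<And>k f. f \<in> Lams {Suc k} \<Longrightarrow> f \<in> invariants W \<Longrightarrow> f \<in> S (Suc k)"
    and f: "f \<in> Ann" "f \<in> Lams {k}"
  shows "f \<in> S k"
  using f
proof (induction k arbitrary: f)
  case 0
  have c: "f x = f 0" for x using Lams_0_const[OF 0(2)] .
  \<comment> \<open>A constant in the radical is tested against \<open>disc\<close>, which is not
    isotropic.\<close>
  have "theta_pair (f * disc) disc = 0" by (rule AnnD[OF 0(1) Lam_disc])
  then have "theta_pair (disc * f) disc = 0" by (simp add: mult.commute)
  then have "f 0 * theta_pair disc disc = 0" unfolding pair_disc_mult[OF Ann_Lam[OF 0(1)]] .
  then have "f = 0" using c pair_disc_disc_nonzero by (simp add: pointwise)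
  then show ?case using zero by simp
next
  case (Suc k)
  have L: "f \<in> Lam" using Suc(2) by (rule Ann_Lam)
  have s: "f - act (refl a) f \<in> S (Suc k)" if "a \<in> \<Psi>" for a
  proof -
    have a: "a \<noteq> 0" using that root_nonzero by auto
    have "divdiff a f \<in> Lams (Suc -` {Suc k})" by (rule divdiff_exists(1)[OF Suc(3) a])
    then have "divdiff a f \<in> Lams {k}" by (simp add: vimage_def)
    then have "divdiff a f \<in> S k" using Suc.IH Ann_divdiff[OF Suc(2) that] by auto
    then show ?thesis using linform[of "divdiff a f" k "cvec a"] divdiff_mult[OF L a] by simp
  qed
  have w: "f - act \<sigma> f \<in> S (Suc k)" if "\<sigma> \<in> W" for \<sigma>
    using that
  proof (induction rule: refl_group_induct)
    case id
    then show ?case using zero by (simp add: act_id)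
  next
    case (step a \<sigma>)
    have "f - act (refl a \<circ> \<sigma>) f = (f - act (refl a) f) + act (refl a) (f - act \<sigma> f)"
      unfolding act_refl_comp[OF step(2)] act_diff by simp
    also have "\<dots> \<in> S (Suc k)" using s[OF step(1)] step by (intro add act refl_group_refl)
    finally show ?case .
  qed
  define avg where "avg = (\<lambda>x. (1 / of_nat (card W)) * (\<Sum>\<sigma>\<in>W. act \<sigma> f) x)"
  have cW: "of_nat (card W) \<noteq> (0 :: complex)" using finite_W refl_group_id by auto
  have "avg \<in> Lams {Suc k}"
    unfolding avg_def by (intro Lams_scale Lams_sum Lams_act refl_group_orthogonal Suc(3))
  moreover have "avg \<in> invariants W"
    unfolding invariants_def
  proof (intro CollectI conjI ballI)
    show "avg \<in> Lam" by (rule Lams_Lam) fact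
    fix \<tau> assume t: "\<tau> \<in> W"
    have "act \<tau> (\<Sum>\<sigma>\<in>W. act \<sigma> f) = (\<Sum>\<sigma>\<in>W. act (\<tau> \<circ> \<sigma>) f)"
      unfolding act_sum by (rule sum.cong) (simp_all only: act_refl_group_comp[OF t])
    also have "\<dots> = (\<Sum>\<sigma>\<in>W. act \<sigma> f)" by (rule sum.reindex_bij_betw[OF bij_refl_group_comp[OF t]])
    finally show "act \<tau> avg = avg" unfolding avg_def act_scale by simp
  qed
  ultimately have "avg \<in> S (Suc k)" by (rule inv)
  have sum: "(\<Sum>\<sigma>\<in>I. f - act \<sigma> f) \<in> S (Suc k)" if "I \<subseteq> W" for I
    using finite_subset[OF that finite_W] that
    by (induction I rule: finite_induct) (auto intro: zero add w)
  have "f = (\<lambda>x. (1 / of_nat (card W)) * (\<Sum>\<sigma>\<in>W. f - act \<sigma> f) x) + avg"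
    unfolding avg_def using cW by (simp add: pointwise sum_pointwise sum_subtractf field_simps)
  also have "\<dots> \<in> S (Suc k)" using sum[OF subset_refl] \<open>avg \<in> S (Suc k)\<close> by (intro add scale)
  finally show ?case .
qed

lemma coinv_ideal_scale: "f \<in> coinv_ideal \<Psi> \<Longrightarrow> (\<lambda>x. c * f x) \<in> coinv_ideal \<Psi>"
  using coinv_ideal_mult[OF _ Lam_const[of c], of f \<Psi>] by (simp add: times_fun_def)

text \<open>An invariant factor passes through antisymmetrization, so the product becomes
  \<open>disc\<close> times a polynomial that vanishes at 0.\<close>

lemma pair_mult_invariant:
  assumes "f \<in> invariants W" "f 0 = 0" "h \<in> Lam" shows "theta_pair (h * f) disc = 0"
proof -
  have f: "f \<in> Lam" using assms by (simp add: invariants_def)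
  obtain k where k: "k \<in> Lam" "alt \<Psi> h = disc * k" using alt_divisible[OF assms(3)] by auto
  have "alt \<Psi> (h * f) = alt \<Psi> h * f"
  proof
    fix x
    have "act \<sigma> (h * f) x = act \<sigma> h x * f x" if "\<sigma> \<in> W" for \<sigma>
      using assms(1) that by (simp add: act_mult times_fun_apply invariants_def)
    then show "alt \<Psi> (h * f) x = (alt \<Psi> h * f) x"
      unfolding alt_def times_fun_apply sum_pointwise sum_distrib_right
      by (intro sum.cong) (simp_all add: mult.assoc)
  qed
  then have a: "alt \<Psi> (h * f) = disc * (k * f)" unfolding k(2) by (simp add: mult.assoc)
  have "of_nat (card W) * theta_pair (h * f) disc = theta_pair (disc * (k * f)) disc"
    using pair_alt[OF subset_refl Lam_mult[OF assms(3) f]] unfolding a by simp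
  also have "\<dots> = 0" unfolding pair_disc_mult[OF Lam_mult[OF k(1) f]] times_fun_apply assms(2) by (simp add: pointwise)
  finally show ?thesis using finite_W refl_group_id by auto
qed

text \<open>Generators of the ideal are in the radical by \<open>pair_mult_invariant\<close>.
  Conversely, \<open>Ann_homogeneous_induct\<close> is applied with the ideal itself in every
  degree, and a general element is taken apart from its top component downwards.\<close>

lemma coinv_ideal_eq_Ann: "coinv_ideal \<Psi> = Ann"
proof (intro equalityI subsetI)
  fix f assume "f \<in> coinv_ideal \<Psi>"
  then show "f \<in> Ann"
  proof (induction rule: coinv_ideal_induct)
    case zero
    have "0 * g = 0" for g :: "complex ^ 'n \<Rightarrow> complex" by (simp add: pointwise)
    then show ?case by (intro AnnI Lam_zero) (simp only: pair_zero_left[OF Lam_disc])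
  next
    case (mem a f d)
    then have f: "f \<in> Lam" "\<And>c x. f (c *s x) = c ^ d * f x" by (auto simp: homogeneous_def)
    have "f (0 *s 0) = 0" unfolding f(2) zero_power[OF mem(4)] by (simp add: pointwise)
    then have "f 0 = 0" by simp
    show ?case
    proof (intro AnnI Lam_mult mem f)
      fix g :: "complex ^ 'n \<Rightarrow> complex" assume "g \<in> Lam"
      then have "theta_pair ((a * g) * f) disc = 0"
        by (intro pair_mult_invariant mem \<open>f 0 = 0\<close> Lam_mult)
      then show "theta_pair (a * f * g) disc = 0" by (simp only: mult_ac)
    qed
  next
    case (add f g)
    then show ?case by (intro Ann_add)
  qed
next
  fix f assume f: "f \<in> Ann"
  have hom: "f \<in> coinv_ideal \<Psi>" if "f \<in> Ann" "f \<in> Lams {k}" for k f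
  proof (rule Ann_homogeneous_induct[of "\<lambda>_. coinv_ideal \<Psi>", OF _ _ _ _ _ _ that])
    fix k f assume f: "f \<in> Lams {Suc k}" "f \<in> invariants W"
    have "homogeneous (Suc k) f" unfolding homogeneous_def using f Lams_Lam Lams_homogeneous by blast
    then have "1 * f \<in> coinv_ideal \<Psi>" by (intro coinv_ideal_mem[of _ _ _ "Suc k"] Lam_one f) auto
    then show "f \<in> coinv_ideal \<Psi>" by simp
  qed (auto intro: coinv_ideal_zero coinv_ideal_add coinv_ideal_scale coinv_ideal_act coinv_ideal_mult Lam_linform)
  obtain k where "f \<in> Lams {..k}" using Lams_bounded[OF Ann_Lam[OF f]] by auto
  then have "\<exists>n. f \<in> Lams {..<n}" by (intro exI[of _ "Suc k"]) (simp add: lessThan_Suc_atMost)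
  then obtain n where "f \<in> Lams {..<n}" ..
  then show "f \<in> coinv_ideal \<Psi>" using f
  proof (induction n arbitrary: f)
    case 0
    then have "f = 0" by (intro Lams_disjoint[OF 0(1) 0(1)]) auto
    then show ?case using coinv_ideal_zero by simp
  next
    case (Suc k)
    have "f \<in> Lams ({..<k} \<union> {k})" by (rule Lams_mono[OF _ Suc.prems(1)]) auto
    then obtain g h where gh: "g \<in> Lams {..<k}" "h \<in> Lams {k}" "f = g + h" by (rule Lams_Un)
    have h: "h \<in> Ann" by (rule Ann_component[OF gh(3) Suc.prems(2) gh(1,2)])
    have "g = f + (\<lambda>x. (-1) * h x)" using gh(3) by (simp add: pointwise)
    moreover have "(\<lambda>x. (-1) * h x) \<in> Ann"
    proof (intro AnnI Lam_scale Ann_Lam[OF h])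
      fix q :: "complex ^ 'n \<Rightarrow> complex" assume q: "q \<in> Lam"
      have *: "(\<lambda>x. (-1) * h x) * q = (\<lambda>x. (-1) * (h * q) x)" by (simp add: pointwise)
      show "theta_pair ((\<lambda>x. (-1) * h x) * q) disc = 0"
        unfolding * pair_scale_left[OF Lam_mult[OF Ann_Lam[OF h] q] Lam_disc] AnnD[OF h q] by (rule mult_zero_right)
    qed
    ultimately have g: "g \<in> Ann" using Ann_add[OF Suc.prems(2)] by (simp only:)
    have "g \<in> coinv_ideal \<Psi>" by (rule Suc.IH[OF gh(1) g])
    then show ?case unfolding gh(3) by (intro coinv_ideal_add hom[OF h gh(2)])
  qed
qed

end


context simple_roots
begin

subsection \<open>Functions on a generic orbit\<close>

text \<open>Twice the usual half sum. A simple reflection permutes the other positive roots, so it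
  maps this vector to itself minus 2 \<alpha>, whence its inner product with \<alpha> is that of
  \<alpha> with itself. No root vanishes at it.\<close>

definition rho :: "real ^ 'n" where "rho = (\<Sum>\<beta>\<in>pos. \<beta>)"

abbreviation base_pt :: "complex ^ 'n" where "base_pt \<equiv> cvec rho"

lemma inner_rho_simple: assumes "\<alpha> \<in> \<Omega>" shows "inner rho \<alpha> = inner \<alpha> \<alpha>"
proof -
  have \<alpha>: "\<alpha> \<in> pos" "\<alpha> \<noteq> 0" using assms simple_pos simple_root root_nonzero by auto
  have r: "rho = \<alpha> + (\<Sum>\<beta>\<in>pos - {\<alpha>}. \<beta>)" unfolding rho_def by (rule sum.remove[OF finite_pos \<alpha>(1)])
  have "refl_real \<alpha> (\<Sum>\<beta>\<in>pos - {\<alpha>}. \<beta>) = (\<Sum>\<beta>\<in>pos - {\<alpha>}. refl_real \<alpha> \<beta>)"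
    using root_act_sum[OF real_orthogonal_refl, of \<alpha> "\<lambda>_. 1" "\<lambda>\<beta>. \<beta>" "pos - {\<alpha>}"] by (simp add: root_act_refl)
  also have "\<dots> = (\<Sum>\<beta>\<in>pos - {\<alpha>}. \<beta>)" by (rule sum.reindex_bij_betw[OF simple_refl_bij[OF assms]])
  finally have "refl_real \<alpha> rho = - \<alpha> + (\<Sum>\<beta>\<in>pos - {\<alpha>}. \<beta>)"
    using root_act_add[OF real_orthogonal_refl, of \<alpha> \<alpha> "\<Sum>\<beta>\<in>pos - {\<alpha>}. \<beta>"] \<alpha>(2)
    unfolding root_act_refl r by (simp add: refl_real_self)
  then have "rho - refl_real \<alpha> rho = 2 *\<^sub>R \<alpha>" by (subst (1) r) (simp add: scaleR_2)
  moreover have "rho - refl_real \<alpha> rho = (2 * inner rho \<alpha> / inner \<alpha> \<alpha>) *\<^sub>R \<alpha>" by (simp add: refl_real_def)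
  ultimately have "(2 * inner rho \<alpha> / inner \<alpha> \<alpha>) *\<^sub>R \<alpha> = 2 *\<^sub>R \<alpha>" by simp
  then have "2 * inner rho \<alpha> / inner \<alpha> \<alpha> = 2" using \<alpha>(2) by (simp only: scaleR_right_imp_eq)
  then show ?thesis using \<alpha>(2) by (simp add: field_simps)
qed

lemma inner_rho_pos: assumes "\<beta> \<in> pos" shows "inner rho \<beta> > 0"
proof -
  have sp: "\<beta> \<in> span \<Omega>" using assms pos_root root_in_span by auto
  have "inner rho \<beta> = inner rho (\<Sum>\<omega>\<in>\<Omega>. coord \<beta> \<omega> *\<^sub>R \<omega>)" by (simp add: sum_coord[OF sp])
  also have "\<dots> = (\<Sum>\<omega>\<in>\<Omega>. coord \<beta> \<omega> * inner \<omega> \<omega>)"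
    unfolding inner_sum_right by (intro sum.cong refl) (simp add: inner_rho_simple)
  finally have eq: "inner rho \<beta> = (\<Sum>\<omega>\<in>\<Omega>. coord \<beta> \<omega> * inner \<omega> \<omega>)" .
  have "\<exists>\<omega>\<in>\<Omega>. coord \<beta> \<omega> \<noteq> 0"
  proof (rule ccontr)
    assume "\<not> ?thesis"
    then have "(\<Sum>\<omega>\<in>\<Omega>. coord \<beta> \<omega> *\<^sub>R \<omega>) = 0" by (intro sum.neutral) auto
    then show False using sum_coord[OF sp] assms pos_root root_nonzero by auto
  qed
  then obtain \<omega> where \<omega>: "\<omega> \<in> \<Omega>" "coord \<beta> \<omega> \<noteq> 0" by auto
  then have "coord \<beta> \<omega> > 0" using assms by (auto simp: pos_iff order_less_le)
  moreover have "inner \<omega> \<omega> > 0" using \<omega>(1) simple_root root_nonzero by simp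
  ultimately have p: "0 < coord \<beta> \<omega> * inner \<omega> \<omega>" by simp
  have nn: "0 \<le> coord \<beta> \<omega>' * inner \<omega>' \<omega>'" if "\<omega>' \<in> \<Omega>" for \<omega>' using assms that by (simp add: pos_iff)
  show ?thesis unfolding eq by (rule sum_pos2[OF finite_simple \<omega>(1)]) (rule p, rule nn)
qed

lemma inner_rho_root: assumes "\<beta> \<in> \<Psi>" shows "inner rho \<beta> \<noteq> 0"
  using inner_rho_pos[of \<beta>] inner_rho_pos[of "- \<beta>"] not_pos_iff[OF assms] by (cases "\<beta> \<in> pos") auto

lemma bil_orbit_nonzero:
  assumes "\<sigma> \<in> W" "\<beta> \<in> \<Psi>" shows "bil (\<sigma> base_pt) (cvec \<beta>) \<noteq> 0"
proof -
  have i: "inv_into UNIV \<sigma> \<in> W" by (rule refl_group_inv[OF assms(1)])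
  have "bil (\<sigma> base_pt) (cvec \<beta>) = bil base_pt (inv_into UNIV \<sigma> (cvec \<beta>))"
    using bil_inv_orthogonal[OF refl_group_orthogonal[OF i], of base_pt "cvec \<beta>"]
    unfolding refl_group_inv_comp(3)[OF assms(1)] .
  also have "\<dots> = complex_of_real (inner rho (root_act (inv_into UNIV \<sigma>) \<beta>))"
    unfolding cvec_root_act[OF refl_group_orthogonal[OF i], symmetric] bil_cvec ..
  finally show ?thesis using inner_rho_root[OF root_act_root[OF i assms(2)]] by simp
qed

text \<open>An element that fixes the base point preserves the inner products of roots with it, and
  their signs tell which roots are positive.\<close>

lemma orbit_free: assumes "\<sigma> \<in> W" "\<sigma> base_pt = base_pt" shows "\<sigma> = id"
proof (rule id_if_pos[OF assms(1)])
  note o = refl_group_orthogonal[OF assms(1)]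
  have r: "root_act \<sigma> rho = rho" using cvec_root_act[OF o, of rho] assms(2) by (simp add: cvec_inject)
  fix \<beta> assume b: "\<beta> \<in> pos"
  have "inner rho (root_act \<sigma> \<beta>) = inner rho \<beta>" using inner_root_act[OF o, of rho \<beta>] r by simp
  then have "inner rho (root_act \<sigma> \<beta>) > 0" using inner_rho_pos[OF b] by simp
  then show "root_act \<sigma> \<beta> \<in> pos"
    using inner_rho_pos[of "- root_act \<sigma> \<beta>"] not_pos_iff[OF root_act_root[OF assms(1) pos_root[OF b]]] by fastforce
qed

lemma disc_base_pt: "disc base_pt \<noteq> 0"
  unfolding disc_def prod_pointwise
  using bil_orbit_nonzero[OF refl_group_id] pos_root finite_pos by (simp add: linform_def id_apply)

lemma sgn_of_inv: "\<sigma> \<in> W \<Longrightarrow> sgn_of (inv_into UNIV \<sigma>) = sgn_of \<sigma>"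
  by (simp add: sgn_of_def len_inv)

lemma disc_orbit: assumes "\<sigma> \<in> W" shows "disc (\<sigma> x) = sgn_of \<sigma> * disc x"
  using fun_cong[OF act_disc[OF refl_group_inv[OF assms]], of x] assms
  by (simp add: act_def refl_group_inv_comp(3) sgn_of_inv)

section \<open>Functions on W as functions on the regular orbit\<close>

definition orbit_funs :: "((complex ^ 'n \<Rightarrow> complex ^ 'n) \<Rightarrow> complex) set" where
  "orbit_funs = {F. \<forall>\<sigma>. \<sigma> \<notin> W \<longrightarrow> F \<sigma> = 0}"

text \<open>The orbit is free, so group elements serve as labels of its points and a function on the
  orbit is a function on W.\<close>

definition orbit_values :: "(complex ^ 'n \<Rightarrow> complex) \<Rightarrow> (complex ^ 'n \<Rightarrow> complex ^ 'n) \<Rightarrow> complex" where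
  "orbit_values f = restr W (\<lambda>\<sigma>. f (\<sigma> base_pt))"

text \<open>On a regular orbit no root vanishes, so the quotient is an honest division. It makes
  sense for all functions on W, which is what the triangular systems below require.\<close>

definition orbit_divdiff :: "real ^ 'n \<Rightarrow> ((complex ^ 'n \<Rightarrow> complex ^ 'n) \<Rightarrow> complex) \<Rightarrow> (complex ^ 'n \<Rightarrow> complex ^ 'n) \<Rightarrow> complex" where
  "orbit_divdiff a F = restr W (\<lambda>\<sigma>. (F \<sigma> - F (refl a \<circ> \<sigma>)) / bil (\<sigma> base_pt) (cvec a))"

definition orbit_divdiffs :: "(real ^ 'n) list \<Rightarrow> ((complex ^ 'n \<Rightarrow> complex ^ 'n) \<Rightarrow> complex) \<Rightarrow> (complex ^ 'n \<Rightarrow> complex ^ 'n) \<Rightarrow> complex" where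
  "orbit_divdiffs as F = foldr orbit_divdiff as F"

lemma orbit_divdiffs_Nil: "orbit_divdiffs [] F = F"
  and orbit_divdiffs_Cons: "orbit_divdiffs (a # as) F = orbit_divdiff a (orbit_divdiffs as F)"
  and orbit_divdiffs_append: "orbit_divdiffs (as @ bs) F = orbit_divdiffs as (orbit_divdiffs bs F)"
  by (simp_all add: orbit_divdiffs_def id_apply o_apply)

lemma orbit_values_orbit_funs: "orbit_values f \<in> orbit_funs"
  by (simp add: orbit_values_def orbit_funs_def restr_def)

lemma orbit_values_eq_iff: "orbit_values f = orbit_values g \<longleftrightarrow> (\<forall>\<sigma>\<in>W. f (\<sigma> base_pt) = g (\<sigma> base_pt))"
  by (auto simp: orbit_values_def restr_def fun_eq_iff)

lemma orbit_values_add: "orbit_values (f + g) = orbit_values f + orbit_values g"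
  and orbit_values_scale: "orbit_values (\<lambda>x. c * f x) = (\<lambda>\<sigma>. c * orbit_values f \<sigma>)"
  by (auto simp: orbit_values_def restr_def pointwise)

lemma orbit_funs_add: "F \<in> orbit_funs \<Longrightarrow> G \<in> orbit_funs \<Longrightarrow> F + G \<in> orbit_funs"
  and orbit_funs_scale: "F \<in> orbit_funs \<Longrightarrow> (\<lambda>\<sigma>. c * F \<sigma>) \<in> orbit_funs"
  and orbit_funs_sum: "(\<And>i. i \<in> I \<Longrightarrow> Q i \<in> orbit_funs) \<Longrightarrow> sum Q I \<in> orbit_funs"
  by (auto simp: orbit_funs_def pointwise sum_pointwise)

lemma orbit_divdiff_add: "orbit_divdiff a (F + G) = orbit_divdiff a F + orbit_divdiff a G"
  and orbit_divdiff_scale: "orbit_divdiff a (\<lambda>\<sigma>. c * F \<sigma>) = (\<lambda>\<sigma>. c * orbit_divdiff a F \<sigma>)"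
  by (auto simp: orbit_divdiff_def restr_def pointwise add_divide_distrib diff_divide_distrib right_diff_distrib)

lemma orbit_divdiffs_add: "orbit_divdiffs as (F + G) = orbit_divdiffs as F + orbit_divdiffs as G"
  by (induction as) (simp_all only: orbit_divdiffs_Nil orbit_divdiffs_Cons orbit_divdiff_add)

lemma orbit_divdiffs_scale: "orbit_divdiffs as (\<lambda>\<sigma>. c * F \<sigma>) = (\<lambda>\<sigma>. c * orbit_divdiffs as F \<sigma>)"
  by (induction as) (simp_all only: orbit_divdiffs_Nil orbit_divdiffs_Cons orbit_divdiff_scale)

lemma orbit_values_divdiff: assumes "f \<in> Lam" "a \<in> \<Psi>" shows "orbit_values (divdiff a f) = orbit_divdiff a (orbit_values f)"
proof
  fix \<sigma>
  show "orbit_values (divdiff a f) \<sigma> = orbit_divdiff a (orbit_values f) \<sigma>"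
  proof (cases "\<sigma> \<in> W")
    case True
    then have c: "refl a \<circ> \<sigma> \<in> W" using assms by (intro refl_group_comp refl_group_refl)
    have "bil (\<sigma> base_pt) (cvec a) * divdiff a f (\<sigma> base_pt) = f (\<sigma> base_pt) - f (refl a (\<sigma> base_pt))"
      using fun_cong[OF divdiff_mult[OF assms(1) root_nonzero[OF assms(2)]], of "\<sigma> base_pt"]
      by (simp add: pointwise linform_def act_refl)
    then have "divdiff a f (\<sigma> base_pt) = (f (\<sigma> base_pt) - f (refl a (\<sigma> base_pt))) / bil (\<sigma> base_pt) (cvec a)"
      using bil_orbit_nonzero[OF True assms(2)] by (simp add: field_simps)
    then show ?thesis using True c by (simp add: orbit_values_def orbit_divdiff_def restr_def o_apply)
  qed (simp add: orbit_values_def orbit_divdiff_def restr_def)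
qed

lemma orbit_values_divdiffs: "as \<in> lists \<Omega> \<Longrightarrow> f \<in> Lam \<Longrightarrow> orbit_values (divdiffs as f) = orbit_divdiffs as (orbit_values f)"
proof (induction as rule: list.induct)
  case (Cons a as)
  then have "as \<in> lists \<Omega>" "a \<in> \<Psi>" using simple_root by auto
  then show ?case using Cons orbit_values_divdiff[OF Lam_divdiffs[OF not_0_set[of as] Cons.prems(2)], of a]
    by (simp add: divdiffs_Cons orbit_divdiffs_Cons)
qed (simp add: divdiffs_Nil orbit_divdiffs_Nil)

text \<open>Expanding the differences evaluates F at products of subwords. Only the full word is
  longer than all the others, and its coefficient is a product of inverses of root values up to
  sign. The constant is chosen before F, so one triangular system serves all functions.\<close>

lemma orbit_divdiffs_leading:
  "as \<in> lists \<Omega> \<Longrightarrow> \<sigma> \<in> W \<Longrightarrow> \<exists>c. c \<noteq> 0 \<and> (\<forall>F. (\<forall>bs\<in>lists \<Omega>. length bs < length as \<longrightarrow> F (refl_word bs \<circ> \<sigma>) = 0)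
     \<longrightarrow> orbit_divdiffs as F \<sigma> = c * F (refl_word (rev as) \<circ> \<sigma>))"
proof (induction as arbitrary: \<sigma> rule: list.induct)
  case Nil
  then show ?case by (intro exI[of _ 1]) (simp add: orbit_divdiffs_Nil refl_word_Nil)
next
  case (Cons a as)
  then have as: "as \<in> lists \<Omega>" "a \<in> \<Omega>" "a \<in> \<Psi>" using simple_root by auto
  have s: "refl a \<circ> \<sigma> \<in> W" using Cons.prems as by (intro refl_group_comp refl_group_refl)
  from Cons.IH[OF as(1) Cons.prems(2)] obtain c1 where c1: "c1 \<noteq> 0 \<and> (\<forall>F. (\<forall>bs\<in>lists \<Omega>. length bs < length as \<longrightarrow> F (refl_word bs \<circ> \<sigma>) = 0)
     \<longrightarrow> orbit_divdiffs as F \<sigma> = c1 * F (refl_word (rev as) \<circ> \<sigma>))" ..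
  from Cons.IH[OF as(1) s] obtain c2 where c2: "c2 \<noteq> 0 \<and> (\<forall>F. (\<forall>bs\<in>lists \<Omega>. length bs < length as \<longrightarrow> F (refl_word bs \<circ> (refl a \<circ> \<sigma>)) = 0)
     \<longrightarrow> orbit_divdiffs as F (refl a \<circ> \<sigma>) = c2 * F (refl_word (rev as) \<circ> (refl a \<circ> \<sigma>)))" ..
  let ?b = "bil (\<sigma> base_pt) (cvec a)"
  have b: "?b \<noteq> 0" by (rule bil_orbit_nonzero[OF Cons.prems(2) as(3)])
  show ?case
  proof (intro exI[of _ "- c2 / ?b"] conjI allI impI)
    show "- c2 / ?b \<noteq> 0" using c2[THEN conjunct1] b by (simp add: pointwise)
    fix F :: "(complex ^ 'n \<Rightarrow> complex ^ 'n) \<Rightarrow> complex" assume F: "\<forall>bs\<in>lists \<Omega>. length bs < length (a # as) \<longrightarrow> F (refl_word bs \<circ> \<sigma>) = 0"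
    have "orbit_divdiffs as F \<sigma> = c1 * F (refl_word (rev as) \<circ> \<sigma>)" using F by (intro c1[THEN conjunct2, rule_format]) auto
    \<comment> \<open>Without the letter a, the word is too short for F to be nonzero; only the
      summand that uses the letter survives.\<close>
    moreover have "F (refl_word (rev as) \<circ> \<sigma>) = 0" using F[rule_format, of "rev as"] as by (auto simp: in_lists_conv_set)
    ultimately have 1: "orbit_divdiffs as F \<sigma> = 0" by (simp add: pointwise)
    have 2: "orbit_divdiffs as F (refl a \<circ> \<sigma>) = c2 * F (refl_word (rev as) \<circ> (refl a \<circ> \<sigma>))"
    proof (rule c2[THEN conjunct2, rule_format])
      fix bs assume "bs \<in> lists \<Omega>" "length bs < length as"
      then have "F (refl_word (bs @ [a]) \<circ> \<sigma>) = 0" using F[rule_format, of "bs @ [a]"] as by auto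
      then show "F (refl_word bs \<circ> (refl a \<circ> \<sigma>)) = 0"
        by (simp add: refl_word_append refl_word_Cons refl_word_Nil comp_assoc)
    qed
    have "orbit_divdiffs (a # as) F \<sigma> = (orbit_divdiffs as F \<sigma> - orbit_divdiffs as F (refl a \<circ> \<sigma>)) / ?b"
      using Cons.prems(2) by (simp add: orbit_divdiffs_Cons orbit_divdiff_def restr_def)
    also have "\<dots> = - c2 / ?b * F (refl_word (rev as) \<circ> (refl a \<circ> \<sigma>))" unfolding 1 2 by (simp add: pointwise)
    also have "refl_word (rev as) \<circ> (refl a \<circ> \<sigma>) = refl_word (rev (a # as)) \<circ> \<sigma>"
      by (simp add: refl_word_append refl_word_Cons refl_word_Nil comp_assoc)
    finally show "orbit_divdiffs (a # as) F \<sigma> = - c2 / ?b * F (refl_word (rev (a # as)) \<circ> \<sigma>)" .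
  qed
qed

text \<open>The reversed words match the ones that occur in the Schubert polynomials after the divided
  differences are moved to the other side of the pairing.\<close>

definition dual_word :: "(complex ^ 'n \<Rightarrow> complex ^ 'n) \<Rightarrow> (real ^ 'n) list" where
  "dual_word u = rev (SOME as. reduced_word \<Omega> (inv_into UNIV u) as)"

lemma dual_word:
  assumes "u \<in> W"
  shows "dual_word u \<in> lists \<Omega>" "refl_word (dual_word u) = u" "length (dual_word u) = len \<Omega> u"
proof -
  let ?as = "SOME as. reduced_word \<Omega> (inv_into UNIV u) as"
  have "reduced_word \<Omega> (inv_into UNIV u) ?as"
    by (rule someI_ex[OF reduced_word_exists[OF refl_group_inv[OF assms]]])
  then have as: "?as \<in> lists \<Omega>" "refl_word ?as = inv_into UNIV u" "length ?as = len \<Omega> u"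
    using len_inv[OF assms] by (auto simp: reduced_word_def)
  show "dual_word u \<in> lists \<Omega>" "length (dual_word u) = len \<Omega> u" using as by (auto simp: dual_word_def in_lists_conv_set)
  show "refl_word (dual_word u) = u"
    unfolding dual_word_def inv_refl_word[symmetric] as(2) by (rule refl_group_inv_comp(3)[OF assms])
qed

lemma len_le_m: "u \<in> W \<Longrightarrow> len \<Omega> u \<le> m"
  using card_mono[OF finite_pos, of "invs u"] by (auto simp: len_eq invs_def)

definition divdiff_at_id :: "(complex ^ 'n \<Rightarrow> complex ^ 'n) \<Rightarrow> ((complex ^ 'n \<Rightarrow> complex ^ 'n) \<Rightarrow> complex) \<Rightarrow> complex" where
  "divdiff_at_id u F = orbit_divdiffs (dual_word u) F id"

lemma divdiff_at_id_add: "divdiff_at_id u (F + G) = divdiff_at_id u F + divdiff_at_id u G"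
  and divdiff_at_id_scale: "divdiff_at_id u (\<lambda>\<sigma>. c * F \<sigma>) = c * divdiff_at_id u F"
  unfolding divdiff_at_id_def orbit_divdiffs_add orbit_divdiffs_scale by (simp_all add: pointwise)

lemma divdiff_at_id_zero: "divdiff_at_id u 0 = 0"
  using divdiff_at_id_scale[of u 0 0] unfolding zero_scale[of 0] by (simp add: pointwise)

lemma divdiff_at_id_sum: "divdiff_at_id u (sum Q I) = (\<Sum>i\<in>I. divdiff_at_id u (Q i))"
  by (induction I rule: infinite_finite_induct) (simp_all add: divdiff_at_id_zero divdiff_at_id_add)

text \<open>The inverse enters because \<open>orbit_divdiffs_leading\<close> reverses the word. It
  has the same length, so the system stays triangular with respect to length.\<close>

lemma divdiff_at_id_leading:
  assumes "u \<in> W"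
  shows "\<exists>c. c \<noteq> 0 \<and> (\<forall>F. (\<forall>\<sigma>\<in>W. len \<Omega> \<sigma> < len \<Omega> u \<longrightarrow> F \<sigma> = 0) \<longrightarrow> divdiff_at_id u F = c * F (inv_into UNIV u))"
proof -
  from orbit_divdiffs_leading[OF dual_word(1)[OF assms] refl_group_id] obtain c where c: "c \<noteq> 0 \<and>
    (\<forall>F. (\<forall>bs\<in>lists \<Omega>. length bs < length (dual_word u) \<longrightarrow> F (refl_word bs \<circ> id) = 0)
     \<longrightarrow> orbit_divdiffs (dual_word u) F id = c * F (refl_word (rev (dual_word u)) \<circ> id))" ..
  have i: "refl_word (rev (dual_word u)) = inv_into UNIV u"
    unfolding inv_refl_word[symmetric] dual_word(2)[OF assms] ..
  show ?thesis
  proof (intro exI[of _ c] conjI allI impI c[THEN conjunct1])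
    fix F :: "(complex ^ 'n \<Rightarrow> complex ^ 'n) \<Rightarrow> complex" assume F: "\<forall>\<sigma>\<in>W. len \<Omega> \<sigma> < len \<Omega> u \<longrightarrow> F \<sigma> = 0"
    have "orbit_divdiffs (dual_word u) F id = c * F (refl_word (rev (dual_word u)) \<circ> id)"
    proof (rule c[THEN conjunct2, rule_format])
      fix bs assume "bs \<in> lists \<Omega>" "length bs < length (dual_word u)"
      then show "F (refl_word bs \<circ> id) = 0"
        using F len_le[of bs] refl_word_W[of bs] dual_word(3)[OF assms] by (simp del: in_lists_conv_set)
    qed
    then show "divdiff_at_id u F = c * F (inv_into UNIV u)" by (simp add: divdiff_at_id_def i)
  qed
qed

lemma divdiff_at_id_injective: assumes "F \<in> orbit_funs" "\<And>u. u \<in> W \<Longrightarrow> divdiff_at_id u F = 0" shows "F = 0"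
proof -
  have "\<forall>\<sigma>\<in>W. len \<Omega> \<sigma> = k \<longrightarrow> F \<sigma> = 0" for k
  proof (induction k rule: less_induct)
    case (less k)
    show ?case
    proof (intro ballI impI)
      fix \<sigma> assume s: "\<sigma> \<in> W" "len \<Omega> \<sigma> = k"
      have i: "inv_into UNIV \<sigma> \<in> W" "len \<Omega> (inv_into UNIV \<sigma>) = k" using s by (auto simp: refl_group_inv len_inv)
      from divdiff_at_id_leading[OF i(1)] obtain c where c: "c \<noteq> 0 \<and> (\<forall>F. (\<forall>\<sigma>'\<in>W. len \<Omega> \<sigma>' < len \<Omega> (inv_into UNIV \<sigma>) \<longrightarrow> F \<sigma>' = 0)
          \<longrightarrow> divdiff_at_id (inv_into UNIV \<sigma>) F = c * F (inv_into UNIV (inv_into UNIV \<sigma>)))" ..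
      have "divdiff_at_id (inv_into UNIV \<sigma>) F = c * F (inv_into UNIV (inv_into UNIV \<sigma>))"
        by (rule c[THEN conjunct2, rule_format]) (use less in \<open>auto simp: i(2)\<close>)
      then show "F \<sigma> = 0" using assms(2)[OF i(1)] c unfolding refl_group_inv_comp(3)[OF s(1)] by simp
    qed
  qed
  then have "F \<sigma> = 0" for \<sigma> using assms(1) by (cases "\<sigma> \<in> W") (auto simp: orbit_funs_def)
  then show ?thesis by (simp add: pointwise)
qed

text \<open>The triangular system is solved length by length; a correction supported in length k
  does not disturb the equations for shorter elements.\<close>

lemma divdiff_at_id_surjective: "\<exists>F\<in>orbit_funs. \<forall>u\<in>W. divdiff_at_id u F = c u"
proof -
  define \<kappa> where "\<kappa> u = (SOME d. d \<noteq> 0 \<and> (\<forall>F. (\<forall>\<sigma>\<in>W. len \<Omega> \<sigma> < len \<Omega> u \<longrightarrow> F \<sigma> = 0) \<longrightarrow> divdiff_at_id u F = d * F (inv_into UNIV u)))" for u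
  have \<kappa>: "\<kappa> u \<noteq> 0 \<and> (\<forall>F. (\<forall>\<sigma>\<in>W. len \<Omega> \<sigma> < len \<Omega> u \<longrightarrow> F \<sigma> = 0) \<longrightarrow> divdiff_at_id u F = \<kappa> u * F (inv_into UNIV u))" if "u \<in> W" for u
    unfolding \<kappa>_def by (rule someI_ex[OF divdiff_at_id_leading[OF that]])
  have "\<exists>F\<in>orbit_funs. \<forall>u\<in>W. len \<Omega> u < k \<longrightarrow> divdiff_at_id u F = c u" for k
  proof (induction k)
    case 0
    have "(0 :: (complex ^ 'n \<Rightarrow> complex ^ 'n) \<Rightarrow> complex) \<in> orbit_funs" by (simp add: orbit_funs_def pointwise)
    then show ?case by auto
  next
    case (Suc k)
    then obtain F where F: "F \<in> orbit_funs" "\<forall>u\<in>W. len \<Omega> u < k \<longrightarrow> divdiff_at_id u F = c u" by auto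
    \<comment> \<open>The correction is the remaining defect divided by the leading coefficient
      \<open>\<kappa>\<close>, placed at the inverse because that is where the leading term is
      evaluated.\<close>
    define H where "H \<sigma> = (if \<sigma> \<in> W \<and> len \<Omega> \<sigma> = k then (c (inv_into UNIV \<sigma>) - divdiff_at_id (inv_into UNIV \<sigma>) F) / \<kappa> (inv_into UNIV \<sigma>) else 0)" for \<sigma>
    have "H \<in> orbit_funs" by (simp add: orbit_funs_def H_def)
    moreover have "divdiff_at_id u (F + H) = c u" if u: "u \<in> W" "len \<Omega> u < Suc k" for u
    proof -
      have "\<forall>\<sigma>\<in>W. len \<Omega> \<sigma> < len \<Omega> u \<longrightarrow> H \<sigma> = 0" using u by (auto simp: H_def)
      then have e: "divdiff_at_id u H = \<kappa> u * H (inv_into UNIV u)" by (intro \<kappa>[OF u(1), THEN conjunct2, rule_format]) auto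
      show ?thesis
      proof (cases "len \<Omega> u = k")
        case True
        then have "H (inv_into UNIV u) = (c u - divdiff_at_id u F) / \<kappa> u"
          using u by (simp add: H_def refl_group_inv len_inv refl_group_inv_comp(3))
        then show ?thesis using e \<kappa>[OF u(1)] by (simp add: divdiff_at_id_add)
      next
        case False
        then have "H (inv_into UNIV u) = 0" using u by (simp add: H_def refl_group_inv len_inv)
        then show ?thesis using e F u False by (simp add: divdiff_at_id_add pointwise)
      qed
    qed
    ultimately show ?case using F(1) orbit_funs_add by blast
  qed
  from this[of "Suc m"] show ?thesis using len_le_m by (simp add: less_Suc_eq_le)
qed

section \<open>Dual bases on the orbit\<close>

definition dual_orbit_fun :: "(complex ^ 'n \<Rightarrow> complex ^ 'n) \<Rightarrow> (complex ^ 'n \<Rightarrow> complex ^ 'n) \<Rightarrow> complex" where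
  "dual_orbit_fun w = (SOME F. F \<in> orbit_funs \<and> (\<forall>u\<in>W. divdiff_at_id u F = (if u = w then 1 else 0)))"

lemma dual_orbit_fun: "dual_orbit_fun w \<in> orbit_funs" "u \<in> W \<Longrightarrow> divdiff_at_id u (dual_orbit_fun w) = (if u = w then 1 else 0)"
proof -
  have "\<exists>F. F \<in> orbit_funs \<and> (\<forall>u\<in>W. divdiff_at_id u F = (if u = w then 1 else 0))" using divdiff_at_id_surjective[of "\<lambda>u. if u = w then 1 else 0"] unfolding Bex_def .
  from someI_ex[OF this] show "dual_orbit_fun w \<in> orbit_funs" "u \<in> W \<Longrightarrow> divdiff_at_id u (dual_orbit_fun w) = (if u = w then 1 else 0)"
    unfolding dual_orbit_fun_def by auto
qed

lemma dual_orbit_fun_expansion: assumes "F \<in> orbit_funs" shows "F = (\<Sum>w\<in>W. (\<lambda>\<sigma>. divdiff_at_id w F * dual_orbit_fun w \<sigma>))"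
proof -
  let ?G = "\<Sum>w\<in>W. (\<lambda>\<sigma>. divdiff_at_id w F * dual_orbit_fun w \<sigma>)"
  have G: "?G \<in> orbit_funs" by (intro orbit_funs_sum orbit_funs_scale dual_orbit_fun)
  have "F + (\<lambda>\<sigma>. (-1) * ?G \<sigma>) = 0"
  proof (rule divdiff_at_id_injective)
    show "F + (\<lambda>\<sigma>. (-1) * ?G \<sigma>) \<in> orbit_funs" by (intro orbit_funs_add orbit_funs_scale assms G)
    fix u assume u: "u \<in> W"
    have "divdiff_at_id u ?G = (\<Sum>w\<in>W. divdiff_at_id w F * (if u = w then 1 else 0))"
      unfolding divdiff_at_id_sum divdiff_at_id_scale using dual_orbit_fun(2)[OF u] by simp
    also have "\<dots> = (\<Sum>w\<in>W. if u = w then divdiff_at_id w F else 0)" by (rule sum.cong) (auto simp: pointwise)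
    also have "\<dots> = divdiff_at_id u F" using u finite_W by simp
    finally show "divdiff_at_id u (F + (\<lambda>\<sigma>. (-1) * ?G \<sigma>)) = 0" unfolding divdiff_at_id_add divdiff_at_id_scale by (simp add: pointwise)
  qed
  then show ?thesis by (simp add: pointwise)
qed

text \<open>The counterpart on the orbit of pairing fg with \<open>disc\<close>: for polynomials f
  and g this is the quotient of \<open>alt\<close> of fg by \<open>disc\<close>, evaluated at the
  base point.\<close>

definition orbit_pair :: "((complex ^ 'n \<Rightarrow> complex ^ 'n) \<Rightarrow> complex) \<Rightarrow> ((complex ^ 'n \<Rightarrow> complex ^ 'n) \<Rightarrow> complex) \<Rightarrow> complex" where
  "orbit_pair F G = (\<Sum>\<sigma>\<in>W. F \<sigma> * G \<sigma> / disc (\<sigma> base_pt))"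

text \<open>Reindexing by the reflection changes the sign of the root value and of
  \<open>disc\<close>. The two changes cancel, so the cross terms on both sides agree.\<close>

lemma orbit_pair_orbit_divdiff: assumes "a \<in> \<Psi>" shows "orbit_pair (orbit_divdiff a F) G = orbit_pair F (orbit_divdiff a G)"
proof -
  define b where "b \<sigma> = bil (\<sigma> base_pt) (cvec a)" for \<sigma>
  define d where "d \<sigma> = disc (\<sigma> base_pt)" for \<sigma>
  have a: "refl a \<in> W" by (rule refl_group_refl[OF assms])
  have b: "b (refl a \<circ> \<sigma>) = - b \<sigma>" for \<sigma>
    by (simp add: b_def o_apply bil_refl_left refl_self[OF root_nonzero[OF assms]] bil_simps)
  have d: "d (refl a \<circ> \<sigma>) = - d \<sigma>" for \<sigma>
    by (simp add: d_def o_apply disc_orbit[OF a] sgn_of_refl[OF assms] pointwise)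
  have "(\<Sum>\<sigma>\<in>W. F (refl a \<circ> \<sigma>) * G \<sigma> / (b \<sigma> * d \<sigma>))
    = (\<Sum>\<sigma>\<in>W. F (refl a \<circ> (refl a \<circ> \<sigma>)) * G (refl a \<circ> \<sigma>) / (b (refl a \<circ> \<sigma>) * d (refl a \<circ> \<sigma>)))"
    by (rule sum.reindex_bij_betw[OF bij_refl_group_comp[OF a], symmetric])
  also have "\<dots> = (\<Sum>\<sigma>\<in>W. F \<sigma> * G (refl a \<circ> \<sigma>) / (b \<sigma> * d \<sigma>))"
  proof (rule sum.cong[OF refl])
    fix \<sigma> :: "complex ^ 'n \<Rightarrow> complex ^ 'n"
    have "refl a \<circ> (refl a \<circ> \<sigma>) = \<sigma>" by (simp add: fun_eq_iff o_apply refl_refl)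
    then show "F (refl a \<circ> (refl a \<circ> \<sigma>)) * G (refl a \<circ> \<sigma>) / (b (refl a \<circ> \<sigma>) * d (refl a \<circ> \<sigma>)) = F \<sigma> * G (refl a \<circ> \<sigma>) / (b \<sigma> * d \<sigma>)"
      unfolding b d minus_mult_minus by (simp only:)
  qed
  finally have swap: "(\<Sum>\<sigma>\<in>W. F (refl a \<circ> \<sigma>) * G \<sigma> / (b \<sigma> * d \<sigma>)) = (\<Sum>\<sigma>\<in>W. F \<sigma> * G (refl a \<circ> \<sigma>) / (b \<sigma> * d \<sigma>))" .
  have "orbit_pair (orbit_divdiff a F) G = (\<Sum>\<sigma>\<in>W. F \<sigma> * G \<sigma> / (b \<sigma> * d \<sigma>) - F (refl a \<circ> \<sigma>) * G \<sigma> / (b \<sigma> * d \<sigma>))"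
    unfolding orbit_pair_def orbit_divdiff_def restr_def b_def[symmetric] d_def[symmetric]
    by (intro sum.cong refl) (simp add: diff_divide_distrib[symmetric] left_diff_distrib[symmetric])
  also have "\<dots> = (\<Sum>\<sigma>\<in>W. F \<sigma> * G \<sigma> / (b \<sigma> * d \<sigma>) - F \<sigma> * G (refl a \<circ> \<sigma>) / (b \<sigma> * d \<sigma>))"
    unfolding sum_subtractf swap ..
  also have "\<dots> = orbit_pair F (orbit_divdiff a G)"
    unfolding orbit_pair_def orbit_divdiff_def restr_def b_def[symmetric] d_def[symmetric]
    by (intro sum.cong refl) (simp add: diff_divide_distrib[symmetric] right_diff_distrib[symmetric])
  finally show ?thesis .
qed

lemma orbit_pair_orbit_divdiffs: "as \<in> lists \<Omega> \<Longrightarrow> orbit_pair (orbit_divdiffs (rev as) F) G = orbit_pair F (orbit_divdiffs as G)"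
proof (induction as arbitrary: F G rule: list.induct)
  case (Cons a as)
  then have "as \<in> lists \<Omega>" "a \<in> \<Psi>" using simple_root by auto
  then show ?case using Cons.IH by (simp add: orbit_divdiffs_append orbit_divdiffs_Cons orbit_divdiffs_Nil orbit_pair_orbit_divdiff)
qed (simp add: orbit_divdiffs_Nil)

text \<open>Invariants are constant on the orbit, so an invariant of positive degree can be replaced
  by a constant. The condition of having the values of a polynomial of smaller degree is stable
  under the operations in \<open>Ann_homogeneous_induct\<close>.\<close>

lemma orbit_values_reduce_homogeneous: assumes "f \<in> Ann" "f \<in> Lams {k}" shows "\<exists>g\<in>Lams {..<k}. orbit_values g = orbit_values f"
proof -
  have "f \<in> {f. \<exists>g\<in>Lams {..<k}. orbit_values g = orbit_values f}"
  proof (rule Ann_homogeneous_induct[of "\<lambda>k. {f. \<exists>g\<in>Lams {..<k}. orbit_values g = orbit_values f}", OF _ _ _ _ _ _ assms])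
    show "0 \<in> {f. \<exists>g\<in>Lams {..<k}. orbit_values g = orbit_values f}" for k using Lams_zero by auto
  next
    fix k f g assume "f \<in> {f. \<exists>g\<in>Lams {..<k}. orbit_values g = orbit_values f}" "g \<in> {f. \<exists>g\<in>Lams {..<k}. orbit_values g = orbit_values f}"
    then obtain f' g' where "f' \<in> Lams {..<k}" "orbit_values f' = orbit_values f" "g' \<in> Lams {..<k}" "orbit_values g' = orbit_values g" by auto
    then show "f + g \<in> {f. \<exists>g\<in>Lams {..<k}. orbit_values g = orbit_values f}"
      by (intro CollectI bexI[of _ "f' + g'"]) (simp_all only: orbit_values_add Lams_add)
  next
    fix k c f assume "f \<in> {f. \<exists>g\<in>Lams {..<k}. orbit_values g = orbit_values f}"
    then obtain f' where "f' \<in> Lams {..<k}" "orbit_values f' = orbit_values f" by auto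
    then show "(\<lambda>x. c * f x) \<in> {f. \<exists>g\<in>Lams {..<k}. orbit_values g = orbit_values f}"
      by (intro CollectI bexI[of _ "\<lambda>x. c * f' x"]) (simp_all only: orbit_values_scale Lams_scale)
  next
    fix k f \<sigma> assume "f \<in> {f. \<exists>g\<in>Lams {..<k}. orbit_values g = orbit_values f}" and s: "\<sigma> \<in> W"
    then obtain f' where f': "f' \<in> Lams {..<k}" "orbit_values f' = orbit_values f" by auto
    have "orbit_values (act \<sigma> f') = orbit_values (act \<sigma> f)"
      unfolding orbit_values_eq_iff
    proof
      fix \<tau> assume "\<tau> \<in> W"
      then have "inv_into UNIV \<sigma> \<circ> \<tau> \<in> W" using s by (intro refl_group_comp refl_group_inv)
      then have "f' ((inv_into UNIV \<sigma> \<circ> \<tau>) base_pt) = f ((inv_into UNIV \<sigma> \<circ> \<tau>) base_pt)" using f'(2) unfolding orbit_values_eq_iff by blast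
      then show "act \<sigma> f' (\<tau> base_pt) = act \<sigma> f (\<tau> base_pt)" by (simp add: act_def o_apply)
    qed
    then show "act \<sigma> f \<in> {f. \<exists>g\<in>Lams {..<k}. orbit_values g = orbit_values f}"
      using f'(1) s by (intro CollectI bexI[of _ "act \<sigma> f'"] Lams_act refl_group_orthogonal)
  next
    fix k f a assume "f \<in> {f. \<exists>g\<in>Lams {..<k}. orbit_values g = orbit_values f}"
    then obtain f' where f': "f' \<in> Lams {..<k}" "orbit_values f' = orbit_values f" by auto
    have "linform a * f' \<in> Lams {..<Suc k}" by (rule Lams_mult[OF Lams_linform[of "{1}"] f'(1)]) auto
    moreover have "orbit_values (linform a * f') = orbit_values (linform a * f)" using f'(2) unfolding orbit_values_eq_iff by (simp add: pointwise)
    ultimately show "linform a * f \<in> {f. \<exists>g\<in>Lams {..<Suc k}. orbit_values g = orbit_values f}" by blast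
  next
    fix k f assume f: "f \<in> Lams {Suc k}" "f \<in> invariants W"
    have "f (\<sigma> base_pt) = f base_pt" if "\<sigma> \<in> W" for \<sigma>
    proof -
      have "act (inv_into UNIV \<sigma>) f = f" using f(2) refl_group_inv[OF that] by (simp add: invariants_def)
      from fun_cong[OF this, of base_pt] show ?thesis by (simp add: act_def refl_group_inv_comp(3)[OF that])
    qed
    then have "orbit_values (\<lambda>x. f base_pt) = orbit_values f" unfolding orbit_values_eq_iff by simp
    then show "f \<in> {f. \<exists>g\<in>Lams {..<Suc k}. orbit_values g = orbit_values f}"
      by (intro CollectI bexI[of _ "\<lambda>x. f base_pt"] Lams_const) auto
  qed
  then show ?thesis by simp
qed

text \<open>Homogeneous polynomials of degree above m are in the radical, so their degree can be
  lowered repeatedly without changing the values on the orbit.\<close>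

lemma orbit_values_reduce: assumes "f \<in> Lam" shows "\<exists>g\<in>Lams {..m}. orbit_values g = orbit_values f"
proof -
  obtain k where "f \<in> Lams {..k}" using Lams_bounded[OF assms] by auto
  then show ?thesis
  proof (induction k arbitrary: f)
    case 0
    then have "f \<in> Lams {..m}" by (rule Lams_mono[rotated]) auto
    then show ?case by auto
  next
    case (Suc k)
    show ?case
    proof (cases "Suc k \<le> m")
      case True
      then have "f \<in> Lams {..m}" by (intro Lams_mono[OF _ Suc(2)]) auto
      then show ?thesis by auto
    next
      case False
      have "f \<in> Lams ({..k} \<union> {Suc k})" by (rule Lams_mono[OF _ Suc(2)]) auto
      then obtain g h where gh: "g \<in> Lams {..k}" "h \<in> Lams {Suc k}" "f = g + h" by (rule Lams_Un)
      have "h \<in> Ann" using False by (intro Ann_high_degree[OF gh(2)]) auto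
      then obtain h' where h': "h' \<in> Lams {..<Suc k}" "orbit_values h' = orbit_values h" using orbit_values_reduce_homogeneous[OF _ gh(2)] by auto
      have "g + h' \<in> Lams {..k}" using gh(1) h'(1) by (intro Lams_add) (simp_all add: lessThan_Suc_atMost)
      from Suc.IH[OF this] show ?thesis unfolding gh(3) orbit_values_add h'(2) .
    qed
  qed
qed

text \<open>Interpolation by a product of affine functions, one for each other point of the orbit,
  chosen from a coordinate that separates it from the base point. The degree of the product is then
  reduced to m.\<close>

lemma orbit_values_delta: "\<exists>f\<in>Lams {..m}. orbit_values f = (\<lambda>\<sigma>. if \<sigma> = id then 1 else 0)"
proof -
  have sep: "\<exists>l\<in>Lam. l base_pt = 1 \<and> l (\<sigma> base_pt) = 0" if s: "\<sigma> \<in> W - {id}" for \<sigma>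
  proof -
    have "\<sigma> base_pt \<noteq> base_pt" using orbit_free s by auto
    then obtain i where i: "\<sigma> base_pt $ i \<noteq> base_pt $ i" by (auto simp: Finite_Cartesian_Product.vec_eq_iff)
    let ?e = "axis i (1 :: complex)"
    have e: "bil x ?e = x $ i" for x
    proof -
      have "bil x ?e = (\<Sum>j\<in>UNIV. if j = i then x $ j else 0)"
        unfolding bil_def by (rule sum.cong) (auto simp: axis_def pointwise)
      then show ?thesis by simp
    qed
    let ?l = "\<lambda>x. 1 / (base_pt $ i - \<sigma> base_pt $ i) * (linform ?e + (\<lambda>x. - (\<sigma> base_pt $ i))) x"
    have "?l \<in> Lam" by (intro Lam_scale Lam_add Lam_linform Lam_const)
    moreover have "?l base_pt = 1 \<and> ?l (\<sigma> base_pt) = 0" using i by (simp add: pointwise linform_def e)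
    ultimately show ?thesis by (intro bexI[of _ ?l])
  qed
  define l where "l \<sigma> = (SOME q. q \<in> Lam \<and> q base_pt = 1 \<and> q (\<sigma> base_pt) = 0)" for \<sigma> :: "complex ^ 'n \<Rightarrow> complex ^ 'n"
  have l: "l \<sigma> \<in> Lam \<and> l \<sigma> base_pt = 1 \<and> l \<sigma> (\<sigma> base_pt) = 0" if "\<sigma> \<in> W - {id}" for \<sigma>
    unfolding l_def by (rule someI_ex[OF sep[OF that, unfolded Bex_def]])
  define p where "p = (\<Prod>\<sigma>\<in>W - {id}. l \<sigma>)"
  have "p \<in> Lam" unfolding p_def using l by (intro Lam_prod) auto
  then obtain f where f: "f \<in> Lams {..m}" "orbit_values f = orbit_values p" using orbit_values_reduce by auto
  have "orbit_values p = (\<lambda>\<sigma>. if \<sigma> = id then 1 else 0)"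
  proof
    fix \<sigma>
    have 1: "p base_pt = 1" unfolding p_def prod_pointwise using l by (intro prod.neutral) auto
    have 2: "p (\<sigma> base_pt) = 0" if "\<sigma> \<in> W" "\<sigma> \<noteq> id"
      unfolding p_def prod_pointwise using that l[of \<sigma>] finite_W by (intro prod_zero) auto
    show "orbit_values p \<sigma> = (if \<sigma> = id then 1 else 0)"
      using 1 2 refl_group_id by (cases "\<sigma> \<in> W"; cases "\<sigma> = id") (auto simp: orbit_values_def restr_def id_apply)
  qed
  then show ?thesis using f by auto
qed

end


lemma Lams_empty: "f \<in> Lams {} \<Longrightarrow> f = 0"
  by (rule Lams_disjoint[of f "{}" "{}"]) auto

section \<open>Polynomials dual to the divided differences\<close>

context simple_roots
begin

definition delta :: "complex ^ 'n \<Rightarrow> complex" where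
  "delta = (SOME f. f \<in> Lams {..m} \<and> orbit_values f = (\<lambda>\<sigma>. if \<sigma> = id then 1 else 0))"

lemma delta: "delta \<in> Lams {..m}" "orbit_values delta = (\<lambda>\<sigma>. if \<sigma> = id then 1 else 0)"
  unfolding delta_def by (rule someI_ex[OF orbit_values_delta[unfolded Bex_def], THEN conjunct1],
    rule someI_ex[OF orbit_values_delta[unfolded Bex_def], THEN conjunct2])

text \<open>Under \<open>orbit_pair\<close> these represent the functionals
  \<open>divdiff_at_id\<close> up to the factor 1 / \<open>disc base_pt\<close>, with degree at most
  m minus the length: long elements give polynomials of low degree.\<close>

definition delta_divdiffs :: "(complex ^ 'n \<Rightarrow> complex ^ 'n) \<Rightarrow> complex ^ 'n \<Rightarrow> complex" where
  "delta_divdiffs u = divdiffs (rev (dual_word u)) delta"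

lemma rev_dual_word: "u \<in> W \<Longrightarrow> rev (dual_word u) \<in> lists \<Omega>"
  using dual_word(1)[of u] by (auto simp: in_lists_conv_set)

lemma Lams_delta_divdiffs: assumes "u \<in> W" shows "delta_divdiffs u \<in> Lams {k. len \<Omega> u + k \<le> m}"
  using Lams_divdiffs[OF not_0_set[OF rev_dual_word[OF assms]] delta(1)] unfolding delta_divdiffs_def
  by (simp add: dual_word(3)[OF assms] vimage_def)

text \<open>The divided differences move to the other argument, and what remains of
  \<open>delta\<close> picks out the summand of the identity.\<close>

lemma orbit_pair_delta_divdiffs: assumes "u \<in> W" shows "orbit_pair (orbit_values (delta_divdiffs u)) F = divdiff_at_id u F / disc base_pt"
proof -
  have "orbit_pair (orbit_values (delta_divdiffs u)) F = orbit_pair (orbit_values delta) (orbit_divdiffs (dual_word u) F)"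
    unfolding delta_divdiffs_def orbit_values_divdiffs[OF rev_dual_word[OF assms] Lams_Lam[OF delta(1)]] by (rule orbit_pair_orbit_divdiffs[OF dual_word(1)[OF assms]])
  also have "\<dots> = (\<Sum>\<sigma>\<in>W. if \<sigma> = id then divdiff_at_id u F / disc base_pt else 0)"
    unfolding orbit_pair_def delta(2) by (rule sum.cong) (auto simp: divdiff_at_id_def id_apply zero_fun_apply)
  also have "\<dots> = divdiff_at_id u F / disc base_pt" using finite_W refl_group_id[of \<Psi>] by simp
  finally show ?thesis .
qed

lemma orbit_pair_sum: "orbit_pair (\<Sum>v\<in>B. (\<lambda>\<sigma>. c v * v \<sigma>)) H = (\<Sum>v\<in>B. c v * orbit_pair v H)"
proof -
  have "orbit_pair (\<Sum>v\<in>B. (\<lambda>\<sigma>. c v * v \<sigma>)) H = (\<Sum>\<sigma>\<in>W. \<Sum>v\<in>B. c v * (v \<sigma> * H \<sigma> / disc (\<sigma> base_pt)))"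
    unfolding orbit_pair_def sum_pointwise sum_distrib_right sum_divide_distrib by (simp add: mult.assoc)
  also have "\<dots> = (\<Sum>v\<in>B. \<Sum>\<sigma>\<in>W. c v * (v \<sigma> * H \<sigma> / disc (\<sigma> base_pt)))" by (rule sum.swap)
  finally show ?thesis unfolding orbit_pair_def sum_distrib_left .
qed

lemma divdiff_at_id_orbit_values: assumes "u \<in> W" "f \<in> Lam" shows "divdiff_at_id u (orbit_values f) = divdiffs (dual_word u) f base_pt"
  unfolding divdiff_at_id_def orbit_values_divdiffs[OF dual_word(1)[OF assms(1)] assms(2), symmetric]
  using refl_group_id[of \<Psi>] by (simp add: orbit_values_def restr_def id_apply)

lemma divdiffs_lower:
  assumes "as \<in> lists \<Omega>" "f \<in> Lams A" "\<And>k. k \<in> A \<Longrightarrow> k < length as" shows "divdiffs as f = 0"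
proof (rule Lams_empty)
  have "(\<lambda>k. length as + k) -` A = {}" using assms(3) by fastforce
  then show "divdiffs as f \<in> Lams {}" using Lams_divdiffs[OF not_0_set[OF assms(1)] assms(2)] by simp
qed

lemma divdiffs_constant:
  assumes "as \<in> lists \<Omega>" "f \<in> Lams {..length as}" shows "divdiffs as f x = divdiffs as f 0"
proof (rule Lams_0_const)
  have "(\<lambda>k. length as + k) -` {..length as} = {0}" by auto
  then show "divdiffs as f \<in> Lams {0}" using Lams_divdiffs[OF not_0_set[OF assms(1)] assms(2)] by simp
qed

lemma divdiffs_higher:
  assumes "as \<in> lists \<Omega>" "f \<in> Lams {k}" "k > length as" shows "divdiffs as f 0 = 0"
proof (rule Lams_positive_at_0)
  have "(\<lambda>k. length as + k) -` {k} \<subseteq> {1..}" using assms(3) by auto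
  then show "divdiffs as f \<in> Lams {1..}"
    by (rule Lams_mono[OF _ Lams_divdiffs[OF not_0_set[OF assms(1)] assms(2)]])
qed

text \<open>The functions on the orbit that come from polynomials of degree at most \<open>k\<close> are counted from
  below by the \<open>delta_divdiffs\<close> and from above by the \<open>dual_orbit_fun\<close>; the two counts agree because multiplication by
  the longest element reverses lengths.\<close>

lemma orbit_values_surjective:
  assumes F: "F \<in> orbit_funs" "\<And>u. u \<in> W \<Longrightarrow> len \<Omega> u > k \<Longrightarrow> divdiff_at_id u F = 0"
  shows "\<exists>f\<in>Lams {..k}. orbit_values f = F"
proof -
  define A where "A = {w \<in> W. m \<le> len \<Omega> w + k}"
  define D where "D = {u \<in> W. len \<Omega> u \<le> k}"
  define B where "B = (\<lambda>w. orbit_values (delta_divdiffs w)) ` A"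
  have AW: "A \<subseteq> W" "finite A" "finite D" using finite_W by (auto simp: A_def D_def)
  have dual: "orbit_pair (orbit_values (delta_divdiffs w)) (dual_orbit_fun w') = (if w = w' then 1 / disc base_pt else 0)" if "w \<in> A" for w w'
  proof -
    have "w \<in> W" using that AW by auto
    then show ?thesis unfolding orbit_pair_delta_divdiffs[OF \<open>w \<in> W\<close>] dual_orbit_fun(2)[OF \<open>w \<in> W\<close>] by (simp add: zero_fun_apply)
  qed
  have BL: "B \<subseteq> orbit_values ` Lams {..k}"
  proof
    fix v assume "v \<in> B"
    then obtain w where w: "w \<in> A" "v = orbit_values (delta_divdiffs w)" by (auto simp: B_def)
    then have "w \<in> W" "m \<le> len \<Omega> w + k" by (auto simp: A_def)
    then have "delta_divdiffs w \<in> Lams {..k}" by (intro Lams_mono[OF _ Lams_delta_divdiffs]) auto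
    then show "v \<in> orbit_values ` Lams {..k}" using w by blast
  qed
  have span: "G \<in> funspace.span (dual_orbit_fun ` D)" if G: "G \<in> orbit_funs" "\<And>u. u \<in> W \<Longrightarrow> len \<Omega> u > k \<Longrightarrow> divdiff_at_id u G = 0" for G
  proof -
    have "(\<Sum>w\<in>W. (\<lambda>\<sigma>. divdiff_at_id w G * dual_orbit_fun w \<sigma>)) \<in> funspace.span (dual_orbit_fun ` D)"
    proof (rule funspace.span_sum)
      fix w assume w: "w \<in> W"
      show "(\<lambda>\<sigma>. divdiff_at_id w G * dual_orbit_fun w \<sigma>) \<in> funspace.span (dual_orbit_fun ` D)"
      proof (cases "len \<Omega> w \<le> k")
        case True
        then show ?thesis using w by (intro funspace.span_scale funspace.span_base imageI) (simp add: D_def)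
      next
        case False
        then have "divdiff_at_id w G = 0" using G(2) w by auto
        then have *: "(\<lambda>\<sigma>. divdiff_at_id w G * dual_orbit_fun w \<sigma>) = 0" by (simp add: pointwise)
        show ?thesis unfolding * by (rule funspace.span_zero)
      qed
    qed
    then show ?thesis using dual_orbit_fun_expansion[OF G(1)] by simp
  qed
  have low: "orbit_values f \<in> funspace.span (dual_orbit_fun ` D)" if "f \<in> Lams {..k}" for f
  proof (rule span[OF orbit_values_orbit_funs])
    fix u assume u: "u \<in> W" "len \<Omega> u > k"
    have "divdiffs (dual_word u) f = 0" by (rule divdiffs_lower[OF dual_word(1)[OF u(1)] that]) (use u dual_word(3)[OF u(1)] in auto)
    then show "divdiff_at_id u (orbit_values f) = 0" unfolding divdiff_at_id_orbit_values[OF u(1) Lams_Lam[OF that]] by (simp add: pointwise)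
  qed
  have inj: "inj_on (\<lambda>w. orbit_values (delta_divdiffs w)) A"
  proof (rule inj_onI)
    fix w w' assume w: "w \<in> A" "w' \<in> A" "orbit_values (delta_divdiffs w) = orbit_values (delta_divdiffs w')"
    have "orbit_pair (orbit_values (delta_divdiffs w)) (dual_orbit_fun w) = orbit_pair (orbit_values (delta_divdiffs w')) (dual_orbit_fun w)" using w(3) by simp
    then show "w = w'" unfolding dual[OF w(1)] dual[OF w(2)] using disc_base_pt by (auto split: if_splits)
  qed
  then have cardB: "card B = card A" unfolding B_def by (rule card_image)
  have finB: "finite B" using AW by (simp add: B_def)
  have indep: "funspace.independent B"
  proof
    assume "funspace.dependent B"
    then obtain c where c: "\<exists>v\<in>B. c v \<noteq> 0" "(\<Sum>v\<in>B. (\<lambda>\<sigma>. c v * v \<sigma>)) = 0"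
      unfolding funspace.dependent_finite[OF finB] by blast
    then obtain w where w: "w \<in> A" "c (orbit_values (delta_divdiffs w)) \<noteq> 0" by (auto simp: B_def)
    let ?v = "orbit_values (delta_divdiffs w)"
    have "orbit_pair (\<Sum>v\<in>B. (\<lambda>\<sigma>. c v * v \<sigma>)) (dual_orbit_fun w) = 0"
      unfolding c(2) orbit_pair_def by (simp add: pointwise)
    then have "(\<Sum>v\<in>B. c v * orbit_pair v (dual_orbit_fun w)) = 0" unfolding orbit_pair_sum .
    moreover have "(\<Sum>v\<in>B. c v * orbit_pair v (dual_orbit_fun w)) = (\<Sum>v\<in>B. if v = ?v then c v / disc base_pt else 0)"
    proof (rule sum.cong[OF refl])
      fix v assume "v \<in> B"
      then obtain w' where w': "w' \<in> A" "v = orbit_values (delta_divdiffs w')" by (auto simp: B_def)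
      show "c v * orbit_pair v (dual_orbit_fun w) = (if v = ?v then c v / disc base_pt else 0)"
      proof (cases "v = ?v")
        case True
        then show ?thesis using dual[OF w(1), of w] by simp
      next
        case False
        then have "w' \<noteq> w" using w' by auto
        then have "orbit_pair v (dual_orbit_fun w) = 0" unfolding w'(2) dual[OF w'(1)] by (simp only: if_False)
        then show ?thesis using False by (simp only: if_False mult_zero_right)
      qed
    qed
    moreover have "?v \<in> B" using w by (auto simp: B_def)
    ultimately have "c ?v / disc base_pt = 0" using finB by (simp only: sum.delta if_True)
    then show False using w(2) disc_base_pt by simp
  qed
  have "card D \<le> card A"
  proof (rule card_inj_on_le[OF _ _ AW(2)])
    have "inj_on (\<lambda>\<sigma>. longest \<Omega> W \<circ> \<sigma>) W"
      using bij_refl_group_comp[OF longest_inverts(1)] by (rule bij_betw_imp_inj_on)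
    then show "inj_on (\<lambda>\<sigma>. longest \<Omega> W \<circ> \<sigma>) D" by (rule inj_on_subset) (auto simp: D_def)
    have "longest \<Omega> W \<circ> u \<in> A" if "u \<in> D" for u
    proof -
      have u: "u \<in> W" "len \<Omega> u \<le> k" using that by (auto simp: D_def)
      have "longest \<Omega> W \<circ> u \<in> W" using longest_inverts(1) u(1) by (rule refl_group_comp)
      then show ?thesis using len_longest_comp[OF u(1)] u(2) by (simp add: A_def)
    qed
    then show "(\<lambda>\<sigma>. longest \<Omega> W \<circ> \<sigma>) ` D \<subseteq> A" by blast
  qed
  \<comment> \<open>Otherwise adding F to B would give an independent set with more elements than
    the spanning set indexed by D.\<close>
  have "F \<in> funspace.span B"
  proof (rule ccontr)
    assume nF: "F \<notin> funspace.span B"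
    then have ind: "funspace.independent (insert F B)" by (rule funspace.independent_insertI[OF _ indep])
    have "B \<subseteq> funspace.span (dual_orbit_fun ` D)"
    proof
      fix v assume "v \<in> B"
      then obtain f where "f \<in> Lams {..k}" "v = orbit_values f" using BL by auto
      then show "v \<in> funspace.span (dual_orbit_fun ` D)" using low by simp
    qed
    moreover have "F \<in> funspace.span (dual_orbit_fun ` D)" by (rule span[OF F])
    ultimately have sub: "insert F B \<subseteq> funspace.span (dual_orbit_fun ` D)" by simp
    have "finite (dual_orbit_fun ` D)" using AW by simp
    from funspace.independent_span_bound[OF this ind sub]
    have "card (insert F B) \<le> card (dual_orbit_fun ` D)" ..
    moreover have "F \<notin> B"
    proof
      assume "F \<in> B"
      then have "F \<in> funspace.span B" by (rule funspace.span_base)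
      then show False using nF by simp
    qed
    ultimately have "Suc (card B) \<le> card (dual_orbit_fun ` D)" using finB by simp
    then show False using card_image_le[OF AW(3), of dual_orbit_fun] \<open>card D \<le> card A\<close> cardB by simp
  qed
  moreover have "funspace.subspace (orbit_values ` Lams {..k})"
    unfolding funspace.subspace_def
  proof (intro conjI ballI allI)
    have "orbit_values 0 = 0" by (simp add: orbit_values_def restr_def pointwise)
    then show "0 \<in> orbit_values ` Lams {..k}" using Lams_zero[of "{..k}"] by (intro image_eqI[of _ _ 0]) auto
    fix f g assume "f \<in> orbit_values ` Lams {..k}" "g \<in> orbit_values ` Lams {..k}"
    then obtain f' g' where "f' \<in> Lams {..k}" "f = orbit_values f'" "g' \<in> Lams {..k}" "g = orbit_values g'" by auto
    then show "f + g \<in> orbit_values ` Lams {..k}" by (intro image_eqI[of _ _ "f' + g'"]) (simp_all only: orbit_values_add Lams_add)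
  next
    fix c f assume "f \<in> orbit_values ` Lams {..k}"
    then obtain f' where "f' \<in> Lams {..k}" "f = orbit_values f'" by auto
    then show "(\<lambda>x. c * f x) \<in> orbit_values ` Lams {..k}" by (intro image_eqI[of _ _ "\<lambda>x. c * f' x"]) (simp_all only: orbit_values_scale Lams_scale)
  qed
  ultimately have "F \<in> orbit_values ` Lams {..k}" using funspace.span_minimal[OF BL] by auto
  then show ?thesis by auto
qed

text \<open>The dual function on the orbit lifts to degree at most the length of w, and the top
  component of the lift is the witness. Longer words kill it, shorter ones leave positive degree,
  and words of equal length give constants, for which evaluation at 0 and at the base point
  agree.\<close>

lemma dual_polynomial:
  assumes w: "w \<in> W"
  shows "\<exists>f\<in>Lam. \<forall>u\<in>W. divdiffs (dual_word u) f 0 = (if u = w then 1 else 0)"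
proof -
  have "\<exists>p\<in>Lams {..len \<Omega> w}. orbit_values p = dual_orbit_fun w"
  proof (rule orbit_values_surjective[OF dual_orbit_fun(1)])
    fix u assume "u \<in> W" "len \<Omega> u > len \<Omega> w"
    then show "divdiff_at_id u (dual_orbit_fun w) = 0" using dual_orbit_fun(2)[of u w] by auto
  qed
  then obtain p where p: "p \<in> Lams {..len \<Omega> w}" "orbit_values p = dual_orbit_fun w" by auto
  have "p \<in> Lams ({..<len \<Omega> w} \<union> {len \<Omega> w})" by (rule Lams_mono[OF _ p(1)]) auto
  then obtain g h where gh: "g \<in> Lams {..<len \<Omega> w}" "h \<in> Lams {len \<Omega> w}" "p = g + h" by (rule Lams_Un)
  have "divdiffs (dual_word u) h 0 = (if u = w then 1 else 0)" if u: "u \<in> W" for u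
  proof -
    note wdu = dual_word[OF u]
    consider "len \<Omega> u = len \<Omega> w" | "len \<Omega> u < len \<Omega> w" | "len \<Omega> u > len \<Omega> w" by linarith
    then show ?thesis
    proof cases
      case 1
      have "divdiffs (dual_word u) g = 0" using wdu 1 by (intro divdiffs_lower[OF wdu(1) gh(1)]) auto
      moreover have "divdiffs (dual_word u) p = divdiffs (dual_word u) g + divdiffs (dual_word u) h"
        unfolding gh(3) by (rule divdiffs_add[OF not_0_set[OF wdu(1)] Lams_Lam[OF gh(1)] Lams_Lam[OF gh(2)]])
      ultimately have "divdiffs (dual_word u) p = divdiffs (dual_word u) h" by simp
      then have "divdiffs (dual_word u) h 0 = divdiffs (dual_word u) p 0" by simp
      also have "\<dots> = divdiffs (dual_word u) p base_pt"
        using p(1) 1 wdu(3) by (intro divdiffs_constant[OF wdu(1), symmetric]) simp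
      also have "\<dots> = divdiff_at_id u (dual_orbit_fun w)" using divdiff_at_id_orbit_values[OF u Lams_Lam[OF p(1)]] p(2) by simp
      finally show ?thesis using dual_orbit_fun(2)[OF u] by simp
    next
      case 2
      then show ?thesis using divdiffs_higher[OF wdu(1) gh(2)] wdu(3) by auto
    next
      case 3
      then have "divdiffs (dual_word u) h = 0" using wdu by (intro divdiffs_lower[OF wdu(1) gh(2)]) auto
      moreover have "u \<noteq> w" using 3 by auto
      ultimately show ?thesis by (simp only: zero_fun_apply if_False)
    qed
  qed
  then show ?thesis using Lams_Lam[OF gh(2)] by blast
qed

text \<open>In degree at most m the antisymmetrization of p is a constant times \<open>disc\<close>.
  Evaluation at the base point shows that the constant is 0.\<close>

lemma pair_vanishing_on_orbit:
  assumes "p \<in> Lams {..m}" "\<And>\<sigma>. \<sigma> \<in> W \<Longrightarrow> p (\<sigma> base_pt) = 0" shows "theta_pair p disc = 0"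
proof -
  have L: "p \<in> Lam" using assms(1) by (rule Lams_Lam)
  obtain h where h: "h \<in> Lam" "alt \<Psi> p = disc * h" using alt_divisible[OF L] by auto
  obtain h1 where h1: "h1 \<in> Lams {1..}" "h = (\<lambda>x. h 0) + h1" using split_const[OF h(1)] .
  have eq: "alt \<Psi> p - (\<lambda>x. h 0 * disc x) = disc * h1"
    unfolding h(2) by (subst h1(2)) (simp add: pointwise algebra_simps)
  have "disc * h1 = 0"
  proof (rule Lams_disjoint)
    show "disc * h1 \<in> Lams {Suc m..}" by (rule Lams_mult[OF Lams_disc h1(1)]) auto
    have "disc \<in> Lams {..m}" by (rule Lams_mono[OF _ Lams_disc]) auto
    then show "disc * h1 \<in> Lams {..m}" unfolding eq[symmetric] by (intro Lams_diff Lams_alt assms(1) Lams_scale)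
  qed auto
  then have a: "alt \<Psi> p = (\<lambda>x. h 0 * disc x)" using eq by simp
  have "alt \<Psi> p base_pt = 0"
    unfolding alt_def sum_pointwise
  proof (rule sum.neutral, intro ballI)
    fix \<sigma> assume "\<sigma> \<in> W"
    then have "act \<sigma> p base_pt = 0" using assms(2)[OF refl_group_inv] by (simp add: act_def)
    then show "sgn_of \<sigma> * act \<sigma> p base_pt = 0" by simp
  qed
  then have "h 0 = 0" using disc_base_pt unfolding a by simp
  then have "theta_pair (alt \<Psi> p) disc = 0"
    unfolding h(2) pair_disc_mult[OF h(1)] by (simp add: pointwise)
  then show ?thesis using pair_alt[OF subset_refl L] finite_W refl_group_id by auto
qed

text \<open>For f homogeneous of degree k, divided differences along words of length at least k are
  constants and so vanish on the orbit as well. Hence the values of f on the orbit are those of some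
  g of smaller degree. Against a factor of degree m - k, the polynomial g pairs to 0 by degree, and
  f - g pairs to 0 by \<open>pair_vanishing_on_orbit\<close>.\<close>

lemma Ann_criterion:
  assumes "f \<in> Lam" "\<And>u. u \<in> W \<Longrightarrow> divdiffs (dual_word u) f 0 = 0" shows "f \<in> Ann"
proof -
  have hom: "f \<in> Ann" if f: "f \<in> Lams {k}" "\<And>u. u \<in> W \<Longrightarrow> divdiffs (dual_word u) f 0 = 0" for f k
  proof -
    have L: "f \<in> Lam" using f(1) by (rule Lams_Lam)
    have e: "divdiff_at_id u (orbit_values f) = 0" if u: "u \<in> W" "len \<Omega> u \<ge> k" for u
    proof -
      have "f \<in> Lams {..length (dual_word u)}" by (rule Lams_mono[OF _ f(1)]) (use u dual_word(3)[OF u(1)] in auto)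
      from divdiffs_constant[OF dual_word(1)[OF u(1)] this, of base_pt] show ?thesis
        unfolding divdiff_at_id_orbit_values[OF u(1) L] f(2)[OF u(1)] .
    qed
    have "\<exists>g\<in>Lams {..<k}. orbit_values g = orbit_values f"
    proof (cases k)
      case 0
      then have "orbit_values f = 0" using e by (intro divdiff_at_id_injective[OF orbit_values_orbit_funs]) auto
      then show ?thesis using Lams_zero[of "{..<k}"] by (intro bexI[of _ 0]) (auto simp: orbit_values_def restr_def pointwise)
    next
      case (Suc j)
      then have "\<exists>g\<in>Lams {..j}. orbit_values g = orbit_values f" using e by (intro orbit_values_surjective[OF orbit_values_orbit_funs]) auto
      then show ?thesis unfolding Suc lessThan_Suc_atMost .
    qed
    then obtain g where g: "g \<in> Lams {..<k}" "orbit_values g = orbit_values f" by auto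
    show ?thesis
    proof (rule AnnI[OF L])
      fix q :: "complex ^ 'n \<Rightarrow> complex" assume "q \<in> Lam"
      then have *: "q \<in> Lams ({j. k + j = m} \<union> {j. k + j \<noteq> m})"
        by (simp add: Lam_eq_Lams Collect_disj_eq[symmetric])
      from * obtain q1 q2 where q: "q1 \<in> Lams {j. k + j = m}" "q2 \<in> Lams {j. k + j \<noteq> m}" "q = q1 + q2" by (rule Lams_Un)
      note Q = q(1)[THEN Lams_Lam] q(2)[THEN Lams_Lam]
      have "f * q2 \<in> Lams {j. j \<noteq> m}" by (rule Lams_mult[OF f(1) q(2)]) auto
      then have 2: "theta_pair (f * q2) disc = 0" by (rule pair_orthogonal[OF _ Lams_disc]) auto
      have gq: "g * q1 \<in> Lams {..<m}" by (rule Lams_mult[OF g(1) q(1)]) auto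
      then have g0: "theta_pair (g * q1) disc = 0" by (rule pair_orthogonal[OF _ Lams_disc]) auto
      have "theta_pair (f * q1 - g * q1) disc = 0"
      proof (rule pair_vanishing_on_orbit)
        have "f * q1 \<in> Lams {..m}" by (rule Lams_mult[OF f(1) q(1)]) auto
        then show "f * q1 - g * q1 \<in> Lams {..m}" by (rule Lams_diff) (rule Lams_mono[OF _ gq], auto)
        fix \<sigma> assume "\<sigma> \<in> W"
        then have "g (\<sigma> base_pt) = f (\<sigma> base_pt)" by (rule bspec[OF g(2)[unfolded orbit_values_eq_iff]])
        then show "(f * q1 - g * q1) (\<sigma> base_pt) = 0" unfolding minus_apply times_fun_apply by simp
      qed
      then have 1: "theta_pair (f * q1) disc = 0"
        using pair_diff_left[OF Lam_mult[OF L Q(1)] Lams_Lam[OF gq] Lam_disc] g0 by simp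
      show "theta_pair (f * q) disc = 0"
        unfolding q(3) distrib_left pair_add_left[OF Lam_mult[OF L Q(1)] Lam_mult[OF L Q(2)] Lam_disc] 1 2 by simp
    qed
  qed
  obtain k where "f \<in> Lams {..k}" using Lams_bounded[OF assms(1)] by auto
  then have "\<exists>n. f \<in> Lams {..<n}" by (intro exI[of _ "Suc k"]) (simp add: lessThan_Suc_atMost)
  then obtain n where "f \<in> Lams {..<n}" ..
  then show ?thesis using assms(2)
  proof (induction n arbitrary: f)
    case 0
    then have "f = 0" by (intro Lams_empty) simp
    then show ?case using coinv_ideal_zero[of \<Psi>] coinv_ideal_eq_Ann by simp
  next
    case (Suc k)
    have "f \<in> Lams ({..<k} \<union> {k})" by (rule Lams_mono[OF _ Suc.prems(1)]) auto
    then obtain g h where gh: "g \<in> Lams {..<k}" "h \<in> Lams {k}" "f = g + h" by (rule Lams_Un)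
    have add: "divdiffs (dual_word u) f 0 = divdiffs (dual_word u) g 0 + divdiffs (dual_word u) h 0" if u: "u \<in> W" for u
      unfolding gh(3) divdiffs_add[OF not_0_set[OF dual_word(1)[OF u]] gh(1,2)[THEN Lams_Lam]] plus_fun_apply ..
    have h0: "divdiffs (dual_word u) h 0 = 0" if u: "u \<in> W" for u
    proof (cases "len \<Omega> u" k rule: linorder_cases)
      case less
      then show ?thesis using dual_word(3)[OF u] by (intro divdiffs_higher[OF dual_word(1)[OF u] gh(2)]) simp
    next
      case equal
      have "divdiffs (dual_word u) g = 0" using dual_word(3)[OF u] equal by (intro divdiffs_lower[OF dual_word(1)[OF u] gh(1)]) auto
      then show ?thesis using add[OF u] Suc.prems(2)[OF u] by (simp add: pointwise)
    next
      case greater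
      then have "divdiffs (dual_word u) h = 0" using dual_word(3)[OF u] by (intro divdiffs_lower[OF dual_word(1)[OF u] gh(2)]) auto
      then show ?thesis by (simp add: pointwise)
    qed
    have "g \<in> Ann"
    proof (rule Suc.IH[OF gh(1)])
      fix u assume u: "u \<in> W"
      show "divdiffs (dual_word u) g 0 = 0" using add[OF u] h0[OF u] Suc.prems(2)[OF u] by simp
    qed
    moreover have "h \<in> Ann" by (rule hom[OF gh(2) h0])
    ultimately show ?case unfolding gh(3) by (rule Ann_add)
  qed
qed

end


section \<open>Duals of Schubert polynomials\<close>

lemma scale_times: "(\<lambda>x. c * f x) * g = (\<lambda>x. c * (f * g) x)" for f g :: "'x \<Rightarrow> complex"
  by (simp only: times_fun_def mult.assoc)

context simple_roots
begin

abbreviation w0 :: "complex ^ 'n \<Rightarrow> complex ^ 'n" where "w0 \<equiv> longest \<Omega> W"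

lemma bij_inv_w0_comp: "bij_betw (\<lambda>\<sigma>. inv_into UNIV w0 \<circ> \<sigma>) W W"
  by (rule bij_refl_group_comp[OF refl_group_inv[OF longest_inverts(1)]])

lemma inv_w0_comp: "\<sigma> \<in> W \<Longrightarrow> inv_into UNIV w0 \<circ> \<sigma> \<in> W"
  by (intro refl_group_comp refl_group_inv longest_inverts(1))

text \<open>The word selected in \<open>divdiff_op\<close> for the inverse of \<sigma> times
  \<open>w0\<close> is the reverse of the \<open>dual_word\<close> of the inverse element. Both come
  from the same choice, so the equality is literal and involves no comparison of reduced
  words.\<close>

lemma schubert_eq_divdiffs:
  assumes "\<sigma> \<in> W"
  shows "schubert \<Psi> \<Omega> \<sigma> = (\<lambda>x. 1 / of_nat (card W) * divdiffs (rev (dual_word (inv_into UNIV w0 \<circ> \<sigma>))) disc x)"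
proof -
  have b: "bij \<sigma>" "bij w0" by (intro real_orthogonal_bij refl_group_orthogonal[OF assms] refl_group_orthogonal[OF longest_inverts(1)])+
  have "inv_into UNIV (inv_into UNIV w0 \<circ> \<sigma>) = inv_into UNIV \<sigma> \<circ> w0"
    unfolding o_inv_distrib[OF bij_imp_bij_inv[OF b(2)] b(1)] inv_inv_eq[OF b(2)] ..
  then show ?thesis
    unfolding schubert_def divdiff_op_def divdiffs_def dual_word_def rev_rev_ident disc_def by simp
qed

lemma Lam_schubert: assumes "\<sigma> \<in> W" shows "schubert \<Psi> \<Omega> \<sigma> \<in> Lam"
  unfolding schubert_eq_divdiffs[OF assms]
  by (intro Lam_scale Lam_divdiffs Lam_disc not_0_set rev_dual_word inv_w0_comp assms)

text \<open>The normalization 1 / |W| of the Schubert polynomials times the factor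
  (\<open>disc\<close>, \<open>disc\<close>) from \<open>pair_disc_mult\<close>.\<close>

definition schubert_const :: complex where
  "schubert_const = theta_pair disc disc / of_nat (card W)"

lemma schubert_const_nonzero: "schubert_const \<noteq> 0"
  unfolding schubert_const_def using pair_disc_disc_nonzero finite_W refl_group_id[of \<Psi>] by auto

lemma pair_schubert:
  assumes s: "\<sigma> \<in> W" and q: "q \<in> Lam"
  shows "theta_pair (q * schubert \<Psi> \<Omega> \<sigma>) disc = schubert_const * divdiffs (dual_word (inv_into UNIV w0 \<circ> \<sigma>)) q 0"
proof -
  let ?u = "inv_into UNIV w0 \<circ> \<sigma>"
  have u: "?u \<in> W" by (rule inv_w0_comp[OF s])
  have L: "divdiffs (rev (dual_word ?u)) disc \<in> Lam" by (intro Lam_divdiffs Lam_disc not_0_set rev_dual_word u)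
  have "theta_pair (divdiffs (rev (dual_word ?u)) disc * q) disc = theta_pair (disc * divdiffs (rev (rev (dual_word ?u))) q) disc"
    by (rule divdiffs_self_adjoint[OF rev_dual_word[OF u] Lam_disc q])
  also have "\<dots> = divdiffs (dual_word ?u) q 0 * theta_pair disc disc"
    unfolding rev_rev_ident by (intro pair_disc_mult Lam_divdiffs not_0_set dual_word(1) u q)
  finally have *: "theta_pair (divdiffs (rev (dual_word ?u)) disc * q) disc = divdiffs (dual_word ?u) q 0 * theta_pair disc disc" .
  have "q * schubert \<Psi> \<Omega> \<sigma> = (\<lambda>x. 1 / of_nat (card W) * (divdiffs (rev (dual_word ?u)) disc * q) x)"
    unfolding schubert_eq_divdiffs[OF s] by (simp add: pointwise)
  then have "theta_pair (q * schubert \<Psi> \<Omega> \<sigma>) disc = 1 / of_nat (card W) * theta_pair (divdiffs (rev (dual_word ?u)) disc * q) disc"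
    by (simp only: pair_scale_left Lam_mult L q Lam_disc)
  then show ?thesis unfolding * schubert_const_def by simp
qed

lemma dual_schubert_witness:
  assumes s: "\<sigma> \<in> W"
  shows "\<exists>q. q \<in> Lam \<and> (\<forall>\<tau>\<in>W. theta_pair (q * schubert \<Psi> \<Omega> \<tau>) disc = (if \<sigma> = \<tau> then 1 else 0))"
proof -
  obtain f where f: "f \<in> Lam" "\<forall>u\<in>W. divdiffs (dual_word u) f 0 = (if u = inv_into UNIV w0 \<circ> \<sigma> then 1 else 0)"
    using dual_polynomial[OF inv_w0_comp[OF s]] by auto
  have "theta_pair ((\<lambda>x. 1 / schubert_const * f x) * schubert \<Psi> \<Omega> \<tau>) disc = (if \<sigma> = \<tau> then 1 else 0)" if t: "\<tau> \<in> W" for \<tau>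
  proof -
    have i: "inv_into UNIV w0 \<circ> \<tau> = inv_into UNIV w0 \<circ> \<sigma> \<longleftrightarrow> \<tau> = \<sigma>"
      by (rule inj_on_eq_iff[OF bij_betw_imp_inj_on[OF bij_inv_w0_comp] t s])
    have "theta_pair ((\<lambda>x. 1 / schubert_const * f x) * schubert \<Psi> \<Omega> \<tau>) disc = 1 / schubert_const * theta_pair (f * schubert \<Psi> \<Omega> \<tau>) disc"
      unfolding scale_times by (intro pair_scale_left Lam_mult f(1) Lam_schubert t Lam_disc)
    also have "\<dots> = divdiffs (dual_word (inv_into UNIV w0 \<circ> \<tau>)) f 0"
      unfolding pair_schubert[OF t f(1)] using schubert_const_nonzero by simp
    also have "\<dots> = (if \<tau> = \<sigma> then 1 else 0)" unfolding f(2)[rule_format, OF inv_w0_comp[OF t]] i ..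
    finally show ?thesis by (simp only: eq_commute)
  qed
  then show ?thesis by (intro exI[of _ "\<lambda>x. 1 / schubert_const * f x"] conjI Lam_scale[OF f(1)] ballI)
qed

text \<open>A polynomial q, determined modulo the radical, for which \<open>Theta q disc\<close> is
  the dual Schubert polynomial; see \<open>dual_schubert_eq\<close>.\<close>

definition dual_poly :: "(complex ^ 'n \<Rightarrow> complex ^ 'n) \<Rightarrow> complex ^ 'n \<Rightarrow> complex" where
  "dual_poly \<sigma> = (SOME q. q \<in> Lam \<and> (\<forall>\<tau>\<in>W. theta_pair (q * schubert \<Psi> \<Omega> \<tau>) disc = (if \<sigma> = \<tau> then 1 else 0)))"

lemma dual_poly_facts:
  assumes "\<sigma> \<in> W"
  shows "dual_poly \<sigma> \<in> Lam \<and> (\<forall>\<tau>\<in>W. theta_pair (dual_poly \<sigma> * schubert \<Psi> \<Omega> \<tau>) disc = (if \<sigma> = \<tau> then 1 else 0))"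
  unfolding dual_poly_def by (rule someI_ex[OF dual_schubert_witness[OF assms]])

lemmas Lam_dual_poly = dual_poly_facts[THEN conjunct1]
  and pair_dual_poly = dual_poly_facts[THEN conjunct2, rule_format]

lemma Ann_if_schubert_orthogonal:
  assumes "f \<in> Lam" "\<And>\<tau>. \<tau> \<in> W \<Longrightarrow> theta_pair (f * schubert \<Psi> \<Omega> \<tau>) disc = 0" shows "f \<in> Ann"
proof (rule Ann_criterion[OF assms(1)])
  fix u assume "u \<in> W"
  then have "u \<in> (\<lambda>\<sigma>. inv_into UNIV w0 \<circ> \<sigma>) ` W" unfolding bij_betw_imp_surj_on[OF bij_inv_w0_comp] .
  then obtain \<sigma> where s: "u = inv_into UNIV w0 \<circ> \<sigma>" "\<sigma> \<in> W" by (rule imageE)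
  have "schubert_const * divdiffs (dual_word u) f 0 = 0"
    unfolding s(1) pair_schubert[OF s(2) assms(1), symmetric] by (rule assms(2)[OF s(2)])
  then show "divdiffs (dual_word u) f 0 = 0" using schubert_const_nonzero by simp
qed

lemma pair_schubert_sum:
  assumes "\<tau> \<in> W"
  shows "theta_pair ((\<Sum>\<sigma>\<in>W. (\<lambda>x. c \<sigma> * dual_poly \<sigma> x)) * schubert \<Psi> \<Omega> \<tau>) disc = c \<tau>"
proof -
  have "(\<Sum>\<sigma>\<in>W. (\<lambda>x. c \<sigma> * dual_poly \<sigma> x)) * schubert \<Psi> \<Omega> \<tau> = (\<Sum>\<sigma>\<in>W. (\<lambda>x. c \<sigma> * (dual_poly \<sigma> * schubert \<Psi> \<Omega> \<tau>) x))"
    unfolding sum_distrib_right by (simp only: times_fun_def mult.assoc)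
  moreover have "theta_pair (\<Sum>\<sigma>\<in>W. (\<lambda>x. c \<sigma> * (dual_poly \<sigma> * schubert \<Psi> \<Omega> \<tau>) x)) disc
    = (\<Sum>\<sigma>\<in>W. theta_pair (\<lambda>x. c \<sigma> * (dual_poly \<sigma> * schubert \<Psi> \<Omega> \<tau>) x) disc)"
    by (rule pair_sum_left) (intro Lam_scale Lam_mult Lam_dual_poly Lam_schubert assms Lam_disc | assumption)+
  moreover have "\<dots> = (\<Sum>\<sigma>\<in>W. if \<sigma> = \<tau> then c \<sigma> else 0)"
  proof (rule sum.cong[OF refl])
    fix \<sigma> assume s: "\<sigma> \<in> W"
    have "theta_pair (\<lambda>x. c \<sigma> * (dual_poly \<sigma> * schubert \<Psi> \<Omega> \<tau>) x) disc = c \<sigma> * theta_pair (dual_poly \<sigma> * schubert \<Psi> \<Omega> \<tau>) disc"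
      by (intro pair_scale_left Lam_mult Lam_dual_poly Lam_schubert assms s Lam_disc)
    then show "theta_pair (\<lambda>x. c \<sigma> * (dual_poly \<sigma> * schubert \<Psi> \<Omega> \<tau>) x) disc = (if \<sigma> = \<tau> then c \<sigma> else 0)"
      unfolding pair_dual_poly[OF s assms] by (simp only: mult_1_right mult_zero_right if_distrib[of "(*) (c \<sigma>)"])
  qed
  moreover have "\<dots> = c \<tau>" using finite_W assms by (simp only: sum.delta if_True)
  ultimately show ?thesis by simp
qed

text \<open>Pairings with Schubert polynomials detect the radical, so matching all of them
  determines a polynomial modulo \<open>Ann\<close>.\<close>

lemma dual_poly_expansion:
  assumes q: "q \<in> Lam"
  shows "q - (\<Sum>\<sigma>\<in>W. (\<lambda>x. theta_pair (q * schubert \<Psi> \<Omega> \<sigma>) disc * dual_poly \<sigma> x)) \<in> Ann"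
proof (rule Ann_if_schubert_orthogonal)
  have L: "(\<Sum>\<sigma>\<in>W. (\<lambda>x. theta_pair (q * schubert \<Psi> \<Omega> \<sigma>) disc * dual_poly \<sigma> x)) \<in> Lam"
    by (intro Lam_sum Lam_scale Lam_dual_poly)
  then show "q - (\<Sum>\<sigma>\<in>W. (\<lambda>x. theta_pair (q * schubert \<Psi> \<Omega> \<sigma>) disc * dual_poly \<sigma> x)) \<in> Lam" by (intro Lam_diff q)
  fix \<tau> assume t: "\<tau> \<in> W"
  show "theta_pair ((q - (\<Sum>\<sigma>\<in>W. (\<lambda>x. theta_pair (q * schubert \<Psi> \<Omega> \<sigma>) disc * dual_poly \<sigma> x))) * schubert \<Psi> \<Omega> \<tau>) disc = 0"
    unfolding left_diff_distrib pair_diff_left[OF Lam_mult[OF q Lam_schubert[OF t]] Lam_mult[OF L Lam_schubert[OF t]] Lam_disc] pair_schubert_sum[OF t]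
    by simp
qed

lemma Theta_Ann_disc: assumes "f \<in> Ann" shows "Theta f disc = 0"
proof (rule pair_nondegenerate)
  note L = Ann_Lam[OF assms]
  show "Theta f disc \<in> Lam" by (rule Lam_Theta[OF L Lam_disc])
  fix g :: "complex ^ 'n \<Rightarrow> complex" assume g: "g \<in> Lam"
  show "theta_pair g (Theta f disc) = 0"
    unfolding pair_mult[OF g L Lam_disc, symmetric] mult.commute[of g] by (rule AnnD[OF assms g])
qed

text \<open>Pairing with h factors through the quotient by the radical. There every f expands in the
  dual polynomials, so a q that represents h on these represents it everywhere.\<close>

lemma theta_perp_coinv_ideal:
  assumes h: "h \<in> theta_perp (coinv_ideal \<Psi>)" shows "\<exists>q\<in>Lam. h = Theta q disc"
proof -
  have L: "h \<in> Lam" and perp: "\<And>f. f \<in> Ann \<Longrightarrow> theta_pair f h = 0"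
    using h unfolding theta_perp_def coinv_ideal_eq_Ann by auto
  \<comment> \<open>Schubert polynomials are dual to \<open>dual_poly\<close> for the form (f, g) ->
    (fg, \<open>disc\<close>), so these coefficients are forced by testing against each
    \<open>dual_poly\<close>.\<close>
  define q where "q = (\<Sum>\<sigma>\<in>W. (\<lambda>x. theta_pair (dual_poly \<sigma>) h * schubert \<Psi> \<Omega> \<sigma> x))"
  have q: "q \<in> Lam" unfolding q_def by (intro Lam_sum Lam_scale Lam_schubert)
  have "h - Theta q disc = 0"
  proof (rule pair_nondegenerate)
    show "h - Theta q disc \<in> Lam" by (intro Lam_diff L Lam_Theta q Lam_disc)
    fix f :: "complex ^ 'n \<Rightarrow> complex" assume f: "f \<in> Lam"
    define c where "c \<sigma> = theta_pair (f * schubert \<Psi> \<Omega> \<sigma>) disc" for \<sigma>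
    let ?s = "\<Sum>\<sigma>\<in>W. (\<lambda>x. c \<sigma> * dual_poly \<sigma> x)"
    have s: "?s \<in> Lam" by (intro Lam_sum Lam_scale Lam_dual_poly)
    have "theta_pair (f - ?s) h = 0" unfolding c_def by (intro perp dual_poly_expansion f)
    then have "theta_pair f h = theta_pair ?s h" using pair_diff_left[OF f s L] by simp
    also have "\<dots> = (\<Sum>\<sigma>\<in>W. theta_pair (\<lambda>x. c \<sigma> * dual_poly \<sigma> x) h)"
      by (rule pair_sum_left) (intro Lam_scale Lam_dual_poly L | assumption)+
    also have "\<dots> = (\<Sum>\<sigma>\<in>W. theta_pair (\<lambda>x. theta_pair (dual_poly \<sigma>) h * (f * schubert \<Psi> \<Omega> \<sigma>) x) disc)"
    proof (rule sum.cong[OF refl])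
      fix \<sigma> assume w: "\<sigma> \<in> W"
      show "theta_pair (\<lambda>x. c \<sigma> * dual_poly \<sigma> x) h = theta_pair (\<lambda>x. theta_pair (dual_poly \<sigma>) h * (f * schubert \<Psi> \<Omega> \<sigma>) x) disc"
        unfolding pair_scale_left[OF Lam_dual_poly[OF w] L] pair_scale_left[OF Lam_mult[OF f Lam_schubert[OF w]] Lam_disc] c_def
        by (rule mult.commute)
    qed
    also have "\<dots> = theta_pair (\<Sum>\<sigma>\<in>W. (\<lambda>x. theta_pair (dual_poly \<sigma>) h * (f * schubert \<Psi> \<Omega> \<sigma>) x)) disc"
      by (rule pair_sum_left[symmetric]) (intro Lam_scale Lam_mult f Lam_schubert Lam_disc | assumption)+
    also have "(\<Sum>\<sigma>\<in>W. (\<lambda>x. theta_pair (dual_poly \<sigma>) h * (f * schubert \<Psi> \<Omega> \<sigma>) x)) = f * q"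
      unfolding q_def sum_distrib_left by (simp only: times_fun_def mult.left_commute)
    also have "theta_pair (f * q) disc = theta_pair f (Theta q disc)" by (rule pair_mult[OF f q Lam_disc])
    finally have "theta_pair f h = theta_pair f (Theta q disc)" .
    then show "theta_pair f (h - Theta q disc) = 0"
      unfolding pair_commute[OF f Lam_diff[OF L Lam_Theta[OF q Lam_disc]]]
        pair_diff_left[OF L Lam_Theta[OF q Lam_disc] f] pair_commute[OF f L] pair_commute[OF f Lam_Theta[OF q Lam_disc]] by simp
  qed
  then have "h = Theta q disc" by simp
  then show ?thesis using q by blast
qed

lemma pair_Theta_disc: assumes "q \<in> Lam" "f \<in> Lam" shows "theta_pair (Theta q disc) f = theta_pair (q * f) disc"
  unfolding pair_commute[OF Lam_Theta[OF assms(1) Lam_disc] assms(2)] pair_mult[OF assms(2,1) Lam_disc, symmetric] mult.commute[of f] ..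

lemma dual_schubert_eq:
  assumes s: "\<sigma> \<in> W" shows "dual_schubert \<Psi> \<Omega> \<sigma> = Theta (dual_poly \<sigma>) disc"
  unfolding dual_schubert_def
proof (rule the_equality)
  note L = Lam_dual_poly[OF s]
  show "Theta (dual_poly \<sigma>) disc \<in> theta_perp (coinv_ideal \<Psi>) \<and>
      (\<forall>\<tau>\<in>W. theta_pair (Theta (dual_poly \<sigma>) disc) (schubert \<Psi> \<Omega> \<tau>) = (if \<sigma> = \<tau> then 1 else 0))"
  proof (intro conjI ballI)
    have "theta_pair f (Theta (dual_poly \<sigma>) disc) = 0" if "f \<in> Ann" for f
      unfolding pair_mult[OF Ann_Lam[OF that] L Lam_disc, symmetric] by (rule AnnD[OF that L])
    then show "Theta (dual_poly \<sigma>) disc \<in> theta_perp (coinv_ideal \<Psi>)"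
      unfolding theta_perp_def coinv_ideal_eq_Ann using Lam_Theta[OF L Lam_disc] by simp
    show "theta_pair (Theta (dual_poly \<sigma>) disc) (schubert \<Psi> \<Omega> \<tau>) = (if \<sigma> = \<tau> then 1 else 0)" if "\<tau> \<in> W" for \<tau>
      unfolding pair_Theta_disc[OF L Lam_schubert[OF that]] by (rule pair_dual_poly[OF s that])
  qed
  fix p assume p: "p \<in> theta_perp (coinv_ideal \<Psi>) \<and>
      (\<forall>\<tau>\<in>W. theta_pair p (schubert \<Psi> \<Omega> \<tau>) = (if \<sigma> = \<tau> then 1 else 0))"
  obtain q where q: "q \<in> Lam" "p = Theta q disc" using theta_perp_coinv_ideal[OF p[THEN conjunct1]] by auto
  have "q - dual_poly \<sigma> \<in> Ann"
  proof (rule Ann_if_schubert_orthogonal[OF Lam_diff[OF q(1) L]])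
    fix \<tau> assume t: "\<tau> \<in> W"
    have "theta_pair (q * schubert \<Psi> \<Omega> \<tau>) disc = (if \<sigma> = \<tau> then 1 else 0)"
      unfolding pair_Theta_disc[OF q(1) Lam_schubert[OF t], symmetric] q(2)[symmetric] by (rule bspec[OF p[THEN conjunct2] t])
    then show "theta_pair ((q - dual_poly \<sigma>) * schubert \<Psi> \<Omega> \<tau>) disc = 0"
      unfolding left_diff_distrib pair_diff_left[OF Lam_mult[OF q(1) Lam_schubert[OF t]] Lam_mult[OF L Lam_schubert[OF t]] Lam_disc]
        pair_dual_poly[OF s t] by simp
  qed
  from Theta_Ann_disc[OF this] have "Theta (q - dual_poly \<sigma>) disc = 0" .
  moreover have "Theta (q - dual_poly \<sigma> + dual_poly \<sigma>) disc = Theta (q - dual_poly \<sigma>) disc + Theta (dual_poly \<sigma>) disc"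
    by (intro Theta_add Lam_diff q(1) L Lam_disc)
  ultimately show "p = Theta (dual_poly \<sigma>) disc" unfolding q(2) by simp
qed

section \<open>The functionals that make up the module\<close>

definition PS_char :: "(real ^ 'n) set \<Rightarrow> complex ^ 'n \<Rightarrow> (complex ^ 'n \<Rightarrow> complex) \<Rightarrow> (complex ^ 'n \<Rightarrow> complex) \<Rightarrow> complex" where
  "PS_char \<Phi> v q = restr (Gam \<Phi>) (\<lambda>g. theta_pair (q * (\<lambda>x. g (x + v))) disc)"

lemma Gam_Lam: "g \<in> Gam \<Phi> \<Longrightarrow> g \<in> Lam"
  by (simp add: invariants_def)

lemma restr_eqI: "(\<And>g. g \<in> X \<Longrightarrow> f g = h g) \<Longrightarrow> restr X f = restr X h"
  by (rule ext) (simp add: restr_def)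

text \<open>By symmetry of the pairing, the operator of \<open>Theta q disc\<close> applied to f and
  evaluated at 0 is the pairing of qf with \<open>disc\<close>.\<close>

lemma PS_char_PS_functional:
  assumes "\<sigma> \<in> W" shows "restr (Gam \<Phi>) (PS_functional \<Psi> \<Omega> v \<sigma>) = PS_char \<Phi> v (dual_poly \<sigma>)"
  unfolding PS_char_def
proof (rule restr_eqI)
  fix g :: "complex ^ 'n \<Rightarrow> complex" assume "g \<in> Gam \<Phi>"
  then have L: "(\<lambda>x. g (x + v)) \<in> Lam" by (intro Lam_translate Gam_Lam)
  show "PS_functional \<Psi> \<Omega> v \<sigma> g = theta_pair (dual_poly \<sigma> * (\<lambda>x. g (x + v))) disc"
    unfolding PS_functional_def dual_schubert_eq[OF assms] theta_pair_def[symmetric]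
    by (rule pair_Theta_disc[OF Lam_dual_poly[OF assms] L])
qed

lemma PS_char_add: assumes "p \<in> Lam" "q \<in> Lam" shows "PS_char \<Phi> v (p + q) = PS_char \<Phi> v p + PS_char \<Phi> v q"
proof
  fix g
  show "PS_char \<Phi> v (p + q) g = (PS_char \<Phi> v p + PS_char \<Phi> v q) g"
  proof (cases "g \<in> Gam \<Phi>")
    case True
    then show ?thesis unfolding plus_fun_apply[of _ _ g] PS_char_def restr_def distrib_right
      by (simp only: if_True pair_add_left Lam_mult Lam_translate Gam_Lam assms Lam_disc)
  qed (simp add: plus_fun_apply PS_char_def restr_def)
qed

lemma PS_char_scale: assumes "q \<in> Lam" shows "PS_char \<Phi> v (\<lambda>x. c * q x) = (\<lambda>g. c * PS_char \<Phi> v q g)"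
proof
  fix g
  show "PS_char \<Phi> v (\<lambda>x. c * q x) g = c * PS_char \<Phi> v q g"
  proof (cases "g \<in> Gam \<Phi>")
    case True
    then show ?thesis unfolding PS_char_def restr_def scale_times
      by (simp add: pair_scale_left Lam_mult Lam_translate Gam_Lam assms Lam_disc)
  qed (simp add: PS_char_def restr_def)
qed

lemma PS_char_Ann: assumes "q \<in> Ann" shows "PS_char \<Phi> v q = 0"
proof
  fix g
  show "PS_char \<Phi> v q g = 0 g"
    unfolding PS_char_def restr_def zero_fun_apply using AnnD[OF assms Lam_translate[OF Gam_Lam]] by simp
qed

text \<open>Admitting all polynomials q in place of the \<open>dual_poly\<close> adds nothing, since
  q matters only modulo the radical. In this form the action of invariants is multiplication on
  q.\<close>

lemma PS_module_eq: "PS_module \<Phi> \<Psi> \<Omega> v = PS_char \<Phi> v ` Lam"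
proof
  have P: "PS_module \<Phi> \<Psi> \<Omega> v = funspace.span ((\<lambda>\<sigma>. PS_char \<Phi> v (dual_poly \<sigma>)) ` W)"
    unfolding PS_module_def by (intro arg_cong[where f = funspace.span] image_cong refl PS_char_PS_functional)
  have "funspace.subspace (PS_char \<Phi> v ` Lam)"
    unfolding funspace.subspace_def
  proof (intro conjI ballI allI)
    show "0 \<in> PS_char \<Phi> v ` Lam"
      using PS_char_Ann[of 0] coinv_ideal_zero[of \<Psi>] unfolding coinv_ideal_eq_Ann
      by (intro image_eqI[of _ _ 0]) (auto intro: Lam_zero)
    fix f g assume "f \<in> PS_char \<Phi> v ` Lam" "g \<in> PS_char \<Phi> v ` Lam"
    then obtain p q where "p \<in> Lam" "f = PS_char \<Phi> v p" "q \<in> Lam" "g = PS_char \<Phi> v q" by auto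
    then show "f + g \<in> PS_char \<Phi> v ` Lam" by (intro image_eqI[of _ _ "p + q"]) (simp_all only: PS_char_add Lam_add)
  next
    fix c f assume "f \<in> PS_char \<Phi> v ` Lam"
    then obtain p where "p \<in> Lam" "f = PS_char \<Phi> v p" by auto
    then show "(\<lambda>x. c * f x) \<in> PS_char \<Phi> v ` Lam" by (intro image_eqI[of _ _ "\<lambda>x. c * p x"]) (simp_all only: PS_char_scale Lam_scale)
  qed
  then show "PS_module \<Phi> \<Psi> \<Omega> v \<subseteq> PS_char \<Phi> v ` Lam"
    unfolding P by (intro funspace.span_minimal) (auto intro!: imageI Lam_dual_poly)
  show "PS_char \<Phi> v ` Lam \<subseteq> PS_module \<Phi> \<Psi> \<Omega> v"
  proof
    fix \<xi> assume "\<xi> \<in> PS_char \<Phi> v ` Lam"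
    then obtain q where q: "q \<in> Lam" "\<xi> = PS_char \<Phi> v q" by auto
    define c where "c \<sigma> = theta_pair (q * schubert \<Psi> \<Omega> \<sigma>) disc" for \<sigma>
    let ?s = "\<Sum>\<sigma>\<in>W. (\<lambda>x. c \<sigma> * dual_poly \<sigma> x)"
    have s: "?s \<in> Lam" by (intro Lam_sum Lam_scale Lam_dual_poly)
    have "PS_char \<Phi> v (q - ?s) = 0" unfolding c_def by (intro PS_char_Ann dual_poly_expansion q)
    then have "\<xi> = PS_char \<Phi> v ?s" using PS_char_add[OF Lam_diff[OF q(1) s] s, of \<Phi> v] q(2) by simp
    moreover have "PS_char \<Phi> v (\<Sum>\<sigma>\<in>A. (\<lambda>x. c \<sigma> * dual_poly \<sigma> x)) \<in> PS_module \<Phi> \<Psi> \<Omega> v" if "A \<subseteq> W" for A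
      using finite_subset[OF that finite_W] that
    proof (induction A rule: finite_induct)
      case empty
      have "0 \<in> Ann" using coinv_ideal_zero[of \<Psi>] unfolding coinv_ideal_eq_Ann .
      from PS_char_Ann[OF this] show ?case unfolding P sum.empty by (simp add: funspace.span_zero)
    next
      case (insert \<sigma> A)
      then have a: "\<sigma> \<in> W" "A \<subseteq> W" by auto
      have "(\<lambda>x. c \<sigma> * dual_poly \<sigma> x) \<in> Lam" "(\<Sum>\<sigma>\<in>A. (\<lambda>x. c \<sigma> * dual_poly \<sigma> x)) \<in> Lam"
        using a by (auto intro!: Lam_scale Lam_dual_poly Lam_sum)
      then have e: "PS_char \<Phi> v (\<Sum>\<sigma>\<in>insert \<sigma> A. (\<lambda>x. c \<sigma> * dual_poly \<sigma> x))
        = (\<lambda>g. c \<sigma> * PS_char \<Phi> v (dual_poly \<sigma>) g) + PS_char \<Phi> v (\<Sum>\<sigma>\<in>A. (\<lambda>x. c \<sigma> * dual_poly \<sigma> x))"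
        unfolding sum.insert[OF insert.hyps] using PS_char_scale[OF Lam_dual_poly[OF a(1)]] by (simp only: PS_char_add)
      have "(\<lambda>g. c \<sigma> * PS_char \<Phi> v (dual_poly \<sigma>) g) \<in> PS_module \<Phi> \<Psi> \<Omega> v"
        unfolding P by (intro funspace.span_scale funspace.span_base imageI a)
      then show ?case unfolding e using insert.IH[OF a(2)] unfolding P by (rule funspace.span_add)
    qed
    ultimately show "\<xi> \<in> PS_module \<Phi> \<Psi> \<Omega> v" by simp
  qed
qed

end


section \<open>Antisymmetrizing over the stabilizer\<close>

context simple_roots
begin

abbreviation roots_at :: "complex ^ 'n \<Rightarrow> (real ^ 'n) set" where
  "roots_at v \<equiv> {\<alpha> \<in> \<Psi>. bil v (cvec \<alpha>) = 0}"

abbreviation disc_at :: "complex ^ 'n \<Rightarrow> complex ^ 'n \<Rightarrow> complex" where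
  "disc_at v \<equiv> (\<Prod>\<beta>\<in>pos_at v. linform (cvec \<beta>))"

text \<open>By \<open>len_longest_min_coset_reps\<close> this is the length of the longest minimal
  coset representative when v is standard.\<close>

abbreviation codegree :: "complex ^ 'n \<Rightarrow> nat" where
  "codegree v \<equiv> m - card (pos_at v)"

lemma root_system_at: "root_system (roots_at v)"
proof -
  have neg: "- \<alpha> \<in> roots_at v" if "\<alpha> \<in> roots_at v" for \<alpha>
    using that minus_root by (auto simp: cvec_minus bil_simps)
  have "{\<beta> \<in> roots_at v. \<exists>c. cvec \<beta> = c *s cvec \<alpha>} = {\<alpha>, -\<alpha>}" if "\<alpha> \<in> roots_at v" for \<alpha>
  proof -
    have "{\<beta> \<in> roots_at v. \<exists>c. cvec \<beta> = c *s cvec \<alpha>} = {\<beta> \<in> \<Psi>. \<exists>c. cvec \<beta> = c *s cvec \<alpha>} \<inter> roots_at v" by auto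
    also have "\<dots> = {\<alpha>, -\<alpha>} \<inter> roots_at v" using root_line[of \<alpha>] that by simp
    also have "\<dots> = {\<alpha>, -\<alpha>}" using that neg[OF that] by auto
    finally show ?thesis .
  qed
  moreover have "refl_real \<alpha> \<beta> \<in> roots_at v" if "\<alpha> \<in> roots_at v" "\<beta> \<in> roots_at v" for \<alpha> \<beta>
  proof -
    have "bil v (cvec (refl_real \<alpha> \<beta>)) = bil (refl \<alpha> v) (cvec \<beta>)" by (simp add: refl_cvec bil_refl_left)
    also have "\<dots> = 0" using that refl_fixes[of v \<alpha>] by simp
    finally show ?thesis using that refl_real_root by simp
  qed
  ultimately show ?thesis unfolding root_system_def using finite_roots zero_not_root by auto
qed

context
  fixes v :: "complex ^ 'n" and J :: "(real ^ 'n) set"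
  assumes J: "J \<subseteq> \<Omega>" "stabilizer \<Psi> v = refl_group J"
begin

lemma pos_at_nonneg_combs: assumes "\<beta> \<in> pos_at v" shows "\<beta> \<in> nonneg_combs J"
proof -
  have \<beta>: "\<beta> \<in> \<Psi>" "bil v (cvec \<beta>) = 0" "\<forall>\<omega>\<in>\<Omega>. 0 \<le> coord \<beta> \<omega>" using assms by (auto simp: pos_iff)
  have "\<beta> = (\<Sum>\<omega>\<in>\<Omega>. coord \<beta> \<omega> *\<^sub>R \<omega>)" using sum_coord[OF root_in_span[OF \<beta>(1)]] ..
  also have "\<dots> = (\<Sum>\<omega>\<in>J. coord \<beta> \<omega> *\<^sub>R \<omega>)"
    using stabilizer_coords(2)[OF J \<beta>(1,2)] J(1) finite_simple by (intro sum.mono_neutral_right) auto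
  finally show ?thesis unfolding nonneg_combs_def using \<beta>(3) J(1) by (intro CollectI exI[of _ "coord \<beta>"]) auto
qed

lemma nonneg_combs_subset: "nonneg_combs J \<subseteq> nonneg_combs \<Omega>"
proof
  fix x assume "x \<in> nonneg_combs J"
  then obtain c where c: "x = (\<Sum>\<omega>\<in>J. c \<omega> *\<^sub>R \<omega>)" "\<forall>\<omega>\<in>J. 0 \<le> c \<omega>" unfolding nonneg_combs_def by auto
  have "x = (\<Sum>\<omega>\<in>\<Omega>. (if \<omega> \<in> J then c \<omega> else 0) *\<^sub>R \<omega>)"
    unfolding c(1) using J(1) finite_simple by (intro sum.mono_neutral_cong_left) auto
  then show "x \<in> nonneg_combs \<Omega>" unfolding nonneg_combs_def using c(2)
    by (intro CollectI exI[of _ "\<lambda>\<omega>. if \<omega> \<in> J then c \<omega> else 0"]) auto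
qed

text \<open>The roots that vanish at v form a root system with base J, so everything proved in the
  locale holds for them. In particular \<open>disc_at v\<close> is not isotropic.\<close>

lemma simple_roots_at: "simple_roots (roots_at v) J"
proof
  show "root_system (roots_at v)" by (rule root_system_at)
  have "J \<subseteq> roots_at v" using J(1) stabilizer_simple[OF J] simple_root by auto
  moreover have "independent J" by (rule independent_mono[OF independent_simple J(1)])
  moreover have "\<beta> \<in> nonneg_combs J \<or> - \<beta> \<in> nonneg_combs J" if \<beta>: "\<beta> \<in> roots_at v" for \<beta>
  proof (cases "\<beta> \<in> pos")
    case True
    then show ?thesis using \<beta> by (intro disjI1 pos_at_nonneg_combs) simp
  next
    case False
    then have "- \<beta> \<in> pos" using \<beta> not_pos_iff by auto
    then show ?thesis using \<beta> by (intro disjI2 pos_at_nonneg_combs) (simp add: cvec_minus bil_simps)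
  qed
  ultimately show "simple_system (roots_at v) J" unfolding simple_system_def by simp
qed

lemma pos_roots_at: "pos_roots (roots_at v) J = pos_at v"
proof
  show "pos_roots (roots_at v) J \<subseteq> pos_at v" unfolding pos_roots_def using nonneg_combs_subset by auto
  show "pos_at v \<subseteq> pos_roots (roots_at v) J" using pos_at_nonneg_combs pos_root unfolding pos_roots_def by auto
qed

lemma disc_at_eq: "disc_at v = simple_roots.disc (roots_at v) J"
  unfolding simple_roots.disc_def[OF simple_roots_at] pos_roots_at ..

lemma pair_disc_at_nonzero: "theta_pair (disc_at v) (disc_at v) \<noteq> 0"
  unfolding disc_at_eq by (rule simple_roots.pair_disc_disc_nonzero[OF simple_roots_at])

lemma pair_disc_at_mult:
  "h \<in> Lam \<Longrightarrow> theta_pair (disc_at v * h) (disc_at v) = h 0 * theta_pair (disc_at v) (disc_at v)"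
  unfolding disc_at_eq by (rule simple_roots.pair_disc_mult[OF simple_roots_at])

end

section \<open>The homogeneous polynomial that controls the top power\<close>

definition top_poly :: "complex ^ 'n \<Rightarrow> complex ^ 'n \<Rightarrow> complex" where
  "top_poly v = Theta (disc_at v) disc"

lemma Lam_disc_at: "disc_at v \<in> Lam"
  by (intro Lam_prod Lam_linform)

lemma card_pos_at: "codegree v + card (pos_at v) = m"
  using card_mono[OF finite_pos, of "pos_at v"] by auto

lemma Lams_top_poly: "top_poly v \<in> Lams {codegree v}"
proof -
  have "disc_at v \<in> Lams {card (pos_at v)}" using finite_pos by (intro Lams_prod Lams_linform) auto
  from Lams_Theta[OF this Lams_disc] show ?thesis
    unfolding top_poly_def by (rule Lams_mono[rotated]) (use card_pos_at[of v] in auto)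
qed

lemma Lam_top_poly: "top_poly v \<in> Lam"
  by (rule Lams_Lam[OF Lams_top_poly])

text \<open>Evaluation at v is evaluation at 0 after translation. The translate of
  \<open>disc\<close> by v splits into \<open>disc_at v\<close>, whose factors are unchanged, and
  the product E of the other factors, whose value at 0 is the product of the nonzero root values at
  v.\<close>

lemma top_poly_nonzero:
  assumes J: "J \<subseteq> \<Omega>" "stabilizer \<Psi> v = refl_group J" shows "top_poly v v \<noteq> 0"
proof -
  define E where "E = (\<Prod>\<beta>\<in>pos - pos_at v. (\<lambda>x. linform (cvec \<beta>) (x + v)))"
  have E: "E \<in> Lam" unfolding E_def by (intro Lam_prod Lam_translate Lam_linform)
  have "E 0 = (\<Prod>\<beta>\<in>pos - pos_at v. bil v (cvec \<beta>))" by (simp add: E_def prod_pointwise linform_def)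
  then have E0: "E 0 \<noteq> 0" using finite_pos by simp
  have "(\<lambda>x. disc (x + v)) = (\<Prod>\<beta>\<in>pos. (\<lambda>x. linform (cvec \<beta>) (x + v)))"
    by (simp add: disc_def fun_eq_iff prod_pointwise)
  also have "\<dots> = E * (\<Prod>\<beta>\<in>pos_at v. (\<lambda>x. linform (cvec \<beta>) (x + v)))"
    unfolding E_def using finite_pos by (intro prod.subset_diff) auto
  also have "(\<Prod>\<beta>\<in>pos_at v. (\<lambda>x. linform (cvec \<beta>) (x + v))) = disc_at v"
    by (intro prod.cong refl) (simp add: linform_def bil_simps)
  finally have *: "(\<lambda>x. disc (x + v)) = E * disc_at v" .
  have "top_poly v v = Theta (disc_at v) (\<lambda>x. disc (x + v)) 0"
    unfolding top_poly_def Theta_translate[OF Lam_disc_at Lam_disc] by simp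
  also have "\<dots> = theta_pair (disc_at v * E) (disc_at v)"
    unfolding * theta_pair_def[symmetric] mult.commute[of E]
    by (rule pair_commute[OF Lam_disc_at Lam_mult[OF Lam_disc_at E]])
  also have "\<dots> = E 0 * theta_pair (disc_at v) (disc_at v)" by (rule pair_disc_at_mult[OF J E])
  finally show ?thesis using E0 pair_disc_at_nonzero[OF J] by simp
qed

lemma pair_at_disc:
  assumes "F \<in> Lam" shows "theta_pair (disc_at v * F) disc = theta_pair F (top_poly v)"
  unfolding top_poly_def mult.commute[of "disc_at v"] by (rule pair_mult[OF assms Lam_disc_at Lam_disc])

text \<open>Antisymmetrizing over the stabilizer turns any factor \<open>q\<close> into a multiple of \<open>disc_at v\<close>.\<close>

lemma pair_stabilizer_invariant:
  assumes q: "q \<in> Lam"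
  shows "\<exists>p\<in>Lam. \<forall>F\<in>Lam. (\<forall>\<sigma>\<in>refl_group (roots_at v). act \<sigma> F = F) \<longrightarrow>
    theta_pair (q * F) disc = theta_pair (p * F) (top_poly v)"
proof -
  let ?R = "roots_at v"
  have R: "?R \<subseteq> \<Psi>" by auto
  have c: "of_nat (card (refl_group ?R)) \<noteq> (0 :: complex)"
    using finite_subset[OF refl_group_mono[OF R] finite_W] refl_group_id[of ?R] by auto
  have "alt ?R q \<in> Lam" using Lams_alt q unfolding Lam_eq_Lams .
  moreover have "act (refl \<beta>) (alt ?R q) = - alt ?R q" if "\<beta> \<in> pos_at v" for \<beta>
    using that pos_root by (intro act_refl_alt R) auto
  ultimately obtain p where p: "p \<in> Lam" "alt ?R q = disc_at v * p"
    using alternating_divisible[of "pos_at v" "alt ?R q"] by auto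
  define p' where "p' = (\<lambda>x. 1 / of_nat (card (refl_group ?R)) * p x)"
  have "theta_pair (q * F) disc = theta_pair (p' * F) (top_poly v)"
    if F: "F \<in> Lam" "\<forall>\<sigma>\<in>refl_group ?R. act \<sigma> F = F" for F
  proof -
    have "alt ?R (q * F) = alt ?R q * F"
      unfolding alt_def sum_distrib_right
    proof (rule sum.cong[OF refl])
      fix \<sigma> assume "\<sigma> \<in> refl_group ?R"
      then have "act \<sigma> F = F" using F(2) by simp
      then show "(\<lambda>x. sgn_of \<sigma> * act \<sigma> (q * F) x) = (\<lambda>x. sgn_of \<sigma> * act \<sigma> q x) * F"
        unfolding scale_times act_mult by simp
    qed
    then have "alt ?R (q * F) = disc_at v * (p * F)" unfolding p(2) by (simp only: mult.assoc)
    then have a: "of_nat (card (refl_group ?R)) * theta_pair (q * F) disc = theta_pair (p * F) (top_poly v)"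
      using pair_alt[OF R Lam_mult[OF q F(1)]] pair_at_disc[OF Lam_mult[OF p(1) F(1)]] by simp
    have "theta_pair (p' * F) (top_poly v) = 1 / of_nat (card (refl_group ?R)) * theta_pair (p * F) (top_poly v)"
      unfolding p'_def scale_times by (rule pair_scale_left[OF Lam_mult[OF p(1) F(1)] Lam_top_poly])
    then show ?thesis unfolding a[symmetric] using c by simp
  qed
  moreover have "p' \<in> Lam" unfolding p'_def by (rule Lam_scale[OF p(1)])
  ultimately show ?thesis by (intro bexI[of _ p']) auto
qed

text \<open>The k-th power of \<phi> has only components of degree at least k, while
  \<open>top_poly\<close> lives in degree \<open>codegree v\<close>. At that exponent just the
  constant term of p contributes, and one step further nothing does.\<close>

lemma pair_power_top_poly:
  assumes \<phi>: "\<phi> \<in> Lams {1..}" and p: "p \<in> Lam"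
  shows "theta_pair (p * \<phi> ^ codegree v) (top_poly v) = p 0 * theta_pair (\<phi> ^ codegree v) (top_poly v)"
    and "theta_pair (p * \<phi> ^ Suc (codegree v)) (top_poly v) = 0"
proof -
  note L = Lams_Lam[OF \<phi>]
  have zero: "theta_pair h (top_poly v) = 0" if "h \<in> Lams {Suc (codegree v)..}" for h
    by (rule pair_orthogonal[OF that Lams_top_poly]) auto
  have pw: "\<phi> ^ k \<in> Lams {k..}" for k using Lams_power[OF \<phi>, of k] by simp
  obtain p1 where p1: "p1 \<in> Lams {1..}" "p = (\<lambda>x. p 0) + p1" using split_const[OF p] .
  have *: "p * \<phi> ^ codegree v = (\<lambda>x. p 0 * (\<phi> ^ codegree v) x) + p1 * \<phi> ^ codegree v"
    by (rule ext, subst p1(2)) (simp add: plus_fun_apply times_fun_apply distrib_right)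
  have "p1 * \<phi> ^ codegree v \<in> Lams {Suc (codegree v)..}"
    by (rule Lams_mult[OF p1(1) pw]) auto
  then show "theta_pair (p * \<phi> ^ codegree v) (top_poly v) = p 0 * theta_pair (\<phi> ^ codegree v) (top_poly v)"
    unfolding * using pair_add_left[OF Lam_scale[OF Lam_power[OF L]] Lam_mult[OF Lams_Lam[OF p1(1)] Lam_power[OF L]] Lam_top_poly]
      pair_scale_left[OF Lam_power[OF L] Lam_top_poly] zero by simp
  have "p * \<phi> ^ Suc (codegree v) \<in> Lams {Suc (codegree v)..}"
    by (rule Lams_mult[OF _ pw]) (use p in \<open>auto simp: Lam_eq_Lams\<close>)
  then show "theta_pair (p * \<phi> ^ Suc (codegree v)) (top_poly v) = 0" by (rule zero)
qed

end

lemma act_power: "act \<sigma> (f ^ k) = act \<sigma> f ^ k"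
  by (induction k) (simp_all only: power_0 power_Suc act_one act_mult)

lemma refl_group_fixes:
  assumes "\<sigma> \<in> refl_group R" "\<And>\<alpha>. \<alpha> \<in> R \<Longrightarrow> bil v (cvec \<alpha>) = 0" shows "\<sigma> v = v"
  using assms(1) by (induction rule: refl_group_induct) (simp_all add: id_apply o_apply refl_fixes assms(2))

text \<open>The group generated by these reflections fixes v, so it commutes with translation by
  v.\<close>

lemma act_translate_invariant:
  assumes f: "f \<in> invariants (refl_group \<Phi>)" and R: "R \<subseteq> \<Phi>" "\<And>\<alpha>. \<alpha> \<in> R \<Longrightarrow> bil v (cvec \<alpha>) = 0"
    and s: "\<sigma> \<in> refl_group R"
  shows "act \<sigma> (\<lambda>x. f (x + v)) = (\<lambda>x. f (x + v))"
proof
  fix x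
  have i: "inv_into UNIV \<sigma> \<in> refl_group R" by (rule refl_group_inv[OF s])
  have "inv_into UNIV \<sigma> x + v = inv_into UNIV \<sigma> (x + v)"
    using real_orthogonal_add[OF refl_group_orthogonal[OF i], of x v] refl_group_fixes[OF i R(2)] by simp
  moreover have "act \<sigma> f = f" using f subsetD[OF refl_group_mono[OF R(1)] s] by (simp add: invariants_def)
  ultimately have "f (inv_into UNIV \<sigma> x + v) = f (x + v)" using fun_cong[of "act \<sigma> f" f "x + v"] unfolding act_def by (simp only:)
  then show "act \<sigma> (\<lambda>x. f (x + v)) x = f (x + v)" by (simp add: act_def)
qed


section \<open>Genericity\<close>

lemma alg_gen_sum: "finite I \<Longrightarrow> (\<And>i. i \<in> I \<Longrightarrow> f i \<in> alg_gen L) \<Longrightarrow> sum f I \<in> alg_gen L"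
proof (induction I rule: finite_induct)
  case empty
  show ?case using alg_gen.const[of 0] by (simp add: zero_fun_def)
qed (auto intro: alg_gen.add)

lemma quotient_functional:
  fixes E A :: "('x \<Rightarrow> complex) set" and l :: "('x \<Rightarrow> complex) \<Rightarrow> complex"
  assumes E: "funspace.subspace E" and A: "A \<subseteq> E" "0 \<in> A"
    and add: "\<And>f g. f \<in> E \<Longrightarrow> g \<in> E \<Longrightarrow> l (f + g) = l f + l g"
    and scale: "\<And>c f. f \<in> E \<Longrightarrow> l (\<lambda>x. c * f x) = c * l f"
    and vanish: "\<And>f. f \<in> A \<Longrightarrow> l f = 0"
  shows "\<exists>\<phi>\<in>quotient_dual E A. \<forall>f\<in>E. \<phi> (coset_of E A f) = l f"
proof -
  define \<phi> where "\<phi> q = l (SOME g. g \<in> q)" for q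
  have \<phi>: "\<phi> (coset_of E A f) = l f" if f: "f \<in> E" for f
  proof -
    define g where "g = (SOME g. g \<in> coset_of E A f)"
    have "f \<in> coset_of E A f" using f A(2) by (simp add: coset_of_def)
    then have "(SOME g. g \<in> coset_of E A f) \<in> coset_of E A f" by (rule someI[of "\<lambda>g. g \<in> coset_of E A f"])
    then have g: "g - f \<in> A" unfolding g_def[symmetric] by (simp add: coset_of_def)
    have "l ((g - f) + f) = l (g - f) + l f" by (rule add[OF subsetD[OF A(1) g] f])
    then show ?thesis unfolding \<phi>_def g_def[symmetric] using vanish[OF g] by simp
  qed
  have "\<phi> \<in> quotient_dual E A"
    unfolding quotient_dual_def
    by (intro CollectI conjI ballI allI)
      (simp_all only: \<phi> add scale funspace.subspace_add[OF E] funspace.subspace_scale[OF E])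
  then show ?thesis using \<phi> by (intro bexI[of _ \<phi>]) auto
qed

text \<open>In a basis of M, the coordinates of \<open>T \<gamma> \<xi>\<close> are linear in
  \<gamma> and vanish on A, hence are linear forms on the quotient. Iteration multiplies and adds
  such forms. The vector \<xi> is generalized because the induction needs the claim for all basis
  vectors.\<close>

lemma polynomial_iterate:
  fixes M :: "('y \<Rightarrow> complex) set" and E A :: "('x \<Rightarrow> complex) set"
  assumes M: "M = funspace.span S" "finite S"
    and E: "funspace.subspace E" and A: "A \<subseteq> E" "0 \<in> A"
    and T: "\<And>\<gamma>. \<gamma> \<in> E \<Longrightarrow> linear_on M (T \<gamma>)"
    and T_add: "\<And>\<gamma> \<delta> \<xi>. \<gamma> \<in> E \<Longrightarrow> \<delta> \<in> E \<Longrightarrow> \<xi> \<in> M \<Longrightarrow> T (\<gamma> + \<delta>) \<xi> = T \<gamma> \<xi> + T \<delta> \<xi>"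
    and T_scale: "\<And>c \<gamma> \<xi>. \<gamma> \<in> E \<Longrightarrow> \<xi> \<in> M \<Longrightarrow> T (\<lambda>x. c * \<gamma> x) \<xi> = (\<lambda>y. c * T \<gamma> \<xi> y)"
    and T_vanish: "\<And>\<gamma> \<xi>. \<gamma> \<in> A \<Longrightarrow> \<xi> \<in> M \<Longrightarrow> T \<gamma> \<xi> = 0"
    and \<xi>: "\<xi> \<in> M"
  shows "\<exists>p\<in>alg_gen (quotient_dual E A). \<forall>\<gamma>\<in>E. p (coset_of E A \<gamma>) = (T \<gamma> ^^ k) \<xi> y"
proof -
  have sub: "funspace.subspace M" unfolding M(1) by (rule funspace.subspace_span)
  obtain B where B: "B \<subseteq> S" "funspace.independent B" "S \<subseteq> funspace.span B"
    by (rule funspace.maximal_independent_subset[of S])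
  have spB: "funspace.span B = M"
    unfolding M(1) using funspace.span_mono[OF B(1)] funspace.span_minimal[OF B(3) funspace.subspace_span] by (rule antisym)
  have finB: "finite B" using B(1) M(2) by (rule finite_subset)
  have BM: "b \<in> M" if "b \<in> B" for b unfolding spB[symmetric] by (rule funspace.span_base[OF that])
  have TM: "T \<gamma> \<eta> \<in> M" if "\<gamma> \<in> E" "\<eta> \<in> M" for \<gamma> \<eta> using T[OF that(1)] that(2) unfolding linear_on_def by auto
  let ?r = "funspace.representation B"
  show ?thesis using \<xi>
  proof (induction k arbitrary: \<xi>)
    case 0
    show ?case by (intro bexI[of _ "\<lambda>q. \<xi> y"] ballI alg_gen.const) (simp add: id_apply)
  next
    case (Suc k)
    define p where "p b = (SOME p. p \<in> alg_gen (quotient_dual E A) \<and> (\<forall>\<gamma>\<in>E. p (coset_of E A \<gamma>) = (T \<gamma> ^^ k) b y))" for b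
    have p: "p b \<in> alg_gen (quotient_dual E A) \<and> (\<forall>\<gamma>\<in>E. p b (coset_of E A \<gamma>) = (T \<gamma> ^^ k) b y)" if "b \<in> B" for b
      unfolding p_def by (rule someI_ex[OF Suc.IH[OF BM[OF that], unfolded Bex_def]])
    have lin: "\<exists>\<phi>\<in>quotient_dual E A. \<forall>\<gamma>\<in>E. \<phi> (coset_of E A \<gamma>) = ?r (T \<gamma> \<xi>) b" for b
    proof (rule quotient_functional[OF E A])
      fix \<gamma> \<delta> assume g: "\<gamma> \<in> E" "\<delta> \<in> E"
      note s = TM[OF g(1) Suc.prems, folded spB] TM[OF g(2) Suc.prems, folded spB]
      have "?r (T \<gamma> \<xi> + T \<delta> \<xi>) = (\<lambda>b. ?r (T \<gamma> \<xi>) b + ?r (T \<delta> \<xi>) b)"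
        by (rule funspace.representation_add[OF B(2) s(2,1)])
      then
      show "?r (T (\<gamma> + \<delta>) \<xi>) b = ?r (T \<gamma> \<xi>) b + ?r (T \<delta> \<xi>) b"
        unfolding T_add[OF g Suc.prems] by (simp only:)
    next
      fix c \<gamma> assume g: "\<gamma> \<in> E"
      have "T \<gamma> \<xi> \<in> funspace.span B" unfolding spB by (rule TM[OF g Suc.prems])
      from funspace.representation_scale[OF B(2) this]
      show "?r (T (\<lambda>x. c * \<gamma> x) \<xi>) b = c * ?r (T \<gamma> \<xi>) b" unfolding T_scale[OF g Suc.prems] by simp
    next
      fix \<gamma> assume g: "\<gamma> \<in> A"
      show "?r (T \<gamma> \<xi>) b = 0" unfolding T_vanish[OF g Suc.prems] funspace.representation_zero ..
    qed
    have ex: "\<exists>\<phi>. \<phi> \<in> quotient_dual E A \<and> (\<forall>\<gamma>\<in>E. \<phi> (coset_of E A \<gamma>) = ?r (T \<gamma> \<xi>) b)" for b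
      using lin[of b] unfolding Bex_def .
    define \<phi> where "\<phi> b = (SOME \<phi>. \<phi> \<in> quotient_dual E A \<and> (\<forall>\<gamma>\<in>E. \<phi> (coset_of E A \<gamma>) = ?r (T \<gamma> \<xi>) b))" for b
    have \<phi>: "\<phi> b \<in> quotient_dual E A \<and> (\<forall>\<gamma>\<in>E. \<phi> b (coset_of E A \<gamma>) = ?r (T \<gamma> \<xi>) b)" for b
      unfolding \<phi>_def by (rule someI_ex[OF ex])
    show ?case
    \<comment> \<open>The first application of T is expanded in the basis; the remaining k
      applications act on the basis vectors.\<close>
    proof (rule bexI[of _ "\<Sum>b\<in>B. \<phi> b * p b"], rule ballI)
      show "(\<Sum>b\<in>B. \<phi> b * p b) \<in> alg_gen (quotient_dual E A)"
        by (rule alg_gen_sum[OF finB]) (rule alg_gen.mult[OF alg_gen.gen[OF \<phi>[THEN conjunct1]] p[THEN conjunct1]])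
      fix \<gamma> assume g: "\<gamma> \<in> E"
      have "T \<gamma> \<xi> = (\<Sum>b\<in>B. (\<lambda>x. ?r (T \<gamma> \<xi>) b * b x))"
        using TM[OF g Suc.prems] unfolding spB[symmetric]
        by (intro funspace.sum_representation_eq[OF B(2) _ finB, symmetric]) auto
      moreover have "(T \<gamma> ^^ k) (\<Sum>b\<in>B. (\<lambda>x. ?r (T \<gamma> \<xi>) b * b x)) = (\<Sum>b\<in>B. (\<lambda>x. ?r (T \<gamma> \<xi>) b * (T \<gamma> ^^ k) b x))"
        by (rule linear_on_sum[OF linear_on_funpow[OF T[OF g]] sub finB BM, THEN conjunct2])
      ultimately have "(T \<gamma> ^^ Suc k) \<xi> = (\<Sum>b\<in>B. (\<lambda>x. ?r (T \<gamma> \<xi>) b * (T \<gamma> ^^ k) b x))"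
        unfolding funpow_Suc_right o_apply by simp
      then show "(\<Sum>b\<in>B. \<phi> b * p b) (coset_of E A \<gamma>) = (T \<gamma> ^^ Suc k) \<xi> y"
        unfolding sum_pointwise times_fun_apply using \<phi> p g by (simp add: sum_pointwise)
    qed
  qed
qed


section \<open>The action of invariants on the module\<close>

lemma Gam_add: "f \<in> Gam \<Phi> \<Longrightarrow> g \<in> Gam \<Phi> \<Longrightarrow> f + g \<in> Gam \<Phi>"
  and Gam_mult: "f \<in> Gam \<Phi> \<Longrightarrow> g \<in> Gam \<Phi> \<Longrightarrow> f * g \<in> Gam \<Phi>"
  and Gam_scale: "f \<in> Gam \<Phi> \<Longrightarrow> (\<lambda>x. c * f x) \<in> Gam \<Phi>"
  and Gam_zero: "0 \<in> Gam \<Phi>" and Gam_one: "1 \<in> Gam \<Phi>"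
  unfolding invariants_def
  by (simp_all only: mem_Collect_eq Lam_add Lam_mult Lam_scale Lam_zero Lam_one act_add act_mult act_scale act_zero act_one) auto

lemma subspace_Gam: "funspace.subspace (Gam \<Phi>)"
  unfolding funspace.subspace_def using Gam_zero Gam_add Gam_scale by auto

text \<open>An explicit element of \<open>Gam \<Phi>\<close> that witnesses genericity: its
  derivative at v is the linear form of v, as \<open>shift_half_norm\<close> shows.\<close>

definition half_norm :: "complex ^ 'n \<Rightarrow> complex" where
  "half_norm x = 1 / 2 * bil x x"

lemma Lams_half_norm: "half_norm \<in> (Lams {2} :: (complex ^ 'n \<Rightarrow> complex) set)"
proof -
  have "(half_norm :: complex ^ 'n \<Rightarrow> complex) = (\<lambda>x. 1 / 2 * (\<Sum>i\<in>UNIV. linform (axis i 1) * linform (axis i 1)) x)"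
  proof
    fix x :: "complex ^ 'n"
    have e: "bil x (axis i 1) = x $ i" for i
    proof -
      have "bil x (axis i 1) = (\<Sum>j\<in>UNIV. if j = i then x $ j else 0)"
        unfolding bil_def by (rule sum.cong) (auto simp: axis_def zero_fun_apply)
      then show ?thesis by simp
    qed
    show "half_norm x = 1 / 2 * (\<Sum>i\<in>UNIV. linform (axis i 1) * linform (axis i 1)) x"
      unfolding half_norm_def sum_pointwise times_fun_apply linform_def e bil_def[of x x] ..
  qed
  also have "\<dots> \<in> Lams {2}"
    by (intro Lams_scale Lams_sum Lams_mult[OF Lams_linform[of "{1}"] Lams_linform[of "{1}"]]) auto
  finally show ?thesis .
qed

lemma Gam_half_norm: "half_norm \<in> Gam \<Phi>"
proof -
  have "act \<sigma> half_norm = half_norm" if "\<sigma> \<in> refl_group \<Phi>" for \<sigma>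
  proof
    fix x
    note o = refl_group_orthogonal[OF refl_group_inv[OF that]]
    show "act \<sigma> half_norm x = half_norm x" unfolding act_def half_norm_def real_orthogonal_bil[OF o] ..
  qed
  then show ?thesis using Lams_Lam[OF Lams_half_norm] by (simp add: invariants_def)
qed

text \<open>Every summand of the expansion other than the pure power of a contains b and so has
  degree at least one higher.\<close>

lemma power_leading:
  assumes "a \<in> Lams {1..}" "b \<in> Lams {2..}" shows "(a + b) ^ k - a ^ k \<in> Lams {Suc k..}"
proof (induction k)
  case 0
  show ?case unfolding power_0 diff_self by (rule Lams_zero)
next
  case (Suc k)
  have ab: "a + b \<in> Lams {1..}" by (rule Lams_add[OF assms(1) Lams_mono[OF _ assms(2)]]) auto
  have "a ^ k \<in> Lams {k..}" using Lams_power[OF assms(1), of k] by simp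
  then have 1: "b * a ^ k \<in> Lams {Suc (Suc k)..}" by (rule Lams_mult[OF assms(2)]) auto
  have 2: "(a + b) * ((a + b) ^ k - a ^ k) \<in> Lams {Suc (Suc k)..}" by (rule Lams_mult[OF ab Suc]) auto
  have cancel: "x - y = x - (y + z) + z" for x y z :: "complex ^ 'n \<Rightarrow> complex" by simp
  have eq: "(a + b) ^ Suc k - a ^ Suc k = (a + b) * ((a + b) ^ k - a ^ k) + b * a ^ k"
    unfolding power_Suc right_diff_distrib distrib_right[of a b "a ^ k"] by (rule cancel)
  show ?case unfolding eq by (rule Lams_add[OF 2 1])
qed

definition shift :: "(complex ^ 'n \<Rightarrow> complex) \<Rightarrow> complex ^ 'n \<Rightarrow> complex ^ 'n \<Rightarrow> complex" where
  "shift \<gamma> v = (\<lambda>x. \<gamma> (x + v)) - (\<lambda>x. \<gamma> v)"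

lemma Lams_shift: assumes "\<gamma> \<in> Lam" shows "shift \<gamma> v \<in> Lams {1..}"
  unfolding shift_def
  by (rule Lams_vanishing_at_0[OF Lam_diff[OF Lam_translate[OF assms] Lam_const]]) (simp add: minus_apply)

lemma shift_half_norm: "shift half_norm v = linform v + half_norm"
proof
  fix x
  have "bil (x + v) (x + v) = bil x x + 2 * bil x v + bil v v" unfolding bil_simps bil_commute[of v x] by simp
  then show "shift half_norm v x = (linform v + half_norm) x"
    unfolding shift_def half_norm_def linform_def minus_apply plus_fun_apply by (simp add: add_divide_distrib)
qed

definition shifted_act :: "(real ^ 'n) set \<Rightarrow> complex ^ 'n \<Rightarrow> (complex ^ 'n \<Rightarrow> complex) \<Rightarrow>
    ((complex ^ 'n \<Rightarrow> complex) \<Rightarrow> complex) \<Rightarrow> (complex ^ 'n \<Rightarrow> complex) \<Rightarrow> complex" where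
  "shifted_act \<Phi> v \<gamma> = (\<lambda>f. dual_act (Gam \<Phi>) \<gamma> f - (\<lambda>g. \<gamma> v * f g))"

definition ev :: "(real ^ 'n) set \<Rightarrow> complex ^ 'n \<Rightarrow> (complex ^ 'n \<Rightarrow> complex) \<Rightarrow> complex" where
  "ev \<Phi> v = restr (Gam \<Phi>) (\<lambda>g. g v)"

section \<open>Powers of an invariant minus its value at v\<close>

context simple_roots
begin

lemma dual_act_PS_char:
  assumes "\<gamma> \<in> Gam \<Phi>"
  shows "dual_act (Gam \<Phi>) \<gamma> (PS_char \<Phi> v q) = PS_char \<Phi> v (q * (\<lambda>x. \<gamma> (x + v)))"
  unfolding dual_act_def PS_char_def[of \<Phi> v "q * (\<lambda>x. \<gamma> (x + v))"]
proof (rule restr_eqI)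
  fix g :: "complex ^ 'n \<Rightarrow> complex" assume g: "g \<in> Gam \<Phi>"
  have "(\<lambda>x. (\<gamma> * g) (x + v)) = (\<lambda>x. \<gamma> (x + v)) * (\<lambda>x. g (x + v))" unfolding times_fun_def ..
  then show "PS_char \<Phi> v q (\<gamma> * g) = theta_pair (q * (\<lambda>x. \<gamma> (x + v)) * (\<lambda>x. g (x + v))) disc"
    unfolding PS_char_def restr_def using Gam_mult[OF assms g] by (simp only: if_True mult.assoc)
qed

lemma shifted_act_PS_char:
  assumes g: "\<gamma> \<in> Gam \<Phi>" and q: "q \<in> Lam"
  shows "shifted_act \<Phi> v \<gamma> (PS_char \<Phi> v q) = PS_char \<Phi> v (q * shift \<gamma> v)"
proof -
  have s: "shift \<gamma> v \<in> Lam" by (rule Lams_Lam[OF Lams_shift[OF Gam_Lam[OF g]]])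
  have "q * (\<lambda>x. \<gamma> (x + v)) = q * shift \<gamma> v + (\<lambda>x. \<gamma> v * q x)"
    by (rule ext) (simp add: shift_def times_fun_apply plus_fun_apply minus_apply algebra_simps)
  then show ?thesis
    unfolding shifted_act_def dual_act_PS_char[OF g]
    by (simp only: PS_char_add[OF Lam_mult[OF q s] Lam_scale[OF q]] PS_char_scale[OF q] add_diff_cancel_right')
qed

lemma shifted_act_power_PS_char:
  assumes g: "\<gamma> \<in> Gam \<Phi>" and q: "q \<in> Lam"
  shows "(shifted_act \<Phi> v \<gamma> ^^ k) (PS_char \<Phi> v q) = PS_char \<Phi> v (q * shift \<gamma> v ^ k)"
proof (induction k)
  case 0
  show ?case by (simp add: id_apply)
next
  case (Suc k)
  have s: "shift \<gamma> v ^ k \<in> Lam" by (intro Lam_power Lams_Lam[OF Lams_shift[OF Gam_Lam[OF g]]])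
  show ?case unfolding funpow.simps o_apply Suc shifted_act_PS_char[OF g Lam_mult[OF q s]] power_Suc2 mult.assoc ..
qed

lemma subspace_PS_module: "funspace.subspace (PS_module \<Phi> \<Psi> \<Omega> v)"
  unfolding PS_module_def by (rule funspace.subspace_span)

lemma linear_on_dual_act:
  assumes g: "\<gamma> \<in> Gam \<Phi>" shows "linear_on (PS_module \<Phi> \<Psi> \<Omega> v) (dual_act (Gam \<Phi>) \<gamma>)"
  unfolding linear_on_def
proof (intro conjI ballI allI)
  fix f assume "f \<in> PS_module \<Phi> \<Psi> \<Omega> v"
  then obtain q where "q \<in> Lam" "f = PS_char \<Phi> v q" unfolding PS_module_eq by auto
  then show "dual_act (Gam \<Phi>) \<gamma> f \<in> PS_module \<Phi> \<Psi> \<Omega> v"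
    unfolding PS_module_eq using dual_act_PS_char[OF g] by (simp add: Lam_mult Lam_translate Gam_Lam[OF g])
qed (rule ext; simp add: dual_act_def restr_def plus_fun_apply)+

lemma shifted_act_closed:
  assumes "\<gamma> \<in> Gam \<Phi>" "f \<in> PS_module \<Phi> \<Psi> \<Omega> v" shows "shifted_act \<Phi> v \<gamma> f \<in> PS_module \<Phi> \<Psi> \<Omega> v"
proof -
  obtain q where q: "q \<in> Lam" "f = PS_char \<Phi> v q" using assms(2) unfolding PS_module_eq by auto
  show ?thesis unfolding q(2) shifted_act_PS_char[OF assms(1) q(1)] PS_module_eq
    by (intro imageI Lam_mult q(1) Lams_Lam[OF Lams_shift[OF Gam_Lam[OF assms(1)]]])
qed

lemma linear_on_shifted_act:
  assumes g: "\<gamma> \<in> Gam \<Phi>" shows "linear_on (PS_module \<Phi> \<Psi> \<Omega> v) (shifted_act \<Phi> v \<gamma>)"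
  unfolding linear_on_def
proof (intro conjI ballI allI)
  show "shifted_act \<Phi> v \<gamma> f \<in> PS_module \<Phi> \<Psi> \<Omega> v" if "f \<in> PS_module \<Phi> \<Psi> \<Omega> v" for f
    by (rule shifted_act_closed[OF g that])
qed (rule ext; simp add: shifted_act_def dual_act_def restr_def plus_fun_apply minus_apply algebra_simps)+

text \<open>The shifted invariant and the translated argument f are both fixed by the reflections at
  v, so q can be replaced by p with \<open>top_poly\<close> in place of \<open>disc\<close>. The
  rest is a matter of degrees, and the remaining dependence on f is its value at v.\<close>

lemma shifted_act_power_top:
  assumes sub: "\<Psi> \<subseteq> \<Phi>" and g: "\<gamma> \<in> Gam \<Phi>" and q: "q \<in> Lam"
  shows "(shifted_act \<Phi> v \<gamma> ^^ Suc (codegree v)) (PS_char \<Phi> v q) = 0"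
    and "\<exists>a. (shifted_act \<Phi> v \<gamma> ^^ codegree v) (PS_char \<Phi> v q) = (\<lambda>g. a * ev \<Phi> v g)"
proof -
  let ?s = "shift \<gamma> v"
  from pair_stabilizer_invariant[OF q, of v] obtain p where p: "p \<in> Lam" "\<forall>F\<in>Lam. (\<forall>\<sigma>\<in>refl_group (roots_at v). act \<sigma> F = F) \<longrightarrow>
    theta_pair (q * F) disc = theta_pair (p * F) (top_poly v)" by (rule bexE)
  have s1: "?s \<in> Lams {1..}" by (rule Lams_shift[OF Gam_Lam[OF g]])
  note s = Lams_Lam[OF s1]
  have inv: "act \<sigma> (\<lambda>x. f (x + v)) = (\<lambda>x. f (x + v))" if "f \<in> Gam \<Phi>" "\<sigma> \<in> refl_group (roots_at v)" for f \<sigma>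
    by (rule act_translate_invariant[OF that(1) _ _ that(2)]) (use sub in auto)
  have pair: "theta_pair (q * ?s ^ k * (\<lambda>x. f (x + v))) disc = theta_pair (p * (\<lambda>x. f (x + v)) * ?s ^ k) (top_poly v)"
    if f: "f \<in> Gam \<Phi>" for f k
  proof -
    have F: "?s ^ k * (\<lambda>x. f (x + v)) \<in> Lam" by (rule Lam_mult[OF Lam_power[OF s] Lam_translate[OF Gam_Lam[OF f]]])
    \<comment> \<open>This invariance is what permits antisymmetrizing q alone and leaving the other
      factors untouched.\<close>
    have ai: "act \<sigma> (?s ^ k * (\<lambda>x. f (x + v))) = ?s ^ k * (\<lambda>x. f (x + v))" if t: "\<sigma> \<in> refl_group (roots_at v)" for \<sigma>
    proof -
      have "act \<sigma> (\<lambda>x. \<gamma> v) = (\<lambda>x. \<gamma> v)" by (simp add: act_def)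
      then have "act \<sigma> ?s = ?s" unfolding shift_def act_diff inv[OF g t] by simp
      then show ?thesis unfolding act_mult act_power inv[OF f t] by simp
    qed
    from p(2)[rule_format, OF F ai] show ?thesis
      unfolding mult.assoc mult.commute[of "\<lambda>x. f (x + v)" "?s ^ k"] .
  qed
  have L: "p * (\<lambda>x. f (x + v)) \<in> Lam" if "f \<in> Gam \<Phi>" for f by (rule Lam_mult[OF p(1) Lam_translate[OF Gam_Lam[OF that]]])
  show "(shifted_act \<Phi> v \<gamma> ^^ Suc (codegree v)) (PS_char \<Phi> v q) = 0"
  proof
    fix f
    show "(shifted_act \<Phi> v \<gamma> ^^ Suc (codegree v)) (PS_char \<Phi> v q) f = 0 f"
      unfolding shifted_act_power_PS_char[OF g q] unfolding PS_char_def restr_def zero_fun_apply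
      using pair pair_power_top_poly(2)[OF s1 L] by (simp only: if_cancel cong: if_cong)
  qed
  have "(shifted_act \<Phi> v \<gamma> ^^ codegree v) (PS_char \<Phi> v q) f
    = (p 0 * theta_pair (?s ^ codegree v) (top_poly v)) * ev \<Phi> v f" for f
  proof (cases "f \<in> Gam \<Phi>")
    case True
    have e: "(p * (\<lambda>x. f (x + v))) 0 = p 0 * f v" by (simp add: times_fun_apply)
    have "theta_pair (q * ?s ^ codegree v * (\<lambda>x. f (x + v))) disc = (p 0 * theta_pair (?s ^ codegree v) (top_poly v)) * f v"
      unfolding pair[OF True] pair_power_top_poly(1)[OF s1 L[OF True]] e
      unfolding mult.assoc[of "p 0"] mult.commute[of "f v"] ..
    then show ?thesis
      unfolding shifted_act_power_PS_char[OF g q] unfolding PS_char_def restr_def ev_def using True by (simp only: if_True)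
  next
    case False
    then show ?thesis unfolding shifted_act_power_PS_char[OF g q] unfolding PS_char_def restr_def ev_def by (simp only: if_False mult_zero_right)
  qed
  then show "\<exists>a. (shifted_act \<Phi> v \<gamma> ^^ codegree v) (PS_char \<Phi> v q) = (\<lambda>g. a * ev \<Phi> v g)" by (intro exI ext)
qed

text \<open>For this functional the factor \<open>disc_at v\<close> is already present, so the
  coefficient of the evaluation is explicit; it is the quantity that has to be nonzero for generic
  \<gamma>.\<close>

lemma shifted_act_power_disc_at:
  assumes g: "\<gamma> \<in> Gam \<Phi>"
  shows "(shifted_act \<Phi> v \<gamma> ^^ codegree v) (PS_char \<Phi> v (disc_at v))
    = (\<lambda>f. theta_pair (shift \<gamma> v ^ codegree v) (top_poly v) * ev \<Phi> v f)"
proof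
  fix f
  have s1: "shift \<gamma> v \<in> Lams {1..}" by (rule Lams_shift[OF Gam_Lam[OF g]])
  note s = Lams_Lam[OF s1]
  show "(shifted_act \<Phi> v \<gamma> ^^ codegree v) (PS_char \<Phi> v (disc_at v)) f
    = theta_pair (shift \<gamma> v ^ codegree v) (top_poly v) * ev \<Phi> v f"
  proof (cases "f \<in> Gam \<Phi>")
    case True
    have t: "(\<lambda>x. f (x + v)) \<in> Lam" by (rule Lam_translate[OF Gam_Lam[OF True]])
    have "theta_pair (disc_at v * shift \<gamma> v ^ codegree v * (\<lambda>x. f (x + v))) disc
      = theta_pair ((\<lambda>x. f (x + v)) * shift \<gamma> v ^ codegree v) (top_poly v)"
      unfolding mult.assoc mult.commute[of "shift \<gamma> v ^ codegree v"] by (rule pair_at_disc[OF Lam_mult[OF t Lam_power[OF s]]])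
    also have "\<dots> = f v * theta_pair (shift \<gamma> v ^ codegree v) (top_poly v)"
      using pair_power_top_poly(1)[OF s1 t] by simp
    finally show ?thesis
      unfolding shifted_act_power_PS_char[OF g Lam_disc_at] unfolding PS_char_def restr_def ev_def using True by (simp only: if_True mult.commute)
  next
    case False
    then show ?thesis unfolding shifted_act_power_PS_char[OF g Lam_disc_at] unfolding PS_char_def restr_def ev_def by (simp only: if_False mult_zero_right)
  qed
qed

text \<open>Modulo degrees orthogonal to \<open>top_poly\<close> the shifted half norm may be
  replaced by the linear form of v, and pairing with its power is a factorial times evaluation at
  v.\<close>

lemma half_norm_top:
  assumes "J \<subseteq> \<Omega>" "stabilizer \<Psi> v = refl_group J"
  shows "theta_pair (shift half_norm v ^ codegree v) (top_poly v) \<noteq> 0"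
proof -
  let ?l = "linform v ^ codegree v" and ?s = "shift half_norm v ^ codegree v"
  have "?s - ?l \<in> Lams {Suc (codegree v)..}"
    unfolding shift_half_norm by (rule power_leading[OF Lams_linform Lams_mono[OF _ Lams_half_norm]]) auto
  then have "theta_pair (?s - ?l) (top_poly v) = 0" by (rule pair_orthogonal[OF _ Lams_top_poly]) auto
  moreover have "?s \<in> Lam" by (intro Lam_power Lams_Lam[OF Lams_shift] Lams_Lam[OF Lams_half_norm])
  moreover have "?l \<in> Lam" by (intro Lam_power Lam_linform)
  ultimately have "theta_pair ?s (top_poly v) = theta_pair ?l (top_poly v)"
    using pair_diff_left[OF _ _ Lam_top_poly, of ?s ?l] by simp
  also have "\<dots> = fact (codegree v) * top_poly v v" by (rule pair_linform_power[OF Lams_top_poly])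
  finally show ?thesis using top_poly_nonzero[OF assms] by simp
qed

text \<open>Applying the top power of the shifted half norm to the functional of
  \<open>disc_at v\<close> gives a nonzero multiple of the evaluation.\<close>

lemma ev_PS_module:
  assumes "J \<subseteq> \<Omega>" "stabilizer \<Psi> v = refl_group J" shows "ev \<Phi> v \<in> PS_module \<Phi> \<Psi> \<Omega> v"
proof -
  define K where "K = theta_pair (shift half_norm v ^ codegree v) (top_poly v)"
  have "PS_char \<Phi> v (disc_at v * shift half_norm v ^ codegree v) \<in> PS_module \<Phi> \<Psi> \<Omega> v"
    unfolding PS_module_eq
    by (intro imageI Lam_mult Lam_disc_at Lam_power Lams_Lam[OF Lams_shift] Lams_Lam[OF Lams_half_norm])
  then have "(\<lambda>f. K * ev \<Phi> v f) \<in> PS_module \<Phi> \<Psi> \<Omega> v"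
    unfolding shifted_act_power_PS_char[OF Gam_half_norm Lam_disc_at, symmetric] shifted_act_power_disc_at[OF Gam_half_norm] K_def .
  then have "(\<lambda>f. 1 / K * (K * ev \<Phi> v f)) \<in> PS_module \<Phi> \<Psi> \<Omega> v" by (rule funspace.subspace_scale[OF subspace_PS_module])
  moreover have "(\<lambda>f. 1 / K * (K * ev \<Phi> v f)) = ev \<Phi> v"
    using half_norm_top[OF assms] unfolding K_def by (intro ext) simp
  ultimately show ?thesis by simp
qed

end


theorem theorem6p6:
  fixes \<Phi> \<Psi> \<Omega> :: "(real ^ 'n) set" and v :: "complex ^ 'n"
  assumes "root_system \<Phi>" and "root_subsystem \<Psi> \<Phi>" and "simple_system \<Psi> \<Omega>"
    and "standard \<Psi> \<Omega> v"
  defines "\<Gamma> \<equiv> Gam \<Phi>"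
    and "M \<equiv> PS_module \<Phi> \<Psi> \<Omega> v"
    and "N \<equiv> len \<Omega> (longest \<Omega> (min_coset_reps \<Psi> \<Omega> v)) + 1"
  shows "(\<forall>\<gamma>\<in>\<Gamma>. (\<exists>blocks. jordan_form M (dual_act \<Gamma> \<gamma>) blocks) \<and>
            (\<forall>blocks. jordan_form M (dual_act \<Gamma> \<gamma>) blocks \<longrightarrow>
               (\<forall>(m, a)\<in>set blocks. a = \<gamma> v \<and> m \<le> N) \<and>
               count_list (map fst blocks) N \<le> 1)) \<and>
         generically \<Gamma> (annihilator \<Gamma> M)
           (\<lambda>\<gamma>. \<forall>blocks. jordan_form M (dual_act \<Gamma> \<gamma>) blocks \<longrightarrow>
              count_list (map fst blocks) N = 1)"
proof -
  interpret simple_roots \<Psi> \<Omega>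
    by unfold_locales (use assms(2,3) in \<open>auto simp: root_subsystem_def\<close>)
  have sub: "\<Psi> \<subseteq> \<Phi>" using assms(2) by (simp add: root_subsystem_def)
  obtain J where J: "J \<subseteq> \<Omega>" "stabilizer \<Psi> v = refl_group J" using assms(4) unfolding standard_def by auto
  have N: "N = Suc (codegree v)" using len_longest_min_coset_reps[OF assms(4)] unfolding N_def by simp
  define S where "S = (\<lambda>\<sigma>. restr \<Gamma> (PS_functional \<Psi> \<Omega> v \<sigma>)) ` refl_group \<Psi>"
  have M: "M = funspace.span S" "finite S" unfolding M_def PS_module_def S_def \<Gamma>_def using finite_W by auto
  have ev: "ev \<Phi> v \<in> M" unfolding M_def by (rule ev_PS_module[OF J])
  have lin: "linear_on M (dual_act \<Gamma> \<gamma>)" if "\<gamma> \<in> \<Gamma>" for \<gamma>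
    unfolding M_def \<Gamma>_def by (rule linear_on_dual_act) (use that in \<open>simp add: \<Gamma>_def\<close>)
  have nil: "((\<lambda>f. dual_act \<Gamma> \<gamma> f - (\<lambda>x. \<gamma> v * f x)) ^^ N) f = 0"
    and top: "\<exists>a. ((\<lambda>f. dual_act \<Gamma> \<gamma> f - (\<lambda>x. \<gamma> v * f x)) ^^ (N - 1)) f = (\<lambda>x. a * ev \<Phi> v x)"
    if g: "\<gamma> \<in> \<Gamma>" and f: "f \<in> M" for \<gamma> f
  proof -
    obtain q where q: "q \<in> Lam" "f = PS_char \<Phi> v q" using f unfolding M_def PS_module_eq by auto
    note top = shifted_act_power_top[OF sub g[unfolded \<Gamma>_def] q(1), of v]
    show "((\<lambda>f. dual_act \<Gamma> \<gamma> f - (\<lambda>x. \<gamma> v * f x)) ^^ N) f = 0"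
      unfolding N q(2) \<Gamma>_def using top(1) unfolding shifted_act_def .
    show "\<exists>a. ((\<lambda>f. dual_act \<Gamma> \<gamma> f - (\<lambda>x. \<gamma> v * f x)) ^^ (N - 1)) f = (\<lambda>x. a * ev \<Phi> v x)"
      unfolding N diff_Suc_1 q(2) \<Gamma>_def using top(2) unfolding shifted_act_def .
  qed
  have N1: "1 \<le> N" unfolding N by simp
  have "generically \<Gamma> (annihilator \<Gamma> M)
    (\<lambda>\<gamma>. \<forall>blocks. jordan_form M (dual_act \<Gamma> \<gamma>) blocks \<longrightarrow> count_list (map fst blocks) N = 1)"
  proof -
    let ?A = "annihilator \<Gamma> M" and ?f = "PS_char \<Phi> v (disc_at v)"
    have fM: "?f \<in> M" unfolding M_def PS_module_eq by (rule imageI[OF Lam_disc_at])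
    have A: "?A \<subseteq> \<Gamma>" "0 \<in> ?A"
    proof -
      show "?A \<subseteq> \<Gamma>" unfolding annihilator_def by auto
      have "dual_act \<Gamma> 0 \<xi> = 0" if "\<xi> \<in> M" for \<xi>
      proof -
        obtain q where q: "q \<in> Lam" "\<xi> = PS_char \<Phi> v q" using \<open>\<xi> \<in> M\<close> unfolding M_def PS_module_eq by auto
        have "q * (\<lambda>x. 0 (x + v)) = 0" by (rule ext) (simp add: times_fun_apply zero_fun_apply)
        moreover have "0 \<in> Ann" using coinv_ideal_zero[of \<Psi>] unfolding coinv_ideal_eq_Ann .
        ultimately show ?thesis unfolding q(2) \<Gamma>_def dual_act_PS_char[OF Gam_zero] using PS_char_Ann by simp
      qed
      then show "0 \<in> ?A" unfolding annihilator_def \<Gamma>_def using Gam_zero by simp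
    qed
    \<comment> \<open>Since the evaluation at v belongs to M, an element of the annihilator kills
      it; testing at the constant invariant 1 gives its value at v. Hence the action of \<gamma> -
      \<gamma>(v) also depends only on the class of \<gamma>.\<close>
    have at_v: "\<gamma> v = 0" if "\<gamma> \<in> ?A" for \<gamma>
    proof -
      have g: "\<gamma> \<in> Gam \<Phi>" "dual_act (Gam \<Phi>) \<gamma> (ev \<Phi> v) = 0" using that ev unfolding annihilator_def \<Gamma>_def by auto
      from fun_cong[OF g(2), of 1] show ?thesis
        using Gam_mult[OF g(1) Gam_one] Gam_one[of \<Phi>]
        by (simp add: dual_act_def ev_def restr_def zero_fun_apply)
    qed
    \<comment> \<open>The functional is tested at the constant invariant 1, where the evaluation at
      v equals 1, so that p returns exactly its coefficient.\<close>
    obtain p where p: "p \<in> alg_gen (quotient_dual \<Gamma> ?A)"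
      "\<forall>\<gamma>\<in>\<Gamma>. p (coset_of \<Gamma> ?A \<gamma>) = (shifted_act \<Phi> v \<gamma> ^^ codegree v) ?f 1"
    proof (rule bexE[OF polynomial_iterate[OF M _ A _ _ _ _ fM, of "shifted_act \<Phi> v" "codegree v" 1]])
      show "funspace.subspace \<Gamma>" unfolding \<Gamma>_def by (rule subspace_Gam)
      show "linear_on M (shifted_act \<Phi> v \<gamma>)" if "\<gamma> \<in> \<Gamma>" for \<gamma>
        unfolding M_def by (rule linear_on_shifted_act) (use that in \<open>simp add: \<Gamma>_def\<close>)
      show "shifted_act \<Phi> v \<gamma> \<xi> = 0" if "\<gamma> \<in> ?A" "\<xi> \<in> M" for \<gamma> \<xi>
      proof -
        have "dual_act (Gam \<Phi>) \<gamma> \<xi> = 0" using that unfolding annihilator_def \<Gamma>_def by auto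
        moreover have "(\<lambda>g. 0 * \<xi> g) = 0" by (rule zero_scale)
        ultimately show ?thesis unfolding shifted_act_def at_v[OF that(1)] by (simp only: diff_self)
      qed
      fix \<gamma> \<delta> \<xi> assume "\<gamma> \<in> \<Gamma>" "\<delta> \<in> \<Gamma>" "\<xi> \<in> M"
      then obtain q where q: "q \<in> Lam" "\<xi> = PS_char \<Phi> v q" and g: "\<gamma> \<in> Gam \<Phi>" "\<delta> \<in> Gam \<Phi>"
        unfolding M_def PS_module_eq \<Gamma>_def by auto
      note s = Lams_Lam[OF Lams_shift[OF Gam_Lam[OF g(1)]]] Lams_Lam[OF Lams_shift[OF Gam_Lam[OF g(2)]]]
      have "shift (\<gamma> + \<delta>) v = shift \<gamma> v + shift \<delta> v"
        by (rule ext) (simp add: shift_def plus_fun_apply minus_apply)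
      then show "shifted_act \<Phi> v (\<gamma> + \<delta>) \<xi> = shifted_act \<Phi> v \<gamma> \<xi> + shifted_act \<Phi> v \<delta> \<xi>"
        unfolding q(2) shifted_act_PS_char[OF Gam_add[OF g] q(1)] shifted_act_PS_char[OF g(1) q(1)] shifted_act_PS_char[OF g(2) q(1)]
        by (simp only: distrib_left PS_char_add[OF Lam_mult[OF q(1) s(1)] Lam_mult[OF q(1) s(2)]])
    next
      fix c \<gamma> \<xi> assume "\<gamma> \<in> \<Gamma>" "\<xi> \<in> M"
      then obtain q where q: "q \<in> Lam" "\<xi> = PS_char \<Phi> v q" and g: "\<gamma> \<in> Gam \<Phi>"
        unfolding M_def PS_module_eq \<Gamma>_def by auto
      note s = Lams_Lam[OF Lams_shift[OF Gam_Lam[OF g]]]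
      have "q * shift (\<lambda>x. c * \<gamma> x) v = (\<lambda>x. c * (q * shift \<gamma> v) x)"
        by (rule ext) (simp add: shift_def times_fun_apply minus_apply algebra_simps)
      then show "shifted_act \<Phi> v (\<lambda>x. c * \<gamma> x) \<xi> = (\<lambda>y. c * shifted_act \<Phi> v \<gamma> \<xi> y)"
        unfolding q(2) shifted_act_PS_char[OF Gam_scale[OF g] q(1)] shifted_act_PS_char[OF g q(1)]
        by (simp only: PS_char_scale[OF Lam_mult[OF q(1) s]])
    qed
    have top_value: "p (coset_of \<Gamma> ?A \<gamma>) = theta_pair (shift \<gamma> v ^ codegree v) (top_poly v)" if "\<gamma> \<in> \<Gamma>" for \<gamma>
    proof -
      have g: "\<gamma> \<in> Gam \<Phi>" using that by (simp add: \<Gamma>_def)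
      have e: "ev \<Phi> v 1 = 1" using Gam_one[of \<Phi>] by (simp add: ev_def restr_def one_fun_apply)
      show ?thesis unfolding bspec[OF p(2) that] shifted_act_power_disc_at[OF g] e by (rule mult_1_right)
    qed
    \<comment> \<open>The open set is where p does not vanish; the class of \<open>half_norm\<close>
      shows that it is nonempty.\<close>
    let ?U = "{q \<in> coset_of \<Gamma> ?A ` \<Gamma>. \<exists>p'\<in>{p}. p' q \<noteq> 0}"
    have "zariski_open \<Gamma> ?A ?U" unfolding zariski_open_def using p(1) by (intro exI[of _ "{p}"]) auto
    moreover have "coset_of \<Gamma> ?A half_norm \<in> ?U"
      using top_value[of half_norm] half_norm_top[OF J] Gam_half_norm[of \<Phi>] unfolding \<Gamma>_def by auto
    moreover have "count_list (map fst blocks) N = 1"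
      if g: "\<gamma> \<in> \<Gamma>" and U: "coset_of \<Gamma> ?A \<gamma> \<in> ?U" and b: "jordan_form M (dual_act \<Gamma> \<gamma>) blocks" for \<gamma> blocks
    proof (rule jordan_form_one_dimensional_top_power(3)[OF M lin[OF g] N1 nil[OF g] ev top[OF g] b fM])
      have "(shifted_act \<Phi> v \<gamma> ^^ codegree v) ?f 1 \<noteq> 0" using p(2) g U by auto
      then have "(shifted_act \<Phi> v \<gamma> ^^ codegree v) ?f \<noteq> 0" by (auto simp: zero_fun_apply)
      then show "((\<lambda>f. dual_act \<Gamma> \<gamma> f - (\<lambda>x. \<gamma> v * f x)) ^^ (N - 1)) ?f \<noteq> 0"
        unfolding N diff_Suc_1 \<Gamma>_def shifted_act_def .
    qed
    ultimately show ?thesis unfolding generically_def by (intro exI[of _ ?U]) blast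
  qed
  moreover have "(\<exists>blocks. jordan_form M (dual_act \<Gamma> \<gamma>) blocks) \<and>
    (\<forall>blocks. jordan_form M (dual_act \<Gamma> \<gamma>) blocks \<longrightarrow>
       (\<forall>(m, a)\<in>set blocks. a = \<gamma> v \<and> m \<le> N) \<and> count_list (map fst blocks) N \<le> 1)" if g: "\<gamma> \<in> \<Gamma>" for \<gamma>
    using jordan_form_one_dimensional_top_power(1,2)[OF M lin[OF g] N1 nil[OF g] ev top[OF g]] by simp
  ultimately show ?thesis by simp
qed


end
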